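(* Let $P(A)$ be a symbolic nilpotent presentation on $n$ generators with respect to a set of primes $\Pi$, with coefficients $A$ in $\mathbb{Z}[w,x_1,\ldots,x_m]$. Perform a Smith normal form computation on $Mat(A)$, allowing elements of $Q[p]$ as entries and using pseudo-units in place of units when multiplying a row or column by a unit. Whenever the computation divides by a pseudo-unit, store that pseudo-unit; return the list of stored pseudo-units together with the elementary divisors of $Mat(A)$ obtained. Then the non-zero elementary divisors obtained are all powers of $p$. For $p\in\Pi$ and $w$ a primitive root modulo $p$, put $E_u=\{(x_1,\ldots,x_m)\in\mathbb{Z}_p^m\mid u(w,x_1,\ldots,x_m)=0\}$ for each stored pseudo-unit $u$, and let $E=\bigcup_u E_u$ be the (finite) union over the stored pseudo-units. Outside $E_u$ the pseudo-unit $u$ yields a proper unit in $\mathbb{Z}_p$. Hence for all $(x_1,\ldots,x_m)\in\mathbb{Z}_p^m$ outside $E$ the Schur multiplier of the nilpotent Lie $p$-ring obtained by evaluating $P(A)$ can be determined from this computation on $Mat(A)$: its abelian invariants are the non-zero elementary divisors obtained. For each tuple in the finite set $E$, the Schur multiplier is determined by evaluating $P(A)$ at the tuple and computing again from the evaluated presentation: its abelian invariants are the non-zero elementary divisors of the matrix $Mat(A)$ of the evaluated presentation.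
   Context: A Lie ring is an additive abelian group with a bilinear, alternating multiplication $[\cdot,\cdot]$ satisfying the Jacobi identity; a Lie $p$-ring is a Lie ring with $p^n$ elements for some prime power $p^n$, and it is nilpotent if its lower central series terminates at $\{0\}$. The Schur multiplier of a Lie ring is its second Chevalley--Eilenberg homology group. For a prime $p$, $\mathbb{Z}_p=\{0,\ldots,p-1\}$ is the field with $p$ elements. A presentation $P(A)$ on generators $b_1,\ldots,b_n$ with coefficients $A=(a_{ijk},a_{ik})$ has relations $[b_i,b_j]=\sum_{k=j+1}^n a_{ijk}b_k$ for $1\le i<j\le n$ and $pb_i=\sum_{k=i+1}^n a_{ik}b_k$ for $1\le i\le n$. Coefficients not occurring in these relations are $0$, with $a_{iik}=0$ and $a_{jik}=-a_{ijk}$. Suppose that $p$ is an indeterminate and that the $a_{ijk},a_{ik}$ are polynomials in $\mathbb{Z}[w,x_1,\ldots,x_m]$. Then $P(A)$ is a symbolic nilpotent presentation with respect to a set of primes $\Pi$ if for each $p\in\Pi$ and all $x_1,\ldots,x_m\in\mathbb{Z}_p$ the presentation $P(A)$ evaluated at these values, with $w$ a primitive root modulo $p$, defines a nilpotent Lie $p$-ring of order $p^n$. Matrix $Mat(A)$: consider formal linear combinations of $B_n=\{t_{ij}\mid 1\le i<j\le n\}\cup\{s_i\mid 1\le i\le n\}$, and set $t_{ii}=0$, $t_{ij}=-t_{ji}$ for $j<i$. Let $u_i=\sum_{k=1}^n a_{ik}t_{ki}$ for $1\le i\le n$; $v_{ij}=p\,t_{ij}+\sum_{k=1}^n(a_{ijk}s_k-a_{ik}t_{kj})$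 for $i\ne j$; $w_{ijh}=\sum_{k=1}^n(a_{jhk}t_{ik}+a_{ijk}t_{hk}+a_{hik}t_{jk})$ for $i<j<h$. The rows of $Mat(A)$ are the coefficient vectors of all these elements with respect to $B_n$. For a symbolic presentation its entries lie in $\mathbb{Z}[p,w,x_1,\ldots,x_m]$; for an evaluated presentation (with $p$ a prime) elementary divisors are those of an integer matrix. (The row elements $u_i$, $w_{ijh}$ are not to be confused with pseudo-units $u$ or the indeterminate $w$.) Pseudo-units: let $S=\mathbb{Z}[w,x_1,\ldots,x_m]$ and let $Q$ be its field of fractions, the rational functions in $w,x_1,\ldots,x_m$ over $\mathbb{Z}$. An element $s_np^n+\cdots+s_1p+s_0\in Q[p]$ with $s_i\in Q$ is called a pseudo-unit if $s_0\ne 0$. Every non-zero element of $Q[p]$ can be written as $p^l u$ with $u$ a pseudo-unit. The elementary row (column) operations in a Smith normal form computation are: interchanging two rows (columns), adding a multiple of one row (column) to another, and multiplying one row (column) by a unit of the underlying ring.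
   Formalization: The set of primes Π is assumed infinite; for finite Π the claim can fail, e.g. Π={3}, n=5, [b1,b2]=b4, [b2,b3]=2b4, [b1,b4]=2b5, [b3,b4]=-b5, other coefficients 0, where Mat(A) has elementary divisor 9 but the Schur multiplier has exponent 3. *)

theory Defs
  imports
    "HOL-Algebra.Free_Abelian_Groups"
    "HOL-Algebra.Product_Groups"
    "HOL-Computational_Algebra.Computational_Algebra"
    "HOL-Number_Theory.Residue_Primitive_Roots"
    "Jordan_Normal_Form.Column_Operations"
begin

section \<open>Lie rings\<close>

text \<open>A Lie ring is carried by a HOL-Algebra ring record: the additive part is the abelian group,
  the multiplication is the Lie bracket, and the field \<open>one\<close> plays no role.\<close>

locale lie_ring = abelian_group L for L (structure) +
  assumes bracket_closed: "\<lbrakk>x \<in> carrier L; y \<in> carrier L\<rbrakk> \<Longrightarrow> x \<otimes> y \<in> carrier L"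
    and bracket_add_left: "\<lbrakk>x \<in> carrier L; y \<in> carrier L; z \<in> carrier L\<rbrakk>
      \<Longrightarrow> (x \<oplus> y) \<otimes> z = x \<otimes> z \<oplus> y \<otimes> z"
    and bracket_add_right: "\<lbrakk>x \<in> carrier L; y \<in> carrier L; z \<in> carrier L\<rbrakk>
      \<Longrightarrow> x \<otimes> (y \<oplus> z) = x \<otimes> y \<oplus> x \<otimes> z"
    and bracket_alternating: "x \<in> carrier L \<Longrightarrow> x \<otimes> x = \<zero>"
    and jacobi: "\<lbrakk>x \<in> carrier L; y \<in> carrier L; z \<in> carrier L\<rbrakk>
      \<Longrightarrow> x \<otimes> (y \<otimes> z) \<oplus> y \<otimes> (z \<otimes> x) \<oplus> z \<otimes> (x \<otimes> y) = \<zero>"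

primrec lower_central :: "('a, 'b) ring_scheme \<Rightarrow> nat \<Rightarrow> 'a set" where
  "lower_central L 0 = carrier L"
| "lower_central L (Suc c) =
     generate (add_monoid L) {x \<otimes>\<^bsub>L\<^esub> y | x y. x \<in> lower_central L c \<and> y \<in> carrier L}"

definition nilpotent_lie_ring :: "('a, 'b) ring_scheme \<Rightarrow> bool" where
  "nilpotent_lie_ring L \<longleftrightarrow> lie_ring L \<and> (\<exists>c. lower_central L c = {\<zero>\<^bsub>L\<^esub>})"


section \<open>Chevalley--Eilenberg homology and the Schur multiplier\<close>

text \<open>The exterior power of degree \<open>k\<close> over the integers is the free abelian group on the lists of
  length \<open>k\<close> (a list stands for the wedge product of its entries) modulo the subgroup
  \<open>exterior_relations L k\<close>.\<close>

definition wedge_lists :: "('a, 'b) ring_scheme \<Rightarrow> nat \<Rightarrow> 'a list set" where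
  "wedge_lists L k = {xs. length xs = k \<and> set xs \<subseteq> carrier L}"

definition exterior_relations :: "('a, 'b) ring_scheme \<Rightarrow> nat \<Rightarrow> ('a list \<Rightarrow>\<^sub>0 int) set" where
  "exterior_relations L k = generate (free_Abelian_group (wedge_lists L k))
     ({frag_of (xs[i := a \<oplus>\<^bsub>L\<^esub> b]) - frag_of (xs[i := a]) - frag_of (xs[i := b]) | xs i a b.
         xs \<in> wedge_lists L k \<and> i < k \<and> a \<in> carrier L \<and> b \<in> carrier L} \<union>
      {frag_of xs | xs. xs \<in> wedge_lists L k \<and> (\<exists>i j. i < j \<and> j < k \<and> xs ! i = xs ! j)})"

definition exterior_power :: "('a, 'b) ring_scheme \<Rightarrow> nat \<Rightarrow> ('a list \<Rightarrow>\<^sub>0 int) set monoid" where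
  "exterior_power L k = free_Abelian_group (wedge_lists L k) Mod exterior_relations L k"

definition ce_boundary :: "('a, 'b) ring_scheme \<Rightarrow> 'a list \<Rightarrow> ('a list \<Rightarrow>\<^sub>0 int)" where
  "ce_boundary L xs = (\<Sum>(i, j) \<in> {(i, j). i < j \<and> j < length xs}.
     frag_cmul ((-1) ^ (i + j)) (frag_of ((xs ! i \<otimes>\<^bsub>L\<^esub> xs ! j) # nths xs (- {i, j}))))"

text \<open>The map induced by \<open>ce_boundary\<close> from the exterior power of degree \<open>k\<close> to that of
  degree \<open>k - 1\<close>; the union runs over the representatives of a coset and is a single coset.\<close>

definition ce_differential ::
    "('a, 'b) ring_scheme \<Rightarrow> nat \<Rightarrow> ('a list \<Rightarrow>\<^sub>0 int) set \<Rightarrow> ('a list \<Rightarrow>\<^sub>0 int) set" where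
  "ce_differential L k X = (\<Union>c \<in> X. exterior_relations L (k - 1)
     #>\<^bsub>free_Abelian_group (wedge_lists L (k - 1))\<^esub> frag_extend (ce_boundary L) c)"

definition ce_homology ::
    "('a, 'b) ring_scheme \<Rightarrow> nat \<Rightarrow> ('a list \<Rightarrow>\<^sub>0 int) set set monoid" where
  "ce_homology L k =
     exterior_power L k
       \<lparr>carrier := kernel (exterior_power L k) (exterior_power L (k - 1)) (ce_differential L k)\<rparr>
     Mod (ce_differential L (Suc k) ` carrier (exterior_power L (Suc k)))"

abbreviation schur_multiplier :: "('a, 'b) ring_scheme \<Rightarrow> ('a list \<Rightarrow>\<^sub>0 int) set set monoid" where
  "schur_multiplier L \<equiv> ce_homology L 2"

text \<open>Entries 1 are permitted; they contribute trivial factors.\<close>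

definition has_abelian_invariants :: "('a, 'b) monoid_scheme \<Rightarrow> nat list \<Rightarrow> bool" where
  "has_abelian_invariants G ds \<longleftrightarrow> (\<forall>d \<in> set ds. 0 < d) \<and>
     G \<cong> product_group {..<length ds} (\<lambda>i. integer_mod_group (ds ! i))"


section \<open>Lie rings given by generators and relations\<close>

datatype 'g lie_term =
    Gen 'g
  | Zero
  | Neg "'g lie_term"
  | Plus "'g lie_term" "'g lie_term"
  | Bracket "'g lie_term" "'g lie_term"

definition lie_terms :: "'g set \<Rightarrow> 'g lie_term set" where
  "lie_terms X = {t. set_lie_term t \<subseteq> X}"

inductive_set lie_congruence ::
    "'g set \<Rightarrow> ('g lie_term \<times> 'g lie_term) set \<Rightarrow> ('g lie_term \<times> 'g lie_term) set"
  for X :: "'g set" and R :: "('g lie_term \<times> 'g lie_term) set" where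
  relator: "\<lbrakk>(s, t) \<in> R; s \<in> lie_terms X; t \<in> lie_terms X\<rbrakk> \<Longrightarrow> (s, t) \<in> lie_congruence X R"
| refl: "t \<in> lie_terms X \<Longrightarrow> (t, t) \<in> lie_congruence X R"
| sym: "(s, t) \<in> lie_congruence X R \<Longrightarrow> (t, s) \<in> lie_congruence X R"
| trans: "\<lbrakk>(s, t) \<in> lie_congruence X R; (t, u) \<in> lie_congruence X R\<rbrakk>
    \<Longrightarrow> (s, u) \<in> lie_congruence X R"
| neg_cong: "(s, t) \<in> lie_congruence X R \<Longrightarrow> (Neg s, Neg t) \<in> lie_congruence X R"
| plus_cong: "\<lbrakk>(s, t) \<in> lie_congruence X R; (s', t') \<in> lie_congruence X R\<rbrakk>
    \<Longrightarrow> (Plus s s', Plus t t') \<in> lie_congruence X R"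
| bracket_cong: "\<lbrakk>(s, t) \<in> lie_congruence X R; (s', t') \<in> lie_congruence X R\<rbrakk>
    \<Longrightarrow> (Bracket s s', Bracket t t') \<in> lie_congruence X R"
| plus_assoc: "\<lbrakk>s \<in> lie_terms X; t \<in> lie_terms X; u \<in> lie_terms X\<rbrakk>
    \<Longrightarrow> (Plus (Plus s t) u, Plus s (Plus t u)) \<in> lie_congruence X R"
| plus_comm: "\<lbrakk>s \<in> lie_terms X; t \<in> lie_terms X\<rbrakk>
    \<Longrightarrow> (Plus s t, Plus t s) \<in> lie_congruence X R"
| plus_zero: "s \<in> lie_terms X \<Longrightarrow> (Plus Zero s, s) \<in> lie_congruence X R"
| plus_neg: "s \<in> lie_terms X \<Longrightarrow> (Plus (Neg s) s, Zero) \<in> lie_congruence X R"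
| bracket_plus_left: "\<lbrakk>s \<in> lie_terms X; t \<in> lie_terms X; u \<in> lie_terms X\<rbrakk>
    \<Longrightarrow> (Bracket (Plus s t) u, Plus (Bracket s u) (Bracket t u)) \<in> lie_congruence X R"
| bracket_plus_right: "\<lbrakk>s \<in> lie_terms X; t \<in> lie_terms X; u \<in> lie_terms X\<rbrakk>
    \<Longrightarrow> (Bracket s (Plus t u), Plus (Bracket s t) (Bracket s u)) \<in> lie_congruence X R"
| bracket_self: "s \<in> lie_terms X \<Longrightarrow> (Bracket s s, Zero) \<in> lie_congruence X R"
| bracket_jacobi: "\<lbrakk>s \<in> lie_terms X; t \<in> lie_terms X; u \<in> lie_terms X\<rbrakk>
    \<Longrightarrow> (Plus (Plus (Bracket s (Bracket t u)) (Bracket t (Bracket u s))) (Bracket u (Bracket s t)),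
         Zero) \<in> lie_congruence X R"

definition presented_lie_ring ::
    "'g set \<Rightarrow> ('g lie_term \<times> 'g lie_term) set \<Rightarrow> 'g lie_term set ring" where
  "presented_lie_ring X R = \<lparr>
     carrier = lie_terms X // lie_congruence X R,
     monoid.mult = (\<lambda>U V. \<Union>s \<in> U. \<Union>t \<in> V. lie_congruence X R `` {Bracket s t}),
     one = lie_congruence X R `` {Zero},
     zero = lie_congruence X R `` {Zero},
     add = (\<lambda>U V. \<Union>s \<in> U. \<Union>t \<in> V. lie_congruence X R `` {Plus s t})\<rparr>"

definition term_multiple :: "int \<Rightarrow> 'g lie_term \<Rightarrow> 'g lie_term" where
  "term_multiple c t =
     (if 0 \<le> c then (Plus t ^^ nat c) Zero else Neg ((Plus t ^^ nat (- c)) Zero))"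

definition term_sum :: "'g lie_term list \<Rightarrow> 'g lie_term" where
  "term_sum ts = foldr Plus ts Zero"


section \<open>The presentation \<open>P(A)\<close> and the matrix \<open>Mat(A)\<close>\<close>

text \<open>\<open>bracket_coeff A i j k\<close> is the coefficient with three indices and \<open>power_coeff A i k\<close> the one
  with two indices.\<close>

record 'c coefficients =
  bracket_coeff :: "nat \<Rightarrow> nat \<Rightarrow> nat \<Rightarrow> 'c"
  power_coeff :: "nat \<Rightarrow> nat \<Rightarrow> 'c"

definition map_coefficients :: "('c \<Rightarrow> 'd) \<Rightarrow> 'c coefficients \<Rightarrow> 'd coefficients" where
  "map_coefficients f A = \<lparr>bracket_coeff = (\<lambda>i j k. f (bracket_coeff A i j k)),
                            power_coeff = (\<lambda>i k. f (power_coeff A i k))\<rparr>"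

definition presentation_coefficients :: "nat \<Rightarrow> 'c::ring_1 coefficients \<Rightarrow> bool" where
  "presentation_coefficients n A \<longleftrightarrow>
     (\<forall>i k. power_coeff A i k \<noteq> 0 \<longrightarrow> 1 \<le> i \<and> i < k \<and> k \<le> n) \<and>
     (\<forall>i j k. i < j \<and> bracket_coeff A i j k \<noteq> 0 \<longrightarrow> 1 \<le> i \<and> j < k \<and> k \<le> n) \<and>
     (\<forall>i k. bracket_coeff A i i k = 0) \<and>
     (\<forall>i j k. bracket_coeff A j i k = - bracket_coeff A i j k)"

definition presentation_relations ::
    "nat \<Rightarrow> nat \<Rightarrow> int coefficients \<Rightarrow> (nat lie_term \<times> nat lie_term) set" where
  "presentation_relations n p A =
     {(Bracket (Gen i) (Gen j),
       term_sum (map (\<lambda>k. term_multiple (bracket_coeff A i j k) (Gen k)) [Suc j..<Suc n])) | i j.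
        1 \<le> i \<and> i < j \<and> j \<le> n} \<union>
     {(term_multiple (int p) (Gen i),
       term_sum (map (\<lambda>k. term_multiple (power_coeff A i k) (Gen k)) [Suc i..<Suc n])) | i.
        1 \<le> i \<and> i \<le> n}"

definition presentation_ring :: "nat \<Rightarrow> nat \<Rightarrow> int coefficients \<Rightarrow> nat lie_term set ring" where
  "presentation_ring n p A = presented_lie_ring {1..n} (presentation_relations n p A)"

datatype tail = T nat nat | S nat

definition tails :: "nat \<Rightarrow> tail list" where
  "tails n = [T i j. i \<leftarrow> [1..<Suc n], j \<leftarrow> [Suc i..<Suc n]] @ [S i. i \<leftarrow> [1..<Suc n]]"

text \<open>A formal linear combination is given by its coefficient function on the tails.\<close>

definition t_elem :: "nat \<Rightarrow> nat \<Rightarrow> tail \<Rightarrow> 'c::ring_1" where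
  "t_elem i j e =
     (if i < j then of_bool (e = T i j) else if j < i then - of_bool (e = T j i) else 0)"

definition s_elem :: "nat \<Rightarrow> tail \<Rightarrow> 'c::ring_1" where
  "s_elem i e = of_bool (e = S i)"

definition row_u :: "nat \<Rightarrow> 'c::comm_ring_1 coefficients \<Rightarrow> nat \<Rightarrow> tail \<Rightarrow> 'c" where
  "row_u n A i e = (\<Sum>k = 1..n. power_coeff A i k * t_elem k i e)"

definition row_v :: "nat \<Rightarrow> 'c \<Rightarrow> 'c::comm_ring_1 coefficients \<Rightarrow> nat \<Rightarrow> nat \<Rightarrow> tail \<Rightarrow> 'c" where
  "row_v n P A i j e = P * t_elem i j e +
     (\<Sum>k = 1..n. bracket_coeff A i j k * s_elem k e - power_coeff A i k * t_elem k j e)"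

definition row_w :: "nat \<Rightarrow> 'c::comm_ring_1 coefficients \<Rightarrow> nat \<Rightarrow> nat \<Rightarrow> nat \<Rightarrow> tail \<Rightarrow> 'c" where
  "row_w n A i j h e =
     (\<Sum>k = 1..n. bracket_coeff A j h k * t_elem i k e + bracket_coeff A i j k * t_elem h k e
        + bracket_coeff A h i k * t_elem j k e)"

definition Mat_rows :: "nat \<Rightarrow> 'c \<Rightarrow> 'c::comm_ring_1 coefficients \<Rightarrow> (tail \<Rightarrow> 'c) list" where
  "Mat_rows n P A =
     [row_u n A i. i \<leftarrow> [1..<Suc n]] @
     [row_v n P A i j. i \<leftarrow> [1..<Suc n], j \<leftarrow> [1..<Suc n], i \<noteq> j] @
     [row_w n A i j h. i \<leftarrow> [1..<Suc n], j \<leftarrow> [Suc i..<Suc n], h \<leftarrow> [Suc j..<Suc n]]"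

text \<open>\<open>P\<close> is the value of \<open>p\<close> in the ring of entries: an indeterminate or a prime.\<close>

definition Mat :: "nat \<Rightarrow> 'c \<Rightarrow> 'c::comm_ring_1 coefficients \<Rightarrow> 'c mat" where
  "Mat n P A = mat (length (Mat_rows n P A)) (length (tails n))
     (\<lambda>(r, c). (Mat_rows n P A ! r) (tails n ! c))"


section \<open>Polynomial coefficients and symbolic presentations\<close>

text \<open>Integer polynomials in the variables with numbers \<open>0, 1, 2, \<dots>\<close>, as finitely supported
  functions on monomials. Variable 0 is \<open>w\<close> and variable \<open>i \<ge> 1\<close> is the \<open>i\<close>-th \<open>x\<close>.\<close>

type_synonym mpoly = "(nat \<Rightarrow>\<^sub>0 nat) \<Rightarrow>\<^sub>0 int"

definition S_ring :: "nat \<Rightarrow> mpoly set" where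
  "S_ring m = {f. \<forall>\<mu> \<in> Poly_Mapping.keys f. Poly_Mapping.keys \<mu> \<subseteq> {0..m}}"

definition mpoly_eval :: "(nat \<Rightarrow> int) \<Rightarrow> mpoly \<Rightarrow> int" where
  "mpoly_eval \<rho> f = (\<Sum>\<mu> \<in> Poly_Mapping.keys f. Poly_Mapping.lookup f \<mu> *
     (\<Prod>v \<in> Poly_Mapping.keys \<mu>. \<rho> v ^ Poly_Mapping.lookup \<mu> v))"

definition point :: "nat \<Rightarrow> (nat \<Rightarrow> int) \<Rightarrow> nat \<Rightarrow> int" where
  "point w x = (\<lambda>i. if i = 0 then int w else x i)"

definition Zp_tuples :: "nat \<Rightarrow> nat \<Rightarrow> (nat \<Rightarrow> int) set" where
  "Zp_tuples p m = {1..m} \<rightarrow>\<^sub>E {0..<int p}"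

definition primitive_roots :: "nat \<Rightarrow> nat set" where
  "primitive_roots p = {w. w < p \<and> residue_primroot p w}"

definition evaluated_coefficients ::
    "nat \<Rightarrow> (nat \<Rightarrow> int) \<Rightarrow> mpoly coefficients \<Rightarrow> int coefficients" where
  "evaluated_coefficients w x A = map_coefficients (mpoly_eval (point w x)) A"

definition symbolic_nilpotent_presentation ::
    "nat \<Rightarrow> nat \<Rightarrow> nat set \<Rightarrow> mpoly coefficients \<Rightarrow> bool" where
  "symbolic_nilpotent_presentation n m PS A \<longleftrightarrow>
     presentation_coefficients n A \<and>
     (\<forall>i j k. bracket_coeff A i j k \<in> S_ring m) \<and>
     (\<forall>i k. power_coeff A i k \<in> S_ring m) \<and>
     (\<forall>p \<in> PS. prime p) \<and>
     (\<forall>p \<in> PS. \<forall>w \<in> primitive_roots p. \<forall>x \<in> Zp_tuples p m.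
        nilpotent_lie_ring (presentation_ring n p (evaluated_coefficients w x A)) \<and>
        card (carrier (presentation_ring n p (evaluated_coefficients w x A))) = p ^ n)"


text \<open>The row formulas of \<open>Mat\<close> compare coefficients of the generators, so they describe the Schur
  multiplier when the consistency relations hold as identities between coefficients. For infinitely
  many primes this follows from the definition above; for finitely many it does not. An example for
  the single prime 3 is \<open>n = 5\<close> with \<open>[b1, b2] = b4\<close>, \<open>[b2, b3] = 2 b4\<close>, \<open>[b1, b4] = 2 b5\<close>,
  \<open>[b3, b4] = - b5\<close> and all other coefficients 0: the Jacobi sum of \<open>b1, b2, b3\<close> is \<open>3 b5\<close>, the
  presented ring has order 243 and additive exponent 3, but \<open>Mat\<close> has 9 as an elementary
  divisor.\<close>


section \<open>The ring \<open>Q[p]\<close> and pseudo-units\<close>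

text \<open>Elements of \<open>Q[p]\<close> are univariate polynomials, with \<open>p\<close> the polynomial variable
  \<open>[:0, 1:]\<close>.\<close>

definition Q_field :: "nat \<Rightarrow> mpoly fract set" where
  "Q_field m = {Fract f g | f g. f \<in> S_ring m \<and> g \<in> S_ring m \<and> g \<noteq> 0}"

definition Qp_ring :: "nat \<Rightarrow> mpoly fract poly set" where
  "Qp_ring m = {c. \<forall>i. Polynomial.coeff c i \<in> Q_field m}"

definition Sp_ring :: "nat \<Rightarrow> mpoly poly set" where
  "Sp_ring m = {f. \<forall>i. Polynomial.coeff f i \<in> S_ring m}"

definition pseudo_unit :: "nat \<Rightarrow> mpoly fract poly \<Rightarrow> bool" where
  "pseudo_unit m u \<longleftrightarrow> u \<in> Qp_ring m \<and> Polynomial.coeff u 0 \<noteq> 0"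

text \<open>\<open>c = f / g\<close> with \<open>f\<close> in \<open>S[p]\<close> and \<open>g\<close> a non-zero element of \<open>S\<close>.\<close>

definition fraction_form :: "nat \<Rightarrow> mpoly fract poly \<Rightarrow> mpoly poly \<Rightarrow> mpoly \<Rightarrow> bool" where
  "fraction_form m c f g \<longleftrightarrow> f \<in> Sp_ring m \<and> g \<in> S_ring m \<and> g \<noteq> 0 \<and>
     Polynomial.smult (to_fract g) c = map_poly to_fract f"

text \<open>The value of \<open>c\<close> in the field with \<open>p\<close> elements, computed from some form \<open>f / g\<close> of \<open>c\<close>
  whose denominator does not vanish there. If there is no such form, then \<open>c\<close> has no value, and
  \<open>Zp_value\<close> is 0 as usual for a division by zero.\<close>

definition has_Zp_value ::
    "nat \<Rightarrow> nat \<Rightarrow> nat \<Rightarrow> (nat \<Rightarrow> int) \<Rightarrow> mpoly fract poly \<Rightarrow> int \<Rightarrow> bool" where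
  "has_Zp_value m p w x c r \<longleftrightarrow> r \<in> {0..<int p} \<and>
     (\<exists>f g. fraction_form m c f g \<and>
        \<not> [mpoly_eval (point w x) g = 0] (mod int p) \<and>
        [r * mpoly_eval (point w x) g = poly (map_poly (mpoly_eval (point w x)) f) (int p)]
          (mod int p))"

definition Zp_value ::
    "nat \<Rightarrow> nat \<Rightarrow> nat \<Rightarrow> (nat \<Rightarrow> int) \<Rightarrow> mpoly fract poly \<Rightarrow> int" where
  "Zp_value m p w x c =
     (if \<exists>r. has_Zp_value m p w x c r then THE r. has_Zp_value m p w x c r else 0)"

definition exceptional_set ::
    "nat \<Rightarrow> nat \<Rightarrow> nat \<Rightarrow> mpoly fract poly \<Rightarrow> (nat \<Rightarrow> int) set" where
  "exceptional_set m p w u = {x \<in> Zp_tuples p m. Zp_value m p w x u = 0}"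


section \<open>Smith normal forms\<close>

definition diagonal_entries :: "'a mat \<Rightarrow> 'a list" where
  "diagonal_entries D = map (\<lambda>i. D $$ (i, i)) [0..<min (dim_row D) (dim_col D)]"

definition smith_shape :: "'a::comm_ring_1 mat \<Rightarrow> bool" where
  "smith_shape D \<longleftrightarrow> diagonal_mat D \<and>
     (\<forall>i. Suc i < min (dim_row D) (dim_col D) \<longrightarrow> D $$ (i, i) dvd D $$ (Suc i, Suc i))"

definition int_smith_normal_form :: "int mat \<Rightarrow> int mat \<Rightarrow> bool" where
  "int_smith_normal_form M D \<longleftrightarrow>
     (\<exists>U V. U \<in> carrier_mat (dim_row M) (dim_row M) \<and> invertible_mat U \<and>
            V \<in> carrier_mat (dim_col M) (dim_col M) \<and> invertible_mat V \<and> D = U * M * V) \<and>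
     smith_shape D \<and> (\<forall>d \<in> set (diagonal_entries D). 0 \<le> d)"

text \<open>Multiplying by an element of \<open>Q[p]\<close> that is not in \<open>S[p]\<close> divides by a denominator, which
  is a pseudo-unit.\<close>

inductive stored_denominators :: "nat \<Rightarrow> mpoly fract poly \<Rightarrow> mpoly fract poly list \<Rightarrow> bool"
  for m :: nat where
  no_division: "f \<in> Sp_ring m \<Longrightarrow> stored_denominators m (map_poly to_fract f) []"
| division: "fraction_form m c f g \<Longrightarrow> stored_denominators m c [[:to_fract g:]]"

text \<open>\<open>pseudo_operation m M us M'\<close>: one elementary operation over \<open>Q[p]\<close>, with pseudo-units in
  the role of units, turns \<open>M\<close> into \<open>M'\<close>, and \<open>us\<close> are the pseudo-units by which it divides. A
  division of a row or column by a pseudo-unit must be exact; it is expressed by recovering \<open>M\<close>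
  from \<open>M'\<close>.\<close>

inductive pseudo_operation ::
    "nat \<Rightarrow> mpoly fract poly mat \<Rightarrow> mpoly fract poly list \<Rightarrow> mpoly fract poly mat \<Rightarrow> bool"
  for m :: nat where
  swap_rows: "\<lbrakk>k < dim_row M; l < dim_row M\<rbrakk> \<Longrightarrow> pseudo_operation m M [] (swaprows k l M)"
| swap_cols: "\<lbrakk>k < dim_col M; l < dim_col M\<rbrakk> \<Longrightarrow> pseudo_operation m M [] (swapcols k l M)"
| add_row: "\<lbrakk>k < dim_row M; l < dim_row M; k \<noteq> l; c \<in> Qp_ring m; stored_denominators m c us\<rbrakk>
    \<Longrightarrow> pseudo_operation m M us (addrow c k l M)"
| add_col: "\<lbrakk>k < dim_col M; l < dim_col M; k \<noteq> l; c \<in> Qp_ring m; stored_denominators m c us\<rbrakk>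
    \<Longrightarrow> pseudo_operation m M us (addcol c k l M)"
| mult_row: "\<lbrakk>k < dim_row M; pseudo_unit m u; stored_denominators m u us\<rbrakk>
    \<Longrightarrow> pseudo_operation m M us (multrow k u M)"
| mult_col: "\<lbrakk>k < dim_col M; pseudo_unit m u; stored_denominators m u us\<rbrakk>
    \<Longrightarrow> pseudo_operation m M us (multcol k u M)"
| div_row: "\<lbrakk>k < dim_row M; pseudo_unit m u; M = multrow k u M'\<rbrakk>
    \<Longrightarrow> pseudo_operation m M [u] M'"
| div_col: "\<lbrakk>k < dim_col M; pseudo_unit m u; M = multcol k u M'\<rbrakk>
    \<Longrightarrow> pseudo_operation m M [u] M'"

inductive pseudo_operations ::
    "nat \<Rightarrow> mpoly fract poly mat \<Rightarrow> mpoly fract poly list \<Rightarrow> mpoly fract poly mat \<Rightarrow> bool"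
  for m :: nat where
  start: "pseudo_operations m M [] M"
| step: "\<lbrakk>pseudo_operations m M us M'; pseudo_operation m M' vs M''\<rbrakk>
    \<Longrightarrow> pseudo_operations m M (us @ vs) M''"

text \<open>The diagonal entries of a completed computation are normalised: no pseudo-unit factor of a
  decomposition \<open>p^l * u\<close> is left to divide by.\<close>

definition pseudo_smith_form :: "nat \<Rightarrow> mpoly fract poly mat \<Rightarrow> bool" where
  "pseudo_smith_form m D \<longleftrightarrow> smith_shape D \<and>
     (\<forall>d \<in> set (diagonal_entries D). d \<noteq> 0 \<longrightarrow>
        (\<forall>l u. d = [:0, 1:] ^ l * u \<and> pseudo_unit m u \<longrightarrow> u = 1))"

text \<open>A Smith normal form computation starting at \<open>M\<close> that returns the stored pseudo-units \<open>us\<close>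
  and the elementary divisors \<open>ds\<close>.\<close>

definition pseudo_smith_computation ::
    "nat \<Rightarrow> mpoly fract poly mat \<Rightarrow> mpoly fract poly list \<Rightarrow> mpoly fract poly list \<Rightarrow> bool" where
  "pseudo_smith_computation m M us ds \<longleftrightarrow>
     (\<exists>D. pseudo_operations m M us D \<and> pseudo_smith_form m D \<and> ds = diagonal_entries D)"

definition symbolic_Mat :: "nat \<Rightarrow> mpoly coefficients \<Rightarrow> mpoly fract poly mat" where
  "symbolic_Mat n A = Mat n [:0, 1:] (map_coefficients (\<lambda>f. [:to_fract f:]) A)"

end

theory Submission
  imports Defs "HOL-Library.Function_Algebras" "Jordan_Normal_Form.Char_Poly"
begin

text \<open>By Hopf's formula in its Chevalley--Eilenberg form, the Schur multiplier of the evaluated Lie ring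
  is the kernel of the map \<open>t\<^sub>i\<^sub>j \<mapsto> [b\<^sub>i, b\<^sub>j]\<close>, \<open>s\<^sub>i \<mapsto> - (p b\<^sub>i - \<Sum>a\<^sub>i\<^sub>k b\<^sub>k)\<close> into the free abelian group on the
  generators, modulo the row span of \<open>Mat(A)\<close>. This needs the consistency relations of the presentation
  as identities between integer coefficients. They hold modulo the relations at every evaluation, so
  coordinate by coordinate they are divisible by infinitely many primes at all points, and hence vanish
  as polynomials. A multiple of each kernel element by a power of \<open>p\<close> lies in the row span, so the
  non-zero elementary divisors are the orders of the cyclic factors and are powers of \<open>p\<close>.
  Every step of a symbolic computation can be undone up to a pseudo-unit, so the determinantal divisors
  of the symbolic diagonal form divide the minors of \<open>Mat(A)\<close>. This survives evaluation; outside the exceptional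
  set the computation itself also evaluates to matrices over the integers up to a factor prime to \<open>p\<close>, and the two
  divisibilities determine the evaluated elementary divisors.\<close>

text \<open>Counting elements gives the consistency relations only modulo the lattice of power
  relations, whereas \<open>Mat\<close> is written in coefficients. That lattice is triangular with
  \<open>p\<close> on the diagonal, so the first non-zero coordinate of each of its elements is
  divisible by \<open>p\<close>; each coordinate therefore has to be treated after the polynomials
  of all earlier ones are known to be 0. As \<open>w\<close> takes only primitive roots as values,
  their number \<open>totient (p - 1)\<close> must be shown to be unbounded.

  On the matrix side only divisions are stored. A row may also be multiplied by a pseudo-unit that
  becomes 0 modulo \<open>p\<close> at a point outside the exceptional set, so the evaluated
  transformation can be singular modulo \<open>p\<close> and bounds the determinantal divisors from
  one side only. The other bound is obtained before evaluation: in \<open>Q[p]\<close> a power of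
  \<open>p\<close> that divides \<open>u * y\<close>, with \<open>u\<close> a pseudo-unit, divides
  \<open>y\<close>; and divisibility by a power of \<open>p\<close> is a condition on coefficients,
  so it passes down to polynomials without fractions.\<close>

section \<open>Integer vectors on the generators\<close>

definition int_vecs :: "nat \<Rightarrow> (nat \<Rightarrow> int) set" where
  "int_vecs n = {x. \<forall>i. x i \<noteq> 0 \<longrightarrow> i \<in> {1..n}}"

definition unit_fun :: "nat \<Rightarrow> nat \<Rightarrow> int" where
  "unit_fun i = (\<lambda>j. of_bool (j = i))"

lemma int_vecs_diff: "x \<in> int_vecs n \<Longrightarrow> y \<in> int_vecs n \<Longrightarrow> x - y \<in> int_vecs n"
  unfolding int_vecs_def minus_apply mem_Collect_eq by (metis diff_0_right)

lemma zero_int_vecs: "0 \<in> int_vecs n"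
  by (simp add: int_vecs_def)

lemma unit_fun_int_vecs: "i \<in> {1..n} \<Longrightarrow> unit_fun i \<in> int_vecs n"
  by (simp add: int_vecs_def unit_fun_def)

text \<open>Subgroups are treated throughout as predicates that hold at 0 and are stable under
  differences; negatives arise as \<open>0 - y\<close>, and sums and integer multiples
  follow.\<close>

lemma diff_closed_imp_add_closed:
  fixes P :: "'a::ab_group_add \<Rightarrow> bool"
  assumes "P 0" "\<And>x y. P x \<Longrightarrow> P y \<Longrightarrow> P (x - y)" "P x" "P y"
  shows "P (x + y)"
proof -
  have "P (0 - y)" using assms by blast
  then have "P (x - (0 - y))" using assms by blast
  then show ?thesis by simp
qed

lemma diff_closed_sum:
  fixes P :: "'a::ab_group_add \<Rightarrow> bool"
  assumes "P 0" "\<And>x y. P x \<Longrightarrow> P y \<Longrightarrow> P (x - y)" "\<And>i. i \<in> I \<Longrightarrow> P (f i)"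
  shows "P (sum f I)"
  using assms(3)
proof (induction I rule: infinite_finite_induct)
  case (insert i I)
  have "P (f i + sum f I)"
    by (rule diff_closed_imp_add_closed[of P]) (use assms insert in auto)
  then show ?case using insert by simp
qed (use assms in auto)

lemma diff_closed_mult:
  fixes f :: "'a \<Rightarrow> int"
  assumes "P 0" "\<And>x y. P x \<Longrightarrow> P y \<Longrightarrow> P (x - y)" "P f"
  shows "P (\<lambda>e. k * f e)"
proof (induction k rule: int_induct[where k = 0])
  case base
  then show ?case using assms(1) by (simp add: zero_fun_def)
next
  case (step1 i)
  have "P ((\<lambda>e. i * f e) + f)"
    by (rule diff_closed_imp_add_closed[of P]) (use assms step1 in auto)
  then show ?case by (simp add: plus_fun_def algebra_simps)
next
  case (step2 i)
  have "P ((\<lambda>e. i * f e) - f)" using assms step2 by auto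
  then show ?case by (simp add: fun_diff_def algebra_simps)
qed

lemma int_vecs_sum_unit:
  assumes "x \<in> int_vecs n"
  shows "x = (\<Sum>i = 1..n. (\<lambda>j. x i * unit_fun i j))"
proof
  fix j
  have "(\<Sum>i = 1..n. (\<lambda>j. x i * unit_fun i j)) j = (\<Sum>i = 1..n. x i * unit_fun i j)"
    by (induction rule: infinite_finite_induct) auto
  also have "\<dots> = (\<Sum>i = 1..n. if i = j then x j else 0)"
    by (rule sum.cong) (auto simp: unit_fun_def)
  also have "\<dots> = (if j \<in> {1..n} then x j else 0)" by (rule sum.delta) simp
  also have "\<dots> = x j"
  proof (cases "j \<in> {1..n}")
    case False
    then have "x j = 0" using assms unfolding int_vecs_def by blast
    then show ?thesis by simp
  qed simp
  finally show "x j = (\<Sum>i = 1..n. (\<lambda>j. x i * unit_fun i j)) j" by simp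
qed

text \<open>A linear property is decided on unit vectors. With differences as the only closure
  condition each use has three cases; nested two or three times, the rule settles bilinear and
  trilinear statements.\<close>

lemma int_vecs_induct [consumes 1, case_names zero unit diff]:
  assumes "x \<in> int_vecs n" and "P 0"
    and unit: "\<And>i. i \<in> {1..n} \<Longrightarrow> P (unit_fun i)"
    and diff: "\<And>x y. x \<in> int_vecs n \<Longrightarrow> y \<in> int_vecs n \<Longrightarrow> P x \<Longrightarrow> P y \<Longrightarrow> P (x - y)"
  shows "P x"
proof -
  let ?Q = "\<lambda>x. x \<in> int_vecs n \<and> P x"
  have Q0: "?Q 0" using assms(2) by (simp add: zero_int_vecs)
  have Qd: "?Q x \<Longrightarrow> ?Q y \<Longrightarrow> ?Q (x - y)" for x y
    using diff int_vecs_diff by blast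
  have "?Q (\<Sum>i = 1..n. (\<lambda>j. x i * unit_fun i j))"
  proof (rule diff_closed_sum[of ?Q, OF Q0 Qd])
    fix i assume "i \<in> {1..n}"
    then show "?Q (\<lambda>j. x i * unit_fun i j)"
      by (intro diff_closed_mult[of ?Q, OF Q0 Qd]) (auto simp: unit unit_fun_int_vecs)
  qed auto
  then show ?thesis using int_vecs_sum_unit[OF assms(1)] by simp
qed

lemma sum_fun_apply: "(\<Sum>i\<in>I. f i) e = (\<Sum>i\<in>I. f i e)"
  by (induction I rule: infinite_finite_induct) auto

section \<open>Formal bracket, power relations and tails\<close>

locale lie_coefficients =
  fixes n :: nat and p :: nat and A :: "int coefficients"
  assumes coefficients: "presentation_coefficients n A" and p_pos: "0 < p"
begin

abbreviation "a \<equiv> bracket_coeff A"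
abbreviation "q \<equiv> power_coeff A"

definition bracket :: "(nat \<Rightarrow> int) \<Rightarrow> (nat \<Rightarrow> int) \<Rightarrow> nat \<Rightarrow> int" where
  "bracket x y = (\<lambda>l. \<Sum>i = 1..n. \<Sum>j = 1..n. x i * y j * a i j l)"

text \<open>The endomorphism of the free abelian group that sends the i-th generator to
  \<open>p b_i - (\<Sum>k. a_ik b_k)\<close>; its image is the lattice of power relations.\<close>

definition phi :: "(nat \<Rightarrow> int) \<Rightarrow> nat \<Rightarrow> int" where
  "phi x = (\<lambda>l. int p * x l - (\<Sum>k = 1..n. x k * q k l))"

text \<open>Coordinates of the exterior product of \<open>x\<close> and \<open>y\<close>, with
  \<open>t_ij\<close> standing for the product of the i-th and the j-th generator.\<close>

definition wedge :: "(nat \<Rightarrow> int) \<Rightarrow> (nat \<Rightarrow> int) \<Rightarrow> tail \<Rightarrow> int" where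
  "wedge x y = (\<lambda>e. case e of T i j \<Rightarrow> (if i < j then x i * y j - x j * y i else 0) | S _ \<Rightarrow> 0)"

definition s_part :: "(nat \<Rightarrow> int) \<Rightarrow> tail \<Rightarrow> int" where
  "s_part x = (\<lambda>e. case e of T i j \<Rightarrow> 0 | S i \<Rightarrow> x i)"

definition tail_funs :: "(tail \<Rightarrow> int) set" where
  "tail_funs = {c. \<forall>e. c e \<noteq> 0 \<longrightarrow> e \<in> set (tails n)}"

definition delta :: "(tail \<Rightarrow> int) \<Rightarrow> nat \<Rightarrow> int" where
  "delta c = (\<lambda>l. \<Sum>i = 1..n. \<Sum>j = 1..n. if i < j then c (T i j) * a i j l else 0)"

definition theta :: "(tail \<Rightarrow> int) \<Rightarrow> nat \<Rightarrow> int" where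
  "theta c = delta c - phi (\<lambda>i. c (S i))"

definition cycles :: "(tail \<Rightarrow> int) set" where
  "cycles = {c \<in> tail_funs. theta c = 0}"

definition row_span :: "(tail \<Rightarrow> int) set" where
  "row_span = {c. \<exists>z. c = (\<lambda>e. \<Sum>r < length (Mat_rows n (int p) A). z r * (Mat_rows n (int p) A ! r) e)}"

text \<open>Trilinear extension of the rows \<open>w_ijh\<close>; its image under
  \<open>theta\<close> is the Jacobi sum of \<open>x\<close>, \<open>y\<close>,
  \<open>z\<close>.\<close>

definition jacobi_row :: "(nat \<Rightarrow> int) \<Rightarrow> (nat \<Rightarrow> int) \<Rightarrow> (nat \<Rightarrow> int) \<Rightarrow> tail \<Rightarrow> int" where
  "jacobi_row x y z = wedge x (bracket y z) + wedge y (bracket z x) + wedge z (bracket x y)"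

text \<open>Bilinear extension of the rows \<open>v_ij\<close>. Its image under \<open>theta\<close>
  is \<open>bracket (phi x) y - phi (bracket x y)\<close>, the failure of \<open>phi\<close> to
  commute with bracketing.\<close>

definition central_row :: "(nat \<Rightarrow> int) \<Rightarrow> (nat \<Rightarrow> int) \<Rightarrow> tail \<Rightarrow> int" where
  "central_row x y = wedge (phi x) y + s_part (bracket x y)"

lemma a_antisym: "a j i k = - a i j k"
  using coefficients unfolding presentation_coefficients_def by blast

lemma a_self: "a i i k = 0"
  using coefficients unfolding presentation_coefficients_def by blast

lemma a_support: "a i j k \<noteq> 0 \<Longrightarrow> i \<in> {1..n} \<and> j \<in> {1..n} \<and> k \<in> {1..n}"
proof -
  have *: "i \<in> {1..n} \<and> j \<in> {1..n} \<and> k \<in> {1..n}" if "i < j" "a i j k \<noteq> 0" for i j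
  proof -
    have "1 \<le> i \<and> j < k \<and> k \<le> n"
      using coefficients that unfolding presentation_coefficients_def by blast
    then show ?thesis using that by simp
  qed
  assume nz: "a i j k \<noteq> 0"
  consider "i < j" | "i = j" | "j < i" by linarith
  then show ?thesis
  proof cases
    case 3
    have "a j i k \<noteq> 0" using nz a_antisym[of i j k] by simp
    from *[OF 3 this] show ?thesis by blast
  qed (use nz * a_self in auto)
qed

lemma q_support: "q i k \<noteq> 0 \<Longrightarrow> 1 \<le> i \<and> i < k \<and> k \<le> n"
  using coefficients unfolding presentation_coefficients_def by blast

lemma bracket_unit: "i \<in> {1..n} \<Longrightarrow> j \<in> {1..n} \<Longrightarrow> bracket (unit_fun i) (unit_fun j) = a i j"
proof
  fix l assume ij: "i \<in> {1..n}" "j \<in> {1..n}"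
  have "bracket (unit_fun i) (unit_fun j) l
    = (\<Sum>i' = 1..n. \<Sum>j' = 1..n. if j' = j then (if i' = i then a i j l else 0) else 0)"
    unfolding bracket_def by (intro sum.cong) (auto simp: unit_fun_def)
  also have "\<dots> = a i j l" using ij by (simp add: sum.delta)
  finally show "bracket (unit_fun i) (unit_fun j) l = a i j l" .
qed

lemma bracket_diff_left: "bracket (x - y) z = bracket x z - bracket y z"
  unfolding bracket_def by (rule ext) (simp add: algebra_simps sum_subtractf)

lemma bracket_diff_right: "bracket z (x - y) = bracket z x - bracket z y"
  unfolding bracket_def by (rule ext) (simp add: algebra_simps sum_subtractf)

lemma bracket_zero: "bracket 0 y = 0" "bracket y 0 = 0"
  unfolding bracket_def by auto

lemma bracket_vecs: "bracket x y \<in> int_vecs n"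
proof -
  have "bracket x y l = 0" if "l \<notin> {1..n}" for l
  proof -
    have "a i j l = 0" for i j using a_support[of i j l] that by auto
    then show ?thesis by (simp add: bracket_def)
  qed
  then show ?thesis by (auto simp: int_vecs_def)
qed

lemma phi_diff: "phi (x - y) = phi x - phi y"
  unfolding phi_def by (rule ext) (simp add: algebra_simps sum_subtractf)

lemma phi_zero: "phi 0 = 0"
  unfolding phi_def by auto

lemma phi_vecs: "x \<in> int_vecs n \<Longrightarrow> phi x \<in> int_vecs n"
proof -
  assume x: "x \<in> int_vecs n"
  have "phi x l = 0" if "l \<notin> {1..n}" for l
  proof -
    have "q i l = 0" for i using q_support[of i l] that by (metis One_nat_def atLeastAtMost_iff le_trans less_imp_le_nat)
    moreover have "x l = 0" using x that by (auto simp: int_vecs_def)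
    ultimately show ?thesis by (simp add: phi_def)
  qed
  then show ?thesis by (auto simp: int_vecs_def)
qed

lemma phi_unit: "i \<in> {1..n} \<Longrightarrow> phi (unit_fun i) = (\<lambda>l. int p * unit_fun i l - q i l)"
proof
  fix l assume i: "i \<in> {1..n}"
  have "(\<Sum>k = 1..n. unit_fun i k * q k l) = (\<Sum>k = 1..n. if k = i then q i l else 0)"
    by (intro sum.cong) (auto simp: unit_fun_def)
  then show "phi (unit_fun i) l = int p * unit_fun i l - q i l" using i by (simp add: phi_def)
qed

text \<open>Power coefficients are strictly triangular, so coordinate \<open>l\<close> of
  \<open>phi x\<close> is \<open>p x_l\<close> plus contributions of \<open>x_k\<close> with
  \<open>k < l\<close>; the coordinates of \<open>x\<close> vanish one after another.\<close>

lemma phi_inj: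
  assumes "x \<in> int_vecs n" "phi x = 0"
  shows "x = 0"
proof
  fix l
  show "x l = 0 l"
  proof (induction l rule: less_induct)
    case (less l)
    have "(\<Sum>k = 1..n. x k * q k l) = 0"
    proof (rule sum.neutral, rule ballI)
      fix k show "x k * q k l = 0"
      proof (cases "k < l")
        case False
        then have "q k l = 0" using q_support by blast
        then show ?thesis by simp
      qed (use less in auto)
    qed
    moreover have "phi x l = 0" using assms by simp
    ultimately have "int p * x l = 0" by (simp add: phi_def)
    then show ?case using p_pos by auto
  qed
qed

lemma wedge_diff_left: "wedge (x - y) z = wedge x z - wedge y z"
  unfolding wedge_def by (rule ext) (auto simp: algebra_simps split: tail.split)

lemma wedge_diff_right: "wedge z (x - y) = wedge z x - wedge z y"
  unfolding wedge_def by (rule ext) (auto simp: algebra_simps split: tail.split)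

lemma wedge_antisym: "wedge x y = - wedge y x"
  unfolding wedge_def by (rule ext) (auto simp: algebra_simps split: tail.split)

lemma wedge_self: "wedge x x = 0"
  unfolding wedge_def by (rule ext) (auto simp: algebra_simps split: tail.split)

lemma wedge_zero: "wedge 0 y = 0" "wedge y 0 = 0"
  unfolding wedge_def by (auto split: tail.split)

lemma s_part_diff: "s_part (x - y) = s_part x - s_part y"
  unfolding s_part_def by (rule ext) (auto split: tail.split)

lemma s_part_zero: "s_part 0 = 0"
  unfolding s_part_def by (rule ext) (auto split: tail.split)

lemma set_tails: "set (tails n) = {T i j | i j. 1 \<le> i \<and> i < j \<and> j \<le> n} \<union> {S i | i. 1 \<le> i \<and> i \<le> n}"
proof -
  have "set (tails n) = {T i j | i j. i \<in> set [1..<Suc n] \<and> j \<in> set [Suc i..<Suc n]} \<union> {S i | i. i \<in> set [1..<Suc n]}"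
    unfolding tails_def by auto
  then show ?thesis by (simp only: set_upt atLeastLessThan_iff) (auto simp: less_Suc_eq_le)
qed

lemma tail_funs_diff: "c \<in> tail_funs \<Longrightarrow> d \<in> tail_funs \<Longrightarrow> c - d \<in> tail_funs"
  unfolding tail_funs_def minus_apply mem_Collect_eq by (metis diff_0_right)

lemma wedge_tail_funs: "x \<in> int_vecs n \<Longrightarrow> y \<in> int_vecs n \<Longrightarrow> wedge x y \<in> tail_funs"
proof -
  assume xy: "x \<in> int_vecs n" "y \<in> int_vecs n"
  have "e \<in> set (tails n)" if "wedge x y e \<noteq> 0" for e
  proof (cases e)
    case (T i j)
    then have ij: "i < j" "x i * y j - x j * y i \<noteq> 0" using that by (auto simp: wedge_def split: if_splits)
    have supp: "x k = 0" "y k = 0" if "k \<notin> {1..n}" for k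
      using xy that unfolding int_vecs_def by blast+
    have "i \<in> {1..n}"
    proof (rule ccontr)
      assume "i \<notin> {1..n}"
      from supp[OF this] ij show False by simp
    qed
    moreover have "j \<in> {1..n}"
    proof (rule ccontr)
      assume "j \<notin> {1..n}"
      from supp[OF this] ij show False by simp
    qed
    ultimately show ?thesis using \<open>i < j\<close> T by (simp add: set_tails)
  qed (use that in \<open>simp add: wedge_def\<close>)
  then show ?thesis by (simp add: tail_funs_def)
qed

lemma s_part_tail_funs: "x \<in> int_vecs n \<Longrightarrow> s_part x \<in> tail_funs"
  unfolding s_part_def tail_funs_def int_vecs_def set_tails
  by (auto split: tail.splits)

lemma delta_diff: "delta (c - d) = delta c - delta d"
  unfolding delta_def
proof (rule ext)
  fix l
  have "(if i < j then (c - d) (T i j) * a i j l else 0) =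
    (if i < j then c (T i j) * a i j l else 0) - (if i < j then d (T i j) * a i j l else 0)" for i j
    by (simp add: algebra_simps)
  then show "(\<Sum>i = 1..n. \<Sum>j = 1..n. if i < j then (c - d) (T i j) * a i j l else 0) =
         ((\<lambda>l. \<Sum>i = 1..n. \<Sum>j = 1..n. if i < j then c (T i j) * a i j l else 0) -
          (\<lambda>l. \<Sum>i = 1..n. \<Sum>j = 1..n. if i < j then d (T i j) * a i j l else 0)) l"
    by (simp only: sum_subtractf fun_diff_def)
qed

lemma delta_s_part: "delta (s_part x) = 0"
  unfolding delta_def s_part_def by (rule ext) (simp only: tail.case if_cancel mult_zero_left sum.neutral_const zero_fun_apply)

lemma theta_diff: "theta (c - d) = theta c - theta d"
proof -
  have "(\<lambda>i. (c - d) (S i)) = (\<lambda>i. c (S i)) - (\<lambda>i. d (S i))" by auto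
  then show ?thesis unfolding theta_def delta_diff phi_diff by (simp add: phi_diff)
qed

lemma theta_zero: "theta 0 = 0"
  using theta_diff[of 0 0] by simp

lemma theta_s_part: "theta (s_part x) = - phi x"
  unfolding theta_def delta_s_part by (simp add: s_part_def)

text \<open>The sum over all pairs folds onto \<open>i < j\<close>: diagonal coefficients are 0, and
  transposing the lower triangle supplies, by antisymmetry, the second half of
  \<open>x_i y_j - x_j y_i\<close>.\<close>

lemma delta_wedge: "delta (wedge x y) = bracket x y"
proof
  fix l
  define f where "f i j = x i * y j * a i j l" for i j
  have "bracket x y l = (\<Sum>i = 1..n. \<Sum>j = 1..n. (if i < j then f i j else 0) + (if j < i then f i j else 0))"
    unfolding bracket_def f_def by (intro sum.cong) (auto simp: a_self not_less_iff_gr_or_eq)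
  also have "\<dots> = (\<Sum>i = 1..n. \<Sum>j = 1..n. if i < j then f i j else 0) + (\<Sum>i = 1..n. \<Sum>j = 1..n. if j < i then f i j else 0)"
    by (simp only: sum.distrib)
  also have "(\<Sum>i = 1..n. \<Sum>j = 1..n. if j < i then f i j else 0) = (\<Sum>i = 1..n. \<Sum>j = 1..n. if i < j then f j i else 0)"
    by (rule sum.swap)
  also have "(\<Sum>i = 1..n. \<Sum>j = 1..n. if i < j then f i j else 0) + \<dots>
     = (\<Sum>i = 1..n. \<Sum>j = 1..n. (if i < j then f i j else 0) + (if i < j then f j i else 0))"
    by (simp only: sum.distrib)
  also have "\<dots> = delta (wedge x y) l" unfolding delta_def f_def wedge_def
  proof (rule sum.cong[OF HOL.refl], rule sum.cong[OF HOL.refl])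
    fix i j
    show "(if i < j then x i * y j * a i j l else 0) + (if i < j then x j * y i * a j i l else 0) =
      (if i < j then (case T i j of T i j \<Rightarrow> if i < j then x i * y j - x j * y i else 0 | S x \<Rightarrow> 0) * a i j l else 0)"
      using a_antisym[of j i l] by (simp only: tail.case) (simp add: algebra_simps)
  qed
  finally show "delta (wedge x y) l = bracket x y l" by simp
qed

lemma theta_wedge: "theta (wedge x y) = bracket x y"
  unfolding theta_def delta_wedge using phi_zero by (simp add: wedge_def zero_fun_def)

lemma row_span_diff: "c \<in> row_span \<Longrightarrow> d \<in> row_span \<Longrightarrow> c - d \<in> row_span"
proof -
  assume "c \<in> row_span" "d \<in> row_span"
  then obtain y z where "c = (\<lambda>e. \<Sum>r < length (Mat_rows n (int p) A). y r * (Mat_rows n (int p) A ! r) e)"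
    "d = (\<lambda>e. \<Sum>r < length (Mat_rows n (int p) A). z r * (Mat_rows n (int p) A ! r) e)"
    unfolding row_span_def by blast
  then have "c - d = (\<lambda>e. \<Sum>r < length (Mat_rows n (int p) A). (y r - z r) * (Mat_rows n (int p) A ! r) e)"
    by (auto simp: sum_subtractf algebra_simps)
  then show ?thesis unfolding row_span_def mem_Collect_eq by (rule exI[where x = "\<lambda>r. y r - z r"])
qed

lemma row_span_zero: "0 \<in> row_span"
  unfolding row_span_def by (auto intro!: exI[of _ "\<lambda>_. 0"])

lemma row_span_row: "r \<in> set (Mat_rows n (int p) A) \<Longrightarrow> r \<in> row_span"
proof -
  let ?R = "Mat_rows n (int p) A"
  assume "r \<in> set ?R"
  then obtain k where k: "k < length ?R" "?R ! k = r" by (auto simp: in_set_conv_nth)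
  have "r = (\<lambda>e. \<Sum>i < length ?R. of_bool (i = k) * (?R ! i) e)"
  proof
    fix e
    have "(\<Sum>i < length ?R. of_bool (i = k) * (?R ! i) e) = (\<Sum>i < length ?R. if i = k then (?R ! k) e else 0)"
      by (intro sum.cong) auto
    then show "r e = (\<Sum>i < length ?R. of_bool (i = k) * (?R ! i) e)" using k by simp
  qed
  then show ?thesis unfolding row_span_def mem_Collect_eq by (rule exI[where x = "\<lambda>i. of_bool (i = k)"])
qed

lemma row_span_induct:
  assumes "c \<in> row_span" "Q 0" "\<And>r. r \<in> set (Mat_rows n (int p) A) \<Longrightarrow> Q r"
    "\<And>c d. Q c \<Longrightarrow> Q d \<Longrightarrow> Q (c - d)"
  shows "Q c"
proof -
  obtain z where c: "c = (\<Sum>r < length (Mat_rows n (int p) A). (\<lambda>e. z r * (Mat_rows n (int p) A ! r) e))"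
    using assms(1) unfolding row_span_def fun_eq_iff sum_fun_apply by blast
  show ?thesis unfolding c
  proof (rule diff_closed_sum[of Q])
    show "Q 0" by (fact assms(2))
    show "Q (x - y)" if "Q x" "Q y" for x y using that by (rule assms(4))
    fix r assume "r \<in> {..<length (Mat_rows n (int p) A)}"
    then have r: "Q (Mat_rows n (int p) A ! r)" by (intro assms(3) nth_mem) simp
    show "Q (\<lambda>e. z r * (Mat_rows n (int p) A ! r) e)"
    proof (rule diff_closed_mult[of Q])
      show "Q (x - y)" if "Q x" "Q y" for x y using that by (rule assms(4))
    qed (fact assms(2), fact r)
  qed
qed

lemma t_elem_eq: "t_elem i j = wedge (unit_fun i) (unit_fun j)"
  unfolding t_elem_def wedge_def unit_fun_def
  by (rule ext) (auto split: tail.splits)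

lemma s_elem_eq: "s_elem i = s_part (unit_fun i)"
  unfolding s_elem_def s_part_def unit_fun_def
  by (rule ext) (auto split: tail.splits)

lemma wedge_sum_left:
  assumes "x \<in> int_vecs n"
  shows "(\<Sum>k = 1..n. x k * wedge (unit_fun k) y e) = wedge x y e"
  using assms
proof (induction rule: int_vecs_induct)
  case (unit i)
  have "(\<Sum>k = 1..n. unit_fun i k * wedge (unit_fun k) y e) = (\<Sum>k = 1..n. if k = i then wedge (unit_fun i) y e else 0)"
    by (rule sum.cong) (auto simp: unit_fun_def)
  then show ?case using unit by simp
qed (simp_all add: wedge_diff_left left_diff_distrib sum_subtractf wedge_zero del: zero_fun_apply minus_apply, simp_all add: left_diff_distrib sum_subtractf)

lemma wedge_sum_right:
  assumes "x \<in> int_vecs n"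
  shows "(\<Sum>k = 1..n. x k * wedge y (unit_fun k) e) = wedge y x e"
proof -
  have "(\<Sum>k = 1..n. x k * wedge y (unit_fun k) e) = - (\<Sum>k = 1..n. x k * wedge (unit_fun k) y e)"
  proof -
    have "x k * wedge y (unit_fun k) e = - (x k * wedge (unit_fun k) y e)" for k
      using wedge_antisym[of y "unit_fun k"] by simp
    then show ?thesis by (simp only: sum_negf)
  qed
  also have "\<dots> = wedge y x e" using wedge_sum_left[OF assms] wedge_antisym[of y x] by simp
  finally show ?thesis .
qed

lemma s_part_sum:
  assumes "x \<in> int_vecs n"
  shows "(\<Sum>k = 1..n. x k * s_part (unit_fun k) e) = s_part x e"
  using assms
proof (induction rule: int_vecs_induct)
  case (unit i)
  have "(\<Sum>k = 1..n. unit_fun i k * s_part (unit_fun k) e) = (\<Sum>k = 1..n. if k = i then s_part (unit_fun i) e else 0)"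
    by (rule sum.cong) (auto simp: unit_fun_def)
  then show ?case using unit by simp
qed (simp_all add: s_part_diff left_diff_distrib sum_subtractf s_part_zero del: zero_fun_apply minus_apply, simp_all add: left_diff_distrib sum_subtractf)

lemma q_vecs: "q i \<in> int_vecs n"
proof -
  have "k \<in> {1..n}" if "q i k \<noteq> 0" for k using q_support[OF that] by simp
  then show ?thesis unfolding int_vecs_def by blast
qed

lemma a_vecs: "a i j \<in> int_vecs n"
  using a_support unfolding int_vecs_def by blast

lemma row_v_eq:
  assumes "i \<in> {1..n}" "j \<in> {1..n}"
  shows "row_v n (int p) A i j = central_row (unit_fun i) (unit_fun j)"
proof
  fix e
  have "wedge (phi (unit_fun i)) (unit_fun j) = wedge ((\<lambda>l. int p * unit_fun i l) - q i) (unit_fun j)"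
    using assms by (simp add: phi_unit fun_diff_def)
  also have "\<dots> = wedge (\<lambda>l. int p * unit_fun i l) (unit_fun j) - wedge (q i) (unit_fun j)"
    by (rule wedge_diff_left)
  also have "wedge (\<lambda>l. int p * unit_fun i l) (unit_fun j) = (\<lambda>e. int p * wedge (unit_fun i) (unit_fun j) e)"
    unfolding wedge_def by (rule ext) (auto simp: algebra_simps split: tail.split)
  finally show "row_v n (int p) A i j e = central_row (unit_fun i) (unit_fun j) e"
    using assms unfolding row_v_def central_row_def
    by (simp add: t_elem_eq s_elem_eq sum_subtractf wedge_sum_left[OF q_vecs] s_part_sum[OF a_vecs] bracket_unit del: One_nat_def)
qed

text \<open>In the central row of a generator with itself both \<open>p t_ii\<close> and the bracket
  vanish, which leaves minus the sum of the \<open>a_ik t_ki\<close>; hence the sign. The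
  \<open>u_i\<close> are thus the diagonal cases missing among the \<open>v_ij\<close>.\<close>

lemma row_u_eq:
  assumes "i \<in> {1..n}"
  shows "row_u n A i = - central_row (unit_fun i) (unit_fun i)"
proof
  fix e
  have "wedge (phi (unit_fun i)) (unit_fun i) = wedge ((\<lambda>l. int p * unit_fun i l) - q i) (unit_fun i)"
    using assms by (simp add: phi_unit fun_diff_def)
  also have "\<dots> = wedge (\<lambda>l. int p * unit_fun i l) (unit_fun i) - wedge (q i) (unit_fun i)"
    by (rule wedge_diff_left)
  also have "wedge (\<lambda>l. int p * unit_fun i l) (unit_fun i) = 0"
    unfolding wedge_def by (rule ext) (auto simp: algebra_simps split: tail.split)
  finally show "row_u n A i e = (- central_row (unit_fun i) (unit_fun i)) e"
    using assms unfolding row_u_def central_row_def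
    by (simp add: t_elem_eq wedge_sum_left[OF q_vecs] bracket_unit s_part_def a_self del: One_nat_def split: tail.split)
qed

lemma row_w_eq:
  assumes "i \<in> {1..n}" "j \<in> {1..n}" "h \<in> {1..n}"
  shows "row_w n A i j h = jacobi_row (unit_fun i) (unit_fun j) (unit_fun h)"
  using assms unfolding row_w_def jacobi_row_def
  by (intro ext) (simp add: t_elem_eq sum.distrib wedge_sum_right[OF a_vecs] bracket_unit del: One_nat_def)

lemma mem_set_concat_map: "x \<in> set (concat (map f xs)) \<longleftrightarrow> (\<exists>i \<in> set xs. x \<in> set (f i))"
  by simp

lemma mem_set_if_singleton: "x \<in> set (if b then [y] else []) \<longleftrightarrow> b \<and> x = y"
  by auto

lemma set_Mat_rows: "set (Mat_rows n (int p) A) = {- central_row (unit_fun i) (unit_fun i) | i. i \<in> {1..n}}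
   \<union> {central_row (unit_fun i) (unit_fun j) | i j. i \<in> {1..n} \<and> j \<in> {1..n} \<and> i \<noteq> j}
   \<union> {jacobi_row (unit_fun i) (unit_fun j) (unit_fun h) | i j h. i \<in> {1..n} \<and> j \<in> {1..n} \<and> h \<in> {1..n} \<and> i < j \<and> j < h}"
  (is "_ = ?U \<union> ?V \<union> ?W")
proof -
  have "set (Mat_rows n (int p) A) = {row_u n A i | i. i \<in> set [1..<Suc n]}
   \<union> {row_v n (int p) A i j | i j. i \<in> set [1..<Suc n] \<and> j \<in> set [1..<Suc n] \<and> i \<noteq> j}
   \<union> {row_w n A i j h | i j h. i \<in> set [1..<Suc n] \<and> j \<in> set [Suc i..<Suc n] \<and> h \<in> set [Suc j..<Suc n]}"
  proof -
    have "set [row_u n A i. i \<leftarrow> [1..<Suc n]] = {row_u n A i | i. i \<in> set [1..<Suc n]}"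
      by (simp only: set_map) blast
    moreover have "set [row_v n (int p) A i j. i \<leftarrow> [1..<Suc n], j \<leftarrow> [1..<Suc n], i \<noteq> j]
      = {row_v n (int p) A i j | i j. i \<in> set [1..<Suc n] \<and> j \<in> set [1..<Suc n] \<and> i \<noteq> j}"
      by (rule Set.set_eqI) (simp only: mem_set_concat_map mem_set_if_singleton Bex_def mem_Collect_eq, blast)
    moreover have "set [row_w n A i j h. i \<leftarrow> [1..<Suc n], j \<leftarrow> [Suc i..<Suc n], h \<leftarrow> [Suc j..<Suc n]]
      = {row_w n A i j h | i j h. i \<in> set [1..<Suc n] \<and> j \<in> set [Suc i..<Suc n] \<and> h \<in> set [Suc j..<Suc n]}"
      by (rule Set.set_eqI) (simp only: mem_set_concat_map set_map image_iff Bex_def mem_Collect_eq, blast)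
    ultimately show ?thesis
      unfolding Mat_rows_def by (simp only: set_append Un_assoc)
  qed
  also have "{row_u n A i | i. i \<in> set [1..<Suc n]} = row_u n A ` {1..n}"
    by (auto simp: less_Suc_eq_le)
  also have "{row_v n (int p) A i j | i j. i \<in> set [1..<Suc n] \<and> j \<in> set [1..<Suc n] \<and> i \<noteq> j}
    = {row_v n (int p) A i j | i j. i \<in> {1..n} \<and> j \<in> {1..n} \<and> i \<noteq> j}"
    by (simp only: set_upt atLeastLessThan_iff atLeastAtMost_iff less_Suc_eq_le)
  also have "{row_w n A i j h | i j h. i \<in> set [1..<Suc n] \<and> j \<in> set [Suc i..<Suc n] \<and> h \<in> set [Suc j..<Suc n]}
    = {row_w n A i j h | i j h. i \<in> {1..n} \<and> j \<in> {1..n} \<and> h \<in> {1..n} \<and> i < j \<and> j < h}"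
  proof -
    have "i \<in> set [1..<Suc n] \<and> j \<in> set [Suc i..<Suc n] \<and> h \<in> set [Suc j..<Suc n] \<longleftrightarrow>
      i \<in> {1..n} \<and> j \<in> {1..n} \<and> h \<in> {1..n} \<and> i < j \<and> j < h" for i j h
      by auto
    then show ?thesis by simp
  qed
  also have "row_u n A ` {1..n} = (\<lambda>i. - central_row (unit_fun i) (unit_fun i)) ` {1..n}"
    by (rule image_cong) (simp_all only: row_u_eq)
  also have "\<dots> = ?U" by blast
  also have "{row_v n (int p) A i j | i j. i \<in> {1..n} \<and> j \<in> {1..n} \<and> i \<noteq> j} = ?V"
    by (intro Collect_cong ex_cong1 conj_cong HOL.refl iffI; elim conjE; simp only: row_v_eq simp_thms)
  also have "{row_w n A i j h | i j h. i \<in> {1..n} \<and> j \<in> {1..n} \<and> h \<in> {1..n} \<and> i < j \<and> j < h} = ?W"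
    by (intro Collect_cong ex_cong1 conj_cong HOL.refl iffI; elim conjE; simp only: row_w_eq simp_thms)
  finally show ?thesis .
qed

lemma central_row_diff: "central_row (x - y) z = central_row x z - central_row y z"
   "central_row z (x - y) = central_row z x - central_row z y"
  unfolding central_row_def phi_diff wedge_diff_left wedge_diff_right bracket_diff_left bracket_diff_right s_part_diff
  by auto

lemma central_row_zero: "central_row 0 z = 0" "central_row z 0 = 0"
  unfolding central_row_def phi_zero wedge_zero bracket_zero s_part_zero by auto

lemma jacobi_row_diff: "jacobi_row (x - y) z w = jacobi_row x z w - jacobi_row y z w"
   "jacobi_row z (x - y) w = jacobi_row z x w - jacobi_row z y w"
   "jacobi_row z w (x - y) = jacobi_row z w x - jacobi_row z w y"
  unfolding jacobi_row_def wedge_diff_left wedge_diff_right bracket_diff_left bracket_diff_right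
  by auto

lemma jacobi_row_zero: "jacobi_row 0 z w = 0" "jacobi_row z 0 w = 0" "jacobi_row z w 0 = 0"
  unfolding jacobi_row_def wedge_zero bracket_zero by auto

text \<open>Inherited from \<open>wedge\<close>, because \<open>delta\<close> is additive and
  carries \<open>wedge x y\<close> to \<open>bracket x y\<close>.\<close>

lemma bracket_antisym: "bracket x y = - bracket y x"
  using delta_wedge[of x y] delta_wedge[of y x] wedge_antisym[of x y] delta_diff[of 0 "wedge y x"]
   delta_diff[of 0 0]  by simp

lemma bracket_self: "bracket x x = 0"
  using delta_wedge[of x x] wedge_self[of x] delta_diff[of 0 0] by simp

lemma wedge_minus_right: "wedge x (- y) = - wedge x y"
  using wedge_diff_right[of x 0 y] by (simp add: wedge_zero)

lemma jacobi_row_swap: "jacobi_row y x z = - jacobi_row x y z" "jacobi_row x z y = - jacobi_row x y z"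
  unfolding jacobi_row_def bracket_antisym[of x z]  bracket_antisym[of y x] bracket_antisym[of z y] wedge_minus_right by auto

lemma jacobi_row_self: "jacobi_row x x z = 0" "jacobi_row x z x = 0" "jacobi_row z x x = 0"
  unfolding jacobi_row_def bracket_antisym[of x z] bracket_self wedge_zero wedge_minus_right by auto

lemma row_span_uminus: "c \<in> row_span \<Longrightarrow> - c \<in> row_span"
  using row_span_diff[OF row_span_zero] by fastforce

lemma central_row_in_span:
  assumes "x \<in> int_vecs n" "y \<in> int_vecs n"
  shows "central_row x y \<in> row_span"
  using assms(1)
proof (induction rule: int_vecs_induct)
  case (unit i)
  show ?case using assms(2)
  proof (induction rule: int_vecs_induct)
    case (unit j)
    show ?case
    proof (cases "i = j")
      case True
      have "- central_row (unit_fun i) (unit_fun i) \<in> row_span"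
        by (rule row_span_row) (use \<open>i \<in> {1..n}\<close> in \<open>auto simp: set_Mat_rows\<close>)
      from row_span_uminus[OF this] show ?thesis using True by simp
    next
      case False
      show ?thesis
        by (rule row_span_row) (use \<open>i \<in> {1..n}\<close> \<open>j \<in> {1..n}\<close> False in \<open>auto simp: set_Mat_rows\<close>)
    qed
  qed (simp_all add: central_row_diff central_row_zero row_span_zero row_span_diff del: zero_fun_apply minus_apply)
qed (simp_all add: central_row_diff central_row_zero row_span_zero row_span_diff del: zero_fun_apply minus_apply)

text \<open>Only increasing triples occur as rows. Adjacent transpositions change the sign of
  \<open>jacobi_row\<close>, so triples of distinct indices are reached by sorting, and a repeated
  index gives 0.\<close>

lemma jacobi_row_unit_in_span:
  assumes "i \<in> {1..n}" "j \<in> {1..n}" "h \<in> {1..n}"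
  shows "jacobi_row (unit_fun i) (unit_fun j) (unit_fun h) \<in> row_span"
proof -
  let ?J = "\<lambda>i j h. jacobi_row (unit_fun i) (unit_fun j) (unit_fun h)"
  have 0: "?J i j h \<in> row_span" if "i < j" "j < h" "i \<in> {1..n}" "j \<in> {1..n}" "h \<in> {1..n}" for i j h
    by (rule row_span_row, unfold set_Mat_rows) (use that in blast)
  have 1: "?J i j h \<in> row_span" if "i < j" "i \<in> {1..n}" "j \<in> {1..n}" "h \<in> {1..n}" for i j h
  proof -
    consider "j < h" | "j = h" | "i < h" "h < j" | "i = h" | "h < i" by linarith
    then show ?thesis
    proof cases
      case 3
      then show ?thesis using 0[of i h j] that jacobi_row_swap(2)[of "unit_fun i" "unit_fun j" "unit_fun h"] row_span_uminus by simp
    next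
      case 5
      have "?J h i j \<in> row_span" using 5 0 that by simp
      then show ?thesis using jacobi_row_swap(2)[of "unit_fun i" "unit_fun j" "unit_fun h"]
         jacobi_row_swap(1)[of "unit_fun h" "unit_fun i" "unit_fun j"] by (simp add: row_span_uminus)
    qed (use that 0 in \<open>auto simp: jacobi_row_self row_span_zero\<close>)
  qed
  consider "i < j" | "i = j" | "j < i" by linarith
  then show ?thesis
  proof cases
    case 3
    then show ?thesis using 1[of j i h] assms jacobi_row_swap(1)[of "unit_fun i" "unit_fun j" "unit_fun h"] row_span_uminus by simp
  qed (use 1 assms in \<open>auto simp: jacobi_row_self row_span_zero\<close>)
qed

lemma jacobi_row_in_span:
  assumes "x \<in> int_vecs n" "y \<in> int_vecs n" "z \<in> int_vecs n"
  shows "jacobi_row x y z \<in> row_span"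
  using assms(1)
proof (induction rule: int_vecs_induct)
  case (unit i)
  show ?case using assms(2)
  proof (induction rule: int_vecs_induct)
    case (unit j)
    show ?case using assms(3)
    proof (induction rule: int_vecs_induct)
      case (unit h)
      then show ?case using \<open>i \<in> {1..n}\<close> \<open>j \<in> {1..n}\<close> jacobi_row_unit_in_span by blast
    qed (simp_all add: jacobi_row_diff jacobi_row_zero row_span_zero row_span_diff del: zero_fun_apply minus_apply)
  qed (simp_all add: jacobi_row_diff jacobi_row_zero row_span_zero row_span_diff del: zero_fun_apply minus_apply)
qed (simp_all add: jacobi_row_diff jacobi_row_zero row_span_zero row_span_diff del: zero_fun_apply minus_apply)

text \<open>Every matrix row is, up to sign, a central or a Jacobi row at unit vectors. Cases for
  arbitrary vectors are what the later inductions can supply, and they hide the three families of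
  rows.\<close>

lemma row_span_cases_induct [consumes 1, case_names zero central jacobi diff]:
  assumes "c \<in> row_span" "Q 0"
    and central: "\<And>x y. x \<in> int_vecs n \<Longrightarrow> y \<in> int_vecs n \<Longrightarrow> Q (central_row x y)"
    and jacobi: "\<And>x y z. x \<in> int_vecs n \<Longrightarrow> y \<in> int_vecs n \<Longrightarrow> z \<in> int_vecs n \<Longrightarrow> Q (jacobi_row x y z)"
    and diff: "\<And>c d. Q c \<Longrightarrow> Q d \<Longrightarrow> Q (c - d)"
  shows "Q c"
proof (rule row_span_induct[where Q = Q, OF assms(1,2)])
  fix r assume "r \<in> set (Mat_rows n (int p) A)"
  then consider i where "i \<in> {1..n}" "r = 0 - central_row (unit_fun i) (unit_fun i)"
    | i j where "i \<in> {1..n}" "j \<in> {1..n}" "r = central_row (unit_fun i) (unit_fun j)"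
    | i j h where "i \<in> {1..n}" "j \<in> {1..n}" "h \<in> {1..n}" "r = jacobi_row (unit_fun i) (unit_fun j) (unit_fun h)"
    unfolding set_Mat_rows by (simp only: Un_iff mem_Collect_eq diff_0) blast
  then show "Q r"
    by cases (auto intro!: central jacobi diff assms(2) unit_fun_int_vecs simp del: diff_0)
qed (fact diff)

end

section \<open>Chains, exterior relations and boundaries in degrees one to three\<close>

abbreviation chains :: "('a, 'b) ring_scheme \<Rightarrow> nat \<Rightarrow> ('a list \<Rightarrow>\<^sub>0 int) monoid" where
  "chains L k \<equiv> free_Abelian_group (wedge_lists L k)"

abbreviation chain_boundary :: "('a, 'b) ring_scheme \<Rightarrow> ('a list \<Rightarrow>\<^sub>0 int) \<Rightarrow> ('a list \<Rightarrow>\<^sub>0 int)" where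
  "chain_boundary L \<equiv> frag_extend (ce_boundary L)"

text \<open>Counting positions from 0 instead of 1 changes \<open>i + j\<close> by 2, so the signs
  are the usual ones; on 2-chains the boundary is minus the bracket.\<close>

lemma ce_boundary_2: "ce_boundary L [x, y] = - frag_of [x \<otimes>\<^bsub>L\<^esub> y]"
proof -
  have *: "{(i, j). i < j \<and> j < length [x, y]} = {(0, 1)}" by auto
  show ?thesis unfolding ce_boundary_def * by (simp add: nths_Cons)
qed

lemma ce_boundary_3: "ce_boundary L [x, y, z] =
  frag_of [x \<otimes>\<^bsub>L\<^esub> z, y] - frag_of [x \<otimes>\<^bsub>L\<^esub> y, z] - frag_of [y \<otimes>\<^bsub>L\<^esub> z, x]"
proof -
  have *: "{(i, j). i < j \<and> j < length [x, y, z]} = {(0, 1), (0, 2), (1, 2)}" by auto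
  show ?thesis unfolding ce_boundary_def * by (simp add: nths_Cons)
qed

lemma length_2_cases: "length xs = 2 \<Longrightarrow> \<exists>x y. xs = [x, y]"
  by (auto simp: numeral_2_eq_2 length_Suc_conv)

lemma length_3_cases: "length xs = 3 \<Longrightarrow> \<exists>x y z. xs = [x, y, z]"
  by (auto simp: numeral_3_eq_3 length_Suc_conv)

context lie_ring
begin

abbreviation "E \<equiv> exterior_relations L"

definition exterior_generators :: "nat \<Rightarrow> ('a list \<Rightarrow>\<^sub>0 int) set" where
  "exterior_generators k =
     {frag_of (xs[i := x \<oplus> y]) - frag_of (xs[i := x]) - frag_of (xs[i := y]) | xs i x y.
         xs \<in> wedge_lists L k \<and> i < k \<and> x \<in> carrier L \<and> y \<in> carrier L} \<union>
      {frag_of xs | xs. xs \<in> wedge_lists L k \<and> (\<exists>i j. i < j \<and> j < k \<and> xs ! i = xs ! j)}"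

lemma E_eq: "E k = generate (chains L k) (exterior_generators k)"
  unfolding exterior_relations_def exterior_generators_def ..

lemma wedge_lists_update: "xs \<in> wedge_lists L k \<Longrightarrow> x \<in> carrier L \<Longrightarrow> xs[i := x] \<in> wedge_lists L k"
  unfolding wedge_lists_def using set_update_subset_insert[of xs i x] by auto

lemma keys_diff_subset: "Poly_Mapping.keys a \<subseteq> X \<Longrightarrow> Poly_Mapping.keys b \<subseteq> X \<Longrightarrow> Poly_Mapping.keys (a - b :: 'c \<Rightarrow>\<^sub>0 int) \<subseteq> X"
  using keys_diff[of a b] by blast

lemma exterior_generators_subset: "exterior_generators k \<subseteq> carrier (chains L k)"
proof
  fix c assume "c \<in> exterior_generators k"
  then have "Poly_Mapping.keys c \<subseteq> wedge_lists L k"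
    unfolding exterior_generators_def
  proof (elim UnE CollectE exE conjE)
    fix xs i x y
    assume "xs \<in> wedge_lists L k" "x \<in> carrier L" "y \<in> carrier L"
      and c: "c = frag_of (xs[i := x \<oplus> y]) - frag_of (xs[i := x]) - frag_of (xs[i := y])"
    then have "xs[i := x \<oplus> y] \<in> wedge_lists L k" "xs[i := x] \<in> wedge_lists L k" "xs[i := y] \<in> wedge_lists L k"
      by (simp_all add: wedge_lists_update)
    then show ?thesis unfolding c by (intro keys_diff_subset) simp_all
  qed simp
  then show "c \<in> carrier (chains L k)" by simp
qed

lemma E_subgroup: "subgroup (E k) (chains L k)"
  unfolding E_eq by (rule group.generate_is_subgroup[OF group_free_Abelian_group exterior_generators_subset])

lemma E_chains: "c \<in> E k \<Longrightarrow> Poly_Mapping.keys c \<subseteq> wedge_lists L k"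
  using subsetD[OF subgroup.subset[OF E_subgroup[of k]], of c] by (simp only: carrier_free_Abelian_group_iff)

lemma E_zero: "0 \<in> E k"
  using subgroup.one_closed[OF E_subgroup[of k]] by simp

lemma E_add: "c \<in> E k \<Longrightarrow> d \<in> E k \<Longrightarrow> c + d \<in> E k"
  using subgroup.m_closed[OF E_subgroup[of k]] by simp

lemma E_uminus: "c \<in> E k \<Longrightarrow> - c \<in> E k"
  using subgroup.m_inv_closed[OF E_subgroup[of k], of c] E_chains[of c k] by simp

lemma E_diff: "c \<in> E k \<Longrightarrow> d \<in> E k \<Longrightarrow> c - d \<in> E k"
  using E_add[of c k "- d"] E_uminus[of d k] by simp

lemma E_generator: "c \<in> exterior_generators k \<Longrightarrow> c \<in> E k"
  unfolding E_eq by (rule generate.incl)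

lemma E_induct:
  assumes "c \<in> E k" and 0: "Q 0" and gen: "\<And>c. c \<in> exterior_generators k \<Longrightarrow> Q c"
    and diff: "\<And>c d. Q c \<Longrightarrow> Q d \<Longrightarrow> Q (c - d)"
  shows "Q c"
  using assms(1) unfolding E_eq
proof (induction rule: generate.induct)
  case one
  then show ?case using 0 by simp
next
  case (incl h)
  then show ?case by (rule gen)
next
  case (inv h)
  then have "Poly_Mapping.keys h \<subseteq> wedge_lists L k" using subsetD[OF exterior_generators_subset[of k], of h]
    by (simp only: carrier_free_Abelian_group_iff)
  then show ?case using diff[OF 0 gen[OF inv]] by simp
next
  case (eng h1 h2)
  have "Q (h1 - (0 - h2))" using diff[OF 0 eng.IH(2)] diff[OF eng.IH(1)] by blast
  then show ?case by simp
qed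

lemma E1_add: "x \<in> carrier L \<Longrightarrow> y \<in> carrier L \<Longrightarrow> frag_of [x \<oplus> y] - frag_of [x] - frag_of [y] \<in> E 1"
  by (rule E_generator, unfold exterior_generators_def, rule UnI1, rule CollectI)
    (rule exI[of _ "[x]"], rule exI[of _ 0], auto simp: wedge_lists_def)

lemma E2_add_left: "x \<in> carrier L \<Longrightarrow> y \<in> carrier L \<Longrightarrow> z \<in> carrier L
  \<Longrightarrow> frag_of [x \<oplus> y, z] - frag_of [x, z] - frag_of [y, z] \<in> E 2"
  by (rule E_generator, unfold exterior_generators_def, rule UnI1, rule CollectI)
    (rule exI[of _ "[x, z]"], rule exI[of _ 0], auto simp: wedge_lists_def)

lemma E2_add_right: "x \<in> carrier L \<Longrightarrow> y \<in> carrier L \<Longrightarrow> z \<in> carrier L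
  \<Longrightarrow> frag_of [z, x \<oplus> y] - frag_of [z, x] - frag_of [z, y] \<in> E 2"
  by (rule E_generator, unfold exterior_generators_def, rule UnI1, rule CollectI)
    (rule exI[of _ "[z, x]"], rule exI[of _ 1], auto simp: wedge_lists_def)

lemma E2_self: 
  assumes "x \<in> carrier L" shows "frag_of [x, x] \<in> E 2"
proof -
  have mem: "[x, x] \<in> wedge_lists L 2" using assms by (simp add: wedge_lists_def)
  have ex: "\<exists>i j. i < j \<and> j < (2 :: nat) \<and> [x, x] ! i = [x, x] ! j"
    by (rule exI[where x = 0], rule exI[where x = 1]) simp
  have "frag_of [x, x] \<in> exterior_generators 2"
    unfolding exterior_generators_def
    by (rule UnI2, rule CollectI, rule exI, rule conjI[OF HOL.refl], rule conjI[OF mem ex])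
  then show ?thesis by (rule E_generator)
qed

lemma E1_zero: "frag_of [\<zero>] \<in> E 1"
  using E_uminus[OF E1_add[of \<zero> \<zero>]] by simp

lemma E2_zero_left: "x \<in> carrier L \<Longrightarrow> frag_of [\<zero>, x] \<in> E 2"
  using E_uminus[OF E2_add_left[of \<zero> \<zero> x]] by simp

lemma E2_zero_right: "x \<in> carrier L \<Longrightarrow> frag_of [x, \<zero>] \<in> E 2"
  using E_uminus[OF E2_add_right[of \<zero> \<zero> x]] by simp

lemma minus_add_cancel_right: "x \<in> carrier L \<Longrightarrow> y \<in> carrier L \<Longrightarrow> (x \<ominus> y) \<oplus> y = x"
  by (simp add: a_minus_def a_assoc l_neg)

lemma E1_minus: "x \<in> carrier L \<Longrightarrow> y \<in> carrier L \<Longrightarrow> frag_of [x \<ominus> y] - frag_of [x] + frag_of [y] \<in> E 1"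
  using E_uminus[OF E1_add[of "x \<ominus> y" y]] by (simp add: minus_add_cancel_right algebra_simps)

lemma E2_minus_left: "x \<in> carrier L \<Longrightarrow> y \<in> carrier L \<Longrightarrow> z \<in> carrier L
  \<Longrightarrow> frag_of [x \<ominus> y, z] - frag_of [x, z] + frag_of [y, z] \<in> E 2"
  using E_uminus[OF E2_add_left[of "x \<ominus> y" y z]] by (simp add: minus_add_cancel_right algebra_simps)

lemma E2_minus_right: "x \<in> carrier L \<Longrightarrow> y \<in> carrier L \<Longrightarrow> z \<in> carrier L
  \<Longrightarrow> frag_of [z, x \<ominus> y] - frag_of [z, x] + frag_of [z, y] \<in> E 2"
  using E_uminus[OF E2_add_right[of "x \<ominus> y" y z]] by (simp add: minus_add_cancel_right algebra_simps)

text \<open>Polarisation: expand the product of \<open>x \<oplus> y\<close> with itself and remove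
  the squares of \<open>x\<close> and \<open>y\<close>.\<close>

lemma E2_antisym: "x \<in> carrier L \<Longrightarrow> y \<in> carrier L \<Longrightarrow> frag_of [x, y] + frag_of [y, x] \<in> E 2"
proof -
  assume xy: "x \<in> carrier L" "y \<in> carrier L"
  let ?w = "\<lambda>x y. frag_of [x, y]"
  have "?w (x \<oplus> y) (x \<oplus> y) - (?w (x \<oplus> y) (x \<oplus> y) - ?w x (x \<oplus> y) - ?w y (x \<oplus> y))
     - (?w x (x \<oplus> y) - ?w x x - ?w x y) - (?w y (x \<oplus> y) - ?w y x - ?w y y) - ?w x x - ?w y y \<in> E 2"
    using xy by (intro E_diff E2_add_left E2_add_right E2_self add.m_closed)
  then show ?thesis by simp
qed

lemma bracket_zero_left: "x \<in> carrier L \<Longrightarrow> \<zero> \<otimes> x = \<zero>"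
  using bracket_add_left[of \<zero> \<zero> x] bracket_closed[of \<zero> x] add.r_cancel_one[of "\<zero> \<otimes> x" "\<zero> \<otimes> x"] by simp

lemma bracket_antisymmetric: 
  assumes "x \<in> carrier L" "y \<in> carrier L" shows "x \<otimes> y \<oplus> y \<otimes> x = \<zero>"
proof -
  have "\<zero> = (x \<oplus> y) \<otimes> (x \<oplus> y)" using assms bracket_alternating by simp
  also have "\<dots> = x \<otimes> x \<oplus> y \<otimes> x \<oplus> (x \<otimes> y \<oplus> y \<otimes> y)"
    using assms by (simp only: bracket_add_left bracket_add_right add.m_closed)
  also have "\<dots> = x \<otimes> y \<oplus> y \<otimes> x" using assms by (simp add: bracket_alternating bracket_closed a_comm)
  finally show ?thesis by simp
qed

lemma boundary_E2: "c \<in> E 2 \<Longrightarrow> chain_boundary L c \<in> E 1"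
proof (erule E_induct[where Q = "\<lambda>c. chain_boundary L c \<in> E 1"])
  show "chain_boundary L c \<in> E 1" if "c \<in> exterior_generators 2" for c
    using that unfolding exterior_generators_def
  proof (elim UnE CollectE exE conjE)
    fix xs i x y
    assume xs: "xs \<in> wedge_lists L 2" and i: "i < 2" and xy: "x \<in> carrier L" "y \<in> carrier L"
      and c: "c = frag_of (xs[i := x \<oplus> y]) - frag_of (xs[i := x]) - frag_of (xs[i := y])"
    from xs have len: "length xs = 2" and sub: "set xs \<subseteq> carrier L" by (auto simp: wedge_lists_def)
    obtain u v where "xs = [u, v]" using length_2_cases[OF len] by blast
    with sub have uv: "xs = [u, v]" "u \<in> carrier L" "v \<in> carrier L" by simp_all
    have "i = 0 \<or> i = 1" using i by auto
    then show ?thesis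
    proof
      assume i0: "i = 0"
      have "- (frag_of [x \<otimes> v \<oplus> y \<otimes> v] - frag_of [x \<otimes> v] - frag_of [y \<otimes> v]) \<in> E 1"
        using xy uv by (intro E_uminus E1_add bracket_closed)
      then show ?thesis using xy uv by (simp add: c i0 frag_extend_diff frag_extend_add ce_boundary_2 bracket_add_left algebra_simps)
    next
      assume i1: "i = 1"
      have "- (frag_of [u \<otimes> x \<oplus> u \<otimes> y] - frag_of [u \<otimes> x] - frag_of [u \<otimes> y]) \<in> E 1"
        using xy uv by (intro E_uminus E1_add bracket_closed)
      then show ?thesis using xy uv by (simp add: c i1 frag_extend_diff frag_extend_add ce_boundary_2 bracket_add_right algebra_simps)
    qed
  next
    fix xs i j
    assume xs: "xs \<in> wedge_lists L 2" and c: "c = frag_of xs" and ij: "i < j" "j < 2" "xs ! i = xs ! j"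
    from xs have len: "length xs = 2" and sub: "set xs \<subseteq> carrier L" by (auto simp: wedge_lists_def)
    obtain u v where "xs = [u, v]" using length_2_cases[OF len] by blast
    with sub have uv: "xs = [u, v]" "u \<in> carrier L" "v \<in> carrier L" by simp_all
    have "i = 0 \<and> j = 1" using ij(1,2) by presburger
    then have "[u, v] ! 0 = [u, v] ! 1" using ij(3) uv(1) by metis
    then have "u = v" by simp
    then show ?thesis using uv E_uminus[OF E1_zero] by (simp add: c ce_boundary_2 bracket_alternating)
  qed
qed (auto simp: frag_extend_diff E_zero E_diff)

text \<open>An additivity relation in one slot becomes a combination of three additivity relations
  in degree 2. For two equal entries one of the three terms contains the bracket of an element with
  itself, and the other two cancel.\<close>

lemma boundary_E3: "c \<in> E 3 \<Longrightarrow> chain_boundary L c \<in> E 2"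
proof (erule E_induct[where Q = "\<lambda>c. chain_boundary L c \<in> E 2"])
  let ?w = "\<lambda>x y. frag_of [x, y]"
  let ?L = "\<lambda>x y z. ?w (x \<oplus> y) z - ?w x z - ?w y z"
  let ?R = "\<lambda>z x y. ?w z (x \<oplus> y) - ?w z x - ?w z y"
  show "chain_boundary L c \<in> E 2" if "c \<in> exterior_generators 3" for c
    using that unfolding exterior_generators_def
  proof (elim UnE CollectE exE conjE)
    fix xs i x y
    assume xs: "xs \<in> wedge_lists L 3" and i: "i < 3" and xy: "x \<in> carrier L" "y \<in> carrier L"
      and c: "c = frag_of (xs[i := x \<oplus> y]) - frag_of (xs[i := x]) - frag_of (xs[i := y])"
    from xs have len: "length xs = 3" and sub: "set xs \<subseteq> carrier L" by (auto simp: wedge_lists_def)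
    obtain u v w where "xs = [u, v, w]" using length_3_cases[OF len] by blast
    with sub have uv: "xs = [u, v, w]" "u \<in> carrier L" "v \<in> carrier L" "w \<in> carrier L" by simp_all
    have "i = 0 \<or> i = 1 \<or> i = 2" using i by auto
    then show ?thesis
    proof (elim disjE)
      assume i0: "i = 0"
      have "?L (x \<otimes> w) (y \<otimes> w) v - ?L (x \<otimes> v) (y \<otimes> v) w - ?R (v \<otimes> w) x y \<in> E 2"
        using xy uv by (intro E_diff E2_add_left E2_add_right bracket_closed)
      then show ?thesis using xy uv
        by (simp add: c i0 frag_extend_diff frag_extend_add ce_boundary_3 bracket_add_left algebra_simps)
    next
      assume i1: "i = 1"
      have "?R (u \<otimes> w) x y - ?L (u \<otimes> x) (u \<otimes> y) w - ?L (x \<otimes> w) (y \<otimes> w) u \<in> E 2"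
        using xy uv by (intro E_diff E2_add_left E2_add_right bracket_closed)
      then show ?thesis using xy uv
        by (simp add: c i1 frag_extend_diff frag_extend_add ce_boundary_3 bracket_add_left bracket_add_right algebra_simps)
    next
      assume i2: "i = 2"
      have "?L (u \<otimes> x) (u \<otimes> y) v - ?R (u \<otimes> v) x y - ?L (v \<otimes> x) (v \<otimes> y) u \<in> E 2"
        using xy uv by (intro E_diff E2_add_left E2_add_right bracket_closed)
      then show ?thesis using xy uv
        by (simp add: c i2 frag_extend_diff frag_extend_add ce_boundary_3 bracket_add_right algebra_simps)
    qed
  next
    fix xs i j
    assume xs: "xs \<in> wedge_lists L 3" and c: "c = frag_of xs" and ij: "i < j" "j < 3" "xs ! i = xs ! j"
    from xs have len: "length xs = 3" and sub: "set xs \<subseteq> carrier L" by (auto simp: wedge_lists_def)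
    obtain u v w where "xs = [u, v, w]" using length_3_cases[OF len] by blast
    with sub have uv: "xs = [u, v, w]" "u \<in> carrier L" "v \<in> carrier L" "w \<in> carrier L" by simp_all
    have "i = 0 \<and> j = 1 \<or> i = 0 \<and> j = 2 \<or> i = 1 \<and> j = 2" using ij(1,2) by presburger
    moreover have "[u, v, w] ! 0 = u" "[u, v, w] ! 1 = v" "[u, v, w] ! 2 = w" by simp_all
    moreover have "[u, v, w] ! i = [u, v, w] ! j" using ij(3) uv(1) by simp
    ultimately consider "u = v" | "u = w" | "v = w" by metis
    then show ?thesis
    proof cases
      case 1
      have "0 - ?w \<zero> w \<in> E 2" using uv by (intro E_diff E_zero E2_zero_left)
      then show ?thesis using uv 1 by (simp add: c ce_boundary_3 bracket_alternating)
    next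
      case 2
      \<comment> \<open>Here the two remaining terms carry opposite brackets instead of equal ones;
        additivity in the first slot merges them into \<open>?w \<zero> u\<close>.\<close>
      have "?w \<zero> v + (?w (u \<otimes> v \<oplus> v \<otimes> u) u - ?w (u \<otimes> v) u - ?w (v \<otimes> u) u) - ?w \<zero> u \<in> E 2"
        using uv by (intro E_diff E_add E2_zero_left E2_add_left bracket_closed)
      then show ?thesis using uv 2 by (simp add: c ce_boundary_3 bracket_alternating bracket_antisymmetric algebra_simps)
    next
      case 3
      have "0 - ?w \<zero> u \<in> E 2" using uv by (intro E_diff E_zero E2_zero_left)
      then show ?thesis using uv 3 by (simp add: c ce_boundary_3 bracket_alternating)
    qed
  qed
qed (auto simp: frag_extend_diff E_zero E_diff)

lemma mem_coset_iff: "x \<in> E k #>\<^bsub>chains L k\<^esub> c \<longleftrightarrow> x - c \<in> E k"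
proof -
  have "x \<in> E k #>\<^bsub>chains L k\<^esub> c \<longleftrightarrow> (\<exists>h \<in> E k. x = h + c)"
    unfolding r_coset_def by simp
  also have "\<dots> \<longleftrightarrow> x - c \<in> E k" by (metis add_diff_cancel diff_add_cancel)
  finally show ?thesis .
qed

lemma coset_eq_iff: "E k #>\<^bsub>chains L k\<^esub> c = E k #>\<^bsub>chains L k\<^esub> d \<longleftrightarrow> c - d \<in> E k"
proof
  assume "E k #>\<^bsub>chains L k\<^esub> c = E k #>\<^bsub>chains L k\<^esub> d"
  then show "c - d \<in> E k" using mem_coset_iff[of c k c] mem_coset_iff[of c k d] E_zero[of k] by simp
next
  assume cd: "c - d \<in> E k"
  have "x - c \<in> E k \<longleftrightarrow> x - d \<in> E k" for x
    using E_add[of "x - c" k "c - d"] E_diff[of "x - d" k "c - d"] cd by auto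
  then show "E k #>\<^bsub>chains L k\<^esub> c = E k #>\<^bsub>chains L k\<^esub> d"
    by (intro Set.set_eqI) (simp only: mem_coset_iff)
qed

text \<open>Boundaries of two representatives differ by the boundary of a relation, which is again a
  relation; so the union in the definition collapses to one coset.\<close>

lemma ce_differential_coset:
  assumes "\<And>c. c \<in> E k \<Longrightarrow> chain_boundary L c \<in> E (k - 1)"
  shows "ce_differential L k (E k #>\<^bsub>chains L k\<^esub> c) = E (k - 1) #>\<^bsub>chains L (k - 1)\<^esub> chain_boundary L c"
proof -
  have "E (k - 1) #>\<^bsub>chains L (k - 1)\<^esub> chain_boundary L d = E (k - 1) #>\<^bsub>chains L (k - 1)\<^esub> chain_boundary L c"
    if "d \<in> E k #>\<^bsub>chains L k\<^esub> c" for d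
  proof -
    have "d - c \<in> E k" using that by (simp only: mem_coset_iff)
    then show ?thesis using assms[of "d - c"] by (simp add: coset_eq_iff frag_extend_diff)
  qed
  moreover have "c \<in> E k #>\<^bsub>chains L k\<^esub> c" by (simp add: mem_coset_iff E_zero)
  ultimately show ?thesis unfolding ce_differential_def by blast
qed

end

text \<open>Linear extension from the basis of a free abelian group to integer-valued functions;
  \<open>frag_extend\<close> plays the same role for values in a free abelian group.\<close>

definition lin_extend :: "('b \<Rightarrow> 'e \<Rightarrow> int) \<Rightarrow> ('b \<Rightarrow>\<^sub>0 int) \<Rightarrow> 'e \<Rightarrow> int" where
  "lin_extend f c = (\<lambda>e. \<Sum>k \<in> Poly_Mapping.keys c. Poly_Mapping.lookup c k * f k e)"

lemma lin_extend_superset: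
  assumes "finite B" "Poly_Mapping.keys c \<subseteq> B"
  shows "lin_extend f c e = (\<Sum>k \<in> B. Poly_Mapping.lookup c k * f k e)"
  unfolding lin_extend_def using assms
  by (intro sum.mono_neutral_left) (auto simp: in_keys_iff)

lemma lin_extend_diff: "lin_extend f (c - d) = lin_extend f c - lin_extend f d"
proof
  fix e
  let ?B = "Poly_Mapping.keys c \<union> Poly_Mapping.keys d"
  have "lin_extend f (c - d) e = (\<Sum>k \<in> ?B. Poly_Mapping.lookup (c - d) k * f k e)"
    by (rule lin_extend_superset) (auto simp: keys_diff)
  also have "\<dots> = (\<Sum>k \<in> ?B. Poly_Mapping.lookup c k * f k e) - (\<Sum>k \<in> ?B. Poly_Mapping.lookup d k * f k e)"
    by (simp add: lookup_minus left_diff_distrib sum_subtractf)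
  also have "\<dots> = (lin_extend f c - lin_extend f d) e"
    by (simp add: lin_extend_superset[of ?B])
  finally show "lin_extend f (c - d) e = (lin_extend f c - lin_extend f d) e" .
qed

lemma lin_extend_zero: "lin_extend f 0 = 0"
  using lin_extend_diff[of f 0 0] by simp

lemma lin_extend_of: "lin_extend f (frag_of k) = f k"
  unfolding lin_extend_def by (rule ext) simp

lemma lin_extend_uminus: "lin_extend f (- c) = - lin_extend f c"
  using lin_extend_diff[of f 0 c] by (simp add: lin_extend_zero)

lemma lin_extend_add: "lin_extend f (c + d) = lin_extend f c + lin_extend f d"
  using lin_extend_diff[of f c "- d"] by (simp add: lin_extend_uminus)

context lie_coefficients
begin

lemma tail_funs_sum:
  assumes "c \<in> tail_funs"
  shows "c = (\<Sum>i = 1..n. \<Sum>j = 1..n. (\<lambda>e. (if i < j then c (T i j) else 0) * wedge (unit_fun i) (unit_fun j) e))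
    + (\<Sum>i = 1..n. (\<lambda>e. c (S i) * s_part (unit_fun i) e))"
proof
  fix e
  show "c e = ((\<Sum>i = 1..n. \<Sum>j = 1..n. (\<lambda>e. (if i < j then c (T i j) else 0) * wedge (unit_fun i) (unit_fun j) e))
    + (\<Sum>i = 1..n. (\<lambda>e. c (S i) * s_part (unit_fun i) e))) e"
  proof (cases e)
    case (T k l)
    have "(\<Sum>i = 1..n. \<Sum>j = 1..n. (if i < j then c (T i j) else 0) * wedge (unit_fun i) (unit_fun j) e)
      = (\<Sum>i = 1..n. \<Sum>j = 1..n. if j = l then (if i = k then (if k < l then c (T k l) else 0) else 0) else 0)"
      by (intro sum.cong HOL.refl) (auto simp: T wedge_def unit_fun_def)
    also have "\<dots> = (\<Sum>i = 1..n. if i = k then (if l \<in> {1..n} then (if k < l then c (T k l) else 0) else 0) else 0)"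
      by (intro sum.cong HOL.refl) (simp add: sum.delta del: One_nat_def)
    also have "\<dots> = (if l \<in> {1..n} then if k \<in> {1..n} then if k < l then c (T k l) else 0 else 0 else 0)"
      by (simp add: sum.delta del: One_nat_def)
    also have "\<dots> = c e"
    proof (cases "c e = 0")
      case False
      then have "e \<in> set (tails n)" using assms unfolding tail_funs_def by blast
      then have "1 \<le> k" "k < l" "l \<le> n" unfolding set_tails T by auto
      then show ?thesis by (simp add: T)
    next
      case True
      then have "c (T k l) = 0" by (simp add: T)
      then show ?thesis using True by simp
    qed
    finally show ?thesis by (simp add: sum_fun_apply T s_part_def)
  next
    case (S k)
    have "(\<Sum>i = 1..n. c (S i) * s_part (unit_fun i) e) = (\<Sum>i = 1..n. if i = k then c (S k) else 0)"
      by (intro sum.cong HOL.refl) (auto simp: S s_part_def unit_fun_def)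
    also have "\<dots> = (if k \<in> {1..n} then c (S k) else 0)"
      by simp
    also have "\<dots> = c e"
    proof (cases "c e = 0")
      case False
      then have "e \<in> set (tails n)" using assms unfolding tail_funs_def by blast
      then have "1 \<le> k" "k \<le> n" unfolding set_tails S by auto
      then show ?thesis by (simp add: S)
    next
      case True
      then have "c (S k) = 0" by (simp add: S)
      then show ?thesis using True by simp
    qed
    finally show ?thesis by (simp add: sum_fun_apply S wedge_def)
  qed
qed

lemma tail_funs_induct [consumes 1, case_names zero wedge s_part diff]:
  assumes c: "c \<in> tail_funs" and 0: "P 0"
    and w: "\<And>i j. i \<in> {1..n} \<Longrightarrow> j \<in> {1..n} \<Longrightarrow> P (wedge (unit_fun i) (unit_fun j))"
    and s: "\<And>i. i \<in> {1..n} \<Longrightarrow> P (s_part (unit_fun i))"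
    and d: "\<And>c d. P c \<Longrightarrow> P d \<Longrightarrow> P (c - d)"
  shows "P c"
proof -
  have m: "P (\<lambda>e. k * f e)" if "P f" for k f
    by (rule diff_closed_mult[of P]) (use 0 d that in auto)
  have "P (\<Sum>i = 1..n. \<Sum>j = 1..n. (\<lambda>e. (if i < j then c (T i j) else 0) * wedge (unit_fun i) (unit_fun j) e))"
    by (rule diff_closed_sum[of P], rule 0, erule (1) d, rule diff_closed_sum[of P], rule 0, erule (1) d, rule m, rule w)
  moreover have "P (\<Sum>i = 1..n. (\<lambda>e. c (S i) * s_part (unit_fun i) e))"
    by (rule diff_closed_sum[of P], rule 0, erule (1) d, rule m, rule s)
  ultimately show ?thesis
    by (subst tail_funs_sum[OF c], intro diff_closed_imp_add_closed[of P, OF 0 d])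
qed

lemma zero_tail_funs: "0 \<in> tail_funs"
  by (simp add: tail_funs_def)

lemma S_comp_vecs: "c \<in> tail_funs \<Longrightarrow> (\<lambda>i. c (S i)) \<in> int_vecs n"
  unfolding tail_funs_def int_vecs_def set_tails by auto

lemma phi_image_diff: "x \<in> phi ` int_vecs n \<Longrightarrow> y \<in> phi ` int_vecs n \<Longrightarrow> x - y \<in> phi ` int_vecs n"
  by (elim imageE) (simp add: phi_diff[symmetric] int_vecs_diff del: minus_apply)

lemma phi_image_zero: "0 \<in> phi ` int_vecs n"
  using phi_zero zero_int_vecs by (metis imageI)

lemma phi_image_uminus: "x \<in> phi ` int_vecs n \<Longrightarrow> - x \<in> phi ` int_vecs n"
  using phi_image_diff[OF phi_image_zero] by fastforce

lemma phi_image_add: "x \<in> phi ` int_vecs n \<Longrightarrow> y \<in> phi ` int_vecs n \<Longrightarrow> x + y \<in> phi ` int_vecs n"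
  using phi_image_diff[of x "- y"] phi_image_uminus[of y] by simp

end

section \<open>Cycles of tails against cycles of the complex\<close>

text \<open>\<open>beta\<close> presents \<open>L\<close> additively as the cokernel of
  \<open>phi\<close>, compatibly with brackets. The last two assumptions are equalities of integer
  vectors, not congruences modulo the image of \<open>phi\<close>.\<close>

locale lie_model = lie_coefficients n p A + lie_ring L
  for n p A and L (structure) +
  fixes beta :: "(nat \<Rightarrow> int) \<Rightarrow> 'a"
  assumes beta_closed: "x \<in> int_vecs n \<Longrightarrow> beta x \<in> carrier L"
    and beta_diff: "x \<in> int_vecs n \<Longrightarrow> y \<in> int_vecs n \<Longrightarrow> beta (x - y) = beta x \<ominus> beta y"
    and beta_surj: "g \<in> carrier L \<Longrightarrow> \<exists>x \<in> int_vecs n. beta x = g"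
    and beta_zero_iff: "x \<in> int_vecs n \<Longrightarrow> beta x = \<zero> \<longleftrightarrow> x \<in> phi ` int_vecs n"
    and beta_bracket: "x \<in> int_vecs n \<Longrightarrow> y \<in> int_vecs n \<Longrightarrow> beta (bracket x y) = beta x \<otimes> beta y"
    and phi_bracket: "x \<in> int_vecs n \<Longrightarrow> y \<in> int_vecs n \<Longrightarrow> phi (bracket x y) = bracket (phi x) y"
    and jacobi_bracket: "x \<in> int_vecs n \<Longrightarrow> y \<in> int_vecs n \<Longrightarrow> z \<in> int_vecs n \<Longrightarrow>
       bracket x (bracket y z) + bracket y (bracket z x) + bracket z (bracket x y) = 0"
begin

abbreviation "V \<equiv> int_vecs n"

text \<open>A mere set-theoretic section of \<open>beta\<close>; it is additive only modulo the
  image of \<open>phi\<close>.\<close>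

definition lift :: "'a \<Rightarrow> nat \<Rightarrow> int" where
  "lift g = (SOME x. x \<in> V \<and> beta x = g)"

lemma lift: assumes "g \<in> carrier L" shows "lift g \<in> V" "beta (lift g) = g"
proof -
  have "\<exists>x. x \<in> V \<and> beta x = g" using beta_surj[OF assms] by blast
  from someI_ex[OF this] show "lift g \<in> V" "beta (lift g) = g" unfolding lift_def by blast+
qed

lemma beta_eq_iff:
  assumes "x \<in> V" "y \<in> V" shows "beta x = beta y \<longleftrightarrow> x - y \<in> phi ` V"
proof -
  have "beta x = beta y \<longleftrightarrow> beta x \<ominus> beta y = \<zero>"
    using minus_add_cancel_right[of "beta x" "beta y"] beta_closed[OF assms(1)] beta_closed[OF assms(2)]
    by (auto simp: a_minus_def r_neg)
  also have "\<dots> \<longleftrightarrow> beta (x - y) = \<zero>" by (simp only: beta_diff[OF assms])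
  also have "\<dots> \<longleftrightarrow> x - y \<in> phi ` V" by (rule beta_zero_iff[OF int_vecs_diff[OF assms]])
  finally show ?thesis .
qed

lemma int_vecs_uminus: "x \<in> V \<Longrightarrow> - x \<in> V"
  using int_vecs_diff[OF zero_int_vecs, of x n] by simp

lemma int_vecs_add: "x \<in> V \<Longrightarrow> y \<in> V \<Longrightarrow> x + y \<in> V"
  using int_vecs_diff[of x n "- y"] int_vecs_uminus[of y] by simp

lemma beta_zero: "beta 0 = \<zero>"
  using beta_zero_iff[OF zero_int_vecs] phi_image_zero by blast

lemma beta_uminus: "x \<in> V \<Longrightarrow> beta (- x) = \<ominus> beta x"
  using beta_diff[OF zero_int_vecs, of x] beta_closed[of x] by (simp add: beta_zero a_minus_def)

lemma beta_add: "x \<in> V \<Longrightarrow> y \<in> V \<Longrightarrow> beta (x + y) = beta x \<oplus> beta y"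
  using beta_diff[of x "- y"] beta_closed[of y] by (simp add: beta_uminus int_vecs_uminus a_minus_def)

text \<open>The exact identities of the model enter here: \<open>theta\<close> turns the two kinds
  of rows into the defects of centrality and of the Jacobi law, and a congruence modulo the image of
  \<open>phi\<close> would not make these 0.\<close>

lemma row_span_cycles: "c \<in> row_span \<Longrightarrow> c \<in> cycles"
proof (rule row_span_cases_induct[where Q = "\<lambda>c. c \<in> cycles"])
  show "0 \<in> cycles" by (simp add: cycles_def zero_tail_funs theta_zero)
  show "c - d \<in> cycles" if "c \<in> cycles" "d \<in> cycles" for c d
    using that by (simp add: cycles_def tail_funs_diff theta_diff del: minus_apply)
next
  have theta_add: "theta (c + d) = theta c + theta d" for c d
    using theta_diff[of c "- d"] theta_diff[of 0 d] theta_zero by simp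
  have tf_add: "c + d \<in> tail_funs" if "c \<in> tail_funs" "d \<in> tail_funs" for c d
    using tail_funs_diff[of c "0 - d"] tail_funs_diff[of 0 d] that zero_tail_funs by simp
  show "central_row x y \<in> cycles" if "x \<in> V" "y \<in> V" for x y
    using that unfolding cycles_def central_row_def
    by (simp add: theta_add tf_add wedge_tail_funs s_part_tail_funs phi_vecs bracket_vecs theta_wedge theta_s_part phi_bracket)
  show "jacobi_row x y z \<in> cycles" if "x \<in> V" "y \<in> V" "z \<in> V" for x y z
    using that jacobi_bracket[of x y z] unfolding cycles_def jacobi_row_def
    by (simp add: theta_add tf_add wedge_tail_funs bracket_vecs theta_wedge del: plus_fun_apply)
qed

text \<open>Reads a tail vector as a 2-chain. The \<open>s\<close>-coordinates are dropped: on a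
  cycle they only record the preimage under \<open>phi\<close> of the bracket value.\<close>

definition omega :: "(tail \<Rightarrow> int) \<Rightarrow> ('a list \<Rightarrow>\<^sub>0 int)" where
  "omega c = (\<Sum>i = 1..n. \<Sum>j = 1..n. frag_cmul (if i < j then c (T i j) else 0)
     (frag_of [beta (unit_fun i), beta (unit_fun j)]))"

lemma omega_diff: "omega (c - d) = omega c - omega d"
proof -
  have "(if i < j then (c - d) (T i j) else 0) = (if i < j then c (T i j) else 0) - (if i < j then d (T i j) else 0)" for i j
    by simp
  then show ?thesis unfolding omega_def by (simp only: frag_cmul_diff_distrib sum_subtractf)
qed

lemma omega_zero: "omega 0 = 0"
  using omega_diff[of 0 0] by simp

lemma omega_uminus: "omega (- c) = - omega c"
  using omega_diff[of 0 c] by (simp add: omega_zero)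

lemma omega_add: "omega (c + d) = omega c + omega d"
  using omega_diff[of c "- d"] by (simp add: omega_uminus)

lemma omega_s_part: "omega (s_part x) = 0"
  unfolding omega_def s_part_def by (simp cong: if_cong)

lemma omega_wedge_unit:
  assumes "i \<in> {1..n}" "j \<in> {1..n}" "i < j"
  shows "omega (wedge (unit_fun i) (unit_fun j)) = frag_of [beta (unit_fun i), beta (unit_fun j)]"
proof -
  have "omega (wedge (unit_fun i) (unit_fun j)) = (\<Sum>k = 1..n. \<Sum>l = 1..n. if l = j then
    (if k = i then frag_of [beta (unit_fun i), beta (unit_fun j)] else 0) else 0)"
    unfolding omega_def by (intro sum.cong HOL.refl) (use assms in \<open>auto simp: wedge_def unit_fun_def\<close>)
  then show ?thesis using assms by simp
qed

lemma omega_chains: "Poly_Mapping.keys (omega c) \<subseteq> wedge_lists L 2"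
proof -
  have "omega c \<in> carrier (chains L 2)" unfolding omega_def
  proof (intro sum_closed_free_Abelian_group)
    fix i j assume "i \<in> {1..n}" "j \<in> {1..n}"
    then have "[beta (unit_fun i), beta (unit_fun j)] \<in> wedge_lists L 2"
      by (simp add: wedge_lists_def beta_closed unit_fun_int_vecs del: atLeastAtMost_iff)
    then show "frag_cmul (if i < j then c (T i j) else 0) (frag_of [beta (unit_fun i), beta (unit_fun j)]) \<in> carrier (chains L 2)"
      by auto
  qed
  then show ?thesis by simp
qed

lemma omega_wedge:
  assumes "x \<in> V" "y \<in> V"
  shows "omega (wedge x y) - frag_of [beta x, beta y] \<in> E 2"
  using assms(1)
proof (induction rule: int_vecs_induct)
  case zero
  show ?case using E_uminus[OF E2_zero_left[OF beta_closed[OF assms(2)]]]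
    by (simp add: wedge_zero omega_zero beta_zero del: zero_fun_apply)
next
  case (diff x x')
  have "(omega (wedge x y) - frag_of [beta x, beta y]) - (omega (wedge x' y) - frag_of [beta x', beta y])
    - (frag_of [beta x \<ominus> beta x', beta y] - frag_of [beta x, beta y] + frag_of [beta x', beta y]) \<in> E 2"
    by (rule E_diff[OF E_diff[OF diff(3,4)] E2_minus_left[OF beta_closed[OF diff(1)] beta_closed[OF diff(2)] beta_closed[OF assms(2)]]])
  then show ?case using diff by (simp add: wedge_diff_left omega_diff beta_diff algebra_simps del: minus_apply)
next
  case (unit i)
  show ?case using assms(2)
  proof (induction rule: int_vecs_induct)
    case zero
    show ?case using E_uminus[OF E2_zero_right[OF beta_closed[OF unit_fun_int_vecs[OF unit]]]]
      by (simp add: wedge_zero omega_zero beta_zero del: zero_fun_apply)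
  next
    case (diff x x')
    have "(omega (wedge (unit_fun i) x) - frag_of [beta (unit_fun i), beta x]) - (omega (wedge (unit_fun i) x') - frag_of [beta (unit_fun i), beta x'])
      - (frag_of [beta (unit_fun i), beta x \<ominus> beta x'] - frag_of [beta (unit_fun i), beta x] + frag_of [beta (unit_fun i), beta x']) \<in> E 2"
      by (rule E_diff[OF E_diff[OF diff(3,4)] E2_minus_right[OF beta_closed[OF diff(1)] beta_closed[OF diff(2)] beta_closed[OF unit_fun_int_vecs[OF unit]]]])
    then show ?case using diff by (simp add: wedge_diff_right omega_diff beta_diff algebra_simps del: minus_apply)
  next
    case (unit j)
    let ?i = "beta (unit_fun i)" and ?j = "beta (unit_fun j)"
    have c: "?i \<in> carrier L" "?j \<in> carrier L"
      using beta_closed[OF unit_fun_int_vecs[OF \<open>i \<in> {1..n}\<close>]] beta_closed[OF unit_fun_int_vecs[OF unit]] by blast+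
    consider "i < j" | "i = j" | "j < i" by linarith
    then show ?case
    proof cases
      case 1
      then show ?thesis using omega_wedge_unit[OF \<open>i \<in> {1..n}\<close> unit] by (simp add: E_zero)
    next
      case 2
      then show ?thesis using E_uminus[OF E2_self[OF c(2)]] by (simp add: wedge_self omega_zero del: zero_fun_apply)
    next
      case 3
      have "omega (wedge (unit_fun i) (unit_fun j)) = - frag_of [?j, ?i]"
        using omega_wedge_unit[OF unit \<open>i \<in> {1..n}\<close> 3] omega_uminus
        by (subst wedge_antisym) simp
      then show ?thesis using E_uminus[OF E2_antisym[OF c(2,1)]] by (simp only: minus_add_distrib diff_conv_add_uminus)
    qed
  qed
qed

text \<open>Inverse to \<open>omega\<close> up to relations, built from lifts; another choice of
  lifts alters it on chains by elements of \<open>t_relations\<close> only.\<close>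

definition lam :: "('a list \<Rightarrow>\<^sub>0 int) \<Rightarrow> tail \<Rightarrow> int" where
  "lam = lin_extend (\<lambda>xs. wedge (lift (xs ! 0)) (lift (xs ! 1)))"

definition lam1 :: "('a list \<Rightarrow>\<^sub>0 int) \<Rightarrow> nat \<Rightarrow> int" where
  "lam1 = lin_extend (\<lambda>xs. lift (xs ! 0))"

lemmas lam_simps = lin_extend_diff[of "\<lambda>xs. wedge (lift (xs ! 0)) (lift (xs ! 1))", folded lam_def]
  lin_extend_add[of "\<lambda>xs. wedge (lift (xs ! 0)) (lift (xs ! 1))", folded lam_def]
  lin_extend_uminus[of "\<lambda>xs. wedge (lift (xs ! 0)) (lift (xs ! 1))", folded lam_def]
  lin_extend_zero[of "\<lambda>xs. wedge (lift (xs ! 0)) (lift (xs ! 1))", folded lam_def]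

lemmas lam1_simps = lin_extend_diff[of "\<lambda>xs. lift (xs ! 0)", folded lam1_def]
  lin_extend_add[of "\<lambda>xs. lift (xs ! 0)", folded lam1_def]
  lin_extend_uminus[of "\<lambda>xs. lift (xs ! 0)", folded lam1_def]
  lin_extend_zero[of "\<lambda>xs. lift (xs ! 0)", folded lam1_def]

lemma lam_of: "lam (frag_of [x, y]) = wedge (lift x) (lift y)"
  unfolding lam_def lin_extend_of by simp

lemma lam1_of: "lam1 (frag_of [x]) = lift x"
  unfolding lam1_def lin_extend_of by simp

lemma lam_tail_funs: "Poly_Mapping.keys c \<subseteq> wedge_lists L 2 \<Longrightarrow> lam c \<in> tail_funs"
proof (induction rule: frag_induction)
  case (one xs)
  then have "length xs = 2" "set xs \<subseteq> carrier L" by (auto simp: wedge_lists_def)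
  moreover obtain x y where "xs = [x, y]" using length_2_cases[OF \<open>length xs = 2\<close>] by blast
  ultimately show ?case by (simp add: lam_of wedge_tail_funs lift(1))
qed (simp_all add: lam_simps zero_tail_funs tail_funs_diff del: minus_apply zero_fun_apply)

lemma chain_eq_omega_lam: "Poly_Mapping.keys c \<subseteq> wedge_lists L 2 \<Longrightarrow> c - omega (lam c) \<in> E 2"
proof (induction rule: frag_induction)
  case zero
  show ?case by (simp add: lam_simps omega_zero E_zero del: zero_fun_apply)
next
  case (one xs)
  then have l: "length xs = 2" and s: "set xs \<subseteq> carrier L" by (auto simp: wedge_lists_def)
  obtain x y where xy: "xs = [x, y]" using length_2_cases[OF l] by blast
  with s have c: "x \<in> carrier L" "y \<in> carrier L" by auto
  show ?case using E_uminus[OF omega_wedge[OF lift(1)[OF c(1)] lift(1)[OF c(2)]]] c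
    by (simp add: xy lam_of lift(2))
next
  case (diff c d)
  then have "(c - omega (lam c)) - (d - omega (lam d)) \<in> E 2" by (intro E_diff[of "c - omega (lam c)"])
  then show ?case by (simp add: lam_simps omega_diff algebra_simps del: minus_apply)
qed

text \<open>In degree 1 no two positions can coincide, so additivity is the only kind of relation,
  and a chain collapses to the generator of its sum in \<open>L\<close>.\<close>

lemma chain1_eq: "Poly_Mapping.keys c \<subseteq> wedge_lists L 1 \<Longrightarrow> c - frag_of [beta (lam1 c)] \<in> E 1 \<and> lam1 c \<in> V"
proof (induction rule: frag_induction)
  case zero
  show ?case using E_uminus[OF E1_zero] by (simp add: lam1_simps zero_int_vecs beta_zero del: zero_fun_apply)
next
  case (one xs)
  then have "length xs = 1" and s: "set xs \<subseteq> carrier L" by (auto simp: wedge_lists_def)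
  then obtain x where x: "xs = [x]" by (auto simp: length_Suc_conv)
  with s have c: "x \<in> carrier L" by auto
  show ?case using lift[OF c] by (simp add: x lam1_of E_zero)
next
  case (diff c d)
  then have "(c - frag_of [beta (lam1 c)]) - (d - frag_of [beta (lam1 d)]) 
    - (frag_of [beta (lam1 c) \<ominus> beta (lam1 d)] - frag_of [beta (lam1 c)] + frag_of [beta (lam1 d)]) \<in> E 1"
    by (intro E_diff[OF E_diff E1_minus] beta_closed) simp_all
  then show ?case using diff by (simp add: lam1_simps beta_diff int_vecs_diff algebra_simps del: minus_apply)
qed

lemma lift_minus:
  assumes "x \<in> V" "g \<in> carrier L" "beta x = g"
  shows "lift g - x \<in> phi ` V"
  using beta_eq_iff[OF lift(1)[OF assms(2)] assms(1)] lift(2)[OF assms(2)] assms(3) by simp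

lemma lift_add: "x \<in> carrier L \<Longrightarrow> y \<in> carrier L \<Longrightarrow> lift (x \<oplus> y) - (lift x + lift y) \<in> phi ` V"
  by (rule lift_minus) (simp_all add: int_vecs_add lift beta_add del: plus_fun_apply)

lemma E1_lam1: "c \<in> E 1 \<Longrightarrow> lam1 c \<in> phi ` V"
proof (erule E_induct[where Q = "\<lambda>c. lam1 c \<in> phi ` V"])
  fix c assume "c \<in> exterior_generators 1"
  then show "lam1 c \<in> phi ` V" unfolding exterior_generators_def
  proof (elim UnE CollectE exE conjE)
    fix xs i x y
    assume "xs \<in> wedge_lists L 1" and i: "i < 1" and xy: "x \<in> carrier L" "y \<in> carrier L"
      and c: "c = frag_of (xs[i := x \<oplus> y]) - frag_of (xs[i := x]) - frag_of (xs[i := y])"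
    then have "length xs = 1" by (auto simp: wedge_lists_def)
    then obtain u where "xs = [u]" by (auto simp: length_Suc_conv)
    then have "lam1 c = lift (x \<oplus> y) - (lift x + lift y)"
      using i by (simp add: c lam1_simps lam1_of)
    then show ?thesis using lift_add[OF xy] by simp
  qed auto
qed (simp_all add: lam1_simps phi_image_zero phi_image_diff del: minus_apply zero_fun_apply)

lemma E1_iff:
  assumes "Poly_Mapping.keys c \<subseteq> wedge_lists L 1"
  shows "c \<in> E 1 \<longleftrightarrow> lam1 c \<in> phi ` V"
proof
  assume "lam1 c \<in> phi ` V"
  then have "beta (lam1 c) = \<zero>" using beta_zero_iff chain1_eq[OF assms] by blast
  then show "c \<in> E 1" using E_add[of "c - frag_of [beta (lam1 c)]" 1 "frag_of [\<zero>]"] E1_zero chain1_eq[OF assms] by simp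
qed (rule E1_lam1)

text \<open>The row span with \<open>s\<close>-coordinates left free. Since \<open>omega\<close>
  drops these coordinates, relations between 2-chains can be pulled back only to this larger
  set.\<close>

definition t_relations :: "(tail \<Rightarrow> int) set" where
  "t_relations = {c. \<exists>x \<in> V. c + s_part x \<in> row_span}"

lemma t_relations_diff: "c \<in> t_relations \<Longrightarrow> d \<in> t_relations \<Longrightarrow> c - d \<in> t_relations"
proof -
  assume "c \<in> t_relations" "d \<in> t_relations"
  then obtain x y where xy: "x \<in> V" "y \<in> V" "c + s_part x \<in> row_span" "d + s_part y \<in> row_span"
    unfolding t_relations_def by blast
  then have "(c + s_part x) - (d + s_part y) \<in> row_span" by (intro row_span_diff)
  then have "(c - d) + s_part (x - y) \<in> row_span" unfolding s_part_diff by (simp add: algebra_simps)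
  then show ?thesis using int_vecs_diff[OF xy(1,2)] unfolding t_relations_def by blast
qed

lemma row_span_t_relations: "c \<in> row_span \<Longrightarrow> c \<in> t_relations"
  unfolding t_relations_def using zero_int_vecs s_part_zero by force

lemma t_relations_zero: "0 \<in> t_relations"
  by (rule row_span_t_relations[OF row_span_zero])

lemma t_relations_uminus: "c \<in> t_relations \<Longrightarrow> - c \<in> t_relations"
  using t_relations_diff[OF t_relations_zero, of c] by simp

lemma t_relations_add: "c \<in> t_relations \<Longrightarrow> d \<in> t_relations \<Longrightarrow> c + d \<in> t_relations"
  using t_relations_diff[of c "- d"] t_relations_uminus[of d] by simp

lemma wedge_phi_t_relations: "x \<in> phi ` V \<Longrightarrow> y \<in> V \<Longrightarrow> wedge x y \<in> t_relations"
  unfolding t_relations_def using central_row_in_span bracket_vecs unfolding central_row_def by blast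

lemma wedge_phi_t_relations': "x \<in> phi ` V \<Longrightarrow> y \<in> V \<Longrightarrow> wedge y x \<in> t_relations"
  using t_relations_uminus[OF wedge_phi_t_relations] wedge_antisym[of y x] by metis

lemma s_part_t_relations: "x \<in> V \<Longrightarrow> s_part x \<in> t_relations"
proof -
  assume x: "x \<in> V"
  have "s_part x + s_part (- x) = 0" using s_part_diff[of 0 x] s_part_zero by simp
  then have "s_part x + s_part (- x) \<in> row_span" using row_span_zero by simp
  then show ?thesis using int_vecs_uminus[OF x] unfolding t_relations_def by blast
qed

text \<open>A lift of a sum differs from the sum of the lifts by some \<open>phi z\<close>, and the
  central row of \<open>z\<close> and \<open>y\<close> trades \<open>wedge (phi z) y\<close> for an
  \<open>s\<close>-part.\<close>

lemma E2_lam: "c \<in> E 2 \<Longrightarrow> lam c \<in> t_relations"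
proof (erule E_induct[where Q = "\<lambda>c. lam c \<in> t_relations"])
  fix c assume "c \<in> exterior_generators 2"
  then show "lam c \<in> t_relations" unfolding exterior_generators_def
  proof (elim UnE CollectE exE conjE)
    fix xs i x y
    assume xs: "xs \<in> wedge_lists L 2" and i: "i < 2" and xy: "x \<in> carrier L" "y \<in> carrier L"
      and c: "c = frag_of (xs[i := x \<oplus> y]) - frag_of (xs[i := x]) - frag_of (xs[i := y])"
    from xs have len: "length xs = 2" and sub: "set xs \<subseteq> carrier L" by (auto simp: wedge_lists_def)
    obtain u v where "xs = [u, v]" using length_2_cases[OF len] by blast
    with sub have uv: "xs = [u, v]" "u \<in> carrier L" "v \<in> carrier L" by simp_all
    have "i = 0 \<or> i = 1" using i by auto
    then show ?thesis
    proof
      assume i0: "i = 0"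
      have "lam c = wedge (lift (x \<oplus> y) - (lift x + lift y) ) (lift v)"
        using wedge_diff_left[of "lift (x \<oplus> y) - lift x" "lift y" "lift v"] wedge_diff_left[of "lift (x \<oplus> y)" "lift x" "lift v"]
        by (simp add: c i0 uv lam_simps lam_of diff_diff_eq del: minus_apply plus_fun_apply)
      then show ?thesis using wedge_phi_t_relations[OF lift_add[OF xy] lift(1)[OF uv(3)]] by simp
    next
      assume i1: "i = 1"
      have "lam c = wedge (lift u) (lift (x \<oplus> y) - (lift x + lift y))"
        using wedge_diff_right[of "lift u" "lift (x \<oplus> y) - lift x" "lift y"] wedge_diff_right[of "lift u" "lift (x \<oplus> y)" "lift x"]
        by (simp add: c i1 uv lam_simps lam_of diff_diff_eq del: minus_apply plus_fun_apply)
      then show ?thesis using wedge_phi_t_relations'[OF lift_add[OF xy] lift(1)[OF uv(2)]] by simp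
    qed
  next
    fix xs i j
    assume xs: "xs \<in> wedge_lists L 2" and c: "c = frag_of xs" and ij: "i < j" "j < 2" "xs ! i = xs ! j"
    from xs have len: "length xs = 2" and sub: "set xs \<subseteq> carrier L" by (auto simp: wedge_lists_def)
    obtain u v where uv: "xs = [u, v]" using length_2_cases[OF len] by blast
    have "i = 0 \<and> j = 1" using ij(1,2) by presburger
    then have "[u, v] ! 0 = [u, v] ! 1" using ij(3) uv(1) by metis
    then have "u = v" by simp
    then show ?thesis by (simp add: c uv lam_of wedge_self t_relations_zero del: zero_fun_apply)
  qed
qed (simp_all add: lam_simps t_relations_zero t_relations_diff del: minus_apply zero_fun_apply)

text \<open>The three boundary terms are \<open>[x,z] y - [x,y] z - [y,z] x\<close>; antisymmetry of
  \<open>wedge\<close> and \<open>bracket\<close> brings them into the cyclic form of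
  \<open>jacobi_row\<close>.\<close>

lemma boundary_omega:
  assumes "x \<in> V" "y \<in> V" "z \<in> V"
  shows "chain_boundary L (frag_of [beta x, beta y, beta z]) - omega (jacobi_row x y z) \<in> E 2"
proof -
  have "(frag_of [beta (bracket x z), beta y] - frag_of [beta (bracket x y), beta z] - frag_of [beta (bracket y z), beta x])
   + (omega (wedge (bracket x z) y) - frag_of [beta (bracket x z), beta y])
   - (omega (wedge (bracket x y) z) - frag_of [beta (bracket x y), beta z])
   - (omega (wedge (bracket y z) x) - frag_of [beta (bracket y z), beta x]) 
   = omega (wedge (bracket x z) y - wedge (bracket x y) z - wedge (bracket y z) x)"
    by (simp add: omega_diff del: minus_apply)
  also have "wedge (bracket x z) y - wedge (bracket x y) z - wedge (bracket y z) x = jacobi_row x y z"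
    unfolding jacobi_row_def bracket_antisym[of z x] wedge_antisym[of x "bracket y z"] wedge_antisym[of z "bracket x y"]
      wedge_antisym[of "bracket x z" y] wedge_minus_right
    by (simp add: algebra_simps)
  finally have "chain_boundary L (frag_of [beta x, beta y, beta z]) - omega (jacobi_row x y z) =
    (omega (wedge (bracket x y) z) - frag_of [beta (bracket x y), beta z])
   + (omega (wedge (bracket y z) x) - frag_of [beta (bracket y z), beta x]) 
   - (omega (wedge (bracket x z) y) - frag_of [beta (bracket x z), beta y])"
    using assms by (simp add: ce_boundary_3 beta_bracket algebra_simps)
  also have "\<dots> \<in> E 2" using assms by (intro E_diff E_add omega_wedge bracket_vecs)
  finally show ?thesis .
qed

lemma boundary_chain:
  assumes "Poly_Mapping.keys d \<subseteq> wedge_lists L 3"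
  shows "\<exists>c \<in> row_span. chain_boundary L d - omega c \<in> E 2"
  using assms
proof (induction rule: frag_induction)
  case zero
  show ?case using row_span_zero E_zero by (intro bexI[of _ 0]) (simp_all add: omega_zero del: zero_fun_apply)
next
  case (one xs)
  then have len: "length xs = 3" and sub: "set xs \<subseteq> carrier L" by (auto simp: wedge_lists_def)
  obtain x y z where "xs = [x, y, z]" using length_3_cases[OF len] by blast
  with sub have xyz: "xs = [x, y, z]" "x \<in> carrier L" "y \<in> carrier L" "z \<in> carrier L" by simp_all
  show ?case
    using boundary_omega[OF lift(1) lift(1) lift(1), OF xyz(2-4)] jacobi_row_in_span[OF lift(1) lift(1) lift(1), OF xyz(2-4)]
    by (auto simp: lift(2) xyz)
next
  case (diff c d)
  then obtain c' d' where "c' \<in> row_span" "d' \<in> row_span" "chain_boundary L c - omega c' \<in> E 2" "chain_boundary L d - omega d' \<in> E 2"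
    by blast
  moreover have "(chain_boundary L c - omega c') - (chain_boundary L d - omega d') = chain_boundary L (c - d) - omega (c' - d')"
    by (simp add: frag_extend_diff omega_diff del: minus_apply)
  ultimately show ?case using E_diff row_span_diff by (metis (no_types, lifting))
qed

text \<open>\<open>beta\<close> sends \<open>phi x\<close> to \<zero>, so a central row leaves
  nothing in the exterior square; a Jacobi row is the boundary of a triple.\<close>

lemma row_span_boundary:
  assumes "c \<in> row_span"
  shows "\<exists>d. Poly_Mapping.keys d \<subseteq> wedge_lists L 3 \<and> omega c - chain_boundary L d \<in> E 2"
  using assms
proof (induction rule: row_span_cases_induct)
  case zero
  show ?case by (rule exI[of _ 0]) (simp add: omega_zero E_zero del: zero_fun_apply)
next
  case (central x y)
  have "beta (phi x) = \<zero>" using beta_zero_iff[OF phi_vecs[OF central(1)]] central(1) by blast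
  then have "omega (wedge (phi x) y) - frag_of [\<zero>, beta y] \<in> E 2"
    using omega_wedge[OF phi_vecs[OF central(1)] central(2)] by simp
  then have "(omega (wedge (phi x) y) - frag_of [\<zero>, beta y]) + frag_of [\<zero>, beta y] \<in> E 2"
    using E2_zero_left beta_closed central by (intro E_add) auto
  then show ?case
    by (intro exI[of _ 0]) (simp add: central_row_def omega_add omega_s_part del: plus_fun_apply)
next
  case (jacobi x y z)
  have "- (chain_boundary L (frag_of [beta x, beta y, beta z]) - omega (jacobi_row x y z)) \<in> E 2"
    by (intro E_uminus boundary_omega jacobi)
  moreover have "Poly_Mapping.keys (frag_of [beta x, beta y, beta z]) \<subseteq> wedge_lists L 3"
    using jacobi by (simp add: wedge_lists_def beta_closed)
  ultimately show ?case by (intro exI[of _ "frag_of [beta x, beta y, beta z]"]) simp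
next
  case (diff c d)
  then obtain c' d' where "Poly_Mapping.keys c' \<subseteq> wedge_lists L 3" "Poly_Mapping.keys d' \<subseteq> wedge_lists L 3" 
     "omega c - chain_boundary L c' \<in> E 2" "omega d - chain_boundary L d' \<in> E 2"
    by blast
  moreover have "(omega c - chain_boundary L c') - (omega d - chain_boundary L d') = omega (c - d) - chain_boundary L (c' - d')"
    by (simp add: frag_extend_diff omega_diff del: minus_apply)
  ultimately show ?case using E_diff keys_diff_subset by (metis (no_types, lifting))
qed

lemma lam_omega:
  assumes "c \<in> tail_funs"
  shows "lam (omega c) - c \<in> t_relations"
  using assms
proof (induction rule: tail_funs_induct)
  case (wedge i j)
  let ?i = "unit_fun i" and ?j = "unit_fun j"
  have v: "?i \<in> V" "?j \<in> V" using wedge unit_fun_int_vecs by auto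
  have c: "beta ?i \<in> carrier L" "beta ?j \<in> carrier L" using v by (simp_all add: beta_closed)
  have "lam (omega (wedge ?i ?j) - frag_of [beta ?i, beta ?j]) \<in> t_relations"
    by (intro E2_lam omega_wedge v)
  moreover have "wedge (lift (beta ?i) - ?i) (lift (beta ?j)) + wedge ?i (lift (beta ?j) - ?j) \<in> t_relations"
    by (intro t_relations_add wedge_phi_t_relations wedge_phi_t_relations' lift_minus lift(1) v c HOL.refl)
  ultimately have "lam (omega (wedge ?i ?j) - frag_of [beta ?i, beta ?j]) + 
    (wedge (lift (beta ?i) - ?i) (lift (beta ?j)) + wedge ?i (lift (beta ?j) - ?j)) \<in> t_relations"
    by (rule t_relations_add)
  then show ?case by (simp add: lam_simps lam_of wedge_diff_left wedge_diff_right algebra_simps del: minus_apply plus_fun_apply)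
next
  case (s_part i)
  have "- s_part (unit_fun i) \<in> t_relations" by (intro t_relations_uminus s_part_t_relations unit_fun_int_vecs s_part)
  then show ?case by (simp add: omega_s_part lam_simps del: zero_fun_apply uminus_apply)
next
  case (diff c d)
  then have "(lam (omega c) - c) - (lam (omega d) - d) \<in> t_relations" by (rule t_relations_diff)
  then show ?case by (simp add: lam_simps omega_diff algebra_simps del: minus_apply)
qed (simp add: lam_simps omega_zero t_relations_zero del: zero_fun_apply)

lemma boundary_keys: 
  assumes "Poly_Mapping.keys c \<subseteq> wedge_lists L 2"
  shows "Poly_Mapping.keys (chain_boundary L c) \<subseteq> wedge_lists L 1"
  using assms
proof (induction rule: frag_induction)
  case (one xs)
  then have len: "length xs = 2" and sub: "set xs \<subseteq> carrier L" by (auto simp: wedge_lists_def)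
  obtain u v where "xs = [u, v]" using length_2_cases[OF len] by blast
  with sub show ?case by (simp add: ce_boundary_2 wedge_lists_def bracket_closed)
qed (simp_all add: frag_extend_diff keys_diff_subset)

text \<open>The plus sign reflects the minus sign in the boundary of a 2-chain. Lifting a bracket
  and bracketing representatives differ only by the image of \<open>phi\<close>.\<close>

lemma lam1_boundary_omega:
  assumes "c \<in> tail_funs"
  shows "lam1 (chain_boundary L (omega c)) + delta c \<in> phi ` V"
  using assms
proof (induction rule: tail_funs_induct)
  case (wedge i j)
  let ?i = "unit_fun i" and ?j = "unit_fun j"
  have v: "?i \<in> V" "?j \<in> V" using wedge unit_fun_int_vecs by auto
  have c: "beta ?i \<in> carrier L" "beta ?j \<in> carrier L" using v by (simp_all add: beta_closed)
  have "lam1 (chain_boundary L (omega (wedge ?i ?j) - frag_of [beta ?i, beta ?j])) \<in> phi ` V"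
    by (intro E1_lam1 boundary_E2 omega_wedge v)
  moreover have "lift (beta ?i \<otimes> beta ?j) - bracket ?i ?j \<in> phi ` V"
    by (intro lift_minus bracket_vecs bracket_closed c beta_bracket v)
  ultimately have "lam1 (chain_boundary L (omega (wedge ?i ?j) - frag_of [beta ?i, beta ?j])) - 
     (lift (beta ?i \<otimes> beta ?j) - bracket ?i ?j) \<in> phi ` V"
    by (rule phi_image_diff)
  then show ?case
    by (simp add: lam1_simps frag_extend_diff ce_boundary_2 lam1_of delta_wedge algebra_simps del: minus_apply plus_fun_apply uminus_apply)
next
  case (s_part i)
  then show ?case by (simp add: omega_s_part lam1_simps delta_s_part phi_image_zero del: zero_fun_apply)
next
  case (diff c d)
  then have "(lam1 (chain_boundary L (omega c)) + delta c) - (lam1 (chain_boundary L (omega d)) + delta d) \<in> phi ` V"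
    by (rule phi_image_diff)
  then show ?case by (simp add: lam1_simps omega_diff frag_extend_diff delta_diff algebra_simps del: minus_apply plus_fun_apply)
next
  case zero
  show ?case using delta_diff[of 0 0] by (simp add: omega_zero lam1_simps phi_image_zero del: zero_fun_apply)
qed

lemma boundary_omega_E1_iff:
  assumes "c \<in> tail_funs"
  shows "chain_boundary L (omega c) \<in> E 1 \<longleftrightarrow> delta c \<in> phi ` V"
proof -
  have "chain_boundary L (omega c) \<in> E 1 \<longleftrightarrow> lam1 (chain_boundary L (omega c)) \<in> phi ` V"
    by (intro E1_iff boundary_keys omega_chains)
  also have "\<dots> \<longleftrightarrow> delta c \<in> phi ` V"
    using phi_image_diff[OF lam1_boundary_omega[OF assms], of "lam1 (chain_boundary L (omega c))"]
      phi_image_diff[OF lam1_boundary_omega[OF assms], of "delta c"] by auto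
  finally show ?thesis .
qed

lemma cycles_boundary: "c \<in> cycles \<Longrightarrow> chain_boundary L (omega c) \<in> E 1"
proof -
  assume c: "c \<in> cycles"
  then have t: "c \<in> tail_funs" "theta c = 0" by (auto simp: cycles_def)
  then have "delta c = phi (\<lambda>i. c (S i))" unfolding theta_def by simp
  then show ?thesis using boundary_omega_E1_iff[OF t(1)] S_comp_vecs[OF t(1)] by auto
qed

text \<open>Obtained without expanding a double boundary: modulo relations the boundary of a 3-chain
  is \<open>omega\<close> of a row combination, and row combinations are cycles.\<close>

lemma boundary_boundary:
  assumes "Poly_Mapping.keys d \<subseteq> wedge_lists L 3"
  shows "chain_boundary L (chain_boundary L d) \<in> E 1"
proof -
  obtain c where c: "c \<in> row_span" "chain_boundary L d - omega c \<in> E 2" using boundary_chain[OF assms] by blast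
  have "chain_boundary L (chain_boundary L d - omega c) + chain_boundary L (omega c) \<in> E 1"
    by (intro E_add boundary_E2 c(2) cycles_boundary row_span_cycles c(1))
  then show ?thesis by (simp add: frag_extend_diff)
qed

lemma cycles_surj:
  assumes c: "Poly_Mapping.keys c \<subseteq> wedge_lists L 2" and b: "chain_boundary L c \<in> E 1"
  shows "\<exists>t \<in> cycles. c - omega t \<in> E 2"
proof -
  let ?t = "lam c"
  have t: "?t \<in> tail_funs" by (rule lam_tail_funs[OF c])
  have "chain_boundary L c - chain_boundary L (c - omega ?t) \<in> E 1"
    by (intro E_diff b boundary_E2 chain_eq_omega_lam c)
  then have "chain_boundary L (omega ?t) \<in> E 1" by (simp add: frag_extend_diff)
  then have "delta ?t \<in> phi ` V" using boundary_omega_E1_iff[OF t] by blast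
  then have "theta ?t \<in> phi ` V" unfolding theta_def using S_comp_vecs[OF t] by (intro phi_image_diff) auto
  then obtain x where x: "x \<in> V" "theta ?t = phi x" by blast
  \<comment> \<open>The subtracted \<open>s\<close>-part has \<open>theta\<close> value
    \<open>phi x\<close>, exactly that of \<open>?t\<close>, while \<open>omega\<close> does not see
    it.\<close>
  have "?t - s_part (- x) \<in> cycles" unfolding cycles_def
    using t x int_vecs_uminus[OF x(1)] phi_diff[of 0 x] phi_zero
    by (simp add: tail_funs_diff s_part_tail_funs theta_diff theta_s_part del: minus_apply)
  moreover have "c - omega (?t - s_part (- x)) \<in> E 2"
    using chain_eq_omega_lam[OF c] by (simp add: omega_diff omega_s_part del: minus_apply)
  ultimately show ?thesis by blast
qed

text \<open>The hypothesis places \<open>c - r\<close> in the row span only up to an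
  \<open>s\<close>-part. Since \<open>c - r\<close> and the corrected vector are both cycles,
  \<open>phi\<close> kills this part, and injectivity of \<open>phi\<close> removes it.\<close>

lemma cycles_kernel:
  assumes c: "c \<in> cycles" and d: "Poly_Mapping.keys d \<subseteq> wedge_lists L 3" and e: "omega c - chain_boundary L d \<in> E 2"
  shows "c \<in> row_span"
proof -
  obtain r where r: "r \<in> row_span" "chain_boundary L d - omega r \<in> E 2" using boundary_chain[OF d] by blast
  have "(omega c - chain_boundary L d) + (chain_boundary L d - omega r) \<in> E 2" by (intro E_add e r(2))
  then have "omega (c - r) \<in> E 2" by (simp add: omega_diff del: minus_apply)
  then have 1: "lam (omega (c - r)) \<in> t_relations" by (rule E2_lam)
  have cr: "c - r \<in> cycles"
    using c row_span_cycles[OF r(1)] by (simp add: cycles_def tail_funs_diff theta_diff del: minus_apply)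
  then have t: "c - r \<in> tail_funs" "theta (c - r) = 0" by (simp_all add: cycles_def del: minus_apply)
  have "lam (omega (c - r)) - (lam (omega (c - r)) - (c - r)) \<in> t_relations"
    by (intro t_relations_diff 1 lam_omega t)
  then have "c - r \<in> t_relations" by simp
  then obtain x where x: "x \<in> V" "(c - r) + s_part x \<in> row_span" unfolding t_relations_def by blast
  have "theta ((c - r) + s_part x) = 0" using row_span_cycles[OF x(2)] unfolding cycles_def by simp
  moreover have "theta ((c - r) + s_part x) = theta (c - r) - theta (0 - s_part x)"
    using theta_diff[of "c - r" "0 - s_part x"] by simp
  moreover have "theta (0 - s_part x) = phi x" using theta_diff[of 0 "s_part x"] theta_zero theta_s_part[of x] by simp
  ultimately have "phi x = 0" using t(2) by simp
  then have "x = 0" using phi_inj[OF x(1)] by blast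
  then have "c - r \<in> row_span" using x(2) s_part_zero by simp
  then have "(c - r) - (0 - r) \<in> row_span" using r(1) row_span_zero row_span_diff by blast
  then show ?thesis by simp
qed

end

section \<open>The Schur multiplier as cycles modulo rows\<close>

context lie_coefficients begin

definition cycle_group :: "(tail \<Rightarrow> int) monoid" where
  "cycle_group = \<lparr>carrier = cycles, monoid.mult = (+), one = 0\<rparr>"

lemma cycles_diff: "c \<in> cycles \<Longrightarrow> d \<in> cycles \<Longrightarrow> c - d \<in> cycles"
  by (simp add: cycles_def tail_funs_diff theta_diff del: minus_apply)

lemma cycles_zero: "0 \<in> cycles"
  by (simp add: cycles_def theta_zero tail_funs_def)

lemma cycles_add: "c \<in> cycles \<Longrightarrow> d \<in> cycles \<Longrightarrow> c + d \<in> cycles"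
  by (rule diff_closed_imp_add_closed[of "\<lambda>c. c \<in> cycles"]) (simp_all add: cycles_zero cycles_diff del: minus_apply)

lemma cycle_group: "comm_group cycle_group"
proof (rule comm_groupI)
  fix x assume "x \<in> carrier cycle_group"
  then have "0 - x \<in> cycles" using cycles_diff[OF cycles_zero] by (simp add: cycle_group_def)
  then show "\<exists>y\<in>carrier cycle_group. y \<otimes>\<^bsub>cycle_group\<^esub> x = \<one>\<^bsub>cycle_group\<^esub>"
    by (intro bexI[of _ "0 - x"]) (simp_all add: cycle_group_def)
qed (simp_all add: cycle_group_def cycles_zero cycles_add algebra_simps del: plus_fun_apply)

end

context lie_model begin

abbreviation "two_cycles \<equiv> kernel (exterior_power L 2) (exterior_power L 1) (ce_differential L 2)"

abbreviation "coset2 c \<equiv> E 2 #>\<^bsub>chains L 2\<^esub> c"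

lemma E_normal: "normal (E k) (chains L k)"
  by (rule comm_group.subgroup_imp_normal[OF abelian_free_Abelian_group E_subgroup])

lemma exterior_power_comm_group: "comm_group (exterior_power L k)"
  unfolding exterior_power_def
  by (rule comm_group.abelian_FactGroup[OF abelian_free_Abelian_group E_subgroup])

lemma carrier_exterior_power:
  "carrier (exterior_power L k) = {E k #>\<^bsub>chains L k\<^esub> c | c. Poly_Mapping.keys c \<subseteq> wedge_lists L k}"
  unfolding exterior_power_def FactGroup_def RCOSETS_def by auto

lemma mult_exterior_power:
  assumes "Poly_Mapping.keys c \<subseteq> wedge_lists L k" "Poly_Mapping.keys d \<subseteq> wedge_lists L k"
  shows "(E k #>\<^bsub>chains L k\<^esub> c) \<otimes>\<^bsub>exterior_power L k\<^esub> (E k #>\<^bsub>chains L k\<^esub> d) = E k #>\<^bsub>chains L k\<^esub> (c + d)"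
  using normal.rcos_sum[OF E_normal[of k], of c d] assms
  by (simp add: exterior_power_def FactGroup_def)

lemma one_exterior_power: "\<one>\<^bsub>exterior_power L k\<^esub> = E k"
  by (simp add: exterior_power_def FactGroup_def)

lemma coset_E_iff: "E k #>\<^bsub>chains L k\<^esub> c = E k \<longleftrightarrow> c \<in> E k"
proof -
  have "E k #>\<^bsub>chains L k\<^esub> 0 = E k" unfolding r_coset_def by auto
  then show ?thesis using coset_eq_iff[of k c 0] by simp
qed

lemma boundary_differential: "ce_differential L 2 (coset2 c) = E 1 #>\<^bsub>chains L 1\<^esub> chain_boundary L c"
  using ce_differential_coset[of 2 c] boundary_E2 by simp

lemma boundary_differential3: "ce_differential L 3 (E 3 #>\<^bsub>chains L 3\<^esub> c) = coset2 (chain_boundary L c)"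
  using ce_differential_coset[of 3 c] boundary_E3 by simp

lemma two_cycles_eq: "two_cycles = {coset2 c | c. Poly_Mapping.keys c \<subseteq> wedge_lists L 2 \<and> chain_boundary L c \<in> E 1}"
proof -
  have "ce_differential L 2 (coset2 c) = E 1 \<longleftrightarrow> chain_boundary L c \<in> E 1" for c
    using coset_E_iff[of 1 "chain_boundary L c"] by (simp only: boundary_differential)
  then show ?thesis unfolding kernel_def carrier_exterior_power one_exterior_power by blast
qed

lemma image_boundary3: "ce_differential L (Suc 2) ` carrier (exterior_power L (Suc 2)) =
   {coset2 (chain_boundary L d) | d. Poly_Mapping.keys d \<subseteq> wedge_lists L 3}"
proof -
  have 3: "Suc 2 = 3" by simp
  show ?thesis unfolding 3 carrier_exterior_power using boundary_differential3 by (auto simp: image_iff)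
qed

lemma boundary_keys3: 
  assumes "Poly_Mapping.keys c \<subseteq> wedge_lists L 3"
  shows "Poly_Mapping.keys (chain_boundary L c) \<subseteq> wedge_lists L 2"
  using assms
proof (induction rule: frag_induction)
  case (one xs)
  then have len: "length xs = 3" and sub: "set xs \<subseteq> carrier L" by (auto simp: wedge_lists_def)
  obtain u v w where "xs = [u, v, w]" using length_3_cases[OF len] by blast
  with sub have xs: "xs = [u, v, w]" "u \<in> carrier L" "v \<in> carrier L" "w \<in> carrier L" by simp_all
  then have "Poly_Mapping.keys (frag_of [u \<otimes> w, v] - frag_of [u \<otimes> v, w] - frag_of [v \<otimes> w, u]) \<subseteq> wedge_lists L 2"
    by (intro keys_diff_subset) (simp_all add: wedge_lists_def bracket_closed)
  then show ?case by (simp only: xs(1) frag_extend_of ce_boundary_3)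
qed (simp_all add: frag_extend_diff keys_diff_subset)

lemma uminus_exterior_power:
  assumes "Poly_Mapping.keys c \<subseteq> wedge_lists L k"
  shows "inv\<^bsub>exterior_power L k\<^esub> (E k #>\<^bsub>chains L k\<^esub> c) = E k #>\<^bsub>chains L k\<^esub> (- c)"
proof -
  interpret G: comm_group "exterior_power L k" by (rule exterior_power_comm_group)
  have "E k #>\<^bsub>chains L k\<^esub> 0 = E k" using coset_E_iff E_zero by blast
  then show ?thesis
    using assms mult_exterior_power[of "- c" k c]
    by (intro G.inv_equality) (simp_all add: one_exterior_power carrier_exterior_power, blast, metis keys_minus)
qed

lemma subgroup_of_chains:
  assumes B: "\<And>c. c \<in> B \<Longrightarrow> Poly_Mapping.keys c \<subseteq> wedge_lists L 2" "0 \<in> B" "\<And>c d. c \<in> B \<Longrightarrow> d \<in> B \<Longrightarrow> c - d \<in> B"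
  shows "subgroup {coset2 c | c. c \<in> B} (exterior_power L 2)"
proof -
  interpret G: comm_group "exterior_power L 2" by (rule exterior_power_comm_group)
  have um: "- c \<in> B" if "c \<in> B" for c using B(3)[OF B(2) that] by simp
  have ad: "c + d \<in> B" if "c \<in> B" "d \<in> B" for c d using B(3)[OF that(1) um[OF that(2)]] by simp
  show ?thesis
  proof (rule G.subgroupI)
    show "{coset2 c | c. c \<in> B} \<subseteq> carrier (exterior_power L 2)" using B(1) by (auto simp: carrier_exterior_power)
    show "{coset2 c | c. c \<in> B} \<noteq> {}" using B(2) by blast
  next
    fix x assume "x \<in> {coset2 c | c. c \<in> B}"
    then obtain c where "c \<in> B" "x = coset2 c" by blast
    then show "inv\<^bsub>exterior_power L 2\<^esub> x \<in> {coset2 c | c. c \<in> B}" using um uminus_exterior_power[OF B(1)] by auto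
  next
    fix x y assume "x \<in> {coset2 c | c. c \<in> B}" "y \<in> {coset2 c | c. c \<in> B}"
    then obtain c d where "c \<in> B" "x = coset2 c" "d \<in> B" "y = coset2 d" by blast
    then show "x \<otimes>\<^bsub>exterior_power L 2\<^esub> y \<in> {coset2 c | c. c \<in> B}" using ad mult_exterior_power[OF B(1) B(1)] by auto
  qed
qed

lemma two_cycles_subgroup: "subgroup two_cycles (exterior_power L 2)"
proof -
  have "subgroup {coset2 c | c. c \<in> {c. Poly_Mapping.keys c \<subseteq> wedge_lists L 2 \<and> chain_boundary L c \<in> E 1}} (exterior_power L 2)"
    by (rule subgroup_of_chains) (auto simp: E_zero frag_extend_diff E_diff simp del: One_nat_def intro: subsetD[OF keys_diff_subset])
  then show ?thesis unfolding two_cycles_eq by simp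
qed

lemma image_boundary3_subgroup:
  "subgroup {coset2 (chain_boundary L d) | d. Poly_Mapping.keys d \<subseteq> wedge_lists L 3} (exterior_power L 2)"
proof -
  have "subgroup {coset2 c | c. c \<in> chain_boundary L ` {d. Poly_Mapping.keys d \<subseteq> wedge_lists L 3}} (exterior_power L 2)"
  proof (rule subgroup_of_chains)
    show "0 \<in> chain_boundary L ` {d. Poly_Mapping.keys d \<subseteq> wedge_lists L 3}" by (rule image_eqI[of _ _ 0]) auto
    fix c d assume "c \<in> chain_boundary L ` {d. Poly_Mapping.keys d \<subseteq> wedge_lists L 3}"
      "d \<in> chain_boundary L ` {d. Poly_Mapping.keys d \<subseteq> wedge_lists L 3}"
    then obtain c' d' where "Poly_Mapping.keys c' \<subseteq> wedge_lists L 3" "Poly_Mapping.keys d' \<subseteq> wedge_lists L 3"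
      "c = chain_boundary L c'" "d = chain_boundary L d'" by blast
    then show "c - d \<in> chain_boundary L ` {d. Poly_Mapping.keys d \<subseteq> wedge_lists L 3}"
      by (intro image_eqI[of _ _ "c' - d'"]) (simp_all add: frag_extend_diff keys_diff_subset)
  qed (auto simp: boundary_keys3 intro: subsetD[OF boundary_keys3])
  moreover have "{coset2 c | c. c \<in> chain_boundary L ` {d. Poly_Mapping.keys d \<subseteq> wedge_lists L 3}} =
    {coset2 (chain_boundary L d) | d. Poly_Mapping.keys d \<subseteq> wedge_lists L 3}" by blast
  ultimately show ?thesis by simp
qed

text \<open>Homomorphism theorem for \<open>omega\<close> followed by passage to cosets of exterior
  relations and then modulo boundaries: \<open>cycles_surj\<close> gives surjectivity,
  \<open>cycles_kernel\<close> and \<open>row_span_boundary\<close> the kernel.\<close>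

theorem schur_multiplier_iso: "cycle_group Mod row_span \<cong> schur_multiplier L"
proof -
  define I where "I = {coset2 (chain_boundary L d) | d. Poly_Mapping.keys d \<subseteq> wedge_lists L 3}"
  define G where "G = exterior_power L 2\<lparr>carrier := two_cycles\<rparr>"
  interpret X: comm_group "exterior_power L 2" by (rule exterior_power_comm_group)
  interpret G: group G unfolding G_def
    by (rule subgroup.subgroup_is_group[OF two_cycles_subgroup X.group_axioms])
  have "x \<otimes>\<^bsub>G\<^esub> y = y \<otimes>\<^bsub>G\<^esub> x" if "x \<in> carrier G" "y \<in> carrier G" for x y
  proof -
    have "x \<in> carrier (exterior_power L 2)" "y \<in> carrier (exterior_power L 2)"
      using that subgroup.subset[OF two_cycles_subgroup] unfolding G_def by auto
    then show ?thesis unfolding G_def by (simp add: X.m_comm)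
  qed
  then interpret G: comm_group G by (rule G.group_comm_groupI)
  have schur: "schur_multiplier L = G Mod I"
    unfolding ce_homology_def G_def I_def image_boundary3 by simp
  have Isub: "I \<subseteq> two_cycles"
  proof
    fix X assume "X \<in> I"
    then obtain d where d: "X = coset2 (chain_boundary L d)" "Poly_Mapping.keys d \<subseteq> wedge_lists L 3"
      unfolding I_def by (elim CollectE exE conjE)
    show "X \<in> two_cycles" unfolding two_cycles_eq
      by (intro CollectI exI conjI) (rule d(1), rule boundary_keys3[OF d(2)], rule boundary_boundary[OF d(2)])
  qed
  have "subgroup I (exterior_power L 2)" unfolding I_def by (rule image_boundary3_subgroup)
  then have I: "subgroup I G" unfolding G_def using Isub
    by (intro X.subgroup_incl two_cycles_subgroup)
  then have In: "normal I G" by (rule G.subgroup_imp_normal)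
  interpret Z: comm_group cycle_group by (rule cycle_group)
  have mem: "coset2 (omega c) \<in> two_cycles" if "c \<in> cycles" for c
    unfolding two_cycles_eq using cycles_boundary[OF that] omega_chains by blast
  have h1: "(\<lambda>c. coset2 (omega c)) \<in> hom cycle_group G"
    by (rule homI) (simp_all add: cycle_group_def G_def mem mult_exterior_power omega_chains omega_add del: plus_fun_apply One_nat_def)
  have h2: "(\<lambda>X. I #>\<^bsub>G\<^esub> X) \<in> hom G (G Mod I)" by (rule normal.r_coset_hom_Mod[OF In])
  define f where "f = (\<lambda>c. I #>\<^bsub>G\<^esub> coset2 (omega c))"
  have f: "f \<in> hom cycle_group (G Mod I)"
    using hom_compose[OF h1 h2] unfolding f_def by (simp add: comp_def)
  interpret F: group_hom cycle_group "G Mod I" f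
    by (rule group_hom.intro[OF Z.group_axioms normal.factorgroup_is_group[OF In]]) (unfold_locales, fact f)
  have surj: "f ` carrier cycle_group = carrier (G Mod I)"
  proof
    show "f ` carrier cycle_group \<subseteq> carrier (G Mod I)" using F.hom_closed by blast
    show "carrier (G Mod I) \<subseteq> f ` carrier cycle_group"
    proof
      fix Y assume "Y \<in> carrier (G Mod I)"
      then obtain X where X: "X \<in> two_cycles" "Y = I #>\<^bsub>G\<^esub> X"
        unfolding FactGroup_def RCOSETS_def G_def by auto
      then obtain c where c: "X = coset2 c" "Poly_Mapping.keys c \<subseteq> wedge_lists L 2" "chain_boundary L c \<in> E 1"
        unfolding two_cycles_eq by blast
      obtain t where t: "t \<in> cycles" "c - omega t \<in> E 2" using cycles_surj[OF c(2,3)] by blast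
      have eq: "coset2 c = coset2 (omega t)" using t(2) by (simp only: coset_eq_iff)
      have "f t = I #>\<^bsub>G\<^esub> coset2 (omega t)" by (simp only: f_def)
      also have "\<dots> = Y" unfolding X(2) c(1) eq ..
      finally have "Y = f t" ..
      moreover have "t \<in> carrier cycle_group" using t(1) by (simp add: cycle_group_def)
      ultimately show "Y \<in> f ` carrier cycle_group" by blast
    qed
  qed
  have ker: "kernel cycle_group (G Mod I) f = row_span"
  proof
    show "kernel cycle_group (G Mod I) f \<subseteq> row_span"
    proof
      fix c assume "c \<in> kernel cycle_group (G Mod I) f"
      then have c: "c \<in> cycles" "I #>\<^bsub>G\<^esub> coset2 (omega c) = I"
        unfolding kernel_def f_def by (auto simp: cycle_group_def FactGroup_def)
      then have "coset2 (omega c) \<in> I" using G.coset_join1[OF c(2) _ I] mem by (simp add: G_def del: One_nat_def)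
      then obtain d where d: "Poly_Mapping.keys d \<subseteq> wedge_lists L 3" "coset2 (omega c) = coset2 (chain_boundary L d)"
        unfolding I_def by blast
      then have "omega c - chain_boundary L d \<in> E 2" by (simp only: coset_eq_iff)
      then show "c \<in> row_span" by (rule cycles_kernel[OF c(1) d(1)])
    qed
    show "row_span \<subseteq> kernel cycle_group (G Mod I) f"
    proof
      fix c assume c: "c \<in> row_span"
      then have cc: "c \<in> cycles" by (rule row_span_cycles)
      obtain d where d: "Poly_Mapping.keys d \<subseteq> wedge_lists L 3" "omega c - chain_boundary L d \<in> E 2"
        using row_span_boundary[OF c] by blast
      then have "coset2 (omega c) = coset2 (chain_boundary L d)" by (simp only: coset_eq_iff)
      with d(1) have "coset2 (omega c) \<in> I" unfolding I_def by (intro CollectI exI conjI)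
      moreover have "coset2 (omega c) \<in> carrier G" using mem[OF cc] by (simp add: G_def del: One_nat_def)
      ultimately have "f c = I" unfolding f_def by (intro G.coset_join2 I)
      then show "c \<in> kernel cycle_group (G Mod I) f"
        unfolding kernel_def using cc by (simp add: cycle_group_def FactGroup_def)
    qed
  qed
  show ?thesis using F.FactGroup_iso[OF surj] unfolding ker schur .
qed

end

section \<open>Minors, determinantal divisors and their comparison\<close>

definition minor :: "'a::comm_ring_1 mat \<Rightarrow> nat \<Rightarrow> (nat \<Rightarrow> nat) \<Rightarrow> (nat \<Rightarrow> nat) \<Rightarrow> 'a" where
  "minor M k f g = det (mat k k (\<lambda>(i, j). M $$ (f i, g j)))"

text \<open>Says that \<open>d\<close> divides the k-th determinantal ideal. Divisibility instead of
  a greatest common divisor makes sense over any commutative ring, so the same lemmas serve integers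
  and polynomials.\<close>

definition minors_dvd :: "'a::comm_ring_1 \<Rightarrow> nat \<Rightarrow> 'a mat \<Rightarrow> bool" where
  "minors_dvd d k M \<longleftrightarrow> (\<forall>f g. (\<forall>i<k. f i < dim_row M) \<longrightarrow> (\<forall>j<k. g j < dim_col M) \<longrightarrow> d dvd minor M k f g)"

lemma minor_transpose:
  assumes "\<forall>i<k. f i < dim_row M" "\<forall>j<k. g j < dim_col M"
  shows "minor (transpose_mat M) k g f = minor M k f g"
proof -
  have "mat k k (\<lambda>(i, j). transpose_mat M $$ (g i, f j)) = transpose_mat (mat k k (\<lambda>(i, j). M $$ (f i, g j)))"
    by (rule eq_matI) (use assms in auto)
  then show ?thesis unfolding minor_def by (simp add: det_transpose[of _ k])
qed

lemma minors_dvd_transpose: "minors_dvd d k (transpose_mat M) \<longleftrightarrow> minors_dvd d k M"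
proof -
  have "minors_dvd d k (transpose_mat M)" if "minors_dvd d k M" for M :: "'a mat"
    unfolding minors_dvd_def
  proof (intro allI impI)
    fix f g assume "\<forall>i<k. f i < dim_row (transpose_mat M)" "\<forall>j<k. g j < dim_col (transpose_mat M)"
    then show "d dvd minor (transpose_mat M) k f g"
      using that minor_transpose[of k g M f] unfolding minors_dvd_def by simp
  qed
  from this[of M] this[of "transpose_mat M"] show ?thesis by auto
qed

text \<open>A minor of a product is a linear combination of minors of the right factor with arbitrary, not
  necessarily increasing, row selections; this weak form of the Cauchy--Binet formula suffices.\<close>

lemma minors_dvd_mult_left:
  fixes P M :: "'a::comm_ring_1 mat"
  assumes M: "minors_dvd d k M" and dim: "dim_col P = dim_row M"
  shows "minors_dvd d k (P * M)"
  unfolding minors_dvd_def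
proof (intro allI impI)
  fix f g assume f: "\<forall>i<k. f i < dim_row (P * M)" and g: "\<forall>j<k. g j < dim_col (P * M)"
  let ?r = "dim_row M"
  let ?a = "\<lambda>i t. P $$ (f i, t) \<cdot>\<^sub>v vec k (\<lambda>j. M $$ (t, g j))"
  have "mat k k (\<lambda>(i, j). (P * M) $$ (f i, g j)) = mat\<^sub>r k k (\<lambda>i. finsum_vec TYPE('a) k (?a i) {0..<?r})"
  proof (rule eq_matI)
    fix i j assume ij: "i < dim_row (mat\<^sub>r k k (\<lambda>i. finsum_vec TYPE('a) k (?a i) {0..<?r}))" 
      "j < dim_col (mat\<^sub>r k k (\<lambda>i. finsum_vec TYPE('a) k (?a i) {0..<?r}))"
    then have "finsum_vec TYPE('a) k (?a i) {0..<?r} $ j = (\<Sum>t\<in>{0..<?r}. ?a i t $ j)"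
      by (intro index_finsum_vec) auto
    also have "\<dots> = (\<Sum>t\<in>{0..<?r}. P $$ (f i, t) * M $$ (t, g j))" using ij by simp
    also have "\<dots> = (P * M) $$ (f i, g j)"
      using ij f g dim by (simp add: scalar_prod_def)
    finally show "mat k k (\<lambda>(i, j). (P * M) $$ (f i, g j)) $$ (i, j) =
      mat\<^sub>r k k (\<lambda>i. finsum_vec TYPE('a) k (?a i) {0..<?r}) $$ (i, j)" using ij by simp
  qed auto
  then have "minor (P * M) k f g = (\<Sum>h | (\<forall>i\<in>{0..<k}. h i \<in> {0..<?r}) \<and> (\<forall>i. i \<notin> {0..<k} \<longrightarrow> h i = i).
     det (mat\<^sub>r k k (\<lambda>i. ?a i (h i))))"
    unfolding minor_def by (simp add: det_linear_rows_sum)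
  moreover have "d dvd det (mat\<^sub>r k k (\<lambda>i. ?a i (h i)))" if h: "\<forall>i\<in>{0..<k}. h i \<in> {0..<?r}" for h
  proof -
    have "det (mat\<^sub>r k k (\<lambda>i. ?a i (h i))) =
      (\<Prod>i=0..<k. P $$ (f i, h i)) * det (mat\<^sub>r k k (\<lambda>i. vec k (\<lambda>j. M $$ (h i, g j))))"
      by (rule det_rows_mul) auto
    also have "mat\<^sub>r k k (\<lambda>i. vec k (\<lambda>j. M $$ (h i, g j))) = mat k k (\<lambda>(i, j). M $$ (h i, g j))"
      by (rule eq_matI) auto
    also have "det \<dots> = minor M k h g" by (simp add: minor_def)
    finally show ?thesis using M h g unfolding minors_dvd_def by (auto intro!: dvd_mult)
  qed
  ultimately show "d dvd minor (P * M) k f g" by (auto intro: dvd_sum)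
qed

lemma minors_dvd_mult_right:
  fixes P M :: "'a::comm_ring_1 mat"
  assumes M: "minors_dvd d k M" and dim: "dim_col M = dim_row P"
  shows "minors_dvd d k (M * P)"
proof -
  have "minors_dvd d k (transpose_mat P * transpose_mat M)"
    by (rule minors_dvd_mult_left) (use M dim in \<open>simp_all add: minors_dvd_transpose\<close>)
  moreover have "transpose_mat (M * P) = transpose_mat P * transpose_mat M"
    by (rule transpose_mult[of _ "dim_row M" "dim_col M" _ "dim_col P"]) (use dim in auto)
  ultimately show ?thesis by (metis minors_dvd_transpose)
qed

text \<open>Peel off the maximum of \<open>I\<close>: among \<open>k + 1\<close> distinct natural
  numbers it is at least \<open>k\<close>, so \<open>d k\<close> divides its factor.\<close>

lemma prod_lessThan_dvd_prod:
  fixes d :: "nat \<Rightarrow> 'a::comm_semiring_1"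
  assumes chain: "\<And>i j. i \<le> j \<Longrightarrow> d i dvd d j" and "finite I" "card I = k"
  shows "(\<Prod>i<k. d i) dvd (\<Prod>i\<in>I. d i)"
  using assms(2,3)
proof (induction k arbitrary: I)
  case (Suc k)
  let ?m = "Max I"
  have ne: "I \<noteq> {}" using Suc.prems by auto
  then have m: "?m \<in> I" using Suc.prems by simp
  have "k \<le> ?m"
  proof -
    have "I \<subseteq> {..?m}" using Suc.prems(1) by auto
    then have "card I \<le> card {..?m}" by (rule card_mono[rotated]) simp
    then show ?thesis using Suc.prems(2) by simp
  qed
  moreover have "(\<Prod>i<k. d i) dvd (\<Prod>i\<in>I - {?m}. d i)"
    using Suc m by (intro Suc.IH) auto
  ultimately have "(\<Prod>i<k. d i) * d k dvd (\<Prod>i\<in>I - {?m}. d i) * d ?m"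
    by (intro mult_dvd_mono chain)
  then show ?case using prod.remove[OF Suc.prems(1) m, of d] by (simp add: mult.commute)
qed simp

lemma smith_shape_dvd:
  assumes "smith_shape D" "i \<le> j" "j < min (dim_row D) (dim_col D)"
  shows "D $$ (i, i) dvd D $$ (j, j)"
  using assms(2,3)
proof (induction j rule: dec_induct)
  case (step j)
  then have "D $$ (j, j) dvd D $$ (Suc j, Suc j)" using assms(1) unfolding smith_shape_def by blast
  then show ?case using step by (auto intro: dvd_trans)
qed simp

text \<open>In the Leibniz expansion a non-zero term uses diagonal entries only, one for each
  selected row. Distinct rows give \<open>k\<close> distinct diagonal entries, and a repeated row
  makes the determinant 0.\<close>

lemma smith_shape_minors_dvd:
  fixes D :: "'a::comm_ring_1 mat"
  assumes D: "smith_shape D" and k: "k \<le> min (dim_row D) (dim_col D)"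
  shows "minors_dvd (\<Prod>i<k. D $$ (i, i)) k D"
  unfolding minors_dvd_def
proof (intro allI impI)
  fix f g assume f: "\<forall>i<k. f i < dim_row D" and g: "\<forall>j<k. g j < dim_col D"
  let ?s = "min (dim_row D) (dim_col D)"
  let ?M = "mat k k (\<lambda>(i, j). D $$ (f i, g j))"
  have M: "?M \<in> carrier_mat k k" by simp
  \<comment> \<open>Continued by 0, which everything divides, so that the divisibility chain holds
    for all indices.\<close>
  define d where "d = (\<lambda>i. if i < ?s then D $$ (i, i) else 0)"
  have chain: "d i dvd d j" if "i \<le> j" for i j
    using smith_shape_dvd[OF D that] that by (auto simp: d_def)
  have eq: "(\<Prod>i<k. D $$ (i, i)) = (\<Prod>i<k. d i)"
    by (rule prod.cong) (use k in \<open>auto simp: d_def\<close>)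
  show "(\<Prod>i<k. D $$ (i, i)) dvd minor D k f g"
  proof (cases "inj_on f {..<k}")
    case False
    then obtain i j where ij: "i < k" "j < k" "i \<noteq> j" "f i = f j" unfolding inj_on_def by auto
    have "det ?M = 0"
      by (rule det_identical_rows[OF M ij(3,1,2)]) (rule eq_vecI, use ij in auto)
    then show ?thesis by (simp add: minor_def)
  next
    case True
    have "(\<Prod>i<k. d i) dvd (\<Prod>i\<in>f ` {..<k}. d i)"
      by (rule prod_lessThan_dvd_prod[OF chain]) (use True in \<open>auto simp: card_image\<close>)
    also have "(\<Prod>i\<in>f ` {..<k}. d i) = (\<Prod>i<k. d (f i))" using True by (simp add: prod.reindex)
    finally have 1: "(\<Prod>i<k. d i) dvd (\<Prod>i<k. d (f i))" .
    have 2: "(\<Prod>i<k. d (f i)) dvd (\<Prod>i = 0..<k. ?M $$ (i, q i))" if q: "q permutes {0..<k}" for q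
    proof -
      have "d (f i) dvd ?M $$ (i, q i)" if i: "i < k" for i
      proof -
        have qi: "q i < k" using permutes_in_image[OF q, of i] i by simp
        show ?thesis
        proof (cases "f i = g (q i)")
          case True
          then have "f i < ?s" using f g i qi by (metis min_less_iff_conj)
          then show ?thesis using True i qi by (simp add: d_def)
        next
          case False
          have "diagonal_mat D" using D unfolding smith_shape_def by blast
          then have "D $$ (f i, g (q i)) = 0" using False f g i qi unfolding diagonal_mat_def by blast
          then show ?thesis using i qi by simp
        qed
      qed
      then show ?thesis unfolding atLeast0LessThan by (intro prod_dvd_prod) auto
    qed
    have "(\<Prod>i<k. d i) dvd det ?M"
      unfolding det_def'[OF M] by (intro dvd_sum dvd_mult dvd_trans[OF 1 2]) simp
    then show ?thesis unfolding eq minor_def .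
  qed
qed

lemma minor_diagonal:
  fixes D :: "'a::comm_ring_1 mat"
  assumes "diagonal_mat D" "k \<le> min (dim_row D) (dim_col D)"
  shows "minor D k (\<lambda>i. i) (\<lambda>i. i) = (\<Prod>i<k. D $$ (i, i))"
proof -
  let ?M = "mat k k (\<lambda>(i, j). D $$ (i, j))"
  have "upper_triangular ?M"
    using assms by (intro upper_triangularI) (auto simp: diagonal_mat_def)
  then have "det ?M = prod_list (diag_mat ?M)" by (rule det_upper_triangular[of _ k]) simp
  also have "\<dots> = (\<Prod>i = 0..<k. ?M $$ (i, i))" by (simp add: prod_list_diag_prod)
  also have "\<dots> = (\<Prod>i<k. D $$ (i, i))" by (simp add: atLeast0LessThan)
  finally show ?thesis by (simp add: minor_def)
qed

lemma minors_dvd_diagonal: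
  fixes D :: "'a::comm_ring_1 mat"
  assumes "minors_dvd d k D" "diagonal_mat D" "k \<le> min (dim_row D) (dim_col D)"
  shows "d dvd (\<Prod>i<k. D $$ (i, i))"
proof -
  have "d dvd minor D k (\<lambda>i. i) (\<lambda>i. i)" using assms unfolding minors_dvd_def by auto
  then show ?thesis using minor_diagonal[OF assms(2,3)] by simp
qed

lemma invertible_matE:
  assumes "invertible_mat U" "U \<in> carrier_mat n n"
  obtains U' where "U' \<in> carrier_mat n n" "U * U' = 1\<^sub>m n" "U' * U = 1\<^sub>m n"
proof -
  obtain U' where U': "U * U' = 1\<^sub>m n" "U' * U = 1\<^sub>m (dim_row U')"
    using assms unfolding invertible_mat_def inverts_mat_def by auto
  have "dim_col U' = n" using arg_cong[OF U'(1), of dim_col] by simp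
  moreover have "dim_row U' = n" using arg_cong[OF U'(2), of dim_col] assms(2) by simp
  ultimately show ?thesis using that[of U'] U' by auto
qed

lemma prime_power_dvd_mult_coprime:
  fixes p :: nat and N :: int
  assumes "coprime N (int p)" "int p ^ x dvd N ^ k * int p ^ y"
  shows "int p ^ x dvd int p ^ y"
proof -
  have "coprime (int p ^ x) (N ^ k)" using assms(1) by (simp add: coprime_commute)
  then show ?thesis using assms(2) by (simp add: coprime_dvd_mult_right_iff)
qed

lemma prod_prime_powers:
  fixes p k :: nat and d :: "nat \<Rightarrow> int"
  assumes "\<And>i. i < k \<Longrightarrow> d i \<noteq> 0 \<Longrightarrow> \<exists>l. d i = int p ^ l" "(\<Prod>i<k. d i) \<noteq> (0::int)"
  shows "\<exists>l. (\<Prod>i<k. d i) = int p ^ l"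
  using assms
proof (induction k)
  case (Suc k)
  then obtain l where l: "(\<Prod>i<k. d i) = int p ^ l" by fastforce
  obtain l' where "d k = int p ^ l'" using Suc.prems by fastforce
  then show ?case using l by (simp add: power_add[symmetric], blast)
qed (auto intro: exI[of _ 0])

text \<open>The partial products of the diagonal entries are the determinantal divisors, which are bounded
  from above by \<open>NM\<close> and from below by \<open>minors\<close>.\<close>

lemma smith_entries_determined:
  fixes M D D' P Q :: "int mat" and p :: nat
  defines "s \<equiv> min (dim_row M) (dim_col M)"
  assumes p: "prime p" and snf: "int_smith_normal_form M D'"
    and D: "diagonal_mat D" "dim_row D = dim_row M" "dim_col D = dim_col M"
    and chain: "\<And>i. Suc i < s \<Longrightarrow> D $$ (i, i) = 0 \<Longrightarrow> D $$ (Suc i, Suc i) = 0"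
    and powD: "\<And>i. i < s \<Longrightarrow> D $$ (i, i) \<noteq> 0 \<Longrightarrow> \<exists>l. D $$ (i, i) = int p ^ l"
    and powD': "\<And>i. i < s \<Longrightarrow> D' $$ (i, i) \<noteq> 0 \<Longrightarrow> \<exists>l. D' $$ (i, i) = int p ^ l"
    and minors: "\<And>k. k \<le> s \<Longrightarrow> minors_dvd (\<Prod>i<k. D $$ (i, i)) k M"
    and PQ: "P \<in> carrier_mat (dim_row M) (dim_row M)" "Q \<in> carrier_mat (dim_col M) (dim_col M)"
    and N: "coprime N (int p)" and NM: "N \<cdot>\<^sub>m D = P * M * Q"
    and i: "i < s"
  shows "D' $$ (i, i) = D $$ (i, i)"
proof -
  obtain U V where UV: "U \<in> carrier_mat (dim_row M) (dim_row M)" "invertible_mat U"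
      "V \<in> carrier_mat (dim_col M) (dim_col M)" "invertible_mat V" "D' = U * M * V"
    and sh: "smith_shape D'" using snf unfolding int_smith_normal_form_def by blast
  have dimD': "dim_row D' = dim_row M" "dim_col D' = dim_col M"
    unfolding UV(5) by (simp_all add: carrier_matD[OF UV(1)] carrier_matD[OF UV(3)])
  have diag': "diagonal_mat D'" using sh unfolding smith_shape_def by blast
  obtain U' where cU': "U' \<in> carrier_mat (dim_row M) (dim_row M)" and U': "U * U' = 1\<^sub>m (dim_row M)" "U' * U = 1\<^sub>m (dim_row M)"
    using invertible_matE[OF UV(2,1)] .
  obtain V' where cV': "V' \<in> carrier_mat (dim_col M) (dim_col M)" and V': "V * V' = 1\<^sub>m (dim_col M)" "V' * V = 1\<^sub>m (dim_col M)"
    using invertible_matE[OF UV(4,3)] .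
  have cM: "M \<in> carrier_mat (dim_row M) (dim_col M)" by simp
  have cD': "D' \<in> carrier_mat (dim_row M) (dim_col M)" by (rule carrier_matI[OF dimD'])
  have "U' * D' * V' = U' * (U * (M * V)) * V'"
    unfolding UV(5) assoc_mult_mat[OF UV(1) cM UV(3)] ..
  also have "U' * (U * (M * V)) = (U' * U) * (M * V)"
    by (rule assoc_mult_mat[symmetric, OF cU' UV(1) mult_carrier_mat[OF cM UV(3)]])
  also have "\<dots> = M * V" unfolding U'(2) by (rule left_mult_one_mat[OF mult_carrier_mat[OF cM UV(3)]])
  also have "M * V * V' = M * (V * V')" by (rule assoc_mult_mat[OF cM UV(3) cV'])
  also have "\<dots> = M" unfolding V'(1) by (rule right_mult_one_mat[OF cM])
  finally have M_eq: "M = U' * D' * V'" ..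
  have d1: "(\<Prod>i<k. D $$ (i, i)) dvd (\<Prod>i<k. D' $$ (i, i))" if k: "k \<le> s" for k
  proof -
    have "minors_dvd (\<Prod>i<k. D $$ (i, i)) k D'"
      unfolding UV(5) by (intro minors_dvd_mult_right minors_dvd_mult_left minors k) (simp_all add: carrier_matD[OF UV(1)] carrier_matD[OF UV(3)])
    then show ?thesis by (rule minors_dvd_diagonal[OF _ diag']) (use k dimD' in \<open>simp add: s_def\<close>)
  qed
  \<comment> \<open>The reverse direction goes from \<open>D'\<close> back to \<open>M\<close> and
    on to \<open>N \<cdot>\<^sub>m D\<close>; the leading k-minor there carries the factor
    \<open>N ^ k\<close>, which is prime to \<open>p\<close> and is cancelled below.\<close>
  have d2: "(\<Prod>i<k. D' $$ (i, i)) dvd N ^ k * (\<Prod>i<k. D $$ (i, i))" if k: "k \<le> s" for k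
  proof -
    have "minors_dvd (\<Prod>i<k. D' $$ (i, i)) k D'" by (rule smith_shape_minors_dvd[OF sh]) (use k dimD' in \<open>simp add: s_def\<close>)
    then have "minors_dvd (\<Prod>i<k. D' $$ (i, i)) k (U' * D' * V')"
      by (intro minors_dvd_mult_right minors_dvd_mult_left) (simp_all add: carrier_matD[OF cU'] carrier_matD[OF cV'] dimD')
    then have "minors_dvd (\<Prod>i<k. D' $$ (i, i)) k M" using M_eq by simp
    then have "minors_dvd (\<Prod>i<k. D' $$ (i, i)) k (N \<cdot>\<^sub>m D)"
      unfolding NM by (intro minors_dvd_mult_right minors_dvd_mult_left) (simp_all add: carrier_matD[OF PQ(1)] carrier_matD[OF PQ(2)])
    then have "(\<Prod>i<k. D' $$ (i, i)) dvd (\<Prod>i<k. (N \<cdot>\<^sub>m D) $$ (i, i))"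
      by (rule minors_dvd_diagonal) (use D k in \<open>auto simp: diagonal_mat_def s_def\<close>)
    also have "(\<Prod>i<k. (N \<cdot>\<^sub>m D) $$ (i, i)) = (\<Prod>i<k. N * D $$ (i, i))"
      by (rule prod.cong) (use D k in \<open>auto simp: s_def\<close>)
    finally show ?thesis by (simp add: prod.distrib)
  qed
  have prods: "(\<Prod>i<k. D' $$ (i, i)) = (\<Prod>i<k. D $$ (i, i))" if k: "k \<le> s" for k
  proof (cases "(\<Prod>i<k. D $$ (i, i)) = 0 \<or> (\<Prod>i<k. D' $$ (i, i)) = 0")
    case True
    have "N \<noteq> 0"
    proof
      assume "N = 0"
      then have "p = 1" using N by simp
      then show False using p by simp
    qed
    then have "N ^ k \<noteq> 0" by simp
    then show ?thesis using True d1[OF k] d2[OF k] by (metis dvd_0_left mult_eq_0_iff)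
  next
    case False
    obtain x where x: "(\<Prod>i<k. D $$ (i, i)) = int p ^ x" using prod_prime_powers[of k "\<lambda>i. D $$ (i, i)" p] powD k False by auto
    obtain y where y: "(\<Prod>i<k. D' $$ (i, i)) = int p ^ y" using prod_prime_powers[of k "\<lambda>i. D' $$ (i, i)" p] powD' k False by auto
    have "int p ^ y dvd int p ^ x" using prime_power_dvd_mult_coprime[OF N, of y k x] d2[OF k] x y by simp
    moreover have "int p ^ x dvd int p ^ y" using d1[OF k] x y by simp
    ultimately show ?thesis unfolding x y using zdvd_antisym_nonneg[of "int p ^ y" "int p ^ x"] by simp
  qed
  have zero_D: "D $$ (j, j) = 0" if "D $$ (i, i) = 0" "i \<le> j" "j < s" for i j
    using that(2,3,1) by (induction j rule: dec_induct) (use chain in auto)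
  have zero_D': "D' $$ (j, j) = 0" if "D' $$ (i, i) = 0" "i \<le> j" "j < s" for i j
    using smith_shape_dvd[OF sh that(2)] that dimD' by (simp add: s_def)
  \<comment> \<open>Entries are quotients of consecutive partial products as long as these are
    non-zero; from the first zero on, both diagonals consist of zeros.\<close>
  show ?thesis
  proof (cases "(\<Prod>j<i. D $$ (j, j)) = 0")
    case True
    then obtain j where "j < i" "D $$ (j, j) = 0" by auto
    then have "D $$ (i, i) = 0" using zero_D i by simp
    moreover have "(\<Prod>j<i. D' $$ (j, j)) = 0" using True prods i by simp
    then obtain j' where "j' < i" "D' $$ (j', j') = 0" by auto
    then have "D' $$ (i, i) = 0" using zero_D' i by simp
    ultimately show ?thesis by simp
  next
    case False
    have "(\<Prod>j<Suc i. D' $$ (j, j)) = (\<Prod>j<Suc i. D $$ (j, j))" using prods[of "Suc i"] i by simp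
    then show ?thesis using False prods[of i] i by simp
  qed
qed

text \<open>An abstract Smith normal form reduction. The relation \<open>R\<close> is reachability by the admissible
  operations, \<open>C\<close> the set of admitted entries, \<open>U\<close> the set of admitted multipliers and \<open>\<nu>\<close> a
  Euclidean size function.\<close>

locale smith_reduction =
  fixes R :: "'a::comm_ring_1 mat \<Rightarrow> 'a mat \<Rightarrow> bool" and C U :: "'a set" and \<nu> :: "'a \<Rightarrow> nat"
    and normal_entry :: "'a \<Rightarrow> bool"
  assumes R_refl: "R M M" and R_trans: "R M M' \<Longrightarrow> R M' M'' \<Longrightarrow> R M M''"
    and R_swaprows: "k < dim_row M \<Longrightarrow> l < dim_row M \<Longrightarrow> R M (swaprows k l M)"
    and R_swapcols: "k < dim_col M \<Longrightarrow> l < dim_col M \<Longrightarrow> R M (swapcols k l M)"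
    and R_addrow: "k < dim_row M \<Longrightarrow> l < dim_row M \<Longrightarrow> k \<noteq> l \<Longrightarrow> c \<in> C \<Longrightarrow> R M (addrow c k l M)"
    and R_addcol: "k < dim_col M \<Longrightarrow> l < dim_col M \<Longrightarrow> k \<noteq> l \<Longrightarrow> c \<in> C \<Longrightarrow> R M (addcol c k l M)"
    and R_multrow: "k < dim_row M \<Longrightarrow> u \<in> U \<Longrightarrow> R M (multrow k u M)"
    and R_multcol: "k < dim_col M \<Longrightarrow> u \<in> U \<Longrightarrow> R M (multcol k u M)"
    and one_C: "1 \<in> C" and U_C: "U \<subseteq> C" and add_C: "x \<in> C \<Longrightarrow> y \<in> C \<Longrightarrow> x + y \<in> C"
    and mult_C: "x \<in> C \<Longrightarrow> y \<in> C \<Longrightarrow> x * y \<in> C" and one_U: "1 \<in> U"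
    and euclid: "x \<in> C \<Longrightarrow> y \<in> C \<Longrightarrow> x \<noteq> 0 \<Longrightarrow> \<exists>u\<in>U. \<exists>c\<in>C. u * y + c * x = 0 \<or> \<nu> (u * y + c * x) < \<nu> x"
    and normalise: "x \<in> C \<Longrightarrow> x \<noteq> 0 \<Longrightarrow> \<exists>x'\<in>C. normal_entry x' \<and>
       (\<forall>u\<in>U. \<forall>c\<in>C. \<forall>y\<in>C. u * y + c * x = 0 \<longrightarrow> x' dvd y) \<and>
       (\<forall>d. (d = 0 \<or> normal_entry d) \<and> d dvd x \<longrightarrow> d dvd x') \<and>
       (\<forall>M k. k < dim_row M \<and> k < dim_col M \<and> M $$ (k, k) = x \<and> (\<forall>j<dim_col M. j \<noteq> k \<longrightarrow> M $$ (k, j) = 0) \<longrightarrow>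
          R M (mat (dim_row M) (dim_col M) (\<lambda>(i, j). if i = k \<and> j = k then x' else M $$ (i, j))))"
begin

text \<open>One step of pseudo-division. The multiplier \<open>u\<close> on the reduced row replaces
  a division by the unit part of the pivot.\<close>

definition row_op :: "nat \<Rightarrow> nat \<Rightarrow> 'a \<Rightarrow> 'a \<Rightarrow> 'a mat \<Rightarrow> 'a mat" where
  "row_op i l u c M = addrow c i l (multrow i u M)"

definition col_op :: "nat \<Rightarrow> nat \<Rightarrow> 'a \<Rightarrow> 'a \<Rightarrow> 'a mat \<Rightarrow> 'a mat" where
  "col_op i l u c M = addcol c i l (multcol i u M)"

lemma row_op_index:
  "dim_row (row_op i l u c M) = dim_row M" "dim_col (row_op i l u c M) = dim_col M"
  "i \<noteq> l \<Longrightarrow> l < dim_row M \<Longrightarrow> i' < dim_row M \<Longrightarrow> j < dim_col M \<Longrightarrow>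
    row_op i l u c M $$ (i', j) = (if i' = i then u * M $$ (i, j) + c * M $$ (l, j) else M $$ (i', j))"
  unfolding row_op_def by auto

lemma col_op_index:
  "dim_row (col_op i l u c M) = dim_row M" "dim_col (col_op i l u c M) = dim_col M"
  "i \<noteq> l \<Longrightarrow> l < dim_col M \<Longrightarrow> j < dim_row M \<Longrightarrow> i' < dim_col M \<Longrightarrow>
    col_op i l u c M $$ (j, i') = (if i' = i then u * M $$ (j, i) + c * M $$ (j, l) else M $$ (j, i'))"
  unfolding col_op_def by auto

lemma R_row_op: "i < dim_row M \<Longrightarrow> l < dim_row M \<Longrightarrow> i \<noteq> l \<Longrightarrow> u \<in> U \<Longrightarrow> c \<in> C \<Longrightarrow> R M (row_op i l u c M)"
  unfolding row_op_def by (rule R_trans[OF R_multrow R_addrow]) auto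

lemma R_col_op: "i < dim_col M \<Longrightarrow> l < dim_col M \<Longrightarrow> i \<noteq> l \<Longrightarrow> u \<in> U \<Longrightarrow> c \<in> C \<Longrightarrow> R M (col_op i l u c M)"
  unfolding col_op_def by (rule R_trans[OF R_multcol R_addcol]) auto

text \<open>Invariant after \<open>k\<close> pivots. The last clause is stronger than the divisor
  chain: a finished pivot divides the whole remaining block, and therefore every later pivot formed
  from it.\<close>

definition part :: "nat \<Rightarrow> nat \<Rightarrow> nat \<Rightarrow> 'a mat \<Rightarrow> bool" where
  "part r c k M \<longleftrightarrow> dim_row M = r \<and> dim_col M = c \<and> (\<forall>i<r. \<forall>j<c. M $$ (i, j) \<in> C) \<and>
     (\<forall>i<r. \<forall>j<c. i \<noteq> j \<and> (i < k \<or> j < k) \<longrightarrow> M $$ (i, j) = 0) \<and>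
     (\<forall>i<k. M $$ (i, i) = 0 \<or> normal_entry (M $$ (i, i))) \<and>
     (\<forall>h<k. \<forall>i<r. \<forall>j<c. h \<le> i \<and> h \<le> j \<longrightarrow> M $$ (h, h) dvd M $$ (i, j))"

text \<open>An operation on the trailing block keeps the earlier pivots valid if common divisors of
  the block survive. Only zero or normalised \<open>d\<close> are tested: earlier pivots are of this
  kind, and normalising a pivot preserves no other divisors in general.\<close>

lemma part_transfer:
  assumes M: "part r c k M" and k: "k \<le> min r c" and dims: "dim_row M' = r" "dim_col M' = c"
    and C: "\<And>i j. k \<le> i \<Longrightarrow> k \<le> j \<Longrightarrow> i < r \<Longrightarrow> j < c \<Longrightarrow> M' $$ (i, j) \<in> C"
    and low: "\<And>i j. i < k \<or> j < k \<Longrightarrow> i < r \<Longrightarrow> j < c \<Longrightarrow> M' $$ (i, j) = M $$ (i, j)"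
    and dv: "\<And>d i j. (\<And>i j. k \<le> i \<Longrightarrow> k \<le> j \<Longrightarrow> i < r \<Longrightarrow> j < c \<Longrightarrow> d dvd M $$ (i, j)) \<Longrightarrow>
       k \<le> i \<Longrightarrow> k \<le> j \<Longrightarrow> i < r \<Longrightarrow> j < c \<Longrightarrow> d = 0 \<or> normal_entry d \<Longrightarrow> d dvd M' $$ (i, j)"
  shows "part r c k M'"
proof -
  have 1: "M' $$ (i, j) \<in> C" if "i < r" "j < c" for i j
    using C[of i j] low[of i j] M that unfolding part_def by (metis not_le_imp_less)
  have 2: "M' $$ (i, j) = 0" if "i < r" "j < c" "i \<noteq> j" "i < k \<or> j < k" for i j
    using low[of i j] M that unfolding part_def by auto
  have eq: "M' $$ (i, i) = M $$ (i, i)" if "i < k" for i using low[of i i] that k by auto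
  have nrm: "M $$ (i, i) = 0 \<or> normal_entry (M $$ (i, i))" if "i < k" for i
    using M that unfolding part_def by blast
  have 3: "M' $$ (i, i) = 0 \<or> normal_entry (M' $$ (i, i))" if "i < k" for i
    using eq[OF that] nrm[OF that] by simp
  have dvdM: "M $$ (h, h) dvd M $$ (i, j)" if "h < k" "i < r" "j < c" "h \<le> i" "h \<le> j" for h i j
    using M that unfolding part_def by blast
  have 4: "M' $$ (h, h) dvd M' $$ (i, j)" if "h < k" "i < r" "j < c" "h \<le> i" "h \<le> j" for h i j
  proof (cases "i < k \<or> j < k")
    case True
    then show ?thesis using low[of i j] that dvdM[OF that] eq[of h] by simp
  next
    case False
    have "M $$ (h, h) dvd M' $$ (i, j)"
      by (rule dv) (use False that nrm dvdM in auto)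
    then show ?thesis using eq[of h] that by simp
  qed
  show ?thesis unfolding part_def using dims 1 2 3 4 by blast
qed

lemma part_entry: "part r c k M \<Longrightarrow> i < r \<Longrightarrow> j < c \<Longrightarrow> M $$ (i, j) \<in> C"
  unfolding part_def by blast

lemma part_zero: "part r c k M \<Longrightarrow> i < r \<Longrightarrow> j < c \<Longrightarrow> i \<noteq> j \<Longrightarrow> i < k \<or> j < k \<Longrightarrow> M $$ (i, j) = 0"
  unfolding part_def by blast

lemma part_dims: "part r c k M \<Longrightarrow> dim_row M = r" "part r c k M \<Longrightarrow> dim_col M = c"
  unfolding part_def by blast+

lemma part_row_op:
  assumes M: "part r c k M" and k: "k < min r c" and il: "k \<le> i" "k \<le> l" "i < r" "l < r" "i \<noteq> l"
    and uc: "u \<in> C" "w \<in> C"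
  shows "part r c k (row_op i l u w M)"
proof (rule part_transfer[OF M])
  note [simp] = row_op_index part_dims[OF M] il
  show "row_op i l u w M $$ (i', j) \<in> C" if "k \<le> i'" "k \<le> j" "i' < r" "j < c" for i' j
    using that part_entry[OF M] uc by (auto intro!: add_C mult_C)
  show "row_op i l u w M $$ (i', j) = M $$ (i', j)" if "i' < k \<or> j < k" "i' < r" "j < c" for i' j
  proof (cases "i' = i")
    case True
    then have "j < k" using that il by auto
    then have "M $$ (i, j) = 0" "M $$ (l, j) = 0" using part_zero[OF M, of i j] part_zero[OF M, of l j] il that by auto
    then show ?thesis using that True by simp
  qed (use that in simp)
  show "d dvd row_op i l u w M $$ (i', j)"
    if "\<And>i j. k \<le> i \<Longrightarrow> k \<le> j \<Longrightarrow> i < r \<Longrightarrow> j < c \<Longrightarrow> d dvd M $$ (i, j)" "k \<le> i'" "k \<le> j" "i' < r" "j < c" for d i' j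
    using that by (auto intro!: dvd_add dvd_mult)
qed (use k part_dims[OF M] in \<open>auto simp: row_op_index\<close>)

lemma part_col_op:
  assumes M: "part r c k M" and k: "k < min r c" and il: "k \<le> i" "k \<le> l" "i < c" "l < c" "i \<noteq> l"
    and uc: "u \<in> C" "w \<in> C"
  shows "part r c k (col_op i l u w M)"
proof (rule part_transfer[OF M])
  note [simp] = col_op_index part_dims[OF M] il
  show "col_op i l u w M $$ (j, i') \<in> C" if "k \<le> j" "k \<le> i'" "j < r" "i' < c" for i' j
    using that part_entry[OF M] uc by (auto intro!: add_C mult_C)
  show "col_op i l u w M $$ (j, i') = M $$ (j, i')" if "j < k \<or> i' < k" "j < r" "i' < c" for i' j
  proof (cases "i' = i")
    case True
    then have "j < k" using that il by auto
    then have "M $$ (j, i) = 0" "M $$ (j, l) = 0" using part_zero[OF M, of j i] part_zero[OF M, of j l] il that by auto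
    then show ?thesis using that True by simp
  qed (use that in simp)
  show "d dvd col_op i l u w M $$ (j, i')"
    if "\<And>i j. k \<le> i \<Longrightarrow> k \<le> j \<Longrightarrow> i < r \<Longrightarrow> j < c \<Longrightarrow> d dvd M $$ (i, j)" "k \<le> j" "k \<le> i'" "j < r" "i' < c" for d i' j
    using that by (auto intro!: dvd_add dvd_mult)
qed (use k part_dims[OF M] in \<open>auto simp: col_op_index\<close>)

lemma part_swaprows:
  assumes M: "part r c k M" and k: "k < min r c" and il: "k \<le> i" "k \<le> l" "i < r" "l < r"
  shows "part r c k (swaprows i l M)"
proof (rule part_transfer[OF M])
  note [simp] = part_dims[OF M] il
  show "swaprows i l M $$ (i', j) \<in> C" if "k \<le> i'" "k \<le> j" "i' < r" "j < c" for i' j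
    using that part_entry[OF M] by auto
  show "swaprows i l M $$ (i', j) = M $$ (i', j)" if "i' < k \<or> j < k" "i' < r" "j < c" for i' j
  proof (cases "i' < k")
    case False
    then have "j < k" using that by auto
    then have "M $$ (i, j) = 0" "M $$ (l, j) = 0" "M $$ (i', j) = 0"
      using part_zero[OF M, of i j] part_zero[OF M, of l j] part_zero[OF M, of i' j] il that False by auto
    then show ?thesis using that by simp
  next
    case True
    then have "i' \<noteq> i" "i' \<noteq> l" using il(1,2) by linarith+
    then show ?thesis using that part_dims[OF M] by simp
  qed
  show "d dvd swaprows i l M $$ (i', j)"
    if "\<And>i j. k \<le> i \<Longrightarrow> k \<le> j \<Longrightarrow> i < r \<Longrightarrow> j < c \<Longrightarrow> d dvd M $$ (i, j)" "k \<le> i'" "k \<le> j" "i' < r" "j < c" for d i' j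
    using that by auto
qed (use k part_dims[OF M] in auto)

lemma part_swapcols:
  assumes M: "part r c k M" and k: "k < min r c" and il: "k \<le> i" "k \<le> l" "i < c" "l < c"
  shows "part r c k (swapcols i l M)"
proof (rule part_transfer[OF M])
  note [simp] = part_dims[OF M] il
  show "swapcols i l M $$ (j, i') \<in> C" if "k \<le> j" "k \<le> i'" "j < r" "i' < c" for i' j
    using that part_entry[OF M] by auto
  show "swapcols i l M $$ (j, i') = M $$ (j, i')" if "j < k \<or> i' < k" "j < r" "i' < c" for i' j
  proof (cases "i' < k")
    case False
    then have "j < k" using that by auto
    then have "M $$ (j, i) = 0" "M $$ (j, l) = 0" "M $$ (j, i') = 0"
      using part_zero[OF M, of j i] part_zero[OF M, of j l] part_zero[OF M, of j i'] il that False by auto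
    then show ?thesis using that by simp
  next
    case True
    then have "i' \<noteq> i" "i' \<noteq> l" using il(1,2) by linarith+
    then show ?thesis using that part_dims[OF M] by simp
  qed
  show "d dvd swapcols i l M $$ (j, i')"
    if "\<And>i j. k \<le> i \<Longrightarrow> k \<le> j \<Longrightarrow> i < r \<Longrightarrow> j < c \<Longrightarrow> d dvd M $$ (i, j)" "k \<le> j" "k \<le> i'" "j < r" "i' < c" for d i' j
    using that by auto
qed (use k part_dims[OF M] in auto)

text \<open>Double minimality replaces an algorithm. Among the reachable matrices with non-zero
  pivot one of least pivot size is taken, and among those one with fewest non-zero entries beside
  and below the pivot. A non-zero remainder could be swapped into the pivot position, against the
  first choice; a non-zero entry beside or below the pivot could be cleared, against the
  second.\<close>

lemma part_step:
  assumes M: "part r c k M" and k: "k < min r c"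
  shows "\<exists>M'. R M M' \<and> part r c (Suc k) M'"
proof (cases "\<exists>i j. k \<le> i \<and> k \<le> j \<and> i < r \<and> j < c \<and> M $$ (i, j) \<noteq> 0")
  case False
  have zero: "M $$ (i, j) = 0" if "i < r" "j < c" "k \<le> i" "k \<le> j" for i j
    using False that by blast
  have "part r c (Suc k) M" unfolding part_def
  proof (intro conjI allI impI)
    show "dim_row M = r" "dim_col M = c" by (rule part_dims[OF M])+
    fix i j assume ij: "i < r" "j < c"
    show "M $$ (i, j) \<in> C" by (rule part_entry[OF M ij])
    assume "i \<noteq> j \<and> (i < Suc k \<or> j < Suc k)"
    then show "M $$ (i, j) = 0" using part_zero[OF M ij] zero[OF ij] by (cases "i < k \<or> j < k") auto
  next
    fix h assume "h < Suc k"
    then show "M $$ (h, h) = 0 \<or> normal_entry (M $$ (h, h))"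
      using M zero[of k k] k unfolding part_def by (cases "h = k") auto
  next
    fix h i j assume h: "h < Suc k" and ij: "i < r" "j < c" "h \<le> i \<and> h \<le> j"
    show "M $$ (h, h) dvd M $$ (i, j)"
    proof (cases "h = k")
      case True
      then show ?thesis using zero[OF ij(1,2)] ij(3) by simp
    next
      case False
      then have "h < k" using h by simp
      then show ?thesis using M ij unfolding part_def by blast
    qed
  qed
  then show ?thesis using R_refl by blast
next
  case True
  have kr: "k < r" and kc: "k < c" using k by auto
  define Z where "Z = {X. R M X \<and> part r c k X \<and> X $$ (k, k) \<noteq> 0}"
  define cnt where "cnt X = card {i. k < i \<and> i < r \<and> X $$ (i, k) \<noteq> 0} + card {j. k < j \<and> j < c \<and> X $$ (k, j) \<noteq> 0}" for X :: "'a mat"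
  obtain i j where ij: "k \<le> i" "k \<le> j" "i < r" "j < c" "M $$ (i, j) \<noteq> 0" using True by blast
  have "swapcols k j (swaprows k i M) \<in> Z" unfolding Z_def
  proof (intro CollectI conjI)
    show "R M (swapcols k j (swaprows k i M))"
      by (rule R_trans[OF R_swaprows R_swapcols]) (use ij kr kc part_dims[OF M] in auto)
    show "part r c k (swapcols k j (swaprows k i M))"
      by (rule part_swapcols[OF part_swaprows[OF M k order_refl ij(1) kr ij(3)] k order_refl ij(2) kc ij(4)])
    show "swapcols k j (swaprows k i M) $$ (k, k) \<noteq> 0" using ij kr kc part_dims[OF M] by auto
  qed
  then have "\<exists>X. X \<in> Z" by blast
  from ex_has_least_nat[of "\<lambda>X. X \<in> Z" _ "\<lambda>X. \<nu> (X $$ (k, k))"] this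
  obtain X0 where X0: "X0 \<in> Z" "\<And>Y. Y \<in> Z \<Longrightarrow> \<nu> (X0 $$ (k, k)) \<le> \<nu> (Y $$ (k, k))" by blast
  define Z' where "Z' = {X \<in> Z. \<nu> (X $$ (k, k)) = \<nu> (X0 $$ (k, k))}"
  have "X0 \<in> Z'" using X0(1) by (simp add: Z'_def)
  then have "\<exists>X. X \<in> Z'" by blast
  from ex_has_least_nat[of "\<lambda>X. X \<in> Z'" _ cnt] this
  obtain X where X: "X \<in> Z'" "\<And>Y. Y \<in> Z' \<Longrightarrow> cnt X \<le> cnt Y" by blast
  have nless: "\<not> \<nu> (Y $$ (k, k)) < \<nu> (X0 $$ (k, k))" if "Y \<in> Z" for Y using X0(2)[OF that] by simp
  have row: "\<exists>u\<in>U. \<exists>w\<in>C. u * Y $$ (i, k) + w * Y $$ (k, k) = 0 \<and> row_op i k u w Y \<in> Z'"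
    if Y: "Y \<in> Z'" and i: "k < i" "i < r" for Y i
  proof -
    have YZ: "R M Y" "part r c k Y" "Y $$ (k, k) \<noteq> 0" "\<nu> (Y $$ (k, k)) = \<nu> (X0 $$ (k, k))"
      using Y unfolding Z'_def Z_def by auto
    note [simp] = part_dims[OF YZ(2)]
    obtain u w where uw: "u \<in> U" "w \<in> C" "u * Y $$ (i, k) + w * Y $$ (k, k) = 0 \<or>
        \<nu> (u * Y $$ (i, k) + w * Y $$ (k, k)) < \<nu> (Y $$ (k, k))"
      using euclid[of "Y $$ (k, k)" "Y $$ (i, k)"] part_entry[OF YZ(2)] YZ(3) i kr kc by blast
    let ?Y = "row_op i k u w Y"
    have R1: "R M ?Y" by (rule R_trans[OF YZ(1) R_row_op]) (use uw i kr in auto)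
    have P1: "part r c k ?Y" by (rule part_row_op[OF YZ(2) k]) (use uw U_C i kr in auto)
    have kk: "?Y $$ (k, k) = Y $$ (k, k)" using i kr kc by (simp add: row_op_index)
    have ik: "?Y $$ (i, k) = u * Y $$ (i, k) + w * Y $$ (k, k)" using i kr kc by (simp add: row_op_index)
    have "u * Y $$ (i, k) + w * Y $$ (k, k) = 0"
    proof (rule ccontr)
      assume nz: "u * Y $$ (i, k) + w * Y $$ (k, k) \<noteq> 0"
      have "swaprows k i ?Y \<in> Z" unfolding Z_def
      proof (intro CollectI conjI)
        show "R M (swaprows k i ?Y)" by (rule R_trans[OF R1 R_swaprows]) (use i kr in \<open>auto simp: row_op_index\<close>)
        show "part r c k (swaprows k i ?Y)" by (rule part_swaprows[OF P1 k]) (use i kr in auto)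
        show "swaprows k i ?Y $$ (k, k) \<noteq> 0" using nz ik i kr kc by (simp add: row_op_index)
      qed
      from nless[OF this] show False using uw(3) nz ik i kr kc YZ(4) by (simp add: row_op_index)
    qed
    moreover have "?Y \<in> Z'" unfolding Z'_def Z_def using R1 P1 kk YZ by simp
    ultimately show ?thesis using uw by blast
  qed
  have col: "\<exists>u\<in>U. \<exists>w\<in>C. u * Y $$ (k, i) + w * Y $$ (k, k) = 0 \<and> col_op i k u w Y \<in> Z'"
    if Y: "Y \<in> Z'" and i: "k < i" "i < c" for Y i
  proof -
    have YZ: "R M Y" "part r c k Y" "Y $$ (k, k) \<noteq> 0" "\<nu> (Y $$ (k, k)) = \<nu> (X0 $$ (k, k))"
      using Y unfolding Z'_def Z_def by auto
    note [simp] = part_dims[OF YZ(2)]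
    obtain u w where uw: "u \<in> U" "w \<in> C" "u * Y $$ (k, i) + w * Y $$ (k, k) = 0 \<or>
        \<nu> (u * Y $$ (k, i) + w * Y $$ (k, k)) < \<nu> (Y $$ (k, k))"
      using euclid[of "Y $$ (k, k)" "Y $$ (k, i)"] part_entry[OF YZ(2)] YZ(3) i kr kc by blast
    let ?Y = "col_op i k u w Y"
    have R1: "R M ?Y" by (rule R_trans[OF YZ(1) R_col_op]) (use uw i kc in auto)
    have P1: "part r c k ?Y" by (rule part_col_op[OF YZ(2) k]) (use uw U_C i kc in auto)
    have kk: "?Y $$ (k, k) = Y $$ (k, k)" using i kr kc by (simp add: col_op_index)
    have ik: "?Y $$ (k, i) = u * Y $$ (k, i) + w * Y $$ (k, k)" using i kr kc by (simp add: col_op_index)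
    have "u * Y $$ (k, i) + w * Y $$ (k, k) = 0"
    proof (rule ccontr)
      assume nz: "u * Y $$ (k, i) + w * Y $$ (k, k) \<noteq> 0"
      have "swapcols k i ?Y \<in> Z" unfolding Z_def
      proof (intro CollectI conjI)
        show "R M (swapcols k i ?Y)" by (rule R_trans[OF R1 R_swapcols]) (use i kc in \<open>auto simp: col_op_index\<close>)
        show "part r c k (swapcols k i ?Y)" by (rule part_swapcols[OF P1 k]) (use i kc in auto)
        show "swapcols k i ?Y $$ (k, k) \<noteq> 0" using nz ik i kr kc by (simp add: col_op_index)
      qed
      from nless[OF this] show False using uw(3) nz ik i kr kc YZ(4) by (simp add: col_op_index)
    qed
    moreover have "?Y \<in> Z'" unfolding Z'_def Z_def using R1 P1 kk YZ by simp
    ultimately show ?thesis using uw by blast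
  qed
  have XZ: "R M X" "part r c k X" "X $$ (k, k) \<noteq> 0" using X(1) unfolding Z'_def Z_def by auto
  note [simp] = part_dims[OF XZ(2)]
  have col_zero: "X $$ (i, k) = 0" if i: "k < i" "i < r" for i
  proof (rule ccontr)
    assume nz: "X $$ (i, k) \<noteq> 0"
    obtain u w where uw: "u * X $$ (i, k) + w * X $$ (k, k) = 0" "row_op i k u w X \<in> Z'"
      using row[OF X(1) i] by blast
    let ?Y = "row_op i k u w X"
    have "{i'. k < i' \<and> i' < r \<and> ?Y $$ (i', k) \<noteq> 0} = {i'. k < i' \<and> i' < r \<and> X $$ (i', k) \<noteq> 0} - {i}"
      using i kr kc uw(1) by (auto simp: row_op_index split: if_splits)
    moreover have "card ({i'. k < i' \<and> i' < r \<and> X $$ (i', k) \<noteq> 0} - {i}) < card {i'. k < i' \<and> i' < r \<and> X $$ (i', k) \<noteq> 0}"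
      by (rule card_Diff1_less) (use i nz in auto)
    moreover have "{j. k < j \<and> j < c \<and> ?Y $$ (k, j) \<noteq> 0} = {j. k < j \<and> j < c \<and> X $$ (k, j) \<noteq> 0}"
      using i kr by (auto simp: row_op_index)
    ultimately have "cnt ?Y < cnt X" unfolding cnt_def by simp
    then show False using X(2)[OF uw(2)] by simp
  qed
  have row_zero: "X $$ (k, i) = 0" if i: "k < i" "i < c" for i
  proof (rule ccontr)
    assume nz: "X $$ (k, i) \<noteq> 0"
    obtain u w where uw: "u * X $$ (k, i) + w * X $$ (k, k) = 0" "col_op i k u w X \<in> Z'"
      using col[OF X(1) i] by blast
    let ?Y = "col_op i k u w X"
    have "{i'. k < i' \<and> i' < c \<and> ?Y $$ (k, i') \<noteq> 0} = {i'. k < i' \<and> i' < c \<and> X $$ (k, i') \<noteq> 0} - {i}"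
      using i kr kc uw(1) by (auto simp: col_op_index split: if_splits)
    moreover have "card ({i'. k < i' \<and> i' < c \<and> X $$ (k, i') \<noteq> 0} - {i}) < card {i'. k < i' \<and> i' < c \<and> X $$ (k, i') \<noteq> 0}"
      by (rule card_Diff1_less) (use i nz in auto)
    moreover have "{j. k < j \<and> j < r \<and> ?Y $$ (j, k) \<noteq> 0} = {j. k < j \<and> j < r \<and> X $$ (j, k) \<noteq> 0}"
      using i kc by (auto simp: col_op_index)
    ultimately have "cnt ?Y < cnt X" unfolding cnt_def by simp
    then show False using X(2)[OF uw(2)] by simp
  qed
  \<comment> \<open>Adding row \<open>i\<close> to row \<open>k\<close> leaves the pivot alone,
    because its column is already cleared, and brings the inner entry into the pivot row. The new
    matrix is still of least pivot size, so the entry reduces to 0.\<close>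
  have inner: "\<exists>u\<in>U. \<exists>w\<in>C. u * X $$ (i, j) + w * X $$ (k, k) = 0" if ij: "k < i" "k < j" "i < r" "j < c" for i j
  proof -
    let ?Y = "row_op k i 1 1 X"
    have kk: "?Y $$ (k, k) = X $$ (k, k)" and kj: "?Y $$ (k, j) = X $$ (i, j)"
      using ij kr kc col_zero row_zero by (simp_all add: row_op_index)
    have "R M ?Y" by (rule R_trans[OF XZ(1) R_row_op]) (use ij kr one_U one_C in auto)
    moreover have "part r c k ?Y" by (rule part_row_op[OF XZ(2) k]) (use one_C ij kr in auto)
    ultimately have "?Y \<in> Z'" using X(1) XZ kk unfolding Z'_def Z_def by simp
    from col[OF this ij(2,4)] show ?thesis unfolding kk kj by blast
  qed
  have aC: "X $$ (k, k) \<in> C" using part_entry[OF XZ(2)] kr kc by simp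
  obtain x where x: "x \<in> C" "normal_entry x"
    and x1: "\<forall>u\<in>U. \<forall>c\<in>C. \<forall>y\<in>C. u * y + c * X $$ (k, k) = 0 \<longrightarrow> x dvd y"
    and x2: "\<forall>d. (d = 0 \<or> normal_entry d) \<and> d dvd X $$ (k, k) \<longrightarrow> d dvd x"
    and x3: "\<forall>M k'. k' < dim_row M \<and> k' < dim_col M \<and> M $$ (k', k') = X $$ (k, k) \<and> (\<forall>j<dim_col M. j \<noteq> k' \<longrightarrow> M $$ (k', j) = 0) \<longrightarrow>
          R M (mat (dim_row M) (dim_col M) (\<lambda>(i, j). if i = k' \<and> j = k' then x else M $$ (i, j)))"
    using normalise[OF aC XZ(3)] by (elim bexE conjE) (rule that; assumption)
  have x_dvd: "x dvd y" if "u \<in> U" "w \<in> C" "y \<in> C" "u * y + w * X $$ (k, k) = 0" for u w y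
    using x1 that by blast
  have x_div: "d dvd x" if "d = 0 \<or> normal_entry d" "d dvd X $$ (k, k)" for d
    using x2 that by blast
  define Y where "Y = mat r c (\<lambda>(i, j). if i = k \<and> j = k then x else X $$ (i, j))"
  have Yd: "dim_row Y = r" "dim_col Y = c" by (simp_all add: Y_def)
  have Yi: "Y $$ (i, j) = (if i = k \<and> j = k then x else X $$ (i, j))" if "i < r" "j < c" for i j
    using that by (simp add: Y_def)
  have "X $$ (k, j) = 0" if "j < c" "j \<noteq> k" for j
    using row_zero[of j] part_zero[OF XZ(2), of k j] that kr by (cases "k < j") auto
  then have "R X Y" using x3[rule_format, of k X] kr kc unfolding Y_def by simp
  then have RY: "R M Y" using XZ(1) R_trans by blast
  have PY: "part r c k Y"
  proof (rule part_transfer[OF XZ(2)])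
    show "Y $$ (i, j) \<in> C" if "k \<le> i" "k \<le> j" "i < r" "j < c" for i j
      using Yi[OF that(3,4)] x(1) part_entry[OF XZ(2) that(3,4)] by simp
    show "Y $$ (i, j) = X $$ (i, j)" if "i < k \<or> j < k" "i < r" "j < c" for i j
      using Yi[OF that(2,3)] that by auto
    show "d dvd Y $$ (i, j)"
      if dv: "\<And>i j. k \<le> i \<Longrightarrow> k \<le> j \<Longrightarrow> i < r \<Longrightarrow> j < c \<Longrightarrow> d dvd X $$ (i, j)" and i: "k \<le> i" "k \<le> j" "i < r" "j < c" and d: "d = 0 \<or> normal_entry d" for d i j
      using Yi[OF i(3,4)] dv[OF i] x_div[OF d] dv[of k k] kr kc by auto
  qed (use k Yd in auto)
  have sub: "Y $$ (i, j) = 0" if "i < r" "j < c" "i \<noteq> j" "i < Suc k \<or> j < Suc k" for i j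
  proof (cases "i < k \<or> j < k")
    case True
    then show ?thesis using part_zero[OF PY] that by blast
  next
    case False
    then have "i = k \<and> k < j \<or> j = k \<and> k < i" using that by auto
    then show ?thesis using Yi[OF that(1,2)] col_zero row_zero that by auto
  qed
  have dvk: "x dvd Y $$ (i, j)" if "i < r" "j < c" "k \<le> i" "k \<le> j" for i j
  proof (cases "i = j \<or> (i \<noteq> k \<and> j \<noteq> k)")
    case True
    show ?thesis
    proof (cases "i = k \<and> j = k")
      case True then show ?thesis using Yi[OF that(1,2)] by simp
    next
      case False
      then have "k < i" "k < j" using True that by auto
      from inner[OF this \<open>i < r\<close> \<open>j < c\<close>]
      obtain u w where "u \<in> U" "w \<in> C" "u * X $$ (i, j) + w * X $$ (k, k) = 0" by blast
      then have "x dvd X $$ (i, j)" using x_dvd part_entry[OF XZ(2) that(1,2)] by blast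
      then show ?thesis using Yi[OF that(1,2)] False by auto
    qed
  next
    case False
    then have "Y $$ (i, j) = 0" using sub that by auto
    then show ?thesis by simp
  qed
  have Ykk: "Y $$ (k, k) = x" using Yi kr kc by simp
  have "part r c (Suc k) Y" unfolding part_def
  proof (intro conjI allI impI)
    fix h assume "h < Suc k"
    then show "Y $$ (h, h) = 0 \<or> normal_entry (Y $$ (h, h))"
      using PY Ykk x(2) unfolding part_def by (cases "h = k") auto
  next
    fix h i j assume h: "h < Suc k" and i: "i < r" "j < c" "h \<le> i \<and> h \<le> j"
    show "Y $$ (h, h) dvd Y $$ (i, j)"
    proof (cases "h = k")
      case True then show ?thesis using dvk i Ykk by simp
    next
      case False then show ?thesis using PY h i unfolding part_def by auto
    qed
  qed (use Yd sub part_entry[OF PY] in auto)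
  then show ?thesis using RY by blast
qed

lemma smith_exists:
  assumes "\<And>i j. i < dim_row M \<Longrightarrow> j < dim_col M \<Longrightarrow> M $$ (i, j) \<in> C"
  shows "\<exists>D. R M D \<and> dim_row D = dim_row M \<and> dim_col D = dim_col M \<and> smith_shape D \<and> 
    (\<forall>x \<in> set (diagonal_entries D). x = 0 \<or> normal_entry x)"
proof -
  let ?r = "dim_row M" and ?c = "dim_col M"
  have "\<exists>D. R M D \<and> part ?r ?c k D" if "k \<le> min ?r ?c" for k
    using that
  proof (induction k)
    case 0
    have "part ?r ?c 0 M" using assms unfolding part_def by auto
    then show ?case using R_refl by blast
  next
    case (Suc k)
    then obtain D where D: "R M D" "part ?r ?c k D" by auto
    obtain D' where "R D D'" "part ?r ?c (Suc k) D'" using part_step[OF D(2)] Suc by auto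
    then show ?case using R_trans D by blast
  qed
  then obtain D where D: "R M D" "part ?r ?c (min ?r ?c) D" by blast
  note d = part_dims[OF D(2)]
  have "smith_shape D" unfolding smith_shape_def
  proof (intro conjI allI impI)
    show "diagonal_mat D" unfolding diagonal_mat_def
    proof (intro allI impI)
      fix i j assume ij: "i < dim_row D" "j < dim_col D" "i \<noteq> j"
      then have "i < min ?r ?c \<or> j < min ?r ?c" using d by auto
      then show "D $$ (i, j) = 0" using part_zero[OF D(2), of i j] ij unfolding d by blast
    qed
    fix i assume "Suc i < min (dim_row D) (dim_col D)"
    then show "D $$ (i, i) dvd D $$ (Suc i, Suc i)" using D(2) unfolding part_def by auto
  qed
  moreover have "\<forall>x \<in> set (diagonal_entries D). x = 0 \<or> normal_entry x"
    using D(2) d unfolding diagonal_entries_def part_def by auto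
  ultimately show ?thesis using D(1) d by blast
qed

end

section \<open>Existence of integer Smith normal forms\<close>

definition int_equivalent :: "int mat \<Rightarrow> int mat \<Rightarrow> bool" where
  "int_equivalent M M' \<longleftrightarrow> (\<exists>U V. U \<in> carrier_mat (dim_row M) (dim_row M) \<and> invertible_mat U \<and>
     V \<in> carrier_mat (dim_col M) (dim_col M) \<and> invertible_mat V \<and> M' = U * M * V)"

lemma invertible_matI:
  assumes "U \<in> carrier_mat n n" "U' \<in> carrier_mat n n" "U * U' = 1\<^sub>m n" "U' * U = 1\<^sub>m n"
  shows "invertible_mat U"
  using assms unfolding invertible_mat_def inverts_mat_def by auto

lemma invertible_mat_one: "invertible_mat (1\<^sub>m n)"
  by (rule invertible_matI[of _ n "1\<^sub>m n"]) auto

lemma invertible_mat_mult: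
  fixes U W :: "'a::comm_ring_1 mat"
  assumes "invertible_mat U" "U \<in> carrier_mat n n" "invertible_mat W" "W \<in> carrier_mat n n"
  shows "invertible_mat (U * W)"
proof -
  obtain U' where U': "U' \<in> carrier_mat n n" "U * U' = 1\<^sub>m n" "U' * U = 1\<^sub>m n" using invertible_matE[OF assms(1,2)] .
  obtain W' where W': "W' \<in> carrier_mat n n" "W * W' = 1\<^sub>m n" "W' * W = 1\<^sub>m n" using invertible_matE[OF assms(3,4)] .
  have 1: "(U * W) * (W' * U') = 1\<^sub>m n"
  proof -
    have "(U * W) * (W' * U') = U * (W * (W' * U'))" by (rule assoc_mult_mat[OF assms(2,4)]) (use U' W' in auto)
    also have "W * (W' * U') = (W * W') * U'" by (rule assoc_mult_mat[symmetric, OF assms(4) W'(1) U'(1)])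
    also have "\<dots> = U'" using W' U' by simp
    finally show ?thesis using U' by simp
  qed
  have 2: "(W' * U') * (U * W) = 1\<^sub>m n"
  proof -
    have "(W' * U') * (U * W) = W' * (U' * (U * W))" by (rule assoc_mult_mat[OF W'(1) U'(1)]) (use assms in auto)
    also have "U' * (U * W) = (U' * U) * W" by (rule assoc_mult_mat[symmetric, OF U'(1) assms(2,4)])
    also have "\<dots> = W" using U' assms by simp
    finally show ?thesis using W' by simp
  qed
  show ?thesis by (rule invertible_matI[OF _ _ 1 2]) (use assms U' W' in auto)
qed

lemma int_equivalent_row:
  assumes "U \<in> carrier_mat (dim_row M) (dim_row M)" "invertible_mat U"
  shows "int_equivalent M (U * M)"
proof -
  have "U * M = U * M * 1\<^sub>m (dim_col M)" using assms by simp
  then show ?thesis unfolding int_equivalent_def using assms invertible_mat_one one_carrier_mat by blast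
qed

lemma int_equivalent_col:
  assumes "V \<in> carrier_mat (dim_col M) (dim_col M)" "invertible_mat V"
  shows "int_equivalent M (M * V)"
proof -
  have "M * V = 1\<^sub>m (dim_row M) * M * V" using assms by simp
  then show ?thesis unfolding int_equivalent_def using assms invertible_mat_one one_carrier_mat by blast
qed

lemma int_equivalent_trans:
  assumes "int_equivalent M M'" "int_equivalent M' M''"
  shows "int_equivalent M M''"
proof -
  obtain U V where 1: "U \<in> carrier_mat (dim_row M) (dim_row M)" "invertible_mat U" "V \<in> carrier_mat (dim_col M) (dim_col M)" "invertible_mat V" "M' = U * M * V"
    using assms(1) unfolding int_equivalent_def by blast
  have d: "dim_row M' = dim_row M" "dim_col M' = dim_col M"
    unfolding 1(5) by (simp_all add: carrier_matD[OF 1(1)] carrier_matD[OF 1(3)])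
  obtain U' V' where 2: "U' \<in> carrier_mat (dim_row M) (dim_row M)" "invertible_mat U'" "V' \<in> carrier_mat (dim_col M) (dim_col M)" "invertible_mat V'" "M'' = U' * M' * V'"
    using assms(2) unfolding int_equivalent_def d by blast
  have cM: "M \<in> carrier_mat (dim_row M) (dim_col M)" by simp
  have "M'' = U' * (U * M * V) * V'" unfolding 2(5) 1(5) ..
  also have "U * M * V = U * (M * V)" using assoc_mult_mat[OF 1(1) cM 1(3)] .
  also have "U' * (U * (M * V)) = (U' * U) * (M * V)"
    by (rule assoc_mult_mat[symmetric, OF 2(1) 1(1) mult_carrier_mat[OF cM 1(3)]])
  also have "(U' * U) * (M * V) * V' = (U' * U) * ((M * V) * V')"
    by (rule assoc_mult_mat[OF mult_carrier_mat[OF 2(1) 1(1)] mult_carrier_mat[OF cM 1(3)] 2(3)])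
  also have "(M * V) * V' = M * (V * V')" by (rule assoc_mult_mat[OF cM 1(3) 2(3)])
  also have "(U' * U) * (M * (V * V')) = (U' * U) * M * (V * V')"
    by (rule assoc_mult_mat[symmetric, OF mult_carrier_mat[OF 2(1) 1(1)] cM mult_carrier_mat[OF 1(3) 2(3)]])
  finally have eq: "M'' = U' * U * M * (V * V')" .
  show ?thesis unfolding int_equivalent_def
    by (rule exI[of _ "U' * U"], rule exI[of _ "V * V'"], intro conjI)
      (rule mult_carrier_mat[OF 2(1) 1(1)], rule invertible_mat_mult[OF 2(2,1) 1(2,1)],
       rule mult_carrier_mat[OF 1(3) 2(3)], rule invertible_mat_mult[OF 1(4,3) 2(4,3)], rule eq)
qed

lemma invertible_swaprows_mat: "k < n \<Longrightarrow> l < n \<Longrightarrow> invertible_mat (swaprows_mat n k l :: int mat)"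
  by (rule invertible_matI[of _ n "swaprows_mat n k l"]) (auto simp: swaprows_mat_inv)

lemma invertible_addrow_mat:
  "k < n \<Longrightarrow> l < n \<Longrightarrow> k \<noteq> l \<Longrightarrow> invertible_mat (addrow_mat n a k l :: int mat)"
  using addrow_mat_inv[of k n l a] addrow_mat_inv[of k n l "- a"]
  by (intro invertible_matI[of _ n "addrow_mat n (- a) k l"]) auto

lemma invertible_multrow_mat:
  "k < n \<Longrightarrow> u = 1 \<or> u = - 1 \<Longrightarrow> invertible_mat (multrow_mat n k u :: int mat)"
proof -
  assume k: "k < n" and u: "u = 1 \<or> u = - 1"
  have "multrow_mat n k u * multrow_mat n k u = multrow k u (multrow_mat n k u)"
    by (rule multrow_mat[symmetric, of _ n n]) simp
  also have "\<dots> = 1\<^sub>m n" by (rule eq_matI) (use u in auto)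
  finally show ?thesis by (intro invertible_matI[of _ n "multrow_mat n k u"]) auto
qed

interpretation int_smith: smith_reduction int_equivalent UNIV "{1, - 1}" "\<lambda>x. nat \<bar>x\<bar>" "\<lambda>x. 0 < x"
proof
  fix M M' M'' :: "int mat"
  show "int_equivalent M M" using int_equivalent_row[OF one_carrier_mat invertible_mat_one, of M] by simp
  show "int_equivalent M M' \<Longrightarrow> int_equivalent M' M'' \<Longrightarrow> int_equivalent M M''" by (rule int_equivalent_trans)
next
  fix M :: "int mat" and k l
  assume "k < dim_row M" "l < dim_row M"
  then show "int_equivalent M (swaprows k l M)"
    using int_equivalent_row[OF swaprows_mat_carrier invertible_swaprows_mat] swaprows_mat[of M "dim_row M" "dim_col M" k l] by simp
next
  fix M :: "int mat" and k l
  assume "k < dim_col M" "l < dim_col M"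
  then show "int_equivalent M (swapcols k l M)"
    using int_equivalent_col[OF swaprows_mat_carrier invertible_swaprows_mat] swapcols_mat[of M "dim_row M" "dim_col M" k l] by simp
next
  fix M :: "int mat" and k l c
  assume "k < dim_row M" "l < dim_row M" "k \<noteq> l"
  then show "int_equivalent M (addrow c k l M)"
    using int_equivalent_row[OF addrow_mat_carrier invertible_addrow_mat] addrow_mat[of M "dim_row M" "dim_col M" l c k] by simp
next
  fix M :: "int mat" and k l c
  assume "k < dim_col M" "l < dim_col M" "k \<noteq> l"
  then show "int_equivalent M (addcol c k l M)"
    using int_equivalent_col[OF addrow_mat_carrier invertible_addrow_mat] addcol_mat[of M "dim_row M" "dim_col M" l c k] by simp
next
  fix M :: "int mat" and k and u :: int
  assume "k < dim_row M" "u \<in> {1, - 1}"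
  then show "int_equivalent M (multrow k u M)"
    using int_equivalent_row[OF multrow_mat_carrier invertible_multrow_mat] multrow_mat[of M "dim_row M" "dim_col M" k u] by simp
next
  fix M :: "int mat" and k and u :: int
  assume "k < dim_col M" "u \<in> {1, - 1}"
  then show "int_equivalent M (multcol k u M)"
    using int_equivalent_col[OF multrow_mat_carrier invertible_multrow_mat] multcol_mat[of M "dim_row M" "dim_col M" k u] by simp
next
  fix x y :: int assume "x \<noteq> 0"
  then have "nat \<bar>1 * y + (- (y div x)) * x\<bar> < nat \<bar>x\<bar>"
    using abs_mod_less[of x y] by (simp add: minus_div_mult_eq_mod)
  then show "\<exists>u\<in>{1, - 1}. \<exists>c\<in>UNIV. u * y + c * x = 0 \<or> nat \<bar>u * y + c * x\<bar> < nat \<bar>x\<bar>" by blast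
next
  fix x :: int assume x: "x \<noteq> 0"
  have dvd: "\<bar>x\<bar> dvd y" if "u \<in> {1, - 1}" "u * y + c * x = 0" for u c y
  proof -
    have "u * y = - c * x" using that by simp
    then have "x dvd u * y" by simp
    then show ?thesis using that by auto
  qed
  have red: "int_equivalent M (mat (dim_row M) (dim_col M) (\<lambda>(i, j). if i = k \<and> j = k then \<bar>x\<bar> else M $$ (i, j)))"
    if M: "k < dim_row M" "k < dim_col M" "M $$ (k, k) = x" "\<forall>j<dim_col M. j \<noteq> k \<longrightarrow> M $$ (k, j) = 0" for M k
  proof -
    \<comment> \<open>The rest of the pivot row is 0, so multiplying the row by the sign of the
      pivot changes the pivot alone.\<close>
    have "mat (dim_row M) (dim_col M) (\<lambda>(i, j). if i = k \<and> j = k then \<bar>x\<bar> else M $$ (i, j)) = multrow k (sgn x) M"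
      by (rule eq_matI) (use M in \<open>auto simp: abs_sgn mult.commute\<close>)
    also have "\<dots> = multrow_mat (dim_row M) k (sgn x) * M" by (rule multrow_mat[of M "dim_row M" "dim_col M"]) simp
    finally show ?thesis
      using int_equivalent_row[OF multrow_mat_carrier invertible_multrow_mat[OF M(1)], of "sgn x"] x by (auto simp: sgn_if)
  qed
  show "\<exists>x'\<in>UNIV. 0 < x' \<and> (\<forall>u\<in>{1, - 1}. \<forall>c\<in>UNIV. \<forall>y\<in>UNIV. u * y + c * x = 0 \<longrightarrow> x' dvd y) \<and>
       (\<forall>d. (d = 0 \<or> 0 < d) \<and> d dvd x \<longrightarrow> d dvd x') \<and>
       (\<forall>M k. k < dim_row M \<and> k < dim_col M \<and> M $$ (k, k) = x \<and> (\<forall>j<dim_col M. j \<noteq> k \<longrightarrow> M $$ (k, j) = 0) \<longrightarrow>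
          int_equivalent M (mat (dim_row M) (dim_col M) (\<lambda>(i, j). if i = k \<and> j = k then x' else M $$ (i, j))))"
    by (rule bexI[of _ "\<bar>x\<bar>"]) (use x dvd red in auto)
qed auto

lemma int_smith_normal_form_exists: "\<exists>D. int_smith_normal_form M D"
proof -
  obtain D where "int_equivalent M D" "smith_shape D" "\<forall>x \<in> set (diagonal_entries D). x = 0 \<or> 0 < x"
    using int_smith.smith_exists[of M, OF UNIV_I] by blast
  then show ?thesis unfolding int_smith_normal_form_def int_equivalent_def by (intro exI[of _ D]) auto
qed

section \<open>Integer polynomials\<close>

definition monomial_value :: "(nat \<Rightarrow> int) \<Rightarrow> (nat \<Rightarrow>\<^sub>0 nat) \<Rightarrow> int" where
  "monomial_value \<rho> \<mu> = (\<Prod>v \<in> Poly_Mapping.keys \<mu>. \<rho> v ^ Poly_Mapping.lookup \<mu> v)"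

lemma monomial_value_superset:
  assumes "finite B" "Poly_Mapping.keys \<mu> \<subseteq> B"
  shows "monomial_value \<rho> \<mu> = (\<Prod>v \<in> B. \<rho> v ^ Poly_Mapping.lookup \<mu> v)"
  unfolding monomial_value_def using assms
  by (intro prod.mono_neutral_left) (auto simp: in_keys_iff)

lemma monomial_value_add: "monomial_value \<rho> (\<mu> + \<nu>) = monomial_value \<rho> \<mu> * monomial_value \<rho> \<nu>"
proof -
  let ?B = "Poly_Mapping.keys \<mu> \<union> Poly_Mapping.keys \<nu>"
  have "monomial_value \<rho> (\<mu> + \<nu>) = (\<Prod>v \<in> ?B. \<rho> v ^ Poly_Mapping.lookup (\<mu> + \<nu>) v)"
    by (rule monomial_value_superset) (use keys_add[of \<mu> \<nu>] in auto)
  also have "\<dots> = (\<Prod>v \<in> ?B. \<rho> v ^ Poly_Mapping.lookup \<mu> v) * (\<Prod>v \<in> ?B. \<rho> v ^ Poly_Mapping.lookup \<nu> v)"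
    by (simp add: lookup_add power_add prod.distrib)
  finally show ?thesis by (simp add: monomial_value_superset[of ?B])
qed

text \<open>Supports shrink by cancellation; a common finite superset makes the evaluations of
  several polynomials comparable term by term.\<close>

lemma mpoly_eval_superset:
  assumes "finite B" "Poly_Mapping.keys f \<subseteq> B"
  shows "mpoly_eval \<rho> f = (\<Sum>\<mu> \<in> B. Poly_Mapping.lookup f \<mu> * monomial_value \<rho> \<mu>)"
  unfolding mpoly_eval_def monomial_value_def[symmetric] using assms
  by (intro sum.mono_neutral_left) (auto simp: in_keys_iff)

lemma mpoly_eval_add: "mpoly_eval \<rho> (f + g) = mpoly_eval \<rho> f + mpoly_eval \<rho> g"
proof -
  let ?B = "Poly_Mapping.keys f \<union> Poly_Mapping.keys g"
  have "mpoly_eval \<rho> (f + g) = (\<Sum>\<mu> \<in> ?B. Poly_Mapping.lookup (f + g) \<mu> * monomial_value \<rho> \<mu>)"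
    by (rule mpoly_eval_superset) (use keys_add[of f g] in auto)
  also have "\<dots> = (\<Sum>\<mu> \<in> ?B. Poly_Mapping.lookup f \<mu> * monomial_value \<rho> \<mu>) + (\<Sum>\<mu> \<in> ?B. Poly_Mapping.lookup g \<mu> * monomial_value \<rho> \<mu>)"
    by (simp add: lookup_add distrib_right sum.distrib)
  finally show ?thesis by (simp add: mpoly_eval_superset[of ?B])
qed

lemma mpoly_eval_zero: "mpoly_eval \<rho> 0 = 0"
  by (simp add: mpoly_eval_def)

lemma mpoly_eval_single: "mpoly_eval \<rho> (Poly_Mapping.single \<mu> c) = c * monomial_value \<rho> \<mu>"
  by (subst mpoly_eval_superset[of "{\<mu>}"]) auto

lemma mpoly_eval_sum: "mpoly_eval \<rho> (sum f I) = (\<Sum>i\<in>I. mpoly_eval \<rho> (f i))"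
  by (induction I rule: infinite_finite_induct) (simp_all add: mpoly_eval_add mpoly_eval_zero)

lemma poly_mapping_eq_sum_single:
  fixes f :: "'a \<Rightarrow>\<^sub>0 'b::comm_monoid_add"
  shows "f = (\<Sum>\<mu> \<in> Poly_Mapping.keys f. Poly_Mapping.single \<mu> (Poly_Mapping.lookup f \<mu>))"
proof (rule poly_mapping_eqI)
  fix k
  have "Poly_Mapping.lookup (\<Sum>\<mu> \<in> Poly_Mapping.keys f. Poly_Mapping.single \<mu> (Poly_Mapping.lookup f \<mu>)) k
    = (\<Sum>\<mu> \<in> Poly_Mapping.keys f. if \<mu> = k then Poly_Mapping.lookup f k else 0)"
    unfolding lookup_sum by (rule sum.cong) (auto simp: lookup_single when_def)
  then show "Poly_Mapping.lookup f k =
    Poly_Mapping.lookup (\<Sum>\<mu> \<in> Poly_Mapping.keys f. Poly_Mapping.single \<mu> (Poly_Mapping.lookup f \<mu>)) k"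
    by (simp add: in_keys_iff)
qed

lemma mpoly_eval_mult: "mpoly_eval \<rho> (f * g) = mpoly_eval \<rho> f * mpoly_eval \<rho> g"
proof -
  have "f * g = (\<Sum>\<mu> \<in> Poly_Mapping.keys f. \<Sum>\<nu> \<in> Poly_Mapping.keys g.
    Poly_Mapping.single (\<mu> + \<nu>) (Poly_Mapping.lookup f \<mu> * Poly_Mapping.lookup g \<nu>))"
    by (subst (1) poly_mapping_eq_sum_single[of f], subst (1) poly_mapping_eq_sum_single[of g])
      (simp add: sum_product mult_single)
  then have "mpoly_eval \<rho> (f * g) = (\<Sum>\<mu> \<in> Poly_Mapping.keys f. \<Sum>\<nu> \<in> Poly_Mapping.keys g.
    (Poly_Mapping.lookup f \<mu> * monomial_value \<rho> \<mu>) * (Poly_Mapping.lookup g \<nu> * monomial_value \<rho> \<nu>))"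
    by (simp add: mpoly_eval_sum mpoly_eval_single monomial_value_add mult_ac)
  then show ?thesis by (simp add: sum_product mpoly_eval_superset[of "Poly_Mapping.keys f" f] mpoly_eval_superset[of "Poly_Mapping.keys g" g])
qed

lemma mpoly_eval_one: "mpoly_eval \<rho> 1 = 1"
  using mpoly_eval_single[of \<rho> 0 1] by (simp add: monomial_value_def)

lemma comm_ring_hom_mpoly_eval: "comm_ring_hom (mpoly_eval \<rho>)"
  by unfold_locales (simp_all add: mpoly_eval_add mpoly_eval_mult mpoly_eval_one mpoly_eval_zero)

lemma mpoly_eval_uminus: "mpoly_eval \<rho> (- f) = - mpoly_eval \<rho> f"
  using mpoly_eval_add[of \<rho> f "- f"] by (simp add: mpoly_eval_zero)

lemma mpoly_eval_diff: "mpoly_eval \<rho> (f - g) = mpoly_eval \<rho> f - mpoly_eval \<rho> g"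
  using mpoly_eval_add[of \<rho> f "- g"] by (simp add: mpoly_eval_uminus)

lemma S_ring_zero: "0 \<in> S_ring m" and S_ring_one: "1 \<in> S_ring m"
  by (auto simp: S_ring_def)

lemma S_ring_add: "f \<in> S_ring m \<Longrightarrow> g \<in> S_ring m \<Longrightarrow> f + g \<in> S_ring m"
  unfolding S_ring_def using keys_add[of f g] by blast

lemma S_ring_uminus: "f \<in> S_ring m \<Longrightarrow> - f \<in> S_ring m"
  unfolding S_ring_def by simp

lemma S_ring_diff: "f \<in> S_ring m \<Longrightarrow> g \<in> S_ring m \<Longrightarrow> f - g \<in> S_ring m"
  using S_ring_add[OF _ S_ring_uminus, of f m g] by simp

lemma S_ring_mult:
  assumes "f \<in> S_ring m" "g \<in> S_ring m"
  shows "f * g \<in> S_ring m"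
  unfolding S_ring_def
proof (intro CollectI ballI)
  fix \<mu> assume "\<mu> \<in> Poly_Mapping.keys (f * g)"
  then obtain a b where "\<mu> = a + b" "a \<in> Poly_Mapping.keys f" "b \<in> Poly_Mapping.keys g"
    using keys_mult[of f g] by blast
  then show "Poly_Mapping.keys \<mu> \<subseteq> {0..m}"
    using assms keys_add[of a b] unfolding S_ring_def by blast
qed

lemma S_ring_sum: "(\<And>i. i \<in> I \<Longrightarrow> f i \<in> S_ring m) \<Longrightarrow> sum f I \<in> S_ring m"
  by (induction I rule: infinite_finite_induct) (simp_all add: S_ring_zero S_ring_add)

section \<open>Polynomials vanishing at all primitive roots\<close>

text \<open>Let \<open>s\<close> be least with \<open>n \<le> s ^ 2\<close>. In a factorisation of
  \<open>n\<close> one factor is at most \<open>s\<close>, so there are at most \<open>2 * s\<close>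
  divisors. As \<open>totient d \<le> totient n\<close> for \<open>d dvd n\<close>, the divisor sum
  of totients gives \<open>n \<le> 2 * s * B\<close>, while \<open>(s - 1) ^ 2 < n\<close>; so
  \<open>s\<close> is bounded in terms of \<open>B\<close>.\<close>

lemma totient_bound:
  assumes "totient n \<le> B"
  shows "n \<le> (2 * B + 2) ^ 2"
proof (cases "n = 0")
  case False
  define s where "s = (LEAST s. n \<le> s ^ 2)"
  have ex: "n \<le> n ^ 2" by (simp add: power2_eq_square)
  then have s: "n \<le> s ^ 2" unfolding s_def by (rule LeastI)
  have s0: "s > 0" using s False by (cases s) auto
  have "\<not> n \<le> (s - 1) ^ 2" unfolding s_def using s0 by (intro not_less_Least) (simp add: s_def)
  then have lt: "(s - 1) ^ 2 < n" by simp
  have "{d. d dvd n} \<subseteq> {1..s} \<union> (\<lambda>d. n div d) ` {1..s}"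
  proof
    fix d assume "d \<in> {d. d dvd n}"
    then obtain e where e: "n = d * e" by (auto elim: dvdE)
    have pos: "d > 0" "e > 0" using e False by auto
    show "d \<in> {1..s} \<union> (\<lambda>d. n div d) ` {1..s}"
    proof (cases "d \<le> s")
      case False
      have "e \<le> s"
      proof (rule ccontr)
        assume "\<not> e \<le> s"
        then have "s * s < d * e" using False by (intro mult_strict_mono) auto
        then show False using s e by (simp add: power2_eq_square)
      qed
      moreover have "d = n div e" using e pos by simp
      ultimately show ?thesis using pos by auto
    qed (use pos in auto)
  qed
  then have "card {d. d dvd n} \<le> card ({1..s} \<union> (\<lambda>d. n div d) ` {1..s})" by (intro card_mono) auto
  also have "\<dots> \<le> card {1..s} + card ((\<lambda>d. n div d) ` {1..s})" by (rule card_Un_le)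
  also have "\<dots> \<le> s + s" using card_image_le[of "{1..s}" "\<lambda>d. n div d"] by simp
  finally have card: "card {d. d dvd n} \<le> 2 * s" by simp
  have "n = (\<Sum>d | d dvd n. totient d)" by (simp add: totient_divisor_sum)
  also have "\<dots> \<le> (\<Sum>d | d dvd n. B)"
    by (intro sum_mono) (use assms False in \<open>auto intro: le_trans[OF totient_dvd_mono]\<close>)
  also have "\<dots> \<le> 2 * s * B" using card by simp
  finally have "(s - 1) ^ 2 < 2 * s * B" using lt by linarith
  \<comment> \<open>For \<open>s \<ge> 2 * B + 2\<close> one has
    \<open>(s - 1) ^ 2 > s * (s - 2) \<ge> 2 * s * B\<close>, which is the source of the
    constant.\<close>
  have "s \<le> 2 * B + 2"
  proof (rule ccontr)
    assume "\<not> s \<le> 2 * B + 2"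
    then obtain t where t: "s = 2 * B + 3 + t" using le_Suc_ex[of "2 * B + 3" s] by auto
    have "2 * s * B \<le> (s - 1) ^ 2" unfolding t by (simp add: power2_eq_square algebra_simps)
    then show False using \<open>(s - 1) ^ 2 < 2 * s * B\<close> by simp
  qed
  then have "s ^ 2 \<le> (2 * B + 2) ^ 2" by (rule power_mono) simp
  then show ?thesis using s by linarith
qed simp

lemma card_primitive_roots:
  assumes "prime p" shows "card (primitive_roots p) = totient (p - 1)"
proof -
  have "primitive_roots p = {g \<in> totatives p. residue_primroot p g}"
  proof -
    have "w > 0" if "residue_primroot p w" for w
      using that assms by (cases w) (auto simp: residue_primroot_def)
    then show ?thesis using assms by (auto simp: primitive_roots_def totatives_prime)
  qed
  moreover have "\<exists>g. residue_primroot p g"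
    using prime_primitive_root_exists[of p] assms prime_gt_1_nat by blast
  ultimately show ?thesis using card_residue_primroots[of p] assms by (simp add: totient_prime)
qed

text \<open>A polynomial with more incongruent roots modulo \<open>p\<close> than its degree
  vanishes modulo \<open>p\<close>. Synthetic division by \<open>X - a\<close> keeps the argument
  over the integers: both the remainder and, as \<open>p\<close> does not divide
  \<open>b - a\<close>, the quotient at the other roots are divisible by \<open>p\<close>.\<close>

lemma prime_dvd_coeffs:
  fixes P :: "int poly" and p :: int
  assumes "prime p" "finite A" "degree P < card A" "\<And>a. a \<in> A \<Longrightarrow> p dvd poly P a"
    and "\<And>a b. a \<in> A \<Longrightarrow> b \<in> A \<Longrightarrow> a \<noteq> b \<Longrightarrow> \<not> p dvd a - b"
  shows "[:p:] dvd P"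
  using assms(2-)
proof (induction "card A" arbitrary: A P)
  case (Suc k)
  obtain a where a: "a \<in> A" using Suc.hyps(2) by fastforce
  let ?Q = "synthetic_div P a"
  have P: "P = [:- a, 1:] * ?Q + [:poly P a:]" by (simp only: synthetic_div_correct')
  have const: "[:p:] dvd [:poly P a:]" 
  proof -
    obtain c where "poly P a = p * c" using Suc.prems(3)[OF a] by (elim dvdE)
    then have "[:poly P a:] = [:p:] * [:c:]" by simp
    then show ?thesis by (rule dvdI)
  qed
  show ?case
  proof (cases "degree P = 0")
    case True
    then have "?Q = 0" by (simp add: synthetic_div_eq_0_iff)
    then have "P = [:poly P a:]" using P by (metis mult_zero_right add_0)
    then show ?thesis using const by metis
  next
    case False
    have "[:p:] dvd ?Q"
    proof (rule Suc.hyps(1))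
      show "k = card (A - {a})" using Suc.hyps(2) a Suc.prems(1) by simp
      show "degree ?Q < card (A - {a})" using Suc.prems(1,2) a False by (simp add: degree_synthetic_div)
      fix b assume b: "b \<in> A - {a}"
      have "poly P b = (b - a) * poly ?Q b + poly P a" by (subst P) (simp add: algebra_simps)
      then have "p dvd (b - a) * poly ?Q b" using Suc.prems(3)[OF a] Suc.prems(3)[of b] b by (metis DiffD1 dvd_add_left_iff)
      then show "p dvd poly ?Q b" using Suc.prems(4)[of b a] a b assms(1) by (auto simp: prime_dvd_mult_iff)
    qed (use Suc.prems in auto)
    then show ?thesis using const P by (metis dvd_add dvd_mult)
  qed
qed simp

text \<open>The grid argument, one variable at a time: on a grid larger than every partial degree,
  vanishing modulo \<open>p\<close> forces all coefficients to vanish. Monomials are abstract labels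
  with exponents \<open>e\<close>, and injectivity of the restricted exponents says that they are
  distinct.\<close>

lemma prime_dvd_multi_coeffs:
  fixes c :: "'b \<Rightarrow> int" and e :: "'b \<Rightarrow> nat \<Rightarrow> nat" and p :: int and B :: "nat \<Rightarrow> int set"
  assumes p: "prime p" and "\<And>v. finite (B v)"
    and B: "\<And>v a b. a \<in> B v \<Longrightarrow> b \<in> B v \<Longrightarrow> a \<noteq> b \<Longrightarrow> \<not> p dvd a - b"
    and "finite K" "inj_on (\<lambda>\<mu>. restrict (e \<mu>) {..<k}) K"
    and "\<And>\<mu> v. \<mu> \<in> K \<Longrightarrow> v < k \<Longrightarrow> e \<mu> v < card (B v)"
    and "\<And>x. (\<forall>v<k. x v \<in> B v) \<Longrightarrow> p dvd (\<Sum>\<mu>\<in>K. c \<mu> * (\<Prod>v<k. x v ^ e \<mu> v))"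
    and "\<mu> \<in> K"
  shows "p dvd c \<mu>"
  using assms(4-)
proof (induction k arbitrary: K \<mu>)
  case 0
  have "K = {\<mu>}" using 0(2,5) by (auto simp: inj_on_def)
  then show ?case using 0(4)[of "\<lambda>_. 0"] by simp
next
  case (Suc k)
  define Kd where "Kd = {\<nu> \<in> K. e \<nu> k = e \<mu> k}"
  show ?case
  proof (rule Suc.IH[of Kd])
    show "inj_on (\<lambda>\<mu>. restrict (e \<mu>) {..<k}) Kd"
    proof (rule inj_onI)
      fix \<nu> \<nu>' assume n: "\<nu> \<in> Kd" "\<nu>' \<in> Kd" and eq: "restrict (e \<nu>) {..<k} = restrict (e \<nu>') {..<k}"
      have "e \<nu> v = e \<nu>' v" if "v < Suc k" for v
      proof (cases "v = k")
        case False
        then have "v \<in> {..<k}" using that by simp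
        then show ?thesis using fun_cong[OF eq, of v] by simp
      qed (use n in \<open>simp add: Kd_def\<close>)
      then have "restrict (e \<nu>) {..<Suc k} = restrict (e \<nu>') {..<Suc k}" by auto
      then show "\<nu> = \<nu>'" using Suc.prems(2) n unfolding Kd_def inj_on_def by blast
    qed
  next
    fix x assume x: "\<forall>v<k. x v \<in> B v"
    \<comment> \<open>The sum as a polynomial in the last variable, the others being fixed on the
      grid. Its coefficient at \<open>e \<mu> k\<close> is a sum over \<open>Kd\<close> in one
      variable less.\<close>
    define P where "P = (\<Sum>\<nu>\<in>K. Polynomial.monom (c \<nu> * (\<Prod>v<k. x v ^ e \<nu> v)) (e \<nu> k))"
    have "[:p:] dvd P"
    proof (rule prime_dvd_coeffs[OF p assms(2)[of k]])
      have "0 < card (B k)" using Suc.prems(3)[OF Suc.prems(5), of k] by simp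
      moreover have "degree P \<le> card (B k) - 1" unfolding P_def
      proof (rule degree_sum_le[OF Suc.prems(1)])
        fix \<nu> assume "\<nu> \<in> K"
        then have "e \<nu> k \<le> card (B k) - 1" using Suc.prems(3)[of \<nu> k] by simp
        then show "degree (Polynomial.monom (c \<nu> * (\<Prod>v<k. x v ^ e \<nu> v)) (e \<nu> k)) \<le> card (B k) - 1"
          by (rule le_trans[OF degree_monom_le])
      qed
      ultimately show "degree P < card (B k)" by simp
      fix b assume b: "b \<in> B k"
      have "poly P b = (\<Sum>\<nu>\<in>K. c \<nu> * (\<Prod>v<Suc k. (x(k := b)) v ^ e \<nu> v))"
        unfolding P_def by (simp add: poly_sum poly_monom mult.assoc)
      then show "p dvd poly P b" using Suc.prems(4)[of "x(k := b)"] x b by (simp add: less_Suc_eq)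
    qed (rule B)
    then have "p dvd Polynomial.coeff P (e \<mu> k)" by (simp add: const_poly_dvd_iff)
    also have "Polynomial.coeff P (e \<mu> k) = (\<Sum>\<nu>\<in>K. if e \<nu> k = e \<mu> k then c \<nu> * (\<Prod>v<k. x v ^ e \<nu> v) else 0)"
      unfolding P_def by (simp add: coeff_sum)
    also have "\<dots> = (\<Sum>\<nu>\<in>Kd. c \<nu> * (\<Prod>v<k. x v ^ e \<nu> v))"
      unfolding Kd_def by (rule sum.inter_filter[OF Suc.prems(1), symmetric])
    finally show "p dvd (\<Sum>\<nu>\<in>Kd. c \<nu> * (\<Prod>v<k. x v ^ e \<nu> v))" .
  qed (use Suc.prems in \<open>auto simp: Kd_def\<close>)
qed

lemma monomial_value_S_ring:
  assumes "Poly_Mapping.keys \<mu> \<subseteq> {0..m}"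
  shows "monomial_value \<rho> \<mu> = (\<Prod>v<Suc m. \<rho> v ^ Poly_Mapping.lookup \<mu> v)"
  by (rule monomial_value_superset) (use assms in auto)

text \<open>The number of primitive roots of \<open>p\<close> is \<open>totient (p - 1)\<close> and tends to infinity with \<open>p\<close>, so a
  non-zero polynomial of fixed degree cannot vanish at all admissible points for infinitely many
  primes.\<close>

lemma vanishing_mpoly:
  assumes f: "f \<in> S_ring m" and PS: "infinite PS" "\<And>p. p \<in> PS \<Longrightarrow> prime p"
    and van: "\<And>p w x. p \<in> PS \<Longrightarrow> w \<in> primitive_roots p \<Longrightarrow> x \<in> Zp_tuples p m \<Longrightarrow>
      int p dvd mpoly_eval (point w x) f"
  shows "f = 0"
proof (rule ccontr)
  assume "f \<noteq> 0"
  then obtain \<mu>0 where \<mu>0: "\<mu>0 \<in> Poly_Mapping.keys f" by (metis keys_eq_empty ex_in_conv)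
  let ?K = "Poly_Mapping.keys f"
  let ?l = "\<lambda>\<mu> v. Poly_Mapping.lookup (\<mu> :: nat \<Rightarrow>\<^sub>0 nat) v"
  \<comment> \<open>One bound for all exponents and all absolute values of coefficients: the former
    must stay below the grid size, the latter yields the final contradiction.\<close>
  define N where "N = (\<Sum>\<mu>\<in>?K. (\<Sum>v<Suc m. ?l \<mu> v) + nat \<bar>Poly_Mapping.lookup f \<mu>\<bar>)"
  have N1: "?l \<mu> v \<le> N" if "\<mu> \<in> ?K" "v < Suc m" for \<mu> v
  proof -
    have "?l \<mu> v \<le> (\<Sum>v<Suc m. ?l \<mu> v)" by (rule member_le_sum) (use that in auto)
    also have "\<dots> \<le> (\<Sum>v<Suc m. ?l \<mu> v) + nat \<bar>Poly_Mapping.lookup f \<mu>\<bar>" by simp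
    also have "\<dots> \<le> N" unfolding N_def by (rule member_le_sum) (use that in auto)
    finally show ?thesis .
  qed
  have N2: "\<bar>Poly_Mapping.lookup f \<mu>0\<bar> \<le> int N"
  proof -
    have "nat \<bar>Poly_Mapping.lookup f \<mu>0\<bar> \<le> (\<Sum>v<Suc m. ?l \<mu>0 v) + nat \<bar>Poly_Mapping.lookup f \<mu>0\<bar>" by simp
    also have "\<dots> \<le> N" unfolding N_def by (rule member_le_sum) (use \<mu>0 in auto)
    finally show ?thesis by simp
  qed
  \<comment> \<open>\<open>(2 * N + 2) ^ 2\<close> is the bound of \<open>totient_bound\<close>, to
    be exceeded by \<open>p - 1\<close>; the remaining summands allow for this shift and make
    \<open>p\<close> itself exceed \<open>N\<close>.\<close>
  have "\<not> PS \<subseteq> {..(2 * N + 2) ^ 2 + N + 1}" using PS(1) finite_subset by blast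
  then obtain p where p: "p \<in> PS" "p > (2 * N + 2) ^ 2 + N + 1" by (auto simp: subset_iff not_le)
  have pp: "prime p" by (rule PS(2)[OF p(1)])
  have tot: "N < totient (p - 1)"
  proof (rule ccontr)
    assume "\<not> N < totient (p - 1)"
    then have "p - 1 \<le> (2 * N + 2) ^ 2" using totient_bound[of "p - 1" N] by simp
    then show False using p(2) by simp
  qed
  define B where "B v = (if v = 0 then int ` primitive_roots p else {0..<int p})" for v :: nat
  have Bsub: "B v \<subseteq> {0..<int p}" for v by (auto simp: B_def primitive_roots_def)
  have cardB: "N < card (B v)" for v
  proof (cases "v = 0")
    case True
    then show ?thesis using tot card_primitive_roots[OF pp] by (simp add: B_def card_image)
  next
    case False
    then show ?thesis using p(2) by (simp add: B_def)
  qed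
  have "int p dvd Poly_Mapping.lookup f \<mu>0"
  proof (rule prime_dvd_multi_coeffs[of "int p" B ?K ?l "Suc m" "Poly_Mapping.lookup f"])
    show "prime (int p)" using pp by simp
    show "finite (B v)" for v using Bsub[of v] finite_subset by blast
    show "\<not> int p dvd a - b" if "a \<in> B v" "b \<in> B v" "a \<noteq> b" for v a b
    proof
      assume "int p dvd a - b"
      then have "a mod int p = b mod int p" by (simp add: mod_eq_dvd_iff)
      moreover have "a mod int p = a" "b mod int p = b" using that Bsub[of v] by (auto intro!: mod_pos_pos_trivial)
      ultimately show False using that by simp
    qed
    show "inj_on (\<lambda>\<mu>. restrict (?l \<mu>) {..<Suc m}) ?K"
    proof (rule inj_onI)
      fix \<mu> \<nu> assume mn: "\<mu> \<in> ?K" "\<nu> \<in> ?K" and eq: "restrict (?l \<mu>) {..<Suc m} = restrict (?l \<nu>) {..<Suc m}"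
      show "\<mu> = \<nu>"
      proof (rule poly_mapping_eqI)
        fix v
        show "?l \<mu> v = ?l \<nu> v"
        proof (cases "v < Suc m")
          case True
          then show ?thesis using fun_cong[OF eq, of v] by simp
        next
          case False
          have "Poly_Mapping.keys \<mu> \<subseteq> {0..m}" "Poly_Mapping.keys \<nu> \<subseteq> {0..m}"
            using f mn unfolding S_ring_def by blast+
          then have "v \<notin> Poly_Mapping.keys \<mu>" "v \<notin> Poly_Mapping.keys \<nu>" using False by auto
          then show ?thesis by (simp add: in_keys_iff)
        qed
      qed
    qed
    show "?l \<mu> v < card (B v)" if "\<mu> \<in> ?K" "v < Suc m" for \<mu> v using N1[OF that] cardB[of v] by simp
    show "int p dvd (\<Sum>\<mu>\<in>?K. Poly_Mapping.lookup f \<mu> * (\<Prod>v<Suc m. x v ^ ?l \<mu> v))" if x: "\<forall>v<Suc m. x v \<in> B v" for x :: "nat \<Rightarrow> int"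
    proof -
      have "x 0 \<in> B 0" using x by simp
      then obtain w where w: "w \<in> primitive_roots p" "x 0 = int w" by (auto simp: B_def)
      define y where "y = restrict x {1..m}"
      have y: "y \<in> Zp_tuples p m" unfolding Zp_tuples_def y_def restrict_PiE_iff
      proof
        fix v assume "v \<in> {1..m}"
        then have "x v \<in> B v" using x by simp
        then show "x v \<in> {0..<int p}" using Bsub[of v] by blast
      qed
      have eq: "point w y v = x v" if "v < Suc m" for v
        using that w by (auto simp: point_def y_def)
      have "mpoly_eval (point w y) f = (\<Sum>\<mu>\<in>?K. Poly_Mapping.lookup f \<mu> * monomial_value (point w y) \<mu>)"
        by (rule mpoly_eval_superset) auto
      also have "\<dots> = (\<Sum>\<mu>\<in>?K. Poly_Mapping.lookup f \<mu> * (\<Prod>v<Suc m. x v ^ ?l \<mu> v))"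
      proof (rule sum.cong[OF HOL.refl])
        fix \<mu> assume "\<mu> \<in> ?K"
        then have "Poly_Mapping.keys \<mu> \<subseteq> {0..m}" using f unfolding S_ring_def by blast
        then have "monomial_value (point w y) \<mu> = (\<Prod>v<Suc m. point w y v ^ ?l \<mu> v)" by (rule monomial_value_S_ring)
        also have "\<dots> = (\<Prod>v<Suc m. x v ^ ?l \<mu> v)" by (rule prod.cong) (simp_all add: eq)
        finally show "Poly_Mapping.lookup f \<mu> * monomial_value (point w y) \<mu> = Poly_Mapping.lookup f \<mu> * (\<Prod>v<Suc m. x v ^ ?l \<mu> v)"
          by simp
      qed
      finally show ?thesis using van[OF p(1) w(1) y] by simp
    qed
  qed (use \<mu>0 in auto)
  then have "int p \<le> \<bar>Poly_Mapping.lookup f \<mu>0\<bar>"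
    using \<mu>0 by (intro zdvd_imp_le) (auto simp: in_keys_iff)
  then show False using N2 p(2) by linarith
qed

section \<open>Presented Lie rings\<close>

definition term_class :: "'g set \<Rightarrow> ('g lie_term \<times> 'g lie_term) set \<Rightarrow> 'g lie_term \<Rightarrow> 'g lie_term set" where
  "term_class X R t = lie_congruence X R `` {t}"

lemma lie_terms_simps:
  "Gen g \<in> lie_terms X \<longleftrightarrow> g \<in> X" "Zero \<in> lie_terms X"
  "Neg s \<in> lie_terms X \<longleftrightarrow> s \<in> lie_terms X"
  "Plus s t \<in> lie_terms X \<longleftrightarrow> s \<in> lie_terms X \<and> t \<in> lie_terms X"
  "Bracket s t \<in> lie_terms X \<longleftrightarrow> s \<in> lie_terms X \<and> t \<in> lie_terms X"
  by (auto simp: lie_terms_def)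

lemma term_class_eq: "(s, t) \<in> lie_congruence X R \<Longrightarrow> term_class X R s = term_class X R t"
  unfolding term_class_def by (auto intro: lie_congruence.trans lie_congruence.sym)

lemma term_class_self: "t \<in> lie_terms X \<Longrightarrow> t \<in> term_class X R t"
  unfolding term_class_def by (auto intro: lie_congruence.refl)

lemma mem_term_class: "s \<in> term_class X R t \<longleftrightarrow> (t, s) \<in> lie_congruence X R"
  unfolding term_class_def by simp

lemma presented_lie_ring_simps:
  "carrier (presented_lie_ring X R) = term_class X R ` lie_terms X"
  "zero (presented_lie_ring X R) = term_class X R Zero"
  by (auto simp: presented_lie_ring_def term_class_def quotient_def)

text \<open>The union over representatives collapses, because \<open>Plus\<close> respects the
  congruence.\<close>

lemma presented_lie_ring_add:
  assumes "s \<in> lie_terms X" "t \<in> lie_terms X"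
  shows "term_class X R s \<oplus>\<^bsub>presented_lie_ring X R\<^esub> term_class X R t = term_class X R (Plus s t)"
proof -
  have "(\<Union>s' \<in> term_class X R s. \<Union>t' \<in> term_class X R t. term_class X R (Plus s' t')) = term_class X R (Plus s t)"
  proof (rule Set.set_eqI, rule iffI)
    fix r assume "r \<in> (\<Union>s' \<in> term_class X R s. \<Union>t' \<in> term_class X R t. term_class X R (Plus s' t'))"
    then obtain s' t' where st: "(s, s') \<in> lie_congruence X R" "(t, t') \<in> lie_congruence X R" "r \<in> term_class X R (Plus s' t')"
      by (auto simp: mem_term_class)
    then show "r \<in> term_class X R (Plus s t)" using term_class_eq[OF lie_congruence.plus_cong[OF st(1,2)]] by simp
  qed (use assms term_class_self in blast)
  then show ?thesis by (simp add: presented_lie_ring_def term_class_def)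
qed

lemma presented_lie_ring_bracket:
  assumes "s \<in> lie_terms X" "t \<in> lie_terms X"
  shows "term_class X R s \<otimes>\<^bsub>presented_lie_ring X R\<^esub> term_class X R t = term_class X R (Bracket s t)"
proof -
  have "(\<Union>s' \<in> term_class X R s. \<Union>t' \<in> term_class X R t. term_class X R (Bracket s' t')) = term_class X R (Bracket s t)"
  proof (rule Set.set_eqI, rule iffI)
    fix r assume "r \<in> (\<Union>s' \<in> term_class X R s. \<Union>t' \<in> term_class X R t. term_class X R (Bracket s' t'))"
    then obtain s' t' where st: "(s, s') \<in> lie_congruence X R" "(t, t') \<in> lie_congruence X R" "r \<in> term_class X R (Bracket s' t')"
      by (auto simp: mem_term_class)
    then show "r \<in> term_class X R (Bracket s t)" using term_class_eq[OF lie_congruence.bracket_cong[OF st(1,2)]] by simp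
  qed (use assms term_class_self in blast)
  then show ?thesis by (simp add: presented_lie_ring_def term_class_def)
qed

context lie_ring
begin

lemma eq_minusI: "u \<oplus> v = w \<Longrightarrow> u \<in> carrier L \<Longrightarrow> v \<in> carrier L \<Longrightarrow> u = w \<ominus> v"
  by (auto simp: minus_eq a_assoc r_neg)

lemma bracket_minus_left:
  assumes "x \<in> carrier L" "y \<in> carrier L" "z \<in> carrier L"
  shows "(x \<ominus> y) \<otimes> z = x \<otimes> z \<ominus> y \<otimes> z"
  by (rule eq_minusI) (use assms bracket_add_left[of "x \<ominus> y" y z] in \<open>simp_all add: minus_add_cancel_right bracket_closed\<close>)

lemma bracket_minus_right:
  assumes "x \<in> carrier L" "y \<in> carrier L" "z \<in> carrier L"
  shows "z \<otimes> (x \<ominus> y) = z \<otimes> x \<ominus> z \<otimes> y"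
  by (rule eq_minusI) (use assms bracket_add_right[of z "x \<ominus> y" y] in \<open>simp_all add: minus_add_cancel_right bracket_closed\<close>)

lemma bracket_zero_right: "x \<in> carrier L \<Longrightarrow> x \<otimes> \<zero> = \<zero>"
  using bracket_minus_right[of \<zero> \<zero> x] bracket_closed[of x \<zero>] by (simp add: minus_eq r_neg)

end

context lie_coefficients
begin

lemma int_vecs_add: "x \<in> int_vecs n \<Longrightarrow> y \<in> int_vecs n \<Longrightarrow> x + y \<in> int_vecs n"
  by (rule diff_closed_imp_add_closed[of "\<lambda>x. x \<in> int_vecs n"]) (auto intro: zero_int_vecs int_vecs_diff)

lemma scaled_int_vecs: "x \<in> int_vecs n \<Longrightarrow> (\<lambda>j. c * x j) \<in> int_vecs n"
  by (rule diff_closed_mult[of "\<lambda>x. x \<in> int_vecs n"]) (auto intro: zero_int_vecs int_vecs_diff)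

lemma phi_scaled: "phi (\<lambda>j. c * x j) = (\<lambda>l. c * phi x l)"
  by (rule ext) (simp add: phi_def sum_distrib_left algebra_simps)

text \<open>Division with carry: subtracting a multiple of \<open>phi\<close> of generator
  \<open>m + 1\<close> replaces that coordinate by its remainder modulo \<open>p\<close> and carries
  into later coordinates only, so the digits already reached stay.\<close>

lemma phi_reduction:
  assumes x: "x \<in> int_vecs n" and "m \<le> n"
  shows "\<exists>b \<in> int_vecs n. x - b \<in> phi ` int_vecs n \<and> (\<forall>i \<in> {1..m}. 0 \<le> b i \<and> b i < int p)"
  using \<open>m \<le> n\<close>
proof (induction m)
  case 0
  have "x - x \<in> phi ` int_vecs n" unfolding diff_self by (rule phi_image_zero)
  then show ?case using x by (intro bexI[of _ x] conjI) (assumption, simp)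
next
  case (Suc m)
  have "\<exists>b \<in> int_vecs n. x - b \<in> phi ` int_vecs n \<and> (\<forall>i \<in> {1..m}. 0 \<le> b i \<and> b i < int p)"
    by (rule Suc.IH) (use Suc.prems in simp)
  then obtain b where b: "b \<in> int_vecs n" "x - b \<in> phi ` int_vecs n" "\<forall>i \<in> {1..m}. 0 \<le> b i \<and> b i < int p"
    by (elim bexE conjE) (rule that)
  have m: "Suc m \<in> {1..n}" using Suc.prems by simp
  define u where "u = (\<lambda>j. (b (Suc m) div int p) * unit_fun (Suc m) j)"
  have u: "u \<in> int_vecs n" unfolding u_def by (intro scaled_int_vecs unit_fun_int_vecs m)
  have phi_u: "phi u l = (b (Suc m) div int p) * (int p * unit_fun (Suc m) l - q (Suc m) l)" for l
    unfolding u_def phi_scaled phi_unit[OF m] ..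
  show ?case
  proof (intro bexI conjI ballI)
    show "b - phi u \<in> int_vecs n" by (intro int_vecs_diff b phi_vecs u)
    have "x - (b - phi u) = (x - b) + phi u" by simp
    also have "\<dots> \<in> phi ` int_vecs n" by (intro phi_image_add b imageI u)
    finally show "x - (b - phi u) \<in> phi ` int_vecs n" .
    fix i assume i: "i \<in> {1..Suc m}"
    have q0: "q (Suc m) i = 0" using i q_support[of "Suc m" i] by force
    have "(b - phi u) i = (if i = Suc m then b i mod int p else b i)"
      unfolding fun_diff_def phi_u q0 by (simp add: unit_fun_def minus_mult_div_eq_mod mult.commute)
    moreover have "i \<in> {1..m}" if "i \<noteq> Suc m" using i that by simp
    ultimately show "0 \<le> (b - phi u) i" "(b - phi u) i < int p"
      using b(3) p_pos by (auto simp del: minus_apply)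
  qed
qed

end

declare One_nat_def [simp del]

section \<open>The presentation as a quotient of the free abelian group\<close>

text \<open>The order \<open>p ^ n\<close> is the only information on how far the relations collapse
  the free abelian group; it will show that the kernel of \<open>beta\<close> is no larger than the
  image of \<open>phi\<close>.\<close>

locale presented_lie = lie_coefficients n p A + lie_ring L for n p A and L :: "nat lie_term set ring" (structure) +
  assumes presented: "L = presentation_ring n p A" and card_carrier: "card (carrier L) = p ^ n"
begin

abbreviation "V \<equiv> int_vecs n"
abbreviation "relations \<equiv> presentation_relations n p A"
abbreviation "cls \<equiv> term_class {1..n} relations"
abbreviation "terms \<equiv> lie_terms {1..n}"

lemma L_eq: "L = presented_lie_ring {1..n} relations"
  by (simp add: presented presentation_ring_def)

lemma cls_closed: "t \<in> terms \<Longrightarrow> cls t \<in> carrier L"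
  by (simp add: L_eq presented_lie_ring_simps)

lemma cls_Zero: "cls Zero = \<zero>"
  by (simp add: L_eq presented_lie_ring_simps)

lemma cls_Plus: "s \<in> terms \<Longrightarrow> t \<in> terms \<Longrightarrow> cls (Plus s t) = cls s \<oplus> cls t"
  by (simp add: L_eq presented_lie_ring_add)

lemma cls_Bracket: "s \<in> terms \<Longrightarrow> t \<in> terms \<Longrightarrow> cls (Bracket s t) = cls s \<otimes> cls t"
  by (simp add: L_eq presented_lie_ring_bracket)

lemma cls_Neg:
  assumes "s \<in> terms" shows "cls (Neg s) = \<ominus> cls s"
proof -
  have "cls (Plus (Neg s) s) = cls Zero" by (rule term_class_eq) (rule lie_congruence.plus_neg[OF assms])
  then have "cls (Neg s) \<oplus> cls s = \<zero>" using assms by (simp add: cls_Plus cls_Zero lie_terms_simps)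
  then show ?thesis using minus_equality[of "cls (Neg s)" "cls s"] assms by (simp add: cls_closed lie_terms_simps)
qed

lemma term_power_terms: "t \<in> terms \<Longrightarrow> (Plus t ^^ k) Zero \<in> terms"
  by (induction k) (auto simp: lie_terms_simps)

lemma term_multiple_terms: "t \<in> terms \<Longrightarrow> term_multiple c t \<in> terms"
  by (simp add: term_multiple_def term_power_terms lie_terms_simps)

lemma cls_term_power: "t \<in> terms \<Longrightarrow> cls ((Plus t ^^ k) Zero) = [k] \<cdot> cls t"
proof (induction k)
  case 0
  then show ?case by (simp add: cls_Zero add_pow_def)
next
  case (Suc k)
  have "cls ((Plus t ^^ Suc k) Zero) = cls t \<oplus> [k] \<cdot> cls t"
    using Suc by (simp add: cls_Plus term_power_terms)
  also have "\<dots> = [Suc k] \<cdot> cls t" using Suc.prems by (simp add: cls_closed a_comm)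
  finally show ?case .
qed

lemma cls_term_multiple: "t \<in> terms \<Longrightarrow> cls (term_multiple c t) = [c] \<cdot> cls t"
  by (cases "0 \<le> c")
    (simp_all add: term_multiple_def cls_term_power cls_Neg term_power_terms add_pow_int_ge add_pow_int_lt)

definition beta :: "(nat \<Rightarrow> int) \<Rightarrow> nat lie_term set" where
  "beta x = (\<Oplus>i\<in>{1..n}. [x i] \<cdot> cls (Gen i))"

lemma gen_closed: "i \<in> {1..n} \<Longrightarrow> cls (Gen i) \<in> carrier L"
  by (rule cls_closed) (simp add: lie_terms_simps)

lemma multiple_closed: "g \<in> carrier L \<Longrightarrow> [(c :: int)] \<cdot> g \<in> carrier L"
  by (rule add.int_pow_closed)

lemma multiple_zero: "[(0 :: int)] \<cdot> g = \<zero>"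
  by (simp add: add_pow_def)

lemma beta_closed: "beta x \<in> carrier L"
  unfolding beta_def by (rule finsum_closed) (auto intro: multiple_closed gen_closed)

lemma beta_add: "beta (x + y) = beta x \<oplus> beta y"
proof -
  have "beta (x + y) = (\<Oplus>i\<in>{1..n}. [x i] \<cdot> cls (Gen i) \<oplus> [y i] \<cdot> cls (Gen i))"
    unfolding beta_def
    by (rule finsum_cong') (auto intro!: multiple_closed gen_closed add.int_pow_mult simp: plus_fun_apply)
  also have "\<dots> = beta x \<oplus> beta y"
    unfolding beta_def by (rule finsum_addf) (auto intro: multiple_closed gen_closed)
  finally show ?thesis .
qed

lemma beta_diff: "beta (x - y) = beta x \<ominus> beta y"
  by (rule eq_minusI) (auto simp: beta_add[symmetric] beta_closed)

lemma beta_zero: "beta 0 = \<zero>"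
  using beta_diff[of 0 0] by (simp add: minus_eq r_neg beta_closed)

lemma beta_scaled_unit:
  assumes i: "i \<in> {1..n}"
  shows "beta (\<lambda>j. c * unit_fun i j) = [c] \<cdot> cls (Gen i)"
proof -
  have "beta (\<lambda>j. c * unit_fun i j) = (\<Oplus>j\<in>{1..n}. if i = j then [c] \<cdot> cls (Gen j) else \<zero>)"
    unfolding beta_def
    by (rule finsum_cong') (simp_all add: unit_fun_def multiple_closed gen_closed multiple_zero)
  also have "\<dots> = [c] \<cdot> cls (Gen i)"
    by (rule finsum_singleton) (use i in \<open>auto intro: multiple_closed gen_closed\<close>)
  finally show ?thesis .
qed

lemma beta_unit: "i \<in> {1..n} \<Longrightarrow> beta (unit_fun i) = cls (Gen i)"
  using beta_scaled_unit[of i 1] gen_closed[of i] by (simp add: add.int_pow_1)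

lemma term_sum_terms: "set ts \<subseteq> terms \<Longrightarrow> term_sum ts \<in> terms"
  by (induction ts) (auto simp: term_sum_def lie_terms_simps)

lemma cls_term_sum:
  assumes "distinct ks" "set ks \<subseteq> {1..n}"
  shows "cls (term_sum (map (\<lambda>k. term_multiple (f k) (Gen k)) ks)) = beta (\<lambda>k. if k \<in> set ks then f k else 0)"
  using assms
proof (induction ks)
  case Nil
  have "beta (\<lambda>k. 0) = \<zero>" using beta_zero by (simp add: zero_fun_def)
  then show ?case by (simp add: term_sum_def cls_Zero)
next
  case (Cons k ks)
  have k: "k \<in> {1..n}" "k \<notin> set ks" using Cons.prems by auto
  have kt: "Gen k \<in> terms" using k by (simp add: lie_terms_simps)
  have t: "set (map (\<lambda>k. term_multiple (f k) (Gen k)) ks) \<subseteq> terms"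
    using Cons.prems by (auto intro!: term_multiple_terms simp: lie_terms_simps)
  have "cls (term_sum (map (\<lambda>k. term_multiple (f k) (Gen k)) (k # ks))) =
      cls (term_multiple (f k) (Gen k)) \<oplus> cls (term_sum (map (\<lambda>k. term_multiple (f k) (Gen k)) ks))"
    using cls_Plus[OF term_multiple_terms[OF kt] term_sum_terms[OF t]] by (simp add: term_sum_def)
  also have "\<dots> = beta (\<lambda>j. f k * unit_fun k j) \<oplus> beta (\<lambda>k. if k \<in> set ks then f k else 0)"
    using Cons by (simp add: cls_term_multiple[OF kt] beta_scaled_unit[OF k(1)])
  also have "\<dots> = beta ((\<lambda>j. f k * unit_fun k j) + (\<lambda>k. if k \<in> set ks then f k else 0))"
    by (rule beta_add[symmetric])
  also have "(\<lambda>j. f k * unit_fun k j) + (\<lambda>k. if k \<in> set ks then f k else 0) = (\<lambda>j. if j \<in> set (k # ks) then f j else 0)"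
    by (rule ext) (use k(2) in \<open>auto simp: unit_fun_def\<close>)
  finally show ?case .
qed

lemma relation_class:
  assumes "(s, t) \<in> relations" "s \<in> terms" "t \<in> terms"
  shows "cls s = cls t"
  by (rule term_class_eq) (rule lie_congruence.relator[OF assms])

lemma tail_sum_terms: "term_sum (map (\<lambda>k. term_multiple (f k) (Gen k)) [Suc j..<Suc n]) \<in> terms"
  by (rule term_sum_terms) (auto intro!: term_multiple_terms simp: lie_terms_simps)

lemma cls_tail_sum:
  assumes "\<And>k. f k \<noteq> 0 \<Longrightarrow> j < k \<and> k \<le> n"
  shows "cls (term_sum (map (\<lambda>k. term_multiple (f k) (Gen k)) [Suc j..<Suc n])) = beta f"
proof -
  have "(\<lambda>k. if k \<in> set [Suc j..<Suc n] then f k else 0) = f"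
    by (rule ext) (use assms in force)
  then show ?thesis by (subst cls_term_sum) auto
qed

lemma power_relation:
  assumes i: "i \<in> {1..n}"
  shows "[int p] \<cdot> cls (Gen i) = beta (q i)"
proof -
  have g: "Gen i \<in> terms" using i by (simp add: lie_terms_simps)
  have "cls (term_multiple (int p) (Gen i)) =
      cls (term_sum (map (\<lambda>k. term_multiple (q i k) (Gen k)) [Suc i..<Suc n]))"
    by (rule relation_class[OF _ term_multiple_terms[OF g] tail_sum_terms])
      (use i in \<open>auto simp: presentation_relations_def simp del: upt_Suc\<close>)
  also have "\<dots> = beta (q i)" by (rule cls_tail_sum) (use q_support in auto)
  finally show ?thesis by (simp add: cls_term_multiple[OF g])
qed

lemma bracket_relation:
  assumes ij: "i \<in> {1..n}" "j \<in> {1..n}" "i < j"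
  shows "cls (Gen i) \<otimes> cls (Gen j) = beta (a i j)"
proof -
  have g: "Gen i \<in> terms" "Gen j \<in> terms" using ij by (simp_all add: lie_terms_simps)
  have "cls (Bracket (Gen i) (Gen j)) =
      cls (term_sum (map (\<lambda>k. term_multiple (a i j k) (Gen k)) [Suc j..<Suc n]))"
    by (rule relation_class[OF _ _ tail_sum_terms])
      (use ij in \<open>auto simp: presentation_relations_def lie_terms_simps simp del: upt_Suc\<close>)
  also have "\<dots> = beta (a i j)"
  proof (rule cls_tail_sum)
    fix k assume "a i j k \<noteq> 0"
    moreover have "\<forall>i j k. i < j \<and> a i j k \<noteq> 0 \<longrightarrow> 1 \<le> i \<and> j < k \<and> k \<le> n"
      using coefficients unfolding presentation_coefficients_def by (elim conjE)
    ultimately show "j < k \<and> k \<le> n" using ij(3) by blast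
  qed
  finally show ?thesis by (simp add: cls_Bracket g)
qed

lemma beta_phi: "x \<in> V \<Longrightarrow> beta (phi x) = \<zero>"
proof (induction rule: int_vecs_induct)
  case zero
  show ?case by (simp only: phi_zero beta_zero)
next
  case (unit i)
  have "phi (unit_fun i) = (\<lambda>l. int p * unit_fun i l) - q i" unfolding phi_unit[OF unit] fun_diff_def ..
  then have "beta (phi (unit_fun i)) = [int p] \<cdot> cls (Gen i) \<ominus> beta (q i)"
    by (simp only: beta_diff beta_scaled_unit[OF unit])
  then show ?case by (simp add: power_relation[OF unit] minus_eq r_neg beta_closed)
next
  case (diff x y)
  then show ?case by (simp add: phi_diff beta_diff minus_eq del: minus_apply)
qed

text \<open>The presentation states brackets for \<open>i < j\<close> only; equal and reversed
  indices follow from the alternating law in \<open>L\<close>.\<close>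

lemma beta_bracket_unit:
  assumes i: "i \<in> {1..n}" and j: "j \<in> {1..n}"
  shows "beta (bracket (unit_fun i) (unit_fun j)) = beta (unit_fun i) \<otimes> beta (unit_fun j)"
proof -
  have lt: "beta (bracket (unit_fun i) (unit_fun j)) = beta (unit_fun i) \<otimes> beta (unit_fun j)"
    if "i \<in> {1..n}" "j \<in> {1..n}" "i < j" for i j
    unfolding bracket_unit[OF that(1,2)] beta_unit[OF that(1)] beta_unit[OF that(2)]
    by (rule bracket_relation[OF that, symmetric])
  consider "i < j" | "i = j" | "j < i" by linarith
  then show ?thesis
  proof cases
    case 1
    then show ?thesis using lt i j by blast
  next
    case 2
    then show ?thesis by (simp only: bracket_self beta_zero bracket_alternating[OF beta_closed])
  next
    case 3
    have "bracket (unit_fun i) (unit_fun j) = 0 - bracket (unit_fun j) (unit_fun i)"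
      using bracket_antisym[of "unit_fun i" "unit_fun j"] by simp
    then have "beta (bracket (unit_fun i) (unit_fun j)) = \<zero> \<ominus> beta (unit_fun j) \<otimes> beta (unit_fun i)"
      by (simp only: beta_diff beta_zero lt[OF j i 3])
    also have "\<dots> = beta (unit_fun i) \<otimes> beta (unit_fun j)"
      using minus_equality[OF bracket_antisymmetric[OF beta_closed beta_closed], of "unit_fun j" "unit_fun i"]
      by (simp add: beta_closed minus_eq bracket_closed)
    finally show ?thesis .
  qed
qed

lemma beta_bracket:
  assumes x: "x \<in> V" and y: "y \<in> V"
  shows "beta (bracket x y) = beta x \<otimes> beta y"
  using x
proof (induction rule: int_vecs_induct)
  case zero
  show ?case by (simp only: bracket_zero beta_zero bracket_zero_left[OF beta_closed])
next
  case (unit i)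
  show ?case using y
  proof (induction rule: int_vecs_induct)
    case zero
    show ?case by (simp only: bracket_zero beta_zero bracket_zero_right[OF beta_closed])
  next
    case (unit j)
    then show ?case using beta_bracket_unit \<open>i \<in> {1..n}\<close> by blast
  next
    case (diff x y)
    then show ?case by (simp only: bracket_diff_right beta_diff bracket_minus_right[OF beta_closed beta_closed beta_closed])
  qed
next
  case (diff x y)
  then show ?case by (simp only: bracket_diff_left beta_diff bracket_minus_left[OF beta_closed beta_closed beta_closed])
qed

text \<open>Induction on terms: a bracket of two linear combinations is again one, by the formal
  bracket, so no genuine products remain.\<close>

lemma beta_surj:
  assumes "g \<in> carrier L" shows "\<exists>x \<in> V. beta x = g"
proof -
  have "\<exists>x \<in> V. beta x = cls t" if "t \<in> terms" for t
    using that
  proof (induction t)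
    case (Gen i)
    then have i: "i \<in> {1..n}" by (simp add: lie_terms_simps)
    show ?case by (rule bexI, rule beta_unit[OF i], rule unit_fun_int_vecs[OF i])
  next
    case Zero
    show ?case unfolding cls_Zero by (rule bexI, rule beta_zero, rule zero_int_vecs)
  next
    case (Neg t)
    then obtain x where x: "x \<in> V" "beta x = cls t" "t \<in> terms" by (auto simp: lie_terms_simps)
    have "beta (0 - x) = cls (Neg t)" using x by (simp only: beta_diff beta_zero cls_Neg) (simp add: minus_eq cls_closed)
    then show ?case using int_vecs_diff[OF zero_int_vecs x(1)] by blast
  next
    case (Plus s t)
    then obtain x y where x: "x \<in> V" "beta x = cls s" "s \<in> terms" and y: "y \<in> V" "beta y = cls t" "t \<in> terms"
      by (auto simp: lie_terms_simps)
    have "beta (x + y) = cls (Plus s t)" using x y by (simp only: beta_add cls_Plus)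
    then show ?case using int_vecs_add[OF x(1) y(1)] by blast
  next
    case (Bracket s t)
    then obtain x y where x: "x \<in> V" "beta x = cls s" "s \<in> terms" and y: "y \<in> V" "beta y = cls t" "t \<in> terms"
      by (auto simp: lie_terms_simps)
    have "beta (bracket x y) = cls (Bracket s t)" using x y by (simp only: beta_bracket cls_Bracket)
    then show ?case using bracket_vecs by blast
  qed
  then show ?thesis using assms unfolding L_eq presented_lie_ring_simps by blast
qed

lemma beta_eqI:
  assumes "x - b \<in> phi ` V" shows "beta x = beta b"
proof -
  obtain y where y: "y \<in> V" "x - b = phi y" using assms by blast
  have "x = b + phi y" unfolding y(2)[symmetric] by simp
  then have "beta x = beta b \<oplus> beta (phi y)" by (simp only: beta_add)
  then show ?thesis by (simp add: beta_phi[OF y(1)] beta_closed)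
qed

definition digit_vecs :: "(nat \<Rightarrow> int) set" where
  "digit_vecs = {b \<in> V. \<forall>i \<in> {1..n}. 0 \<le> b i \<and> b i < int p}"

lemma card_digit_vecs: "finite digit_vecs" "card digit_vecs \<le> p ^ n"
proof -
  let ?B = "{1..n} \<rightarrow>\<^sub>E {0..<int p}"
  have "digit_vecs \<subseteq> (\<lambda>b i. if i \<in> {1..n} then b i else 0) ` ?B"
  proof
    fix b assume b: "b \<in> digit_vecs"
    have "b i = (if i \<in> {1..n} then restrict b {1..n} i else 0)" for i
    proof (cases "i \<in> {1..n}")
      case False
      then have "b i = 0" using b unfolding digit_vecs_def int_vecs_def by blast
      then show ?thesis unfolding if_not_P[OF False] .
    qed simp
    then have "b = (\<lambda>i. if i \<in> {1..n} then restrict b {1..n} i else 0)" by (rule ext)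
    moreover have "restrict b {1..n} \<in> ?B" using b unfolding digit_vecs_def by simp
    ultimately show "b \<in> (\<lambda>b i. if i \<in> {1..n} then b i else 0) ` ?B" by (rule image_eqI)
  qed
  note sub = this
  have B: "finite ?B" "card ?B = p ^ n" by (simp_all add: finite_PiE card_PiE)
  show "finite digit_vecs" by (rule finite_subset[OF sub finite_imageI[OF B(1)]])
  have "card digit_vecs \<le> card ((\<lambda>b i. if i \<in> {1..n} then b i else 0) ` ?B)"
    by (rule card_mono[OF finite_imageI[OF B(1)] sub])
  also have "\<dots> \<le> p ^ n" using card_image_le[OF B(1)] unfolding B(2) .
  finally show "card digit_vecs \<le> p ^ n" .
qed

lemma digit_representative:
  assumes "x \<in> V" shows "\<exists>b \<in> digit_vecs. x - b \<in> phi ` V"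
  using phi_reduction[OF assms order_refl] by (auto simp: digit_vecs_def)

text \<open>Counting: every class has a digit representative, and there are at most
  \<open>p ^ n\<close> digit vectors for \<open>p ^ n\<close> elements, so no two of them can have
  the same image.\<close>

lemma inj_on_beta_digits: "inj_on beta digit_vecs"
proof -
  have "carrier L \<subseteq> beta ` digit_vecs"
  proof
    fix g assume "g \<in> carrier L"
    then obtain x where x: "x \<in> V" "beta x = g" using beta_surj by blast
    obtain b where "b \<in> digit_vecs" "x - b \<in> phi ` V" using digit_representative[OF x(1)] by blast
    then show "g \<in> beta ` digit_vecs" using beta_eqI x(2) by blast
  qed
  then have "p ^ n \<le> card (beta ` digit_vecs)"
    unfolding card_carrier[symmetric] by (rule card_mono[OF finite_imageI[OF card_digit_vecs(1)]])
  then have "card (beta ` digit_vecs) = card digit_vecs"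
    using card_digit_vecs(2) card_image_le[OF card_digit_vecs(1), of beta] by linarith
  then show ?thesis by (rule eq_card_imp_inj_on[OF card_digit_vecs(1)])
qed

text \<open>The zero vector is itself a digit vector, so a vector in the kernel of
  \<open>beta\<close> has 0 as its digit representative.\<close>

lemma beta_zero_iff:
  assumes x: "x \<in> V"
  shows "beta x = \<zero> \<longleftrightarrow> x \<in> phi ` V"
proof
  assume "beta x = \<zero>"
  obtain b where b: "b \<in> digit_vecs" "x - b \<in> phi ` V" using digit_representative[OF x] by blast
  have "beta b = beta 0" 
    by (rule HOL.trans[OF HOL.trans[OF beta_eqI[OF b(2), symmetric] \<open>beta x = \<zero>\<close>] beta_zero[symmetric]])
  moreover have "0 \<in> digit_vecs"
    unfolding digit_vecs_def using zero_int_vecs p_pos by (intro CollectI conjI ballI) simp_all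
  ultimately have "b = 0" by (rule inj_onD[OF inj_on_beta_digits _ b(1)])
  then show "x \<in> phi ` V" using b(2) by (simp only: diff_zero)
next
  assume "x \<in> phi ` V"
  then obtain y where y: "x = phi y" "y \<in> V" by (rule imageE)
  show "beta x = \<zero>" unfolding y(1) by (rule beta_phi[OF y(2)])
qed

text \<open>Both terms die under \<open>beta\<close>. At a single point the consistency relations
  are known only in this weak form, modulo the image of \<open>phi\<close>.\<close>

lemma central_in_phi_image:
  assumes "x \<in> V" "y \<in> V"
  shows "phi (bracket x y) - bracket (phi x) y \<in> phi ` V"
proof -
  have "beta (phi (bracket x y) - bracket (phi x) y) = \<zero> \<ominus> \<zero> \<otimes> beta y"
    by (simp only: beta_diff beta_phi[OF bracket_vecs] beta_bracket[OF phi_vecs[OF assms(1)] assms(2)] beta_phi[OF assms(1)])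
  also have "\<dots> = \<zero>" by (simp add: bracket_zero_left beta_closed minus_eq)
  finally show ?thesis
    by (subst beta_zero_iff[symmetric]) (intro int_vecs_diff phi_vecs bracket_vecs)
qed

lemma jacobi_in_phi_image:
  assumes "x \<in> V" "y \<in> V" "z \<in> V"
  shows "bracket x (bracket y z) + bracket y (bracket z x) + bracket z (bracket x y) \<in> phi ` V"
proof -
  have "beta (bracket x (bracket y z) + bracket y (bracket z x) + bracket z (bracket x y)) = \<zero>"
    by (simp only: beta_add beta_bracket assms bracket_vecs jacobi beta_closed)
  then show ?thesis
    by (subst beta_zero_iff[symmetric]) (intro int_vecs_add bracket_vecs)
qed

end

declare One_nat_def [simp]

section \<open>Consistency relations as polynomial identities\<close>

context lie_coefficients
begin

text \<open>If the coordinates of \<open>phi y\<close> below \<open>l\<close> vanish, so do those of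
  \<open>y\<close> by triangularity, and coordinate \<open>l\<close> of \<open>phi y\<close> is just
  \<open>p y_l\<close>.\<close>

lemma phi_leading:
  assumes z: "\<And>k. k < l \<Longrightarrow> phi y k = 0"
  shows "int p dvd phi y l"
proof -
  have q0: "(\<Sum>j = 1..n. y j * q j k) = 0" if "\<And>j. j < k \<Longrightarrow> y j = 0" for k
  proof (rule sum.neutral, rule ballI)
    fix j
    show "y j * q j k = 0"
    proof (cases "q j k = 0")
      case False
      have "j < k" using q_support[OF False] by simp
      then show ?thesis using that by simp
    qed simp
  qed
  have y0: "k < l \<longrightarrow> y k = 0" for k
  proof (induction k rule: less_induct)
    case (less k)
    show ?case
    proof
      assume k: "k < l"
      have "y j = 0" if "j < k" for j using less[OF that] that k by simp
      then have "(\<Sum>j = 1..n. y j * q j k) = 0" by (rule q0)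
      then have "int p * y k = 0" using z[OF k] unfolding phi_def by simp
      then show "y k = 0" using p_pos by simp
    qed
  qed
  have "(\<Sum>j = 1..n. y j * q j l) = 0" by (rule q0) (use y0 in blast)
  then have "phi y l = int p * y l" unfolding phi_def by simp
  then show ?thesis by simp
qed

lemma bracket_unit_left:
  assumes i: "i \<in> {1..n}"
  shows "bracket (unit_fun i) y l = (\<Sum>k = 1..n. y k * a i k l)"
proof -
  have "bracket (unit_fun i) y l = (\<Sum>k = 1..n. if k = i then (\<Sum>j = 1..n. y j * a i j l) else 0)"
    unfolding bracket_def by (rule sum.cong) (auto simp: unit_fun_def)
  then show ?thesis using i by simp
qed

lemma bracket_unit_right:
  assumes j: "j \<in> {1..n}"
  shows "bracket x (unit_fun j) l = (\<Sum>k = 1..n. x k * a k j l)"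
  unfolding bracket_def
proof (rule sum.cong[OF HOL.refl])
  fix i
  have "(\<Sum>k = 1..n. x i * unit_fun j k * a i k l) = (\<Sum>k = 1..n. if k = j then x i * a i j l else 0)"
    by (rule sum.cong) (auto simp: unit_fun_def)
  then show "(\<Sum>k = 1..n. x i * unit_fun j k * a i k l) = x i * a i j l" using j by simp
qed

definition jacobi_sum :: "(nat \<Rightarrow> int) \<Rightarrow> (nat \<Rightarrow> int) \<Rightarrow> (nat \<Rightarrow> int) \<Rightarrow> nat \<Rightarrow> int" where
  "jacobi_sum x y z = bracket x (bracket y z) + bracket y (bracket z x) + bracket z (bracket x y)"

definition central_difference :: "(nat \<Rightarrow> int) \<Rightarrow> (nat \<Rightarrow> int) \<Rightarrow> nat \<Rightarrow> int" where
  "central_difference x y = phi (bracket x y) - bracket (phi x) y"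

lemma jacobi_sum_unit:
  assumes "i \<in> {1..n}" "j \<in> {1..n}" "h \<in> {1..n}"
  shows "jacobi_sum (unit_fun i) (unit_fun j) (unit_fun h) l =
    (\<Sum>k = 1..n. a j h k * a i k l + a h i k * a j k l + a i j k * a h k l)"
  unfolding jacobi_sum_def plus_fun_apply
    bracket_unit[OF assms(2,3)] bracket_unit[OF assms(3,1)] bracket_unit[OF assms(1,2)]
  unfolding bracket_unit_left[OF assms(1)] bracket_unit_left[OF assms(2)] bracket_unit_left[OF assms(3)]
  by (simp only: sum.distrib)

text \<open>The two occurrences of \<open>p a_ijl\<close> cancel. What remains is an expression in
  the coefficients alone, hence the evaluation of a polynomial in which \<open>p\<close> does not
  occur, as the vanishing criterion requires.\<close>

lemma central_difference_unit:
  assumes i: "i \<in> {1..n}" and j: "j \<in> {1..n}"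
  shows "central_difference (unit_fun i) (unit_fun j) l = (\<Sum>k = 1..n. q i k * a k j l - a i j k * q k l)"
proof -
  have "(\<Sum>k = 1..n. int p * unit_fun i k * a k j l) = (\<Sum>k = 1..n. if k = i then int p * a i j l else 0)"
    by (rule sum.cong) (auto simp: unit_fun_def)
  then have "(\<Sum>k = 1..n. int p * unit_fun i k * a k j l) = int p * a i j l" using i by simp
  then have "bracket (phi (unit_fun i)) (unit_fun j) l = int p * a i j l - (\<Sum>k = 1..n. q i k * a k j l)"
    unfolding bracket_unit_right[OF j] phi_unit[OF i] by (simp add: left_diff_distrib sum_subtractf)
  moreover have "phi (bracket (unit_fun i) (unit_fun j)) l = int p * a i j l - (\<Sum>k = 1..n. a i j k * q k l)"
    unfolding bracket_unit[OF i j] phi_def ..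
  ultimately show ?thesis by (simp add: central_difference_def sum_subtractf)
qed

lemma jacobi_sum_diff: "jacobi_sum (x - y) z w = jacobi_sum x z w - jacobi_sum y z w"
   "jacobi_sum z (x - y) w = jacobi_sum z x w - jacobi_sum z y w"
   "jacobi_sum z w (x - y) = jacobi_sum z w x - jacobi_sum z w y"
  unfolding jacobi_sum_def bracket_diff_left bracket_diff_right by (rule ext, simp add: plus_fun_apply)+

lemma jacobi_sum_zero: "jacobi_sum 0 z w = 0" "jacobi_sum z 0 w = 0" "jacobi_sum z w 0 = 0"
  unfolding jacobi_sum_def bracket_zero by (rule ext, simp add: plus_fun_apply)+

lemma jacobi_sum_eq_0:
  assumes unit: "\<And>i j h. i \<in> {1..n} \<Longrightarrow> j \<in> {1..n} \<Longrightarrow> h \<in> {1..n} \<Longrightarrow>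
      jacobi_sum (unit_fun i) (unit_fun j) (unit_fun h) = 0"
    and x: "x \<in> int_vecs n" and y: "y \<in> int_vecs n" and z: "z \<in> int_vecs n"
  shows "jacobi_sum x y z = 0"
proof -
  have 1: "jacobi_sum (unit_fun i) (unit_fun j) z = 0" if "i \<in> {1..n}" "j \<in> {1..n}" for i j
    using z by (induction rule: int_vecs_induct)
      (simp_all only: jacobi_sum_zero jacobi_sum_diff unit that diff_self)
  have 2: "jacobi_sum (unit_fun i) y z = 0" if "i \<in> {1..n}" for i
    using y by (induction rule: int_vecs_induct)
      (simp_all only: jacobi_sum_zero jacobi_sum_diff 1 that diff_self)
  show ?thesis
    using x by (induction rule: int_vecs_induct)
      (simp_all only: jacobi_sum_zero jacobi_sum_diff 2 diff_self)
qed

lemma central_difference_diff: "central_difference (x - y) z = central_difference x z - central_difference y z"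
   "central_difference z (x - y) = central_difference z x - central_difference z y"
  unfolding central_difference_def bracket_diff_left bracket_diff_right phi_diff by (rule ext, simp)+

lemma central_difference_zero: "central_difference 0 z = 0" "central_difference z 0 = 0"
  unfolding central_difference_def bracket_zero phi_zero by simp_all

lemma central_difference_eq_0:
  assumes unit: "\<And>i j. i \<in> {1..n} \<Longrightarrow> j \<in> {1..n} \<Longrightarrow> central_difference (unit_fun i) (unit_fun j) = 0"
    and x: "x \<in> int_vecs n" and y: "y \<in> int_vecs n"
  shows "central_difference x y = 0"
proof -
  have 1: "central_difference (unit_fun i) y = 0" if "i \<in> {1..n}" for i
    using y by (induction rule: int_vecs_induct)
      (simp_all only: central_difference_zero central_difference_diff unit that diff_self)
  show ?thesis
    using x by (induction rule: int_vecs_induct)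
      (simp_all only: central_difference_zero central_difference_diff 1 diff_self)
qed

end

text \<open>Induction on the coordinate: once the earlier polynomials are identically 0, the
  conditional divisibility becomes unconditional at every prime and every point.\<close>

lemma vanishing_family:
  fixes F :: "nat \<Rightarrow> mpoly"
  assumes PS: "infinite PS" "\<forall>p \<in> PS. prime p" and F: "\<And>l. F l \<in> S_ring m"
    and dvd: "\<And>p w x l. p \<in> PS \<Longrightarrow> w \<in> primitive_roots p \<Longrightarrow> x \<in> Zp_tuples p m \<Longrightarrow>
      (\<And>k. k < l \<Longrightarrow> mpoly_eval (point w x) (F k) = 0) \<Longrightarrow> int p dvd mpoly_eval (point w x) (F l)"
  shows "F l = 0"
proof (induction l rule: less_induct)
  case (less l)
  have "int p dvd mpoly_eval (point w x) (F l)" if "p \<in> PS" "w \<in> primitive_roots p" "x \<in> Zp_tuples p m" for p w x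
    by (rule dvd[OF that]) (simp only: less mpoly_eval_zero)
  then show ?case using vanishing_mpoly[OF F] PS by blast
qed

locale symbolic_presentation =
  fixes n m :: nat and PS :: "nat set" and A :: "mpoly coefficients"
  assumes sym: "symbolic_nilpotent_presentation n m PS A" and inf: "infinite PS"
begin

abbreviation "B w x \<equiv> evaluated_coefficients w x A"
abbreviation "ev_ring p w x \<equiv> presentation_ring n p (B w x)"

lemma coeffs: "presentation_coefficients n A"
  and bracket_S: "bracket_coeff A i j k \<in> S_ring m" and power_S: "power_coeff A i k \<in> S_ring m"
  and primes: "p \<in> PS \<Longrightarrow> prime p"
  using sym unfolding symbolic_nilpotent_presentation_def by blast+

lemma evaluated_simps:
  "bracket_coeff (B w x) i j k = mpoly_eval (point w x) (bracket_coeff A i j k)"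
  "power_coeff (B w x) i k = mpoly_eval (point w x) (power_coeff A i k)"
  by (simp_all add: evaluated_coefficients_def map_coefficients_def)

lemma evaluated_presentation_coefficients: "presentation_coefficients n (B w x)"
proof -
  have A: "\<And>i k. power_coeff A i k \<noteq> 0 \<Longrightarrow> 1 \<le> i \<and> i < k \<and> k \<le> n"
    "\<And>i j k. i < j \<Longrightarrow> bracket_coeff A i j k \<noteq> 0 \<Longrightarrow> 1 \<le> i \<and> j < k \<and> k \<le> n"
    "\<And>i k. bracket_coeff A i i k = 0" "\<And>i j k. bracket_coeff A j i k = - bracket_coeff A i j k"
    using coeffs unfolding presentation_coefficients_def by blast+
  have nz: "f \<noteq> 0" if "mpoly_eval (point w x) f \<noteq> 0" for f
    using that by (auto simp: mpoly_eval_zero)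
  show ?thesis
    unfolding presentation_coefficients_def evaluated_simps
  proof (intro conjI allI impI)
    fix i k assume "mpoly_eval (point w x) (power_coeff A i k) \<noteq> 0"
    from A(1)[OF nz[OF this]] show "1 \<le> i" "i < k" "k \<le> n" by simp_all
  next
    fix i j k assume "i < j \<and> mpoly_eval (point w x) (bracket_coeff A i j k) \<noteq> 0"
    then have "i < j" "mpoly_eval (point w x) (bracket_coeff A i j k) \<noteq> 0" by simp_all
    from A(2)[OF this(1) nz[OF this(2)]] show "1 \<le> i" "j < k" "k \<le> n" by simp_all
  next
    fix i k show "mpoly_eval (point w x) (bracket_coeff A i i k) = 0" by (simp only: A(3) mpoly_eval_zero)
  next
    fix i j k show "mpoly_eval (point w x) (bracket_coeff A j i k) = - mpoly_eval (point w x) (bracket_coeff A i j k)"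
      unfolding A(4)[where j = j and i = i] by (rule mpoly_eval_uminus)
  qed
qed

context
  fixes p w x
  assumes pwx: "p \<in> PS" "w \<in> primitive_roots p" "x \<in> Zp_tuples p m"
begin

lemma presented_lie: "presented_lie n p (B w x) (ev_ring p w x)"
proof (intro presented_lie.intro lie_coefficients.intro presented_lie_axioms.intro)
  show "presentation_coefficients n (B w x)" by (rule evaluated_presentation_coefficients)
  show "0 < p" using primes[OF pwx(1)] by (rule prime_gt_0_nat)
  have "nilpotent_lie_ring (ev_ring p w x) \<and> card (carrier (ev_ring p w x)) = p ^ n"
    using sym pwx unfolding symbolic_nilpotent_presentation_def by blast
  then show "lie_ring (ev_ring p w x)" "card (carrier (ev_ring p w x)) = p ^ n"
    by (simp_all add: nilpotent_lie_ring_def)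
qed simp

end

text \<open>At each admissible point the family evaluates to a Jacobi sum and so to some
  \<open>phi y\<close>; \<open>phi_leading\<close> then supplies the divisibility asked for by
  \<open>vanishing_family\<close>.\<close>

lemma jacobi_polynomial:
  assumes ijh: "i \<in> {1..n}" "j \<in> {1..n}" "h \<in> {1..n}"
  shows "(\<Sum>k = 1..n. bracket_coeff A j h k * bracket_coeff A i k l + bracket_coeff A h i k * bracket_coeff A j k l
     + bracket_coeff A i j k * bracket_coeff A h k l) = 0" (is "?F l = 0")
proof (rule vanishing_family[where F = ?F and m = m, OF inf])
  show "\<forall>p\<in>PS. prime p" using primes by blast
  show "?F l \<in> S_ring m" for l by (intro S_ring_sum S_ring_add S_ring_mult bracket_S)
next
  fix p w x l assume pwx: "p \<in> PS" "w \<in> primitive_roots p" "x \<in> Zp_tuples p m"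
    and z: "\<And>k. k < l \<Longrightarrow> mpoly_eval (point w x) (?F k) = 0"
  interpret P: presented_lie n p "B w x" "ev_ring p w x" by (rule presented_lie[OF pwx])
  have eval: "mpoly_eval (point w x) (?F l) = P.jacobi_sum (unit_fun i) (unit_fun j) (unit_fun h) l" for l
    unfolding P.jacobi_sum_unit[OF ijh] by (simp only: mpoly_eval_sum mpoly_eval_add mpoly_eval_mult evaluated_simps)
  have "P.jacobi_sum (unit_fun i) (unit_fun j) (unit_fun h) \<in> P.phi ` int_vecs n"
    unfolding P.jacobi_sum_def by (intro P.jacobi_in_phi_image unit_fun_int_vecs ijh)
  then obtain y where y: "P.jacobi_sum (unit_fun i) (unit_fun j) (unit_fun h) = P.phi y" by (rule imageE)
  show "int p dvd mpoly_eval (point w x) (?F l)"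
    unfolding eval y by (rule P.phi_leading) (use z in \<open>simp only: eval y\<close>)
qed

lemma central_polynomial:
  assumes ij: "i \<in> {1..n}" "j \<in> {1..n}"
  shows "(\<Sum>k = 1..n. power_coeff A i k * bracket_coeff A k j l - bracket_coeff A i j k * power_coeff A k l) = 0"
    (is "?F l = 0")
proof (rule vanishing_family[where F = ?F and m = m, OF inf])
  show "\<forall>p\<in>PS. prime p" using primes by blast
  show "?F l \<in> S_ring m" for l by (intro S_ring_sum S_ring_diff S_ring_mult bracket_S power_S)
next
  fix p w x l assume pwx: "p \<in> PS" "w \<in> primitive_roots p" "x \<in> Zp_tuples p m"
    and z: "\<And>k. k < l \<Longrightarrow> mpoly_eval (point w x) (?F k) = 0"
  interpret P: presented_lie n p "B w x" "ev_ring p w x" by (rule presented_lie[OF pwx])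
  have eval: "mpoly_eval (point w x) (?F l) = P.central_difference (unit_fun i) (unit_fun j) l" for l
    unfolding P.central_difference_unit[OF ij] by (simp only: mpoly_eval_sum mpoly_eval_diff mpoly_eval_mult evaluated_simps)
  have "P.central_difference (unit_fun i) (unit_fun j) \<in> P.phi ` int_vecs n"
    unfolding P.central_difference_def by (intro P.central_in_phi_image unit_fun_int_vecs ij)
  then obtain y where y: "P.central_difference (unit_fun i) (unit_fun j) = P.phi y" by (rule imageE)
  show "int p dvd mpoly_eval (point w x) (?F l)"
    unfolding eval y by (rule P.phi_leading) (use z in \<open>simp only: eval y\<close>)
qed

text \<open>Polynomial identities evaluate to identities between integers, which sharpens the
  congruences known for the presented ring to the exact laws of the model.\<close>

lemma lie_model:
  assumes pwx: "p \<in> PS" "w \<in> primitive_roots p" "x \<in> Zp_tuples p m"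
  shows "\<exists>beta. lie_model n p (B w x) (ev_ring p w x) beta"
proof -
  interpret P: presented_lie n p "B w x" "ev_ring p w x" by (rule presented_lie[OF pwx])
  have jac: "P.jacobi_sum (unit_fun i) (unit_fun j) (unit_fun h) = 0"
    if "i \<in> {1..n}" "j \<in> {1..n}" "h \<in> {1..n}" for i j h
  proof (rule ext)
    fix l
    have "P.jacobi_sum (unit_fun i) (unit_fun j) (unit_fun h) l = mpoly_eval (point w x) 0"
      unfolding P.jacobi_sum_unit[OF that] jacobi_polynomial[OF that, of l, symmetric]
      by (simp only: mpoly_eval_sum mpoly_eval_add mpoly_eval_mult evaluated_simps)
    then show "P.jacobi_sum (unit_fun i) (unit_fun j) (unit_fun h) l = 0 l" by (simp add: mpoly_eval_zero)
  qed
  have cen: "P.central_difference (unit_fun i) (unit_fun j) = 0" if "i \<in> {1..n}" "j \<in> {1..n}" for i j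
  proof (rule ext)
    fix l
    have "P.central_difference (unit_fun i) (unit_fun j) l = mpoly_eval (point w x) 0"
      unfolding P.central_difference_unit[OF that] central_polynomial[OF that, of l, symmetric]
      by (simp only: mpoly_eval_sum mpoly_eval_diff mpoly_eval_mult evaluated_simps)
    then show "P.central_difference (unit_fun i) (unit_fun j) l = 0 l" by (simp add: mpoly_eval_zero)
  qed
  have "lie_model n p (B w x) (ev_ring p w x) P.beta"
  proof (intro lie_model.intro lie_model_axioms.intro)
    show "lie_coefficients n p (B w x)" "lie_ring (ev_ring p w x)"
      by (rule P.lie_coefficients_axioms, rule P.lie_ring_axioms)
    show "P.phi (P.bracket x y) = P.bracket (P.phi x) y" if "x \<in> int_vecs n" "y \<in> int_vecs n" for x y
      using P.central_difference_eq_0[OF cen that] unfolding P.central_difference_def by (simp only: right_minus_eq)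
    show "P.bracket x (P.bracket y z) + P.bracket y (P.bracket z x) + P.bracket z (P.bracket x y) = 0"
      if "x \<in> int_vecs n" "y \<in> int_vecs n" "z \<in> int_vecs n" for x y z
      using P.jacobi_sum_eq_0[OF jac that] unfolding P.jacobi_sum_def .
  qed (rule P.beta_closed P.beta_diff P.beta_surj P.beta_zero_iff P.beta_bracket; assumption?)+
  then show ?thesis by (rule exI[of _ P.beta])
qed

end

section \<open>Torsion\<close>

context lie_coefficients
begin

text \<open>\<open>p x\<close> is \<open>phi x\<close> plus a vector whose support starts at least
  one place later. So \<open>d\<close> counts the trailing coordinates that may be non-zero, and
  each of them costs one factor \<open>p\<close>.\<close>

lemma prime_power_multiple_in_phi_image:
  assumes "d \<le> n" "x \<in> int_vecs n" "\<And>j. j \<le> n - d \<Longrightarrow> x j = 0"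
  shows "(\<lambda>l. int p ^ d * x l) \<in> phi ` int_vecs n"
  using assms
proof (induction d arbitrary: x)
  case 0
  have "x j = 0" for j
  proof (cases "j \<le> n")
    case False
    then show ?thesis using 0(2) unfolding int_vecs_def by force
  qed (use 0(3) in simp)
  then have "(\<lambda>l. int p ^ 0 * x l) = 0" by (intro ext) simp
  then show ?case by (simp only: phi_image_zero)
next
  case (Suc d)
  define y where "y = (\<lambda>l. int p * x l) - phi x"
  have y: "y l = (\<Sum>k = 1..n. x k * q k l)" for l by (simp add: y_def phi_def)
  have yV: "y \<in> int_vecs n" unfolding y_def by (intro int_vecs_diff scaled_int_vecs phi_vecs Suc.prems)
  have "(\<lambda>l. int p ^ d * y l) \<in> phi ` int_vecs n"
  proof (rule Suc.IH[OF _ yV])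
    show "d \<le> n" using Suc.prems by simp
    fix j assume j: "j \<le> n - d"
    show "y j = 0" unfolding y
    proof (rule sum.neutral, rule ballI)
      fix k
      show "x k * q k j = 0"
      proof (cases "q k j = 0")
        case False
        have "k < j" using q_support[OF False] by simp
        then have "k \<le> n - Suc d" using j by simp
        then show ?thesis using Suc.prems(3) by simp
      qed simp
    qed
  qed
  moreover have "phi (\<lambda>l. int p ^ d * x l) \<in> phi ` int_vecs n"
    by (intro imageI scaled_int_vecs Suc.prems)
  ultimately have "(\<lambda>l. int p ^ d * y l) + phi (\<lambda>l. int p ^ d * x l) \<in> phi ` int_vecs n" by (rule phi_image_add)
  moreover have "(\<lambda>l. int p ^ d * y l) + phi (\<lambda>l. int p ^ d * x l) = (\<lambda>l. int p ^ Suc d * x l)"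
    unfolding phi_scaled by (rule ext) (simp add: y_def plus_fun_apply algebra_simps)
  ultimately show ?case by (simp only:)
qed

lemma theta_scaled: "theta (\<lambda>e. k * c e) = (\<lambda>l. k * theta c l)"
proof -
  have "delta (\<lambda>e. k * c e) l = k * delta c l" for l
    unfolding delta_def sum_distrib_left by (intro sum.cong) auto
  then show ?thesis unfolding theta_def phi_scaled by (intro ext) (simp add: right_diff_distrib)
qed

end

context lie_model
begin

text \<open>Write \<open>p ^ n\<close> times the i-th generator as \<open>phi z\<close>; the central
  row of \<open>z\<close> and the j-th generator then exchanges \<open>p ^ n\<close> times
  \<open>t_ij\<close> for an \<open>s\<close>-part.\<close>

lemma multiple_congruent_s_part:
  assumes "c \<in> tail_funs"
  shows "\<exists>v \<in> V. (\<lambda>e. int p ^ n * c e) - s_part v \<in> row_span"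
  using assms
proof (induction rule: tail_funs_induct)
  case zero
  have "(\<lambda>e. int p ^ n * (0 :: tail \<Rightarrow> int) e) - s_part 0 = 0" unfolding s_part_zero by (rule ext) simp
  then show ?case using row_span_zero by (intro bexI[OF _ zero_int_vecs]) (simp only:)
next
  case (wedge i j)
  have "(\<lambda>l. int p ^ n * unit_fun i l) \<in> phi ` V"
    by (rule prime_power_multiple_in_phi_image[OF order_refl unit_fun_int_vecs[OF wedge(1)]])
      (use wedge(1) in \<open>simp add: unit_fun_def\<close>)
  then obtain z where z: "(\<lambda>l. int p ^ n * unit_fun i l) = phi z" "z \<in> V" by (rule imageE)
  have "(\<lambda>e. int p ^ n * wedge (unit_fun i) (unit_fun j) e) = wedge (phi z) (unit_fun j)"
    unfolding z(1)[symmetric] by (rule ext) (simp add: wedge_def algebra_simps split: tail.split)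
  also have "\<dots> = central_row z (unit_fun j) - s_part (bracket z (unit_fun j))"
    unfolding central_row_def by (simp only: add_diff_cancel_right')
  finally have "(\<lambda>e. int p ^ n * wedge (unit_fun i) (unit_fun j) e) - s_part (0 - bracket z (unit_fun j)) =
      central_row z (unit_fun j)"
    by (simp only: s_part_diff s_part_zero) simp
  then show ?case using central_row_in_span[OF z(2) unit_fun_int_vecs[OF wedge(2)]]
    by (intro bexI[OF _ int_vecs_diff[OF zero_int_vecs bracket_vecs[of z "unit_fun j"]]]) (simp only:)
next
  case (s_part i)
  have "(\<lambda>e. int p ^ n * s_part (unit_fun i) e) - s_part (\<lambda>l. int p ^ n * unit_fun i l) = 0"
    by (rule ext) (simp add: s_part_def split: tail.split)
  then show ?case using row_span_zero
    by (intro bexI[OF _ scaled_int_vecs[OF unit_fun_int_vecs[OF s_part], of "int p ^ n"]]) (simp only:)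
next
  case (diff c d)
  then obtain v w where v: "v \<in> V" "(\<lambda>e. int p ^ n * c e) - s_part v \<in> row_span"
    and w: "w \<in> V" "(\<lambda>e. int p ^ n * d e) - s_part w \<in> row_span" by (elim bexE) (rule that)
  have "(\<lambda>e. int p ^ n * (c - d) e) - s_part (v - w) =
      ((\<lambda>e. int p ^ n * c e) - s_part v) - ((\<lambda>e. int p ^ n * d e) - s_part w)"
    unfolding s_part_diff by (rule ext) (simp add: algebra_simps)
  then show ?case using row_span_diff[OF v(2) w(2)]
    by (intro bexI[OF _ int_vecs_diff[OF v(1) w(1)]]) (simp only:)
qed

lemma scaled_cycles: "c \<in> cycles \<Longrightarrow> (\<lambda>e. k * c e) \<in> cycles"
  by (rule diff_closed_mult[of "\<lambda>c. c \<in> cycles", OF cycles_zero cycles_diff])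

text \<open>The \<open>s\<close>-part left over by the congruence is a difference of cycles, so
  \<open>phi\<close> kills it and it is 0.\<close>

lemma prime_power_multiple_in_row_span:
  assumes c: "c \<in> cycles"
  shows "(\<lambda>e. int p ^ n * c e) \<in> row_span"
proof -
  have "c \<in> tail_funs" using c by (simp add: cycles_def)
  from multiple_congruent_s_part[OF this]
  obtain v where v: "v \<in> V" "(\<lambda>e. int p ^ n * c e) - s_part v \<in> row_span" by (elim bexE) (rule that)
  have "(\<lambda>e. int p ^ n * c e) - ((\<lambda>e. int p ^ n * c e) - s_part v) \<in> cycles"
    by (rule cycles_diff[OF scaled_cycles[OF c] row_span_cycles[OF v(2)]])
  then have "theta (s_part v) = 0" by (simp add: cycles_def del: minus_apply)
  then have "phi v = 0" unfolding theta_s_part by (simp only: neg_equal_0_iff_equal)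
  then have "v = 0" by (rule phi_inj[OF v(1)])
  then show ?thesis using v(2) by (simp only: s_part_zero diff_zero)
qed

text \<open>The values of \<open>theta\<close> lie in a torsion-free group. Together with the
  preceding lemma this makes the cycles the saturation of the row span.\<close>

lemma cycles_of_multiple:
  assumes c: "c \<in> tail_funs" and k: "k \<noteq> 0" "(\<lambda>e. k * c e) \<in> row_span"
  shows "c \<in> cycles"
proof -
  have "theta (\<lambda>e. k * c e) = 0"
    using row_span_cycles[OF k(2)] by (simp add: cycles_def)
  then have "(\<lambda>l. k * theta c l) = 0" unfolding theta_scaled .
  from fun_cong[OF this] have "theta c l = 0" for l using k(1) by simp
  then have "theta c = 0" by (intro ext) simp
  then show ?thesis using c by (simp add: cycles_def)
qed

end

section \<open>Abelian invariants from the Smith normal form\<close>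

lemma distinct_concat_map:
  assumes "distinct xs" "\<And>x. x \<in> set xs \<Longrightarrow> distinct (f x)"
    "\<And>x y. x \<in> set xs \<Longrightarrow> y \<in> set xs \<Longrightarrow> x \<noteq> y \<Longrightarrow> set (f x) \<inter> set (f y) = {}"
  shows "distinct (concat (map f xs))"
  using assms
proof (induction xs)
  case (Cons x xs)
  have "set (f x) \<inter> set (f y) = {}" if "y \<in> set xs" for y
    by (rule Cons.prems(3)) (use Cons.prems(1) that in auto)
  then have "set (f x) \<inter> set (concat (map f xs)) = {}" by auto
  moreover have "distinct (concat (map f xs))" by (rule Cons.IH) (use Cons.prems in auto)
  ultimately show ?case using Cons.prems(2)[of x] by simp
qed simp

lemma distinct_tails: "distinct (tails n)"
proof -
  have "distinct (concat (map (\<lambda>i. map (\<lambda>j. T i j) [Suc i..<Suc n]) [1..<Suc n]))"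
    by (rule distinct_concat_map) (auto simp: distinct_map inj_on_def simp del: upt_Suc)
  then show ?thesis unfolding tails_def
    by (auto simp: distinct_map inj_on_def simp del: upt_Suc)
qed

lemma row_mult_diagonal:
  fixes G D :: "int mat"
  assumes "G \<in> carrier_mat 1 r" "D \<in> carrier_mat r c" "diagonal_mat D" "i < c"
  shows "(G * D) $$ (0, i) = (if i < r then G $$ (0, i) * D $$ (i, i) else 0)"
proof -
  have "(G * D) $$ (0, i) = (\<Sum>t = 0..<r. G $$ (0, t) * D $$ (t, i))"
    using assms(1,2,4) by (auto simp: scalar_prod_def)
  also have "\<dots> = (\<Sum>t = 0..<r. if t = i then G $$ (0, i) * D $$ (i, i) else 0)"
    by (rule sum.cong) (use assms in \<open>auto simp: diagonal_mat_def\<close>)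
  finally show ?thesis by simp
qed

locale smith_model = lie_model n p A L beta
  for n p A and L (structure) and beta +
  fixes D :: "int mat"
  assumes p_prime: "prime p" and snf: "int_smith_normal_form (Mat n (int p) A) D"
begin

abbreviation "n_rows \<equiv> length (Mat_rows n (int p) A)"
abbreviation "n_cols \<equiv> length (tails n)"
abbreviation "M \<equiv> Mat n (int p) A"

lemma M_carrier: "M \<in> carrier_mat n_rows n_cols"
  by (simp add: Mat_def)

lemma M_entry: "r < n_rows \<Longrightarrow> j < n_cols \<Longrightarrow> M $$ (r, j) = (Mat_rows n (int p) A ! r) (tails n ! j)"
  by (simp add: Mat_def)

definition transforms :: "int mat \<Rightarrow> int mat \<Rightarrow> int mat \<Rightarrow> int mat \<Rightarrow> bool" where
  "transforms U U' W W' \<longleftrightarrow> U \<in> carrier_mat n_rows n_rows \<and> U' \<in> carrier_mat n_rows n_rows \<and>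
    W \<in> carrier_mat n_cols n_cols \<and> W' \<in> carrier_mat n_cols n_cols \<and> U' * U = 1\<^sub>m n_rows \<and>
    W * W' = 1\<^sub>m n_cols \<and> W' * W = 1\<^sub>m n_cols \<and> D = U * M * W"

lemma transforms_exist: "\<exists>U U' W W'. transforms U U' W W'"
proof -
  obtain U W where U: "U \<in> carrier_mat n_rows n_rows" "invertible_mat U"
    and W: "W \<in> carrier_mat n_cols n_cols" "invertible_mat W" and D: "D = U * M * W"
    using snf M_carrier unfolding int_smith_normal_form_def by auto
  obtain U' where U': "U' \<in> carrier_mat n_rows n_rows" "U' * U = 1\<^sub>m n_rows"
    using invertible_matE[OF U(2,1)] by metis
  obtain W' where W': "W' \<in> carrier_mat n_cols n_cols" "W * W' = 1\<^sub>m n_cols" "W' * W = 1\<^sub>m n_cols"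
    using invertible_matE[OF W(2,1)] by metis
  show ?thesis
    unfolding transforms_def by (intro exI conjI) (rule U(1) U'(1) W(1) W'(1) U'(2) W'(2) W'(3) D)+
qed

text \<open>The four matrices are picked successively by choice, so that they are constants shared
  by all lemmas about the given \<open>D\<close>.\<close>

definition left_mat where "left_mat = (SOME U. \<exists>U' W W'. transforms U U' W W')"
definition left_inv where "left_inv = (SOME U'. \<exists>W W'. transforms left_mat U' W W')"
definition right_mat where "right_mat = (SOME W. \<exists>W'. transforms left_mat left_inv W W')"
definition right_inv where "right_inv = (SOME W'. transforms left_mat left_inv right_mat W')"

lemma transforms: "transforms left_mat left_inv right_mat right_inv"
proof -
  have "\<exists>U' W W'. transforms left_mat U' W W'" unfolding left_mat_def by (rule someI_ex[OF transforms_exist])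
  then have "\<exists>W W'. transforms left_mat left_inv W W'" unfolding left_inv_def by (rule someI_ex)
  then have "\<exists>W'. transforms left_mat left_inv right_mat W'" unfolding right_mat_def by (rule someI_ex)
  then show ?thesis unfolding right_inv_def by (rule someI_ex)
qed

lemma mats: "left_mat \<in> carrier_mat n_rows n_rows" "left_inv \<in> carrier_mat n_rows n_rows"
  "right_mat \<in> carrier_mat n_cols n_cols" "right_inv \<in> carrier_mat n_cols n_cols"
  "left_inv * left_mat = 1\<^sub>m n_rows" "right_mat * right_inv = 1\<^sub>m n_cols" "right_inv * right_mat = 1\<^sub>m n_cols"
  "D = left_mat * M * right_mat"
  using transforms unfolding transforms_def by - ((elim conjE, assumption)+)

lemma D_carrier: "D \<in> carrier_mat n_rows n_cols"
  by (rule HOL.ssubst[OF mats(8), of "\<lambda>E. E \<in> carrier_mat n_rows n_cols"])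
    (rule mult_carrier_mat[OF mult_carrier_mat[OF mats(1) M_carrier] mats(3)])

lemma D_diagonal: "diagonal_mat D"
  using snf unfolding int_smith_normal_form_def smith_shape_def by blast

text \<open>The diagonal padded by zeros up to the number of columns; a zero marks a coordinate in
  which the row span, and with it every cycle, is trivial.\<close>

definition invariant :: "nat \<Rightarrow> int" where
  "invariant i = (if i < min n_rows n_cols then D $$ (i, i) else 0)"

definition row_mat :: "(tail \<Rightarrow> int) \<Rightarrow> int mat" where
  "row_mat c = mat 1 n_cols (\<lambda>(_, j). c (tails n ! j))"

text \<open>Coordinates after the column transformation; in them the row span becomes a direct sum
  of multiples.\<close>

definition coord :: "(tail \<Rightarrow> int) \<Rightarrow> nat \<Rightarrow> int" where
  "coord c i = (\<Sum>j = 0..<n_cols. c (tails n ! j) * right_mat $$ (j, i))"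

lemma row_mat_carrier: "row_mat c \<in> carrier_mat 1 n_cols"
  by (simp add: row_mat_def)

lemma row_mat_right: "i < n_cols \<Longrightarrow> (row_mat c * right_mat) $$ (0, i) = coord c i"
  using mats(3) by (auto simp: row_mat_def coord_def scalar_prod_def)

lemma coord_add: "coord (c + d) i = coord c i + coord d i"
  by (simp add: coord_def plus_fun_apply algebra_simps sum.distrib)

lemma coord_scaled: "coord (\<lambda>e. k * c e) i = k * coord c i"
  by (simp add: coord_def sum_distrib_left mult.assoc)

lemma D_mult: "G \<in> carrier_mat 1 n_rows \<Longrightarrow> i < n_cols \<Longrightarrow>
    (G * D) $$ (0, i) = (if i < n_rows then G $$ (0, i) * invariant i else 0)"
  by (subst row_mult_diagonal[OF _ D_carrier D_diagonal]) (auto simp: invariant_def)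

lemma row_combination:
  assumes "Z \<in> carrier_mat 1 n_rows" "j < n_cols"
  shows "(Z * M) $$ (0, j) = (\<Sum>r < n_rows. Z $$ (0, r) * (Mat_rows n (int p) A ! r) (tails n ! j))"
proof -
  have "(Z * M) $$ (0, j) = (\<Sum>r = 0..<n_rows. Z $$ (0, r) * M $$ (r, j))"
    using assms M_carrier by (auto simp: scalar_prod_def)
  also have "\<dots> = (\<Sum>r < n_rows. Z $$ (0, r) * (Mat_rows n (int p) A ! r) (tails n ! j))"
    by (rule sum.cong) (auto simp: M_entry assms(2) atLeast0LessThan)
  finally show ?thesis .
qed

lemma tail_funs_eqI:
  assumes "c \<in> tail_funs" "d \<in> tail_funs" "\<And>j. j < n_cols \<Longrightarrow> c (tails n ! j) = d (tails n ! j)"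
  shows "c = d"
proof (rule ext)
  fix e
  show "c e = d e"
  proof (cases "e \<in> set (tails n)")
    case True
    then obtain j where "j < n_cols" "e = tails n ! j" by (auto simp: in_set_conv_nth)
    then show ?thesis using assms(3) by simp
  next
    case False
    then have "c e = 0" "d e = 0" using assms(1,2) unfolding tail_funs_def by blast+
    then show ?thesis by (simp only:)
  qed
qed

lemma row_span_tail_funs: "c \<in> row_span \<Longrightarrow> c \<in> tail_funs"
  using row_span_cycles unfolding cycles_def by blast

text \<open>If \<open>c\<close> is the combination \<open>Z * M\<close>, then \<open>c\<close> times
  \<open>right_mat\<close> is \<open>(Z * left_inv) * D\<close>, whose entries are multiples of the
  diagonal ones.\<close>

lemma invariant_dvd_coord:
  assumes "c \<in> row_span" and i: "i < n_cols"
  shows "invariant i dvd coord c i"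
proof -
  obtain z where z: "c = (\<lambda>e. \<Sum>r < n_rows. z r * (Mat_rows n (int p) A ! r) e)"
    using assms(1) unfolding row_span_def by blast
  define Z where "Z = mat 1 n_rows (\<lambda>(_, r). z r)"
  have Z: "Z \<in> carrier_mat 1 n_rows" by (simp add: Z_def)
  have ZM: "row_mat c = Z * M"
  proof (rule eq_matI)
    fix k j assume kj: "k < dim_row (Z * M)" "j < dim_col (Z * M)"
    then have k: "k = 0" and j: "j < n_cols" using M_carrier by (auto simp: Z_def)
    show "row_mat c $$ (k, j) = (Z * M) $$ (k, j)"
      unfolding k row_combination[OF Z j] by (simp add: row_mat_def z Z_def j)
  qed (use M_carrier in \<open>auto simp: Z_def row_mat_def\<close>)
  have "row_mat c * right_mat = Z * M * right_mat" by (simp only: ZM)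
  also have "\<dots> = (Z * (left_inv * left_mat)) * M * right_mat" by (simp only: mats(5) right_mult_one_mat[OF Z])
  also have "Z * (left_inv * left_mat) = (Z * left_inv) * left_mat"
    by (rule assoc_mult_mat[OF Z mats(2,1), symmetric])
  also have "(Z * left_inv) * left_mat * M = (Z * left_inv) * (left_mat * M)"
    by (rule assoc_mult_mat[OF mult_carrier_mat[OF Z mats(2)] mats(1) M_carrier])
  also have "(Z * left_inv) * (left_mat * M) * right_mat = (Z * left_inv) * (left_mat * M * right_mat)"
    by (rule assoc_mult_mat[OF mult_carrier_mat[OF Z mats(2)] mult_carrier_mat[OF mats(1) M_carrier] mats(3)])
  also have "left_mat * M * right_mat = D" by (rule mats(8)[symmetric])
  finally have "coord c i = ((Z * left_inv) * D) $$ (0, i)" using row_mat_right[OF i, of c] by simp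
  then show ?thesis unfolding D_mult[OF mult_carrier_mat[OF Z mats(2)] i]
    by (simp add: invariant_def split: if_splits)
qed

lemma row_spanI:
  assumes c: "c \<in> tail_funs" and dvd: "\<And>i. i < n_cols \<Longrightarrow> invariant i dvd coord c i"
  shows "c \<in> row_span"
proof -
  \<comment> \<open>Where \<open>invariant i\<close> is 0, divisibility forces the coordinate to be
    0 as well, and the default quotient 0 is the right one.\<close>
  define G where "G = mat 1 n_rows (\<lambda>(_, i). coord c i div invariant i)"
  have G: "G \<in> carrier_mat 1 n_rows" by (simp add: G_def)
  have GD: "G * D = row_mat c * right_mat"
  proof (rule eq_matI)
    fix k i assume "k < dim_row (row_mat c * right_mat)" "i < dim_col (row_mat c * right_mat)"
    then have k: "k = 0" and i: "i < n_cols" using mats(3) by (auto simp: row_mat_def)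
    have "coord c i = (if i < n_rows then coord c i div invariant i * invariant i else 0)"
      using dvd[OF i] by (auto simp: invariant_def)
    then show "(G * D) $$ (k, i) = (row_mat c * right_mat) $$ (k, i)"
      unfolding k D_mult[OF G i] row_mat_right[OF i] by (auto simp: G_def)
  qed (use G D_carrier mats(3) in \<open>auto simp: row_mat_def\<close>)
  define Z where "Z = G * left_mat"
  have Z: "Z \<in> carrier_mat 1 n_rows" unfolding Z_def by (rule mult_carrier_mat[OF G mats(1)])
  have ZG: "Z * M = G * (left_mat * M)" unfolding Z_def by (rule assoc_mult_mat[OF G mats(1) M_carrier])
  have "Z * M = Z * M * (right_mat * right_inv)"
    by (simp only: mats(6) right_mult_one_mat[OF mult_carrier_mat[OF Z M_carrier]])
  also have "\<dots> = Z * M * right_mat * right_inv"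
    by (rule assoc_mult_mat[OF mult_carrier_mat[OF Z M_carrier] mats(3,4), symmetric])
  also have "Z * M * right_mat = G * (left_mat * M) * right_mat" by (simp only: ZG)
  also have "G * (left_mat * M) * right_mat = G * (left_mat * M * right_mat)"
    by (rule assoc_mult_mat[OF G mult_carrier_mat[OF mats(1) M_carrier] mats(3)])
  also have "left_mat * M * right_mat = D" by (rule mats(8)[symmetric])
  also have "G * D * right_inv = row_mat c * (right_mat * right_inv)"
    unfolding GD by (rule assoc_mult_mat[OF row_mat_carrier mats(3,4)])
  also have "\<dots> = row_mat c" by (simp only: mats(6) right_mult_one_mat[OF row_mat_carrier])
  finally have ZM: "Z * M = row_mat c" .
  define c' where "c' = (\<lambda>e. \<Sum>r < n_rows. Z $$ (0, r) * (Mat_rows n (int p) A ! r) e)"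
  have c': "c' \<in> row_span" unfolding row_span_def c'_def
    by (rule CollectI, rule exI[of _ "\<lambda>r. Z $$ (0, r)"], rule HOL.refl)
  have "c = c'"
  proof (rule tail_funs_eqI[OF c row_span_tail_funs[OF c']])
    fix j assume j: "j < n_cols"
    have "c (tails n ! j) = row_mat c $$ (0, j)" using j by (simp add: row_mat_def)
    also have "\<dots> = c' (tails n ! j)" unfolding ZM[symmetric] row_combination[OF Z j] c'_def ..
    finally show "c (tails n ! j) = c' (tails n ! j)" .
  qed
  then show ?thesis using c' by (simp only:)
qed

text \<open>The row \<open>y\<close> is carried back by \<open>right_inv\<close>; distinctness of
  the tails ensures that the resulting function takes the intended value at each of them.\<close>

lemma coord_surj: "\<exists>c \<in> tail_funs. \<forall>i < n_cols. coord c i = y i"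
proof -
  define Y where "Y = mat 1 n_cols (\<lambda>(_, i). y i)"
  have Y: "Y \<in> carrier_mat 1 n_cols" by (simp add: Y_def)
  define c where "c = (\<lambda>e. \<Sum>j = 0..<n_cols. if tails n ! j = e then (Y * right_inv) $$ (0, j) else 0)"
  have cj: "c (tails n ! j) = (Y * right_inv) $$ (0, j)" if j: "j < n_cols" for j
  proof -
    have "c (tails n ! j) = (\<Sum>k = 0..<n_cols. if k = j then (Y * right_inv) $$ (0, j) else 0)"
      unfolding c_def by (rule sum.cong) (use j nth_eq_iff_index_eq[OF distinct_tails] in auto)
    then show ?thesis using j by simp
  qed
  have "c \<in> tail_funs" unfolding tail_funs_def
  proof (intro CollectI allI impI)
    fix e assume "c e \<noteq> 0"
    have "\<exists>j \<in> {0..<n_cols}. tails n ! j = e"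
    proof (rule ccontr)
      assume *: "\<not> (\<exists>j \<in> {0..<n_cols}. tails n ! j = e)"
      have "c e = 0" unfolding c_def by (rule sum.neutral) (use * in auto)
      then show False using \<open>c e \<noteq> 0\<close> by simp
    qed
    then show "e \<in> set (tails n)" by auto
  qed
  moreover have "row_mat c = Y * right_inv"
    by (rule eq_matI) (use Y mats(4) cj in \<open>auto simp: row_mat_def\<close>)
  then have "row_mat c * right_mat = Y * (right_inv * right_mat)"
    by (simp only: assoc_mult_mat[OF Y mats(4,3)])
  then have "row_mat c * right_mat = Y" by (simp only: mats(7) right_mult_one_mat[OF Y])
  then have "\<forall>i < n_cols. coord c i = y i" using row_mat_right[of _ c] by (simp add: Y_def)
  ultimately show ?thesis by (intro bexI)
qed

text \<open>The multiple of the cycle by \<open>p ^ n\<close> lies in the row span, where this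
  coordinate is divisible by 0.\<close>

lemma coord_cycle_eq_0:
  assumes "c \<in> cycles" "i < n_cols" "invariant i = 0"
  shows "coord c i = 0"
proof -
  have "invariant i dvd coord (\<lambda>e. int p ^ n * c e) i"
    by (rule invariant_dvd_coord[OF prime_power_multiple_in_row_span[OF assms(1)] assms(2)])
  then show ?thesis using assms(3) p_pos by (simp add: coord_scaled)
qed

text \<open>The product of the non-zero invariants moves \<open>c\<close> into the row span, and a
  vector with a non-zero multiple there is a cycle.\<close>

lemma cyclesI:
  assumes c: "c \<in> tail_funs" and z: "\<And>i. i < n_cols \<Longrightarrow> invariant i = 0 \<Longrightarrow> coord c i = 0"
  shows "c \<in> cycles"
proof -
  define N where "N = (\<Prod>i \<in> {i. i < n_cols \<and> invariant i \<noteq> 0}. invariant i)"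
  have "N \<noteq> 0" unfolding N_def by simp
  moreover have "(\<lambda>e. N * c e) \<in> row_span"
  proof (rule row_spanI)
    show "(\<lambda>e. N * c e) \<in> tail_funs" using c unfolding tail_funs_def by simp
    fix i assume i: "i < n_cols"
    show "invariant i dvd coord (\<lambda>e. N * c e) i"
    proof (cases "invariant i = 0")
      case True
      then show ?thesis using z[OF i] by (simp add: coord_scaled)
    next
      case False
      then have "invariant i dvd N" unfolding N_def using i by (intro dvd_prodI) auto
      then show ?thesis by (simp add: coord_scaled)
    qed
  qed
  ultimately show ?thesis by (rule cycles_of_multiple[OF c])
qed

text \<open>Test on the vector whose only non-zero transformed coordinate is a 1 at
  \<open>i\<close>: it is a cycle, and its multiple by \<open>p ^ n\<close> lies in the row
  span.\<close>

lemma invariant_dvd_prime_power: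
  assumes i: "i < n_cols" "invariant i \<noteq> 0"
  shows "invariant i dvd int p ^ n"
proof -
  obtain c where c: "c \<in> tail_funs" "\<forall>k < n_cols. coord c k = of_bool (k = i)"
    using coord_surj[of "\<lambda>k. of_bool (k = i)"] by (elim bexE) (rule that)
  have "c \<in> cycles" by (rule cyclesI[OF c(1)]) (use c(2) i in auto)
  from invariant_dvd_coord[OF prime_power_multiple_in_row_span[OF this] i(1)]
  show ?thesis using c(2) i(1) by (simp add: coord_scaled)
qed

lemma invariant_nonneg: "0 \<le> invariant i"
proof (cases "i < min n_rows n_cols")
  case True
  then have "D $$ (i, i) \<in> set (diagonal_entries D)" using D_carrier by (auto simp: diagonal_entries_def)
  then show ?thesis using snf True by (simp add: int_smith_normal_form_def invariant_def)
next
  case False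
  have "invariant i = 0" unfolding invariant_def by (rule if_not_P[OF False])
  then show ?thesis by simp
qed

lemma invariant_prime_power:
  assumes i: "i < n_cols" "invariant i \<noteq> 0"
  shows "\<exists>l. invariant i = int p ^ l"
proof -
  have "int (nat (invariant i)) = invariant i" using invariant_nonneg by simp
  then have "nat (invariant i) dvd p ^ n"
    using invariant_dvd_prime_power[OF i] by (metis of_nat_dvd_iff of_nat_power)
  then obtain l where "nat (invariant i) = p ^ l" using divides_primepow_nat[OF p_prime] by blast
  then have "invariant i = int p ^ l" using \<open>int (nat (invariant i)) = invariant i\<close> by (metis of_nat_power)
  then show ?thesis ..
qed

lemma diagonal_prime_power:
  assumes i: "i < min (dim_row D) (dim_col D)" "D $$ (i, i) \<noteq> 0"
  shows "\<exists>l. D $$ (i, i) = int p ^ l"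
proof -
  have "i < n_cols" "invariant i = D $$ (i, i)" using i(1) D_carrier by (auto simp: invariant_def)
  then show ?thesis using invariant_prime_power[of i] i(2) by metis
qed

definition positions :: "nat list" where
  "positions = filter (\<lambda>i. D $$ (i, i) \<noteq> 0) [0..<min n_rows n_cols]"

definition divisors :: "nat list" where
  "divisors = map nat (filter (\<lambda>d. d \<noteq> 0) (diagonal_entries D))"

lemma divisors_eq: "divisors = map (\<lambda>i. nat (invariant i)) positions"
proof -
  have "min (dim_row D) (dim_col D) = min n_rows n_cols" using D_carrier by auto
  then have "divisors = map (\<lambda>i. nat (D $$ (i, i))) positions"
    by (simp add: divisors_def positions_def diagonal_entries_def filter_map comp_def)
  then show ?thesis by (simp add: positions_def invariant_def)
qed

lemma positions_nth:
  assumes "k < length positions"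
  shows "positions ! k < n_cols" "invariant (positions ! k) \<noteq> 0" "0 < invariant (positions ! k)"
    "int (divisors ! k) = invariant (positions ! k)"
proof -
  have "positions ! k \<in> set positions" using assms by simp
  then show 1: "positions ! k < n_cols" "invariant (positions ! k) \<noteq> 0"
    by (auto simp: positions_def invariant_def)
  then show 2: "0 < invariant (positions ! k)" using invariant_nonneg[of "positions ! k"] by simp
  show "int (divisors ! k) = invariant (positions ! k)" using assms 2 by (simp add: divisors_eq)
qed

lemma positions_surj:
  assumes "i < n_cols" "invariant i \<noteq> 0"
  shows "\<exists>k < length positions. positions ! k = i"
proof -
  have "i \<in> set positions" using assms by (auto simp: positions_def invariant_def split: if_splits)
  then show ?thesis by (simp add: in_set_conv_nth)
qed

definition invariants_group :: "(nat \<Rightarrow> int) monoid" where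
  "invariants_group = product_group {..<length divisors} (\<lambda>i. integer_mod_group (divisors ! i))"

text \<open>Only positions with non-zero invariant are kept, since cycles vanish at the others. An
  invariant 1 contributes a trivial factor.\<close>

definition residue_map :: "(tail \<Rightarrow> int) \<Rightarrow> nat \<Rightarrow> int" where
  "residue_map c = (\<lambda>k \<in> {..<length divisors}. coord c (positions ! k) mod int (divisors ! k))"

lemma length_divisors: "length divisors = length positions"
  by (simp add: divisors_eq)

lemma divisors_pos: "k < length divisors \<Longrightarrow> 0 < divisors ! k"
  using positions_nth(3,4)[of k] by (simp add: length_divisors)

lemma invariants_group: "group invariants_group"
  unfolding invariants_group_def by (rule product_group) simp

lemma carrier_invariants_group:
  "carrier invariants_group = (\<Pi>\<^sub>E k \<in> {..<length divisors}. {0..<int (divisors ! k)})"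
  unfolding invariants_group_def carrier_product_group
  by (rule PiE_cong) (use divisors_pos in \<open>auto simp: carrier_integer_mod_group\<close>)

lemma residue_map_closed: "residue_map c \<in> carrier invariants_group"
  unfolding carrier_invariants_group residue_map_def using divisors_pos by simp

lemma residue_map_hom: "residue_map \<in> hom cycle_group invariants_group"
proof (rule homI)
  show "residue_map c \<in> carrier invariants_group" for c by (rule residue_map_closed)
  fix c d
  show "residue_map (c \<otimes>\<^bsub>cycle_group\<^esub> d) = residue_map c \<otimes>\<^bsub>invariants_group\<^esub> residue_map d"
    unfolding invariants_group_def mult_product_group residue_map_def cycle_group_def
    by (rule restrict_ext) (simp add: coord_add mult_integer_mod_group mod_add_eq del: plus_fun_apply)
qed

lemma residue_map_surj: "residue_map ` carrier cycle_group = carrier invariants_group"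
proof (intro equalityI subsetI)
  fix t assume t: "t \<in> carrier invariants_group"
  define y where "y i = (\<Sum>k < length positions. if positions ! k = i then t k else 0)" for i
  have yk: "y (positions ! k) = t k" if k: "k < length positions" for k
  proof -
    have "distinct positions" by (simp add: positions_def)
    then have "y (positions ! k) = (\<Sum>k' < length positions. if k' = k then t k else 0)"
      unfolding y_def by (intro sum.cong) (use k nth_eq_iff_index_eq in auto)
    then show ?thesis using k by simp
  qed
  have y0: "y i = 0" if "invariant i = 0" for i
    unfolding y_def by (rule sum.neutral) (use positions_nth(2) that in auto)
  obtain c where c: "c \<in> tail_funs" "\<forall>i < n_cols. coord c i = y i"
    using coord_surj[of y] by (elim bexE) (rule that)
  have cyc: "c \<in> cycles" by (rule cyclesI[OF c(1)]) (use c(2) y0 in auto)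
  have "residue_map c = t"
  proof (rule PiE_ext)
    show "residue_map c \<in> (\<Pi>\<^sub>E k \<in> {..<length divisors}. {0..<int (divisors ! k)})"
      using residue_map_closed unfolding carrier_invariants_group .
    show t': "t \<in> (\<Pi>\<^sub>E k \<in> {..<length divisors}. {0..<int (divisors ! k)})"
      using t unfolding carrier_invariants_group .
    fix k assume k: "k \<in> {..<length divisors}"
    then have kp: "k < length positions" by (simp add: length_divisors)
    have "t k \<in> {0..<int (divisors ! k)}" using PiE_mem[OF t' k] .
    moreover have "coord c (positions ! k) = t k" using c(2) positions_nth(1)[OF kp] yk[OF kp] by simp
    ultimately show "residue_map c k = t k" using k by (simp add: residue_map_def)
  qed
  then show "t \<in> residue_map ` carrier cycle_group"
    using cyc by (intro image_eqI[of _ _ c]) (simp_all add: cycle_group_def)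
qed (use residue_map_closed in blast)

lemma residue_map_kernel: "kernel cycle_group invariants_group residue_map = row_span"
proof -
  have one: "\<one>\<^bsub>invariants_group\<^esub> = (\<lambda>k \<in> {..<length divisors}. 0)"
    unfolding invariants_group_def one_product_group by (rule restrict_ext) (simp add: one_integer_mod_group)
  have iff: "residue_map c = \<one>\<^bsub>invariants_group\<^esub> \<longleftrightarrow>
      (\<forall>k < length positions. invariant (positions ! k) dvd coord c (positions ! k))" for c
  proof -
    have "residue_map c = \<one>\<^bsub>invariants_group\<^esub> \<longleftrightarrow>
        (\<forall>k < length positions. coord c (positions ! k) mod int (divisors ! k) = 0)"
      unfolding one residue_map_def by (auto simp: fun_eq_iff length_divisors restrict_def split: if_splits)
    then show ?thesis using positions_nth(4) by (auto simp: dvd_eq_mod_eq_0)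
  qed
  show ?thesis
  proof (intro equalityI subsetI)
    fix c assume "c \<in> kernel cycle_group invariants_group residue_map"
    then have c: "c \<in> cycles" and res: "residue_map c = \<one>\<^bsub>invariants_group\<^esub>"
      by (simp_all add: kernel_def cycle_group_def)
    show "c \<in> row_span"
    proof (rule row_spanI)
      show "c \<in> tail_funs" using c by (simp add: cycles_def)
      fix i assume i: "i < n_cols"
      show "invariant i dvd coord c i"
      proof (cases "invariant i = 0")
        case True
        then show ?thesis using coord_cycle_eq_0[OF c i] by simp
      next
        case False
        then obtain k where k: "k < length positions" "positions ! k = i" using positions_surj[OF i] by blast
        have "\<forall>k < length positions. invariant (positions ! k) dvd coord c (positions ! k)"
          using res unfolding iff .
        then have "invariant (positions ! k) dvd coord c (positions ! k)" using k(1) by simp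
        then show ?thesis unfolding k(2) .
      qed
    qed
  next
    fix c assume c: "c \<in> row_span"
    have "residue_map c = \<one>\<^bsub>invariants_group\<^esub>"
      unfolding iff by (intro allI impI invariant_dvd_coord[OF c] positions_nth(1))
    then show "c \<in> kernel cycle_group invariants_group residue_map"
      using row_span_cycles[OF c] by (simp add: kernel_def cycle_group_def)
  qed
qed

theorem schur_multiplier_invariants: "has_abelian_invariants (schur_multiplier L) divisors"
proof -
  interpret h: group_hom cycle_group invariants_group residue_map
    unfolding group_hom_def group_hom_axioms_def
    by (intro conjI comm_group.axioms(2)[OF cycle_group] invariants_group residue_map_hom)
  have iso: "cycle_group Mod row_span \<cong> invariants_group"
    using h.FactGroup_iso[OF residue_map_surj] unfolding residue_map_kernel .
  have "group (cycle_group Mod row_span)"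
    using normal.factorgroup_is_group[OF h.normal_kernel] unfolding residue_map_kernel .
  then have "schur_multiplier L \<cong> cycle_group Mod row_span"
    using schur_multiplier_iso by (rule group.iso_sym)
  then have "schur_multiplier L \<cong> invariants_group" using iso by (rule iso_trans)
  moreover have "\<forall>d \<in> set divisors. 0 < d" using divisors_pos by (auto simp: in_set_conv_nth)
  ultimately show ?thesis unfolding has_abelian_invariants_def invariants_group_def by (intro conjI)
qed

end

section \<open>The ring \<open>Q[p]\<close>\<close>

lemma Q_fieldE:
  assumes "a \<in> Q_field m"
  obtains f g where "f \<in> S_ring m" "g \<in> S_ring m" "g \<noteq> 0" "a = Fract f g"
  using assms unfolding Q_field_def by blast

lemma Q_field_to_fract: "f \<in> S_ring m \<Longrightarrow> to_fract f \<in> Q_field m"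
  unfolding Q_field_def to_fract_def using S_ring_one[of m] zero_neq_one by fastforce

lemma Q_field_add:
  assumes "a \<in> Q_field m" "b \<in> Q_field m" shows "a + b \<in> Q_field m"
proof -
  obtain f g where 1: "f \<in> S_ring m" "g \<in> S_ring m" "g \<noteq> 0" "a = Fract f g" using Q_fieldE[OF assms(1)] .
  obtain f' g' where 2: "f' \<in> S_ring m" "g' \<in> S_ring m" "g' \<noteq> 0" "b = Fract f' g'" using Q_fieldE[OF assms(2)] .
  have "a + b = Fract (f * g' + f' * g) (g * g')" using 1 2 by simp
  moreover have "f * g' + f' * g \<in> S_ring m" "g * g' \<in> S_ring m" "g * g' \<noteq> 0"
    using 1 2 by (simp_all add: S_ring_add S_ring_mult)
  ultimately show ?thesis unfolding Q_field_def by blast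
qed

lemma Q_field_mult:
  assumes "a \<in> Q_field m" "b \<in> Q_field m" shows "a * b \<in> Q_field m"
proof -
  obtain f g where 1: "f \<in> S_ring m" "g \<in> S_ring m" "g \<noteq> 0" "a = Fract f g" using Q_fieldE[OF assms(1)] .
  obtain f' g' where 2: "f' \<in> S_ring m" "g' \<in> S_ring m" "g' \<noteq> 0" "b = Fract f' g'" using Q_fieldE[OF assms(2)] .
  have "a * b = Fract (f * f') (g * g')" using 1 2 by simp
  moreover have "f * f' \<in> S_ring m" "g * g' \<in> S_ring m" "g * g' \<noteq> 0"
    using 1 2 by (simp_all add: S_ring_mult)
  ultimately show ?thesis unfolding Q_field_def by blast
qed

lemma Q_field_zero: "0 \<in> Q_field m" and Q_field_one: "1 \<in> Q_field m"
  using Q_field_to_fract[OF S_ring_zero] Q_field_to_fract[OF S_ring_one] by simp_all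

lemma Q_field_uminus: "a \<in> Q_field m \<Longrightarrow> - a \<in> Q_field m"
  using Q_field_mult[OF Q_field_to_fract[OF S_ring_uminus[OF S_ring_one]]] by fastforce

lemma Q_field_diff: "a \<in> Q_field m \<Longrightarrow> b \<in> Q_field m \<Longrightarrow> a - b \<in> Q_field m"
  using Q_field_add[OF _ Q_field_uminus, of a m b] by simp

lemma Q_field_inverse:
  assumes "a \<in> Q_field m" shows "inverse a \<in> Q_field m"
proof (cases "a = 0")
  case False
  obtain f g where 1: "f \<in> S_ring m" "g \<in> S_ring m" "g \<noteq> 0" "a = Fract f g" using Q_fieldE[OF assms] .
  then have "f \<noteq> 0" using False by (auto simp: fract_collapse)
  moreover have "inverse a = Fract g f" using 1 by simp
  ultimately show ?thesis using 1 unfolding Q_field_def by blast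
qed (simp add: Q_field_zero)

lemma Q_field_sum: "(\<And>i. i \<in> I \<Longrightarrow> f i \<in> Q_field m) \<Longrightarrow> sum f I \<in> Q_field m"
  by (induction I rule: infinite_finite_induct) (simp_all add: Q_field_zero Q_field_add)

lemma Qp_ringI: "(\<And>i. Polynomial.coeff c i \<in> Q_field m) \<Longrightarrow> c \<in> Qp_ring m"
  by (simp add: Qp_ring_def)

lemma Qp_ringD: "c \<in> Qp_ring m \<Longrightarrow> Polynomial.coeff c i \<in> Q_field m"
  by (simp add: Qp_ring_def)

lemma Qp_ring_add: "c \<in> Qp_ring m \<Longrightarrow> d \<in> Qp_ring m \<Longrightarrow> c + d \<in> Qp_ring m"
  by (simp add: Qp_ring_def Q_field_add)

lemma Qp_ring_uminus: "c \<in> Qp_ring m \<Longrightarrow> - c \<in> Qp_ring m"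
  by (simp add: Qp_ring_def Q_field_uminus)

lemma Qp_ring_mult: "c \<in> Qp_ring m \<Longrightarrow> d \<in> Qp_ring m \<Longrightarrow> c * d \<in> Qp_ring m"
  by (simp add: Qp_ring_def coeff_mult Q_field_sum Q_field_mult)

lemma Qp_ring_zero: "0 \<in> Qp_ring m" and Qp_ring_one: "1 \<in> Qp_ring m"
  by (simp_all add: Qp_ring_def Q_field_zero Q_field_one)

lemma Qp_ring_fract_poly: "f \<in> Sp_ring m \<Longrightarrow> fract_poly f \<in> Qp_ring m"
  by (simp add: Sp_ring_def Qp_ring_def coeff_map_poly Q_field_to_fract)

lemma Sp_ring_zero: "0 \<in> Sp_ring m" and Sp_ring_one: "1 \<in> Sp_ring m"
  by (simp_all add: Sp_ring_def S_ring_zero S_ring_one)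

lemma Sp_ring_add: "c \<in> Sp_ring m \<Longrightarrow> d \<in> Sp_ring m \<Longrightarrow> c + d \<in> Sp_ring m"
  by (simp add: Sp_ring_def S_ring_add)

lemma Sp_ring_uminus: "c \<in> Sp_ring m \<Longrightarrow> - c \<in> Sp_ring m"
  by (simp add: Sp_ring_def S_ring_uminus)

lemma Sp_ring_mult: "c \<in> Sp_ring m \<Longrightarrow> d \<in> Sp_ring m \<Longrightarrow> c * d \<in> Sp_ring m"
  by (simp add: Sp_ring_def coeff_mult S_ring_sum S_ring_mult)

lemma Sp_ring_const: "f \<in> S_ring m \<Longrightarrow> [:f:] \<in> Sp_ring m"
  by (simp add: Sp_ring_def coeff_pCons S_ring_zero split: nat.split)

lemma Sp_ring_X: "[:0, 1:] \<in> Sp_ring m"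
  by (auto simp: Sp_ring_def coeff_pCons S_ring_zero S_ring_one split: nat.split)

text \<open>The common denominator is the product of the denominators of the coefficients, collected
  along \<open>pCons\<close>.\<close>

lemma fraction_form_exists:
  assumes "c \<in> Qp_ring m"
  shows "\<exists>f g. fraction_form m c f g"
  using assms
proof (induction c)
  case 0
  have "fraction_form m 0 0 1" by (simp add: fraction_form_def Sp_ring_zero S_ring_one)
  then show ?case by blast
next
  case (pCons a c)
  have a: "a \<in> Q_field m" using Qp_ringD[OF pCons.prems, of 0] by simp
  have "c \<in> Qp_ring m" using Qp_ringD[OF pCons.prems, of "Suc _"] by (intro Qp_ringI) simp
  then obtain f g where fg: "fraction_form m c f g" using pCons.IH by blast
  obtain u v where uv: "u \<in> S_ring m" "v \<in> S_ring m" "v \<noteq> 0" "a = Fract u v" using Q_fieldE[OF a] .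
  have va: "to_fract v * a = to_fract u" using uv by (simp add: Fract_conv_to_fract)
  let ?f = "pCons (u * g) (Polynomial.smult v f)" and ?g = "v * g"
  have "?f \<in> Sp_ring m" using fg uv
    by (auto simp: fraction_form_def Sp_ring_def coeff_pCons S_ring_mult split: nat.split)
  moreover have "Polynomial.smult (to_fract ?g) (pCons a c) = fract_poly ?f"
  proof -
    have "Polynomial.smult (to_fract ?g) (pCons a c) = pCons (to_fract v * a * to_fract g) (Polynomial.smult (to_fract v) (Polynomial.smult (to_fract g) c))"
      by (simp add: mult_ac)
    also have "\<dots> = pCons (to_fract u * to_fract g) (Polynomial.smult (to_fract v) (fract_poly f))"
      using fg va by (simp add: fraction_form_def)
    also have "\<dots> = fract_poly ?f"
      by (rule poly_eqI) (auto simp: coeff_map_poly coeff_pCons split: nat.split)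
    finally show ?thesis .
  qed
  ultimately have "fraction_form m (pCons a c) ?f ?g"
    using fg uv by (simp add: fraction_form_def S_ring_mult)
  then show ?case by blast
qed

lemma X_power: "[:0, 1:] ^ l = (Polynomial.monom 1 l :: 'a::comm_ring_1 poly)"
  by (simp add: monom_altdef)

lemma coeff_X_power_mult:
  "Polynomial.coeff ([:0, 1:] ^ l * u) k = (if k < l then 0 else Polynomial.coeff (u :: 'a::comm_ring_1 poly) (k - l))"
  by (simp add: X_power coeff_monom_mult)

lemma X_power_dvd_iff: "[:0, 1:] ^ l dvd (c :: 'a::comm_ring_1 poly) \<longleftrightarrow> (\<forall>k<l. Polynomial.coeff c k = 0)"
proof
  assume "[:0, 1:] ^ l dvd c"
  then obtain u where "c = [:0, 1:] ^ l * u" by (elim dvdE)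
  then show "\<forall>k<l. Polynomial.coeff c k = 0" by (simp add: coeff_X_power_mult)
next
  assume "\<forall>k<l. Polynomial.coeff c k = 0"
  then have "c = [:0, 1:] ^ l * poly_shift l c"
    by (intro poly_eqI) (simp add: coeff_X_power_mult coeff_poly_shift)
  then show "[:0, 1:] ^ l dvd c" by (rule dvdI)
qed

text \<open>The reason why pseudo-units may act as units: over a domain the lowest coefficient of
  \<open>u * y\<close> is that of \<open>y\<close> times the non-zero constant coefficient of
  \<open>u\<close>.\<close>

lemma X_power_dvd_mult_cancel:
  fixes u y :: "'a::idom poly"
  assumes u: "Polynomial.coeff u 0 \<noteq> 0" and d: "[:0, 1:] ^ l dvd u * y"
  shows "[:0, 1:] ^ l dvd y"
  unfolding X_power_dvd_iff
proof (intro allI impI)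
  fix k show "k < l \<Longrightarrow> Polynomial.coeff y k = 0"
  proof (induction k rule: less_induct)
    case (less k)
    have "0 = Polynomial.coeff (u * y) k" using d less.prems unfolding X_power_dvd_iff by simp
    also have "\<dots> = (\<Sum>i\<le>k. Polynomial.coeff u i * Polynomial.coeff y (k - i))" by (rule coeff_mult)
    also have "\<dots> = (\<Sum>i\<le>k. if i = 0 then Polynomial.coeff u 0 * Polynomial.coeff y k else 0)"
      by (rule sum.cong) (use less in auto)
    also have "\<dots> = Polynomial.coeff u 0 * Polynomial.coeff y k" by simp
    finally show ?case using u by simp
  qed
qed

text \<open>The coefficients of the quotient are computed recursively as for power series, dividing
  only by the constant coefficient of \<open>u\<close>. So an exact division by a pseudo-unit
  introduces no variables beyond the given ones.\<close>

lemma Qp_ring_quotient: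
  assumes u: "u \<in> Qp_ring m" "Polynomial.coeff u 0 \<noteq> 0" and uc: "u * c \<in> Qp_ring m"
  shows "c \<in> Qp_ring m"
proof (rule Qp_ringI)
  fix k show "Polynomial.coeff c k \<in> Q_field m"
  proof (induction k rule: less_induct)
    case (less k)
    have "Polynomial.coeff (u * c) k = (\<Sum>i\<le>k. Polynomial.coeff u i * Polynomial.coeff c (k - i))" by (rule coeff_mult)
    also have "\<dots> = Polynomial.coeff u 0 * Polynomial.coeff c k + (\<Sum>i\<in>{..k} - {0}. Polynomial.coeff u i * Polynomial.coeff c (k - i))"
      by (subst sum.remove[of _ 0]) auto
    finally have "Polynomial.coeff c k = inverse (Polynomial.coeff u 0) *
      (Polynomial.coeff (u * c) k - (\<Sum>i\<in>{..k} - {0}. Polynomial.coeff u i * Polynomial.coeff c (k - i)))"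
      using u(2) by (simp add: field_simps)
    moreover have "\<dots> \<in> Q_field m"
      by (intro Q_field_mult Q_field_inverse Q_field_diff Q_field_sum Qp_ringD[OF u(1)] Qp_ringD[OF uc] less.IH) auto
    ultimately show ?case by simp
  qed
qed

text \<open>The exponent of the decomposition into a power of \<open>p\<close> and a pseudo-unit; it
  serves as Euclidean size.\<close>

definition p_order :: "'a::zero poly \<Rightarrow> nat" where
  "p_order c = (LEAST i. Polynomial.coeff c i \<noteq> 0)"

lemma coeff_p_order: "c \<noteq> 0 \<Longrightarrow> Polynomial.coeff c (p_order c) \<noteq> 0"
  unfolding p_order_def by (rule LeastI_ex) (auto simp: poly_eq_iff)

lemma coeff_less_p_order: "k < p_order c \<Longrightarrow> Polynomial.coeff c k = 0"
  unfolding p_order_def using not_less_Least by blast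

lemma p_order_decomposition:
  assumes c: "c \<in> Qp_ring m" "c \<noteq> 0"
  shows "\<exists>u. c = [:0, 1:] ^ p_order c * u \<and> pseudo_unit m u"
proof (intro exI conjI)
  show "c = [:0, 1:] ^ p_order c * poly_shift (p_order c) c"
    by (intro poly_eqI) (simp add: coeff_X_power_mult coeff_poly_shift coeff_less_p_order)
  show "pseudo_unit m (poly_shift (p_order c) c)"
    unfolding pseudo_unit_def
    using c coeff_p_order[OF c(2)] by (simp add: Qp_ring_def coeff_poly_shift)
qed

lemma X_power_pseudo_unit:
  assumes "[:0, 1:] ^ l = [:0, 1:] ^ k * u" "pseudo_unit m u"
  shows "u = 1"
proof -
  have u0: "Polynomial.coeff u 0 \<noteq> 0" using assms(2) by (simp add: pseudo_unit_def)
  have "Polynomial.coeff ([:0, 1:] ^ l * (1 :: mpoly fract poly)) k \<noteq> 0"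
    using u0 assms(1) coeff_X_power_mult[of k u k] by simp
  then have "k = l" by (auto simp: X_power coeff_monom split: if_splits)
  then have "[:0, 1:] ^ k * u = [:0, 1:] ^ k * 1" using assms(1) by simp
  moreover have "[:0, 1:] ^ k \<noteq> (0 :: mpoly fract poly)" by simp
  ultimately show ?thesis by (simp only: mult_cancel_left) simp
qed

section \<open>Existence of the symbolic computation\<close>

lemma pseudo_operations_trans:
  assumes "pseudo_operations m M us M'" "pseudo_operations m M' vs M''"
  shows "pseudo_operations m M (us @ vs) M''"
  using assms(2,1)
proof (induction rule: pseudo_operations.induct)
  case (step M' us' M1 vs' M2)
  then show ?case using pseudo_operations.step[of m M "us @ us'" M1 vs' M2] by simp
qed simp

definition pseudo_reachable :: "nat \<Rightarrow> mpoly fract poly mat \<Rightarrow> mpoly fract poly mat \<Rightarrow> bool" where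
  "pseudo_reachable m M M' \<longleftrightarrow> (\<exists>us. pseudo_operations m M us M')"

lemma pseudo_reachable_step: "pseudo_operation m M us M' \<Longrightarrow> pseudo_reachable m M M'"
  unfolding pseudo_reachable_def using pseudo_operations.step[OF pseudo_operations.start] by blast

lemma stored_denominators_exists: "c \<in> Qp_ring m \<Longrightarrow> \<exists>us. stored_denominators m c us"
  using fraction_form_exists stored_denominators.division by blast

text \<open>With pseudo-units as multipliers \<open>Q[p]\<close> is reduced like a discrete
  valuation ring. If the order of \<open>y\<close> is at least that of \<open>x\<close>, and
  \<open>u\<close> is the pseudo-unit factor of \<open>x\<close>, then \<open>u * y\<close> is a
  multiple of \<open>x\<close>; otherwise \<open>y\<close> itself is a remainder of smaller
  order.\<close>

interpretation pseudo_smith: smith_reduction "pseudo_reachable m" "Qp_ring m" "{u. pseudo_unit m u}" p_order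
    "\<lambda>x. \<exists>l. x = [:0, 1:] ^ l" for m
proof
  fix M M' M'' :: "mpoly fract poly mat"
  show "pseudo_reachable m M M" unfolding pseudo_reachable_def using pseudo_operations.start by blast
  show "pseudo_reachable m M M' \<Longrightarrow> pseudo_reachable m M' M'' \<Longrightarrow> pseudo_reachable m M M''"
    unfolding pseudo_reachable_def using pseudo_operations_trans by blast
next
  fix M :: "mpoly fract poly mat" and k l
  show "k < dim_row M \<Longrightarrow> l < dim_row M \<Longrightarrow> pseudo_reachable m M (swaprows k l M)"
    by (rule pseudo_reachable_step[OF pseudo_operation.swap_rows])
  show "k < dim_col M \<Longrightarrow> l < dim_col M \<Longrightarrow> pseudo_reachable m M (swapcols k l M)"
    by (rule pseudo_reachable_step[OF pseudo_operation.swap_cols])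
next
  fix M :: "mpoly fract poly mat" and k l c
  assume "k < dim_row M" "l < dim_row M" "k \<noteq> l" and c: "c \<in> Qp_ring m"
  moreover obtain us where "stored_denominators m c us" using stored_denominators_exists[OF c] by blast
  ultimately show "pseudo_reachable m M (addrow c k l M)"
    by (intro pseudo_reachable_step[OF pseudo_operation.add_row])
next
  fix M :: "mpoly fract poly mat" and k l c
  assume "k < dim_col M" "l < dim_col M" "k \<noteq> l" and c: "c \<in> Qp_ring m"
  moreover obtain us where "stored_denominators m c us" using stored_denominators_exists[OF c] by blast
  ultimately show "pseudo_reachable m M (addcol c k l M)"
    by (intro pseudo_reachable_step[OF pseudo_operation.add_col])
next
  fix M :: "mpoly fract poly mat" and k u
  assume k: "k < dim_row M" and "u \<in> {u. pseudo_unit m u}"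
  then have u: "pseudo_unit m u" "u \<in> Qp_ring m" by (auto simp: pseudo_unit_def)
  obtain us where "stored_denominators m u us" using stored_denominators_exists[OF u(2)] by blast
  then show "pseudo_reachable m M (multrow k u M)"
    using k u by (intro pseudo_reachable_step[OF pseudo_operation.mult_row])
next
  fix M :: "mpoly fract poly mat" and k u
  assume k: "k < dim_col M" and "u \<in> {u. pseudo_unit m u}"
  then have u: "pseudo_unit m u" "u \<in> Qp_ring m" by (auto simp: pseudo_unit_def)
  obtain us where "stored_denominators m u us" using stored_denominators_exists[OF u(2)] by blast
  then show "pseudo_reachable m M (multcol k u M)"
    using k u by (intro pseudo_reachable_step[OF pseudo_operation.mult_col])
next
  fix x y :: "mpoly fract poly"
  assume x: "x \<in> Qp_ring m" "x \<noteq> 0" and y: "y \<in> Qp_ring m"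
  obtain u where u: "x = [:0, 1:] ^ p_order x * u" "pseudo_unit m u" using p_order_decomposition[OF x] by blast
  show "\<exists>u\<in>{u. pseudo_unit m u}. \<exists>c\<in>Qp_ring m. u * y + c * x = 0 \<or> p_order (u * y + c * x) < p_order x"
  proof (cases "[:0, 1:] ^ p_order x dvd y")
    case True
    define y' where "y' = poly_shift (p_order x) y"
    have y': "y = [:0, 1:] ^ p_order x * y'"
      using True unfolding X_power_dvd_iff y'_def
      by (intro poly_eqI) (simp add: coeff_X_power_mult coeff_poly_shift)
    have "y' \<in> Qp_ring m" using y by (simp add: y'_def Qp_ring_def coeff_poly_shift)
    then have "- y' \<in> Qp_ring m" by (rule Qp_ring_uminus)
    moreover have "u * y + (- y') * x = 0"
    proof -
      define q where "q = ([:0, 1:] ^ p_order x :: mpoly fract poly)"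
      have e: "x = q * u" "y = q * y'" unfolding q_def by (rule u(1), rule y')
      have "u * y = u * (q * y')" by (rule arg_cong[OF e(2)])
      also have "\<dots> = y' * (q * u)" by (simp only: mult_ac)
      also have "\<dots> = y' * x" by (rule arg_cong[OF e(1)[symmetric]])
      finally show ?thesis by (simp only: mult_minus_left right_minus)
    qed
    ultimately show ?thesis using u(2) by blast
  next
    case False
    then obtain k where k: "k < p_order x" "Polynomial.coeff y k \<noteq> 0" unfolding X_power_dvd_iff by blast
    have "p_order y \<le> k" unfolding p_order_def by (rule Least_le) (rule k(2))
    then have "p_order (1 * y + 0 * x) < p_order x" using k by simp
    moreover have "pseudo_unit m 1" by (simp add: pseudo_unit_def Qp_ring_one)
    ultimately show ?thesis using Qp_ring_zero by blast
  qed
next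
  fix x :: "mpoly fract poly"
  assume x: "x \<in> Qp_ring m" "x \<noteq> 0"
  obtain u where u: "x = [:0, 1:] ^ p_order x * u" "pseudo_unit m u" using p_order_decomposition[OF x] by blast
  let ?x = "[:0, 1:] ^ p_order x :: mpoly fract poly"
  have 1: "?x \<in> Qp_ring m"
    by (rule Qp_ringI) (auto simp: X_power coeff_monom Q_field_zero Q_field_one)
  have 2: "?x dvd y" if "v \<in> {u. pseudo_unit m u}" "v * y + c * x = 0" for v c y
  proof -
    have "v * y = - (c * x)" using that(2) by (simp only: eq_neg_iff_add_eq_0)
    moreover have "?x dvd - (c * x)"
      unfolding dvd_minus_iff by (rule dvd_mult) (rule dvdI[OF u(1)])
    ultimately have "?x dvd v * y" by (rule back_subst[OF _ HOL.sym, rotated])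
    moreover have "Polynomial.coeff v 0 \<noteq> 0" using that(1) unfolding pseudo_unit_def by simp
    ultimately show ?thesis by (rule X_power_dvd_mult_cancel[rotated])
  qed
  have 3: "d dvd ?x" if "d = 0 \<or> (\<exists>l. d = [:0, 1:] ^ l)" "d dvd x" for d
  proof -
    have "d \<noteq> 0" 
    proof
      assume "d = 0"
      with that(2) have "x = 0" by (simp only: dvd_0_left_iff)
      with x(2) show False by (rule notE)
    qed
    with that(1) obtain l where l: "d = [:0, 1:] ^ l" by (elim disjE exE) simp
    have "l \<le> p_order x"
    proof (rule ccontr)
      assume "\<not> l \<le> p_order x"
      moreover have "\<forall>k<l. Polynomial.coeff x k = 0" using that(2) unfolding l X_power_dvd_iff .
      ultimately have "Polynomial.coeff x (p_order x) = 0" by simp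
      then show False using coeff_p_order[OF x(2)] by blast
    qed
    then show ?thesis unfolding l by (rule le_imp_power_dvd)
  qed
  have 4: "pseudo_reachable m M (mat (dim_row M) (dim_col M) (\<lambda>(i, j). if i = k \<and> j = k then ?x else M $$ (i, j)))"
    if M: "k < dim_row M \<and> k < dim_col M \<and> M $$ (k, k) = x \<and> (\<forall>j<dim_col M. j \<noteq> k \<longrightarrow> M $$ (k, j) = 0)" for M k
  \<comment> \<open>The pivot is the only non-zero entry of its row, so dividing the row by the
    pseudo-unit factor of the pivot is exact and leaves the power of \<open>p\<close>.\<close>
  proof (rule pseudo_reachable_step[OF pseudo_operation.div_row])
    show "k < dim_row M" using M by simp
    show "pseudo_unit m u" by (rule u(2))
    show "M = multrow k u (mat (dim_row M) (dim_col M) (\<lambda>(i, j). if i = k \<and> j = k then ?x else M $$ (i, j)))"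
    proof (rule eq_matI)
      fix i j
      assume ij: "i < dim_row (multrow k u (mat (dim_row M) (dim_col M) (\<lambda>(i, j). if i = k \<and> j = k then ?x else M $$ (i, j))))"
        "j < dim_col (multrow k u (mat (dim_row M) (dim_col M) (\<lambda>(i, j). if i = k \<and> j = k then ?x else M $$ (i, j))))"
      show "M $$ (i, j) = multrow k u (mat (dim_row M) (dim_col M) (\<lambda>(i, j). if i = k \<and> j = k then ?x else M $$ (i, j))) $$ (i, j)"
      proof (cases "i = k \<and> j = k")
        case True
        have "x = u * ?x" by (subst mult.commute) (rule u(1))
        then have "M $$ (k, k) = u * ?x" using M by (simp only:)
        then show ?thesis using ij True by simp
      next
        case False
        then show ?thesis using ij M by auto
      qed
    qed auto
  qed
  show "\<exists>x'\<in>Qp_ring m. (\<exists>l. x' = [:0, 1:] ^ l) \<and>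
       (\<forall>u\<in>{u. pseudo_unit m u}. \<forall>c\<in>Qp_ring m. \<forall>y\<in>Qp_ring m. u * y + c * x = 0 \<longrightarrow> x' dvd y) \<and>
       (\<forall>d. (d = 0 \<or> (\<exists>l. d = [:0, 1:] ^ l)) \<and> d dvd x \<longrightarrow> d dvd x') \<and>
       (\<forall>M k. k < dim_row M \<and> k < dim_col M \<and> M $$ (k, k) = x \<and> (\<forall>j<dim_col M. j \<noteq> k \<longrightarrow> M $$ (k, j) = 0) \<longrightarrow>
          pseudo_reachable m M (mat (dim_row M) (dim_col M) (\<lambda>(i, j). if i = k \<and> j = k then x' else M $$ (i, j))))"
  proof (rule bexI[OF _ 1], intro conjI)
    show "\<exists>l. ?x = [:0, 1:] ^ l" by (rule exI, rule HOL.refl)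
    show "\<forall>u\<in>{u. pseudo_unit m u}. \<forall>c\<in>Qp_ring m. \<forall>y\<in>Qp_ring m. u * y + c * x = 0 \<longrightarrow> ?x dvd y"
      by (intro ballI impI) (rule 2)
    show "\<forall>d. (d = 0 \<or> (\<exists>l. d = [:0, 1:] ^ l)) \<and> d dvd x \<longrightarrow> d dvd ?x"
      by (intro allI impI) (elim conjE, rule 3)
    show "\<forall>M k. k < dim_row M \<and> k < dim_col M \<and> M $$ (k, k) = x \<and> (\<forall>j<dim_col M. j \<noteq> k \<longrightarrow> M $$ (k, j) = 0) \<longrightarrow>
          pseudo_reachable m M (mat (dim_row M) (dim_col M) (\<lambda>(i, j). if i = k \<and> j = k then ?x else M $$ (i, j)))"
      by (intro allI impI) (rule 4)
  qed
qed (auto simp: Qp_ring_one Qp_ring_add Qp_ring_mult pseudo_unit_def)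

lemma pseudo_smith_computation_exists:
  assumes "\<And>i j. i < dim_row M \<Longrightarrow> j < dim_col M \<Longrightarrow> M $$ (i, j) \<in> Qp_ring m"
  shows "\<exists>us ds. pseudo_smith_computation m M us ds"
proof -
  obtain D where D: "pseudo_reachable m M D" "smith_shape D" 
    "\<forall>x \<in> set (diagonal_entries D). x = 0 \<or> (\<exists>l. x = [:0, 1:] ^ l)"
    using pseudo_smith.smith_exists[OF assms] by blast
  obtain us where us: "pseudo_operations m M us D" using D(1) unfolding pseudo_reachable_def by blast
  have "u = 1" if "d \<in> set (diagonal_entries D)" "d \<noteq> 0" "d = [:0, 1:] ^ k * u" "pseudo_unit m u" for d k u
  proof -
    have "\<exists>l. d = [:0, 1:] ^ l" using bspec[OF D(3) that(1)] that(2) by (elim disjE) simp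
    then obtain l where l: "d = [:0, 1:] ^ l" ..
    show ?thesis by (rule X_power_pseudo_unit[OF _ that(4)]) (rule HOL.trans[OF l[symmetric] that(3)])
  qed
  then have "pseudo_smith_form m D"
    unfolding pseudo_smith_form_def by (intro conjI D(2) ballI impI allI) (elim conjE)
  then show ?thesis unfolding pseudo_smith_computation_def using us by blast
qed

lemma pseudo_operation_dims:
  assumes "pseudo_operation m M us M'" shows "dim_row M' = dim_row M" "dim_col M' = dim_col M"
  using assms by (cases, auto)+

lemma pseudo_operations_dims:
  assumes "pseudo_operations m M us M'" shows "dim_row M' = dim_row M \<and> dim_col M' = dim_col M"
  using assms
proof (induction rule: pseudo_operations.induct)
  case (step M us M' vs M'')
  then show ?case using pseudo_operation_dims[OF step.hyps(2)] by simp
qed simp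

lemma pseudo_operation_Qp_ring:
  assumes "pseudo_operation m M us M'" and M: "\<And>i j. i < dim_row M \<Longrightarrow> j < dim_col M \<Longrightarrow> M $$ (i, j) \<in> Qp_ring m"
    and ij: "i < dim_row M'" "j < dim_col M'"
  shows "M' $$ (i, j) \<in> Qp_ring m"
  using assms(1)
proof cases
  case (div_row k u)
  have d: "i < dim_row M" "j < dim_col M" using pseudo_operation_dims[OF assms(1)] ij by auto
  have u: "u \<in> Qp_ring m" "Polynomial.coeff u 0 \<noteq> 0" using div_row by (auto simp: pseudo_unit_def)
  have "M $$ (i, j) = (if k = i then u * M' $$ (i, j) else M' $$ (i, j))" using div_row ij by simp
  then show ?thesis using M[OF d] Qp_ring_quotient[OF u, of "M' $$ (i, j)"] by (auto split: if_splits)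
next
  case (div_col k u)
  have d: "i < dim_row M" "j < dim_col M" using pseudo_operation_dims[OF assms(1)] ij by auto
  have u: "u \<in> Qp_ring m" "Polynomial.coeff u 0 \<noteq> 0" using div_col by (auto simp: pseudo_unit_def)
  have "M $$ (i, j) = (if k = j then u * M' $$ (i, j) else M' $$ (i, j))" using div_col ij by simp
  then show ?thesis using M[OF d] Qp_ring_quotient[OF u, of "M' $$ (i, j)"] by (auto split: if_splits)
qed (use ij in \<open>auto intro!: M Qp_ring_add Qp_ring_mult simp: pseudo_unit_def\<close>)

lemma pseudo_operations_Qp_ring:
  assumes "pseudo_operations m M us M'" and "\<And>i j. i < dim_row M \<Longrightarrow> j < dim_col M \<Longrightarrow> M $$ (i, j) \<in> Qp_ring m"
    and "i < dim_row M'" "j < dim_col M'"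
  shows "M' $$ (i, j) \<in> Qp_ring m"
  using assms
proof (induction arbitrary: i j rule: pseudo_operations.induct)
  case (step M us M' vs M'')
  show ?case
    by (rule pseudo_operation_Qp_ring[OF step.hyps(2) step.IH]) (use step.prems in auto)
qed

lemma pseudo_smith_form_entries:
  assumes "pseudo_smith_form m D" "\<And>i j. i < dim_row D \<Longrightarrow> j < dim_col D \<Longrightarrow> D $$ (i, j) \<in> Qp_ring m"
    and "i < min (dim_row D) (dim_col D)" "D $$ (i, i) \<noteq> 0"
  shows "\<exists>l. D $$ (i, i) = [:0, 1:] ^ l"
proof -
  have "D $$ (i, i) \<in> Qp_ring m" using assms(2,3) by simp
  then obtain u where u: "D $$ (i, i) = [:0, 1:] ^ p_order (D $$ (i, i)) * u" "pseudo_unit m u"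
    using p_order_decomposition[OF _ assms(4)] by blast
  have "D $$ (i, i) \<in> set (diagonal_entries D)" using assms(3) by (auto simp: diagonal_entries_def)
  moreover have "\<forall>d \<in> set (diagonal_entries D). d \<noteq> 0 \<longrightarrow>
        (\<forall>l u. d = [:0, 1:] ^ l * u \<and> pseudo_unit m u \<longrightarrow> u = 1)"
    using assms(1) unfolding pseudo_smith_form_def by (rule conjunct2)
  ultimately have "\<forall>l u. D $$ (i, i) = [:0, 1:] ^ l * u \<and> pseudo_unit m u \<longrightarrow> u = 1"
    using assms(4) by (meson bspec mp)
  then have "u = 1" using u by meson
  then show ?thesis using u(1) unfolding mult_1_right by (intro exI) (simp only: mult_1_right)
qed

section \<open>Tracking a symbolic computation\<close>

definition diag_matrix :: "nat \<Rightarrow> (nat \<Rightarrow> 'a::zero) \<Rightarrow> 'a mat" where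
  "diag_matrix r \<alpha> = mat r r (\<lambda>(i, j). if i = j then \<alpha> i else 0)"

text \<open>Adding \<open>b / g\<close> times one row to another with the denominator cleared: every
  row is scaled by \<open>g\<close>, and \<open>b\<close> stands in the single off-diagonal
  place.\<close>

definition add_matrix :: "nat \<Rightarrow> 'a \<Rightarrow> nat \<Rightarrow> nat \<Rightarrow> 'a \<Rightarrow> 'a::zero mat" where
  "add_matrix r g k l b = mat r r (\<lambda>(i, j). if i = j then g else if i = k \<and> j = l then b else 0)"

lemma diag_matrix_carrier: "diag_matrix r \<alpha> \<in> carrier_mat r r"
  by (simp add: diag_matrix_def)

lemma add_matrix_carrier: "add_matrix r g k l b \<in> carrier_mat r r"
  by (simp add: add_matrix_def)

lemma map_diag_matrix: "h 0 = 0 \<Longrightarrow> map_mat h (diag_matrix r \<alpha>) = diag_matrix r (\<lambda>i. h (\<alpha> i))"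
  by (rule eq_matI) (auto simp: diag_matrix_def)

lemma map_add_matrix: "h 0 = 0 \<Longrightarrow> map_mat h (add_matrix r g k l b) = add_matrix r (h g) k l (h b)"
  by (rule eq_matI) (auto simp: add_matrix_def)

lemma map_swaprows_mat: "h 0 = 0 \<Longrightarrow> h 1 = 1 \<Longrightarrow> map_mat h (swaprows_mat r k l) = swaprows_mat r k l"
  by (rule eq_matI) (auto simp: swaprows_mat_def)

lemma diag_matrix_mult_left:
  fixes B :: "'a::comm_ring_1 mat"
  assumes "i < dim_row B" "j < dim_col B"
  shows "(diag_matrix (dim_row B) \<alpha> * B) $$ (i, j) = \<alpha> i * B $$ (i, j)"
proof -
  have "(diag_matrix (dim_row B) \<alpha> * B) $$ (i, j) = (\<Sum>t = 0..<dim_row B. (if i = t then \<alpha> i else 0) * B $$ (t, j))"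
    using assms by (simp add: diag_matrix_def scalar_prod_def)
  also have "\<dots> = (\<Sum>t = 0..<dim_row B. (if t = i then \<alpha> i * B $$ (i, j) else 0))"
    by (rule sum.cong) (use assms in auto)
  finally show ?thesis using assms by simp
qed

lemma diag_matrix_mult_right:
  fixes B :: "'a::comm_ring_1 mat"
  assumes "i < dim_row B" "j < dim_col B"
  shows "(B * diag_matrix (dim_col B) \<alpha>) $$ (i, j) = \<alpha> j * B $$ (i, j)"
proof -
  have "(B * diag_matrix (dim_col B) \<alpha>) $$ (i, j) = (\<Sum>t = 0..<dim_col B. B $$ (i, t) * (if t = j then \<alpha> t else 0))"
    using assms by (simp add: diag_matrix_def scalar_prod_def)
  also have "\<dots> = (\<Sum>t = 0..<dim_col B. (if t = j then \<alpha> j * B $$ (i, j) else 0))"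
    by (rule sum.cong) (use assms in auto)
  finally show ?thesis using assms by simp
qed

lemma add_matrix_mult_left:
  fixes B :: "'a::comm_ring_1 mat"
  assumes "i < dim_row B" "j < dim_col B" "k \<noteq> l" "l < dim_row B"
  shows "(add_matrix (dim_row B) g k l b * B) $$ (i, j) = g * B $$ (i, j) + (if i = k then b * B $$ (l, j) else 0)"
proof -
  have "(add_matrix (dim_row B) g k l b * B) $$ (i, j) = (\<Sum>t = 0..<dim_row B. (if i = t then g else if i = k \<and> t = l then b else 0) * B $$ (t, j))"
    using assms by (simp add: add_matrix_def scalar_prod_def)
  also have "\<dots> = (\<Sum>t = 0..<dim_row B. (if t = i then g * B $$ (i, j) else 0) +
     (if t = l then if i = k then b * B $$ (l, j) else 0 else 0))"
    by (rule sum.cong) (use assms in auto)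
  finally show ?thesis using assms by (simp add: sum.distrib)
qed

lemma add_matrix_mult_right:
  fixes B :: "'a::comm_ring_1 mat"
  assumes "i < dim_row B" "j < dim_col B" "k \<noteq> l" "l < dim_col B"
  shows "(B * add_matrix (dim_col B) g l k b) $$ (i, j) = g * B $$ (i, j) + (if j = k then b * B $$ (i, l) else 0)"
proof -
  have "(B * add_matrix (dim_col B) g l k b) $$ (i, j) = (\<Sum>t = 0..<dim_col B. B $$ (i, t) * (if t = j then g else if t = l \<and> j = k then b else 0))"
    using assms by (simp add: add_matrix_def scalar_prod_def)
  also have "\<dots> = (\<Sum>t = 0..<dim_col B. (if t = j then g * B $$ (i, j) else 0) +
     (if t = l then if j = k then b * B $$ (i, l) else 0 else 0))"
    by (rule sum.cong) (use assms in auto)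
  finally show ?thesis using assms by (simp add: sum.distrib)
qed

lemma minors_dvd_smult:
  fixes M :: "'a::comm_ring_1 mat"
  assumes M: "minors_dvd d k (h \<cdot>\<^sub>m M)" and d: "\<And>y. d dvd h ^ k * y \<Longrightarrow> d dvd y"
  shows "minors_dvd d k M"
  unfolding minors_dvd_def
proof (intro allI impI)
  fix f g assume f: "\<forall>i<k. f i < dim_row M" "\<forall>j<k. g j < dim_col M"
  then have "d dvd minor (h \<cdot>\<^sub>m M) k f g" using M by (simp add: minors_dvd_def)
  moreover have "mat k k (\<lambda>(i, j). (h \<cdot>\<^sub>m M) $$ (f i, g j)) = h \<cdot>\<^sub>m mat k k (\<lambda>(i, j). M $$ (f i, g j))"
    by (rule eq_matI) (use f in auto)
  then have "minor (h \<cdot>\<^sub>m M) k f g = h ^ k * minor M k f g" unfolding minor_def by (simp add: det_smult)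
  ultimately have "d dvd h ^ k * minor M k f g" by (simp only:)
  then show "d dvd minor M k f g" by (rule d)
qed

lemma one_smult_mat: "1 \<cdot>\<^sub>m M = (M :: 'a::comm_ring_1 mat)"
  by (rule eq_matI) auto

lemma multrow_entries:
  "M = multrow k u M' \<Longrightarrow> i < dim_row M' \<Longrightarrow> j < dim_col M' \<Longrightarrow>
    M $$ (i, j) = (if k = i then u * M' $$ (i, j) else M' $$ (i, j))"
  by simp

lemma multcol_entries:
  "M = multcol k u M' \<Longrightarrow> i < dim_row M' \<Longrightarrow> j < dim_col M' \<Longrightarrow>
    M $$ (i, j) = (if k = j then u * M' $$ (i, j) else M' $$ (i, j))"
  by simp

text \<open>Multiplication of one row by \<open>u\<close> is undone without division by multiplying
  all the other rows by \<open>u\<close>, which yields \<open>u\<close> times the old matrix. All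
  other operations are undone exactly, with \<open>h = 1\<close>.\<close>

lemma pseudo_operation_backward:
  assumes "pseudo_operation m M us M'"
  shows "\<exists>h E. Polynomial.coeff h 0 \<noteq> 0 \<and>
    (E \<in> carrier_mat (dim_row M) (dim_row M) \<and> h \<cdot>\<^sub>m M = E * M' \<or>
     E \<in> carrier_mat (dim_col M) (dim_col M) \<and> h \<cdot>\<^sub>m M = M' * E)"
proof -
  have one: "Polynomial.coeff (1 :: mpoly fract poly) 0 \<noteq> 0" by simp
  have row: ?thesis if "Polynomial.coeff h 0 \<noteq> 0" "E \<in> carrier_mat (dim_row M) (dim_row M)" "h \<cdot>\<^sub>m M = E * M'" for h E
    using that by blast
  have col: ?thesis if "Polynomial.coeff h 0 \<noteq> 0" "E \<in> carrier_mat (dim_col M) (dim_col M)" "h \<cdot>\<^sub>m M = M' * E" for h E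
    using that by blast
  have row1: ?thesis if "E \<in> carrier_mat (dim_row M) (dim_row M)" "E * M' = M" for E
    by (rule row[OF one that(1)]) (simp only: one_smult_mat that(2))
  have col1: ?thesis if "E \<in> carrier_mat (dim_col M) (dim_col M)" "M' * E = M" for E
    by (rule col[OF one that(1)]) (simp only: one_smult_mat that(2))
  have d: "dim_row M' = dim_row M" "dim_col M' = dim_col M" using pseudo_operation_dims[OF assms] .
  have dr: "diag_matrix (dim_row M) \<alpha> * M' = mat (dim_row M) (dim_col M) (\<lambda>(i, j). \<alpha> i * M' $$ (i, j))" for \<alpha>
    by (rule eq_matI) (use diag_matrix_mult_left[of _ M' _ \<alpha>] d in \<open>auto simp: diag_matrix_def\<close>)
  have dc: "M' * diag_matrix (dim_col M) \<alpha> = mat (dim_row M) (dim_col M) (\<lambda>(i, j). \<alpha> j * M' $$ (i, j))" for \<alpha>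
    by (rule eq_matI) (use diag_matrix_mult_right[of _ M' _ \<alpha>] d in \<open>auto simp: diag_matrix_def\<close>)
  show ?thesis using assms
  proof cases
    case (swap_rows k l)
    have "swaprows_mat (dim_row M) k l * M' = swaprows k l M'"
      by (rule swaprows_mat[symmetric]) (use swap_rows d in auto)
    also have "\<dots> = M" unfolding swap_rows by (rule eq_matI) (use swap_rows in auto)
    finally show ?thesis by (rule row1[OF swaprows_mat_carrier])
  next
    case (swap_cols k l)
    have "M' * swaprows_mat (dim_col M) k l = swapcols k l M'"
      by (rule swapcols_mat[symmetric]) (use swap_cols d in auto)
    also have "\<dots> = M" unfolding swap_cols by (rule eq_matI) (use swap_cols in auto)
    finally show ?thesis by (rule col1[OF swaprows_mat_carrier])
  next
    case (add_row k l c)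
    have "addrow_mat (dim_row M) (- c) k l * M' = addrow (- c) k l M'"
      by (rule addrow_mat[symmetric]) (use add_row d in auto)
    also have "\<dots> = M" unfolding add_row by (rule eq_matI) (use add_row in auto)
    finally show ?thesis by (rule row1[OF addrow_mat_carrier])
  next
    case (add_col k l c)
    have "M' * addrow_mat (dim_col M) (- c) l k = addcol (- c) k l M'"
      by (rule addcol_mat[symmetric]) (use add_col d in auto)
    also have "\<dots> = M" unfolding add_col by (rule eq_matI) (use add_col in auto)
    finally show ?thesis by (rule col1[OF addrow_mat_carrier])
  next
    case (mult_row k u)
    have "u \<cdot>\<^sub>m M = diag_matrix (dim_row M) (\<lambda>i. if i = k then 1 else u) * M'"
      unfolding dr by (rule eq_matI) (use mult_row in auto)
    then show ?thesis using mult_row by (intro row[OF _ diag_matrix_carrier]) (auto simp: pseudo_unit_def)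
  next
    case (mult_col k u)
    have "u \<cdot>\<^sub>m M = M' * diag_matrix (dim_col M) (\<lambda>i. if i = k then 1 else u)"
      unfolding dc by (rule eq_matI) (use mult_col in auto)
    then show ?thesis using mult_col by (intro col[OF _ diag_matrix_carrier]) (auto simp: pseudo_unit_def)
  next
    case (div_row k u)
    have "M = diag_matrix (dim_row M) (\<lambda>i. if i = k then u else 1) * M'"
    proof (rule eq_matI)
      fix i j
      assume ij: "i < dim_row (diag_matrix (dim_row M) (\<lambda>i. if i = k then u else 1) * M')" "j < dim_col (diag_matrix (dim_row M) (\<lambda>i. if i = k then u else 1) * M')"
      then have "i < dim_row M'" "j < dim_col M'" using d by (simp_all add: diag_matrix_def)
      from multrow_entries[OF div_row(4) this]
      show "M $$ (i, j) = (diag_matrix (dim_row M) (\<lambda>i. if i = k then u else 1) * M') $$ (i, j)"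
        unfolding dr using ij d by (simp add: diag_matrix_def)
    qed (use d in \<open>auto simp: diag_matrix_def\<close>)
    from this[symmetric] show ?thesis by (rule row1[OF diag_matrix_carrier])
  next
    case (div_col k u)
    have "M = M' * diag_matrix (dim_col M) (\<lambda>i. if i = k then u else 1)"
    proof (rule eq_matI)
      fix i j
      assume ij: "i < dim_row (M' * diag_matrix (dim_col M) (\<lambda>i. if i = k then u else 1))" "j < dim_col (M' * diag_matrix (dim_col M) (\<lambda>i. if i = k then u else 1))"
      then have "i < dim_row M'" "j < dim_col M'" using d by (simp_all add: diag_matrix_def)
      from multcol_entries[OF div_col(4) this]
      show "M $$ (i, j) = (M' * diag_matrix (dim_col M) (\<lambda>i. if i = k then u else 1)) $$ (i, j)"
        unfolding dc using ij d by (simp add: diag_matrix_def)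
    qed (use d in \<open>auto simp: diag_matrix_def\<close>)
    from this[symmetric] show ?thesis by (rule col1[OF diag_matrix_carrier])
  qed
qed

text \<open>Read backwards, each operation contributes a factor \<open>h ^ k\<close> to the minors
  of order \<open>k\<close>; its constant coefficient is again non-zero, so it cancels from
  divisibility by \<open>d\<close>.\<close>

lemma pseudo_operations_minors:
  assumes "pseudo_operations m M us M'" "minors_dvd d k M'"
    and d: "\<And>h y. Polynomial.coeff h 0 \<noteq> 0 \<Longrightarrow> d dvd h * y \<Longrightarrow> d dvd y"
  shows "minors_dvd d k M"
  using assms(1,2)
proof (induction rule: pseudo_operations.induct)
  case (step M us M' vs M'')
  obtain h E where h: "Polynomial.coeff h 0 \<noteq> 0" and
    E: "E \<in> carrier_mat (dim_row M') (dim_row M') \<and> h \<cdot>\<^sub>m M' = E * M'' \<or>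
     E \<in> carrier_mat (dim_col M') (dim_col M') \<and> h \<cdot>\<^sub>m M' = M'' * E"
    using pseudo_operation_backward[OF step.hyps(2)] by blast
  note dims = pseudo_operation_dims[OF step.hyps(2)]
  have "minors_dvd d k (h \<cdot>\<^sub>m M')"
    using E
  proof (elim disjE conjE)
    assume "E \<in> carrier_mat (dim_row M') (dim_row M')" "h \<cdot>\<^sub>m M' = E * M''"
    then show ?thesis using minors_dvd_mult_left[OF step.prems, of E] dims by simp
  next
    assume "E \<in> carrier_mat (dim_col M') (dim_col M')" "h \<cdot>\<^sub>m M' = M'' * E"
    then show ?thesis using minors_dvd_mult_right[OF step.prems, of E] dims by simp
  qed
  moreover have "Polynomial.coeff (h ^ k) 0 \<noteq> 0" using h by (simp add: coeff_0_power)
  ultimately have "minors_dvd d k M'" by (rule minors_dvd_smult[OF _ d])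
  then show ?case by (rule step.IH)
qed

definition value_at :: "nat \<Rightarrow> (nat \<Rightarrow> int) \<Rightarrow> mpoly poly \<Rightarrow> int" where
  "value_at p \<rho> f = poly (map_poly (mpoly_eval \<rho>) f) (int p)"

lemma comm_ring_hom_value_at: "comm_ring_hom (value_at p \<rho>)"
proof -
  interpret e: comm_ring_hom "mpoly_eval \<rho>" by (rule comm_ring_hom_mpoly_eval)
  interpret m: map_poly_comm_ring_hom "mpoly_eval \<rho>" ..
  show ?thesis
    by unfold_locales (simp_all add: value_at_def m.hom_add m.hom_mult)
qed

interpretation value_hom: comm_ring_hom "value_at p \<rho>" for p \<rho>
  by (rule comm_ring_hom_value_at)

lemma comm_ring_hom_fract_poly: "comm_ring_hom (map_poly (to_fract :: mpoly \<Rightarrow> mpoly fract))"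
  by unfold_locales (simp_all add: fract_poly_add fract_poly_mult)

interpretation fract_hom: comm_ring_hom "map_poly (to_fract :: mpoly \<Rightarrow> mpoly fract)"
  by (rule comm_ring_hom_fract_poly)

lemma value_at_const: "value_at p \<rho> [:g:] = mpoly_eval \<rho> g"
  by (cases "g = 0") (simp_all add: value_at_def map_poly_pCons mpoly_eval_zero)

lemma value_at_X: "value_at p \<rho> [:0, 1:] = int p"
  by (simp add: value_at_def map_poly_pCons mpoly_eval_zero mpoly_eval_one)

lemma value_at_smult: "value_at p \<rho> (Polynomial.smult g f) = mpoly_eval \<rho> g * value_at p \<rho> f"
proof -
  have "Polynomial.smult g f = [:g:] * f" by simp
  then show ?thesis by (simp only: value_hom.hom_mult value_at_const)
qed

lemma fract_poly_const: "map_poly to_fract [:g:] = [:to_fract g:]" for g :: mpoly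
  by (rule poly_eqI) (simp add: coeff_map_poly coeff_pCons split: nat.split)

context
  fixes m p w :: nat and x :: "nat \<Rightarrow> int"
  assumes p: "prime p"
begin

abbreviation "val \<equiv> value_at p (point w x)"
abbreviation "ev \<equiv> mpoly_eval (point w x)"

lemma prime_int_p: "prime (int p)"
  using p by simp

lemma not_dvd_one: "\<not> int p dvd 1"
  using prime_int_p not_prime_unit by blast

lemma has_Zp_value_iff: "has_Zp_value m p w x c r \<longleftrightarrow> r \<in> {0..<int p} \<and>
     (\<exists>f g. fraction_form m c f g \<and> \<not> int p dvd ev g \<and> int p dvd r * ev g - val f)"
  unfolding has_Zp_value_def value_at_def by (simp add: cong_iff_dvd_diff)

text \<open>Two fraction forms of \<open>c\<close> agree after cross-multiplication. This equation
  can be evaluated, and the denominators, being prime to \<open>p\<close>, cancel modulo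
  \<open>p\<close>.\<close>

lemma has_Zp_value_unique:
  assumes "has_Zp_value m p w x c r" "has_Zp_value m p w x c r'"
  shows "r = r'"
proof -
  obtain f g where 1: "r \<in> {0..<int p}" "fraction_form m c f g" "\<not> int p dvd ev g" "int p dvd r * ev g - val f"
    using assms(1) unfolding has_Zp_value_iff by blast
  obtain f' g' where 2: "r' \<in> {0..<int p}" "fraction_form m c f' g'" "\<not> int p dvd ev g'" "int p dvd r' * ev g' - val f'"
    using assms(2) unfolding has_Zp_value_iff by blast
  have e1: "Polynomial.smult (to_fract g) c = fract_poly f" and e2: "Polynomial.smult (to_fract g') c = fract_poly f'"
    using 1 2 by (auto simp: fraction_form_def)
  have "fract_poly (Polynomial.smult g' f) = fract_poly (Polynomial.smult g f')"
    by (simp only: fract_poly_smult e1[symmetric] e2[symmetric] smult_smult mult.commute)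
  then have "Polynomial.smult g' f = Polynomial.smult g f'" by (simp only: fract_poly_eq_iff)
  from arg_cong[OF this, of val] have eq: "ev g' * val f = ev g * val f'" by (simp only: value_at_smult)
  have "int p dvd ev g' * (r * ev g - val f) - ev g * (r' * ev g' - val f')"
    by (intro dvd_diff dvd_mult 1(4) 2(4))
  also have "\<dots> = (r - r') * (ev g * ev g')" using eq by (simp add: algebra_simps)
  finally have "int p dvd r - r'" using 1(3) 2(3) prime_int_p by (simp add: prime_dvd_mult_iff)
  then have "r mod int p = r' mod int p" unfolding mod_eq_dvd_iff .
  moreover have "r mod int p = r" "r' mod int p = r'" using 1(1) 2(1) by auto
  ultimately show ?thesis by (simp only:)
qed

lemma Zp_value_nonzero:
  assumes "Zp_value m p w x u \<noteq> 0"
  shows "\<exists>r. has_Zp_value m p w x u r \<and> r \<noteq> 0"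
proof -
  obtain r where r: "has_Zp_value m p w x u r" using assms unfolding Zp_value_def by (auto split: if_splits)
  then have "(THE r. has_Zp_value m p w x u r) = r" using has_Zp_value_unique by blast
  then show ?thesis using r assms unfolding Zp_value_def by (auto split: if_splits)
qed

lemma has_Zp_value_not_dvd: "has_Zp_value m p w x u r \<Longrightarrow> r \<noteq> 0 \<Longrightarrow> \<not> int p dvd r"
  unfolding has_Zp_value_iff using zdvd_not_zless[of r "int p"] by auto

lemma has_Zp_value_coprime: "has_Zp_value m p w x u r \<Longrightarrow> r \<noteq> 0 \<Longrightarrow> coprime r (int p)"
  unfolding coprime_commute[of r] by (rule prime_imp_coprime[OF prime_int_p has_Zp_value_not_dvd])

text \<open>The numerator is congruent to the value times the denominator, and \<open>p\<close>
  divides neither of these factors.\<close>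

lemma Zp_value_fraction:
  assumes "Zp_value m p w x u \<noteq> 0"
  shows "\<exists>f g. Polynomial.smult (to_fract g) u = fract_poly f \<and> \<not> int p dvd ev g \<and> \<not> int p dvd val f"
proof -
  obtain r where r: "has_Zp_value m p w x u r" "r \<noteq> 0" using Zp_value_nonzero[OF assms] by blast
  then obtain f g where fg: "fraction_form m u f g" "\<not> int p dvd ev g" "int p dvd r * ev g - val f"
    unfolding has_Zp_value_iff by blast
  have nd: "\<not> int p dvd r * ev g"
    unfolding prime_dvd_mult_iff[OF prime_int_p] using has_Zp_value_not_dvd[OF r] fg(2) by blast
  have "\<not> int p dvd val f"
  proof
    assume "int p dvd val f"
    then have "int p dvd (r * ev g - val f) + val f" by (rule dvd_add[OF fg(3)])
    then show False using nd by (simp only: diff_add_cancel)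
  qed
  then show ?thesis using fg by (auto simp: fraction_form_def)
qed

text \<open>The value of the stored constant \<open>g\<close> may come from a different form, with
  numerator \<open>f'\<close> and denominator \<open>g'\<close>. Then \<open>f' = g' * g\<close> as
  polynomials, so \<open>g\<close> divides a number prime to \<open>p\<close> after
  evaluation.\<close>

lemma stored_denominators_fraction:
  assumes "stored_denominators m c us" "\<And>u. u \<in> set us \<Longrightarrow> Zp_value m p w x u \<noteq> 0"
  shows "\<exists>f g. Polynomial.smult (to_fract g) c = fract_poly f \<and> \<not> int p dvd ev g"
  using assms(1)
proof cases
  case (no_division f)
  show ?thesis
  proof (intro exI conjI)
    show "Polynomial.smult (to_fract 1) c = fract_poly f" unfolding no_division(1) to_fract_1 by (rule smult_1_left)
    show "\<not> int p dvd ev 1" unfolding mpoly_eval_one by (rule not_dvd_one)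
  qed
next
  case (division f g)
  obtain f' g' where fg: "Polynomial.smult (to_fract g') [:to_fract g:] = fract_poly f'" "\<not> int p dvd ev g'" "\<not> int p dvd val f'"
    using Zp_value_fraction[OF assms(2), of "[:to_fract g:]"] division by auto
  have "fract_poly f' = fract_poly [:g' * g:]" unfolding fg(1)[symmetric] fract_poly_const by simp
  then have "f' = [:g' * g:]" by (simp only: fract_poly_eq_iff)
  then have "val f' = ev g' * ev g" by (simp only: value_at_const mpoly_eval_mult)
  then have "\<not> int p dvd ev g" using fg(3) by auto
  then show ?thesis using division by (auto simp: fraction_form_def)
qed

text \<open>\<open>h\<close> is a common denominator with value prime to \<open>p\<close>, and
  \<open>P\<close>, \<open>Q\<close> contain no fractions, so the equation can be evaluated. Neither
  of them is claimed to be invertible.\<close>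

definition specializes :: "mpoly fract poly mat \<Rightarrow> mpoly fract poly mat \<Rightarrow> bool" where
  "specializes M M' \<longleftrightarrow> (\<exists>h P Q. \<not> int p dvd val h \<and> P \<in> carrier_mat (dim_row M) (dim_row M) \<and>
     Q \<in> carrier_mat (dim_col M) (dim_col M) \<and>
     fract_poly h \<cdot>\<^sub>m M' = map_mat fract_poly P * M * map_mat fract_poly Q)"

lemma map_one_mat: "map_mat fract_poly (1\<^sub>m n) = (1\<^sub>m n :: mpoly fract poly mat)"
  by (rule eq_matI) auto

lemma specializes_row:
  assumes "\<not> int p dvd val h" "P \<in> carrier_mat (dim_row M) (dim_row M)" "fract_poly h \<cdot>\<^sub>m M' = map_mat fract_poly P * M"
  shows "specializes M M'"
  unfolding specializes_def
proof (intro exI conjI)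
  show "fract_poly h \<cdot>\<^sub>m M' = map_mat fract_poly P * M * map_mat fract_poly (1\<^sub>m (dim_col M))"
    unfolding assms(3) map_one_mat by (rule right_mult_one_mat[symmetric]) (use assms(2) in auto)
qed (use assms in auto)

lemma specializes_col:
  assumes "\<not> int p dvd val h" "P \<in> carrier_mat (dim_col M) (dim_col M)" "fract_poly h \<cdot>\<^sub>m M' = M * map_mat fract_poly P"
  shows "specializes M M'"
  unfolding specializes_def
proof (intro exI conjI)
  show "fract_poly h \<cdot>\<^sub>m M' = map_mat fract_poly (1\<^sub>m (dim_row M)) * M * map_mat fract_poly P"
    unfolding assms(3) map_one_mat by simp
qed (use assms in auto)

lemma specializes_refl: "specializes M M"
proof (rule specializes_row[of 1 "1\<^sub>m (dim_row M)"])
  show "\<not> int p dvd val 1" unfolding value_hom.hom_one by (rule not_dvd_one)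
  show "fract_poly 1 \<cdot>\<^sub>m M = map_mat fract_poly (1\<^sub>m (dim_row M)) * M" unfolding map_one_mat by (rule eq_matI) auto
qed simp

lemma specializes_trans:
  assumes "specializes M M'" "specializes M' M''" and d: "dim_row M' = dim_row M" "dim_col M' = dim_col M"
  shows "specializes M M''"
proof -
  let ?F = "map_mat fract_poly"
  obtain h P Q where 1: "\<not> int p dvd val h" "P \<in> carrier_mat (dim_row M) (dim_row M)" "Q \<in> carrier_mat (dim_col M) (dim_col M)"
    "fract_poly h \<cdot>\<^sub>m M' = ?F P * M * ?F Q" using assms(1) unfolding specializes_def by blast
  obtain h' P' Q' where 2: "\<not> int p dvd val h'" "P' \<in> carrier_mat (dim_row M) (dim_row M)" "Q' \<in> carrier_mat (dim_col M) (dim_col M)"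
    "fract_poly h' \<cdot>\<^sub>m M'' = ?F P' * M' * ?F Q'" using assms(2) unfolding specializes_def d by blast
  have c: "?F P \<in> carrier_mat (dim_row M) (dim_row M)" "?F P' \<in> carrier_mat (dim_row M) (dim_row M)"
    "?F Q \<in> carrier_mat (dim_col M) (dim_col M)" "?F Q' \<in> carrier_mat (dim_col M) (dim_col M)"
    using 1(2,3) 2(2,3) by auto
  have cM: "M \<in> carrier_mat (dim_row M) (dim_col M)" by simp
  have cM': "M' \<in> carrier_mat (dim_row M) (dim_col M)" by (rule carrier_matI[OF d])
  have "fract_poly (h * h') \<cdot>\<^sub>m M'' = fract_poly h \<cdot>\<^sub>m (fract_poly h' \<cdot>\<^sub>m M'')"
    by (rule eq_matI) (auto simp: fract_hom.hom_mult mult.assoc)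
  also have "\<dots> = fract_poly h \<cdot>\<^sub>m (?F P' * M' * ?F Q')" by (simp only: 2(4))
  also have "\<dots> = (fract_poly h \<cdot>\<^sub>m (?F P' * M')) * ?F Q'"
    by (rule mult_smult_assoc_mat[symmetric, OF mult_carrier_mat[OF c(2) cM'] c(4)])
  also have "fract_poly h \<cdot>\<^sub>m (?F P' * M') = ?F P' * (fract_poly h \<cdot>\<^sub>m M')"
    by (rule mult_smult_distrib[symmetric, OF c(2) cM'])
  also have "\<dots> = ?F P' * (?F P * M * ?F Q)" by (simp only: 1(4))
  also have "?F P * M * ?F Q = ?F P * (M * ?F Q)" by (rule assoc_mult_mat[OF c(1) cM c(3)])
  also have "?F P' * (?F P * (M * ?F Q)) = (?F P' * ?F P) * (M * ?F Q)"
    by (rule assoc_mult_mat[symmetric, OF c(2) c(1) mult_carrier_mat[OF cM c(3)]])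
  also have "(?F P' * ?F P) * (M * ?F Q) * ?F Q' = (?F P' * ?F P) * ((M * ?F Q) * ?F Q')"
    by (rule assoc_mult_mat[OF mult_carrier_mat[OF c(2) c(1)] mult_carrier_mat[OF cM c(3)] c(4)])
  also have "(M * ?F Q) * ?F Q' = M * (?F Q * ?F Q')" by (rule assoc_mult_mat[OF cM c(3) c(4)])
  also have "(?F P' * ?F P) * (M * (?F Q * ?F Q')) = (?F P' * ?F P) * M * (?F Q * ?F Q')"
    by (rule assoc_mult_mat[symmetric, OF mult_carrier_mat[OF c(2) c(1)] cM mult_carrier_mat[OF c(3) c(4)]])
  also have "?F P' * ?F P = ?F (P' * P)" by (rule fract_hom.mat_hom_mult[symmetric, OF 2(2) 1(2)])
  also have "?F Q * ?F Q' = ?F (Q * Q')" by (rule fract_hom.mat_hom_mult[symmetric, OF 1(3) 2(3)])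
  finally have "fract_poly (h * h') \<cdot>\<^sub>m M'' = ?F (P' * P) * M * ?F (Q * Q')" .
  moreover have "\<not> int p dvd val (h * h')" using 1(1) 2(1) prime_int_p by (simp add: value_hom.hom_mult prime_dvd_mult_iff)
  ultimately show ?thesis unfolding specializes_def
    using mult_carrier_mat[OF 2(2) 1(2)] mult_carrier_mat[OF 1(3) 2(3)] by blast
qed

text \<open>If the multiplier is \<open>f / g\<close>, the clearing factor \<open>h\<close> is the
  denominator \<open>g\<close> for an addition or a multiplication, and the numerator
  \<open>f\<close> for a division. Storing the denominators of multipliers and the divisors
  themselves makes each of these prime to \<open>p\<close>.\<close>

lemma pseudo_operation_specializes:
  assumes op: "pseudo_operation m M us M'" and us: "\<And>u. u \<in> set us \<Longrightarrow> Zp_value m p w x u \<noteq> 0"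
  shows "specializes M M'"
proof -
  have one: "\<not> int p dvd val 1" unfolding value_hom.hom_one by (rule not_dvd_one)
  have d: "dim_row M' = dim_row M" "dim_col M' = dim_col M" using pseudo_operation_dims[OF op] .
  have F0: "fract_poly 0 = (0 :: mpoly fract poly)" "fract_poly 1 = (1 :: mpoly fract poly)" by simp_all
  have sm: "fract_poly [:g:] * y = Polynomial.smult (to_fract g) y" for g :: mpoly and y
    unfolding fract_poly_const by simp
  have frac: "\<exists>f g. fract_poly [:g:] * c = fract_poly f \<and> \<not> int p dvd val [:g:]" if "stored_denominators m c us" for c
    using stored_denominators_fraction[OF that us] unfolding sm value_at_const by blast
  have frac': "\<exists>f g. fract_poly [:g:] * u = fract_poly f \<and> \<not> int p dvd val f" if "u \<in> set us" for u
    using Zp_value_fraction[OF us[OF that]] unfolding sm by blast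
  have dr: "map_mat fract_poly (diag_matrix (dim_row M) \<alpha>) * M = mat (dim_row M) (dim_col M) (\<lambda>(i, j). fract_poly (\<alpha> i) * M $$ (i, j))" for \<alpha>
    unfolding map_diag_matrix[where h = "fract_poly :: mpoly poly \<Rightarrow> mpoly fract poly", OF F0(1)]
    by (rule eq_matI) (use diag_matrix_mult_left[of _ M _ "\<lambda>i. fract_poly (\<alpha> i)"] in \<open>auto simp: diag_matrix_def\<close>)
  have dc: "M * map_mat fract_poly (diag_matrix (dim_col M) \<alpha>) = mat (dim_row M) (dim_col M) (\<lambda>(i, j). fract_poly (\<alpha> j) * M $$ (i, j))" for \<alpha>
    unfolding map_diag_matrix[where h = "fract_poly :: mpoly poly \<Rightarrow> mpoly fract poly", OF F0(1)]
    by (rule eq_matI) (use diag_matrix_mult_right[of _ M _ "\<lambda>i. fract_poly (\<alpha> i)"] in \<open>auto simp: diag_matrix_def\<close>)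
  have ar: "map_mat fract_poly (add_matrix (dim_row M) g k l b) * M = mat (dim_row M) (dim_col M)
      (\<lambda>(i, j). fract_poly g * M $$ (i, j) + (if i = k then fract_poly b * M $$ (l, j) else 0))" if "k \<noteq> l" "l < dim_row M" for g b :: "mpoly poly" and k l
    unfolding map_add_matrix[where h = "fract_poly :: mpoly poly \<Rightarrow> mpoly fract poly", OF F0(1)]
    by (rule eq_matI) (use add_matrix_mult_left[of _ M _ k l "fract_poly g" "fract_poly b"] that in \<open>auto simp: add_matrix_def\<close>)
  have ac: "M * map_mat fract_poly (add_matrix (dim_col M) g l k b) = mat (dim_row M) (dim_col M)
      (\<lambda>(i, j). fract_poly g * M $$ (i, j) + (if j = k then fract_poly b * M $$ (i, l) else 0))" if "k \<noteq> l" "l < dim_col M" for g b :: "mpoly poly" and k l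
    unfolding map_add_matrix[where h = "fract_poly :: mpoly poly \<Rightarrow> mpoly fract poly", OF F0(1)]
    by (rule eq_matI) (use add_matrix_mult_right[of _ M _ k l "fract_poly g" "fract_poly b"] that in \<open>auto simp: add_matrix_def\<close>)
  show ?thesis using op
  proof cases
    case (swap_rows k l)
    have "M' = swaprows_mat (dim_row M) k l * M" unfolding swap_rows by (rule swaprows_mat) (use swap_rows in auto)
    then show ?thesis
      by (intro specializes_row[OF one, of "swaprows_mat (dim_row M) k l"]) (simp_all add: map_swaprows_mat one_smult_mat)
  next
    case (swap_cols k l)
    have "M' = M * swaprows_mat (dim_col M) k l" unfolding swap_cols by (rule swapcols_mat) (use swap_cols in auto)
    then show ?thesis
      by (intro specializes_col[OF one, of "swaprows_mat (dim_col M) k l"]) (simp_all add: map_swaprows_mat one_smult_mat)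
  next
    case (add_row k l c)
    obtain f g where fg: "fract_poly [:g:] * c = fract_poly f" "\<not> int p dvd val [:g:]" using frac[OF add_row(6)] by blast
    have "fract_poly [:g:] \<cdot>\<^sub>m M' = map_mat fract_poly (add_matrix (dim_row M) [:g:] k l f) * M"
      unfolding ar[OF add_row(4,3)] fg(1)[symmetric]
      by (rule eq_matI) (use add_row in \<open>auto simp: algebra_simps\<close>)
    then show ?thesis by (rule specializes_row[OF fg(2) add_matrix_carrier])
  next
    case (add_col k l c)
    obtain f g where fg: "fract_poly [:g:] * c = fract_poly f" "\<not> int p dvd val [:g:]" using frac[OF add_col(6)] by blast
    have "fract_poly [:g:] \<cdot>\<^sub>m M' = M * map_mat fract_poly (add_matrix (dim_col M) [:g:] l k f)"
      unfolding ac[OF add_col(4,3)] fg(1)[symmetric]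
      by (rule eq_matI) (use add_col in \<open>auto simp: algebra_simps\<close>)
    then show ?thesis by (rule specializes_col[OF fg(2) add_matrix_carrier])
  next
    case (mult_row k u)
    obtain f g where fg: "fract_poly [:g:] * u = fract_poly f" "\<not> int p dvd val [:g:]" using frac[OF mult_row(4)] by blast
    have "fract_poly [:g:] \<cdot>\<^sub>m M' = map_mat fract_poly (diag_matrix (dim_row M) (\<lambda>i. if i = k then f else [:g:])) * M"
      unfolding dr
      by (rule eq_matI) (use mult_row in \<open>auto simp: fg(1)[symmetric] algebra_simps\<close>)
    then show ?thesis by (rule specializes_row[OF fg(2) diag_matrix_carrier])
  next
    case (mult_col k u)
    obtain f g where fg: "fract_poly [:g:] * u = fract_poly f" "\<not> int p dvd val [:g:]" using frac[OF mult_col(4)] by blast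
    have "fract_poly [:g:] \<cdot>\<^sub>m M' = M * map_mat fract_poly (diag_matrix (dim_col M) (\<lambda>i. if i = k then f else [:g:]))"
      unfolding dc
      by (rule eq_matI) (use mult_col in \<open>auto simp: fg(1)[symmetric] algebra_simps\<close>)
    then show ?thesis by (rule specializes_col[OF fg(2) diag_matrix_carrier])
  next
    case (div_row k u)
    obtain f g where fg: "fract_poly [:g:] * u = fract_poly f" "\<not> int p dvd val f" using frac'[of u] div_row by auto
    have "M $$ (i, j) = (if k = i then u * M' $$ (i, j) else M' $$ (i, j))" if "i < dim_row M" "j < dim_col M" for i j
      by (rule multrow_entries[OF div_row(4)]) (use that d in simp_all)
    then have "fract_poly f \<cdot>\<^sub>m M' = map_mat fract_poly (diag_matrix (dim_row M) (\<lambda>i. if i = k then [:g:] else f)) * M"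
      unfolding dr
      by (intro eq_matI) (use d in \<open>auto simp: fg(1)[symmetric] algebra_simps\<close>)
    then show ?thesis by (rule specializes_row[OF fg(2) diag_matrix_carrier])
  next
    case (div_col k u)
    obtain f g where fg: "fract_poly [:g:] * u = fract_poly f" "\<not> int p dvd val f" using frac'[of u] div_col by auto
    have "M $$ (i, j) = (if k = j then u * M' $$ (i, j) else M' $$ (i, j))" if "i < dim_row M" "j < dim_col M" for i j
      by (rule multcol_entries[OF div_col(4)]) (use that d in simp_all)
    then have "fract_poly f \<cdot>\<^sub>m M' = M * map_mat fract_poly (diag_matrix (dim_col M) (\<lambda>i. if i = k then [:g:] else f))"
      unfolding dc
      by (intro eq_matI) (use d in \<open>auto simp: fg(1)[symmetric] algebra_simps\<close>)
    then show ?thesis by (rule specializes_col[OF fg(2) diag_matrix_carrier])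
  qed
qed

lemma pseudo_operations_specializes:
  assumes "pseudo_operations m M us M'" "\<And>u. u \<in> set us \<Longrightarrow> Zp_value m p w x u \<noteq> 0"
  shows "specializes M M'"
  using assms
proof (induction rule: pseudo_operations.induct)
  case (start M)
  show ?case by (rule specializes_refl)
next
  case (step M us M' vs M'')
  have "specializes M M'" by (rule step.IH) (use step.prems in auto)
  moreover have "specializes M' M''" by (rule pseudo_operation_specializes[OF step.hyps(2)]) (use step.prems in auto)
  ultimately show ?case using specializes_trans pseudo_operations_dims[OF step.hyps(1)] by blast
qed

end

section \<open>Evaluating the symbolic matrix\<close>

context comm_ring_hom
begin

lemma hom_t_elem: "hom (t_elem i j e) = t_elem i j e"
  by (simp add: t_elem_def of_bool_def hom_uminus)

lemma hom_s_elem: "hom (s_elem i e) = s_elem i e"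
  by (simp add: s_elem_def of_bool_def)

lemma Mat_rows_hom: "Mat_rows n (hom P) (map_coefficients hom A) = map (\<lambda>f e. hom (f e)) (Mat_rows n P A)"
proof -
  have hd: "hom (a - b) = hom a - hom b" for a b by (rule hom_minus)
  have u: "row_u n (map_coefficients hom A) = (\<lambda>i e. hom (row_u n A i e))"
    by (intro ext) (simp add: row_u_def map_coefficients_def hom_sum hom_mult hom_t_elem)
  have v: "row_v n (hom P) (map_coefficients hom A) = (\<lambda>i j e. hom (row_v n P A i j e))"
    by (intro ext) (simp add: row_v_def map_coefficients_def hom_sum hom_mult hom_add hd hom_t_elem hom_s_elem)
  have w: "row_w n (map_coefficients hom A) = (\<lambda>i j h e. hom (row_w n A i j h e))"
    by (intro ext) (simp add: row_w_def map_coefficients_def hom_sum hom_mult hom_add hom_t_elem)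
  have e: "map f (if b then [a] else []) = (if b then [f a] else [])" for f :: "(tail \<Rightarrow> 'a) \<Rightarrow> (tail \<Rightarrow> 'b)" and a b by simp
  show ?thesis unfolding Mat_rows_def map_append map_concat map_map comp_def u v w e ..
qed

lemma Mat_hom: "Mat n (hom P) (map_coefficients hom A) = map_mat hom (Mat n P A)"
  by (rule eq_matI) (simp_all add: Mat_def Mat_rows_hom)

lemma minor_hom:
  assumes "\<forall>i<k. f i < dim_row M" "\<forall>j<k. g j < dim_col M"
  shows "minor (map_mat hom M) k f g = hom (minor M k f g)"
proof -
  have "mat k k (\<lambda>(i, j). map_mat hom M $$ (f i, g j)) = map_mat hom (mat k k (\<lambda>(i, j). M $$ (f i, g j)))"
    by (rule eq_matI) (use assms in auto)
  then show ?thesis unfolding minor_def by (simp only: hom_det)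
qed

end

lemma Sp_ring_diff: "c \<in> Sp_ring m \<Longrightarrow> d \<in> Sp_ring m \<Longrightarrow> c - d \<in> Sp_ring m"
  unfolding diff_conv_add_uminus by (intro Sp_ring_add Sp_ring_uminus)

lemma Sp_ring_sum: "(\<And>i. i \<in> I \<Longrightarrow> f i \<in> Sp_ring m) \<Longrightarrow> sum f I \<in> Sp_ring m"
  by (induction I rule: infinite_finite_induct) (auto intro: Sp_ring_zero Sp_ring_add)

lemma Sp_ring_t_elem: "t_elem i j e \<in> Sp_ring m"
  by (simp add: t_elem_def of_bool_def Sp_ring_zero Sp_ring_one Sp_ring_uminus)

lemma Sp_ring_s_elem: "s_elem i e \<in> Sp_ring m"
  by (simp add: s_elem_def of_bool_def Sp_ring_zero Sp_ring_one)

text \<open>The matrix over polynomials without fractions; the symbolic and the evaluated matrix are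
  both images of it under ring homomorphisms.\<close>

definition polynomial_Mat :: "nat \<Rightarrow> mpoly coefficients \<Rightarrow> mpoly poly mat" where
  "polynomial_Mat n A = Mat n [:0, 1:] (map_coefficients (\<lambda>f. [:f:]) A)"

lemma symbolic_Mat_eq: "symbolic_Mat n A = map_mat fract_poly (polynomial_Mat n A)"
proof -
  have "map_coefficients fract_poly (map_coefficients (\<lambda>f. [:f:]) A) = map_coefficients (\<lambda>f. [:to_fract f:]) A"
    by (simp add: map_coefficients_def fract_poly_const)
  moreover have "fract_poly [:0, 1 :: mpoly:] = [:0, 1:]"
    by (rule poly_eqI) (simp add: coeff_map_poly coeff_pCons split: nat.split)
  ultimately show ?thesis
    using fract_hom.Mat_hom[of n "[:0, 1:]" "map_coefficients (\<lambda>f. [:f:]) A"]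
    unfolding symbolic_Mat_def polynomial_Mat_def by (simp only:)
qed

lemma evaluated_Mat_eq:
  "Mat n (int p) (evaluated_coefficients w x A) = map_mat (value_at p (point w x)) (polynomial_Mat n A)"
proof -
  have "map_coefficients (value_at p (point w x)) (map_coefficients (\<lambda>f. [:f:]) A) = evaluated_coefficients w x A"
    by (simp add: map_coefficients_def evaluated_coefficients_def value_at_const)
  then show ?thesis
    using value_hom.Mat_hom[of n p "point w x" "[:0, 1:]" "map_coefficients (\<lambda>f. [:f:]) A"]
    unfolding polynomial_Mat_def value_at_X by (simp only:)
qed

lemma polynomial_Mat_Sp_ring:
  assumes A: "\<And>i j k. bracket_coeff A i j k \<in> S_ring m" "\<And>i k. power_coeff A i k \<in> S_ring m"
    and ij: "i < dim_row (polynomial_Mat n A)" "j < dim_col (polynomial_Mat n A)"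
  shows "polynomial_Mat n A $$ (i, j) \<in> Sp_ring m"
proof -
  let ?A = "map_coefficients (\<lambda>f. [:f:]) A"
  have c: "bracket_coeff ?A i j k \<in> Sp_ring m" "power_coeff ?A i k \<in> Sp_ring m" for i j k
    using A by (simp_all add: map_coefficients_def Sp_ring_const)
  have r: "f e \<in> Sp_ring m" if "f \<in> set (Mat_rows n [:0, 1:] ?A)" for f e
  proof -
    have u: "row_u n ?A i e \<in> Sp_ring m" for i
      unfolding row_u_def by (intro Sp_ring_sum Sp_ring_mult c Sp_ring_t_elem)
    have v: "row_v n [:0, 1:] ?A i j e \<in> Sp_ring m" for i j
      unfolding row_v_def by (intro Sp_ring_add Sp_ring_sum Sp_ring_diff Sp_ring_mult c Sp_ring_t_elem Sp_ring_s_elem Sp_ring_X)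
    have w: "row_w n ?A i j h e \<in> Sp_ring m" for i j h
      unfolding row_w_def by (intro Sp_ring_add Sp_ring_sum Sp_ring_mult c Sp_ring_t_elem)
    show ?thesis using that unfolding Mat_rows_def
      by (auto simp: u v w simp del: upt_Suc split: if_splits)
  qed
  have "polynomial_Mat n A $$ (i, j) = (Mat_rows n [:0, 1:] ?A ! i) (tails n ! j)" "i < length (Mat_rows n [:0, 1:] ?A)"
    using ij by (simp_all add: polynomial_Mat_def Mat_def)
  then show ?thesis using r[OF nth_mem] by (simp only:)
qed

section \<open>Comparison of the symbolic and the evaluated computation\<close>

lemma p_order_X_power: "p_order ([:0, 1 :: 'a::comm_ring_1:] ^ l) = l"
  unfolding p_order_def X_power by (rule Least_equality) (auto split: if_splits)

lemma fract_poly_X_power: "fract_poly ([:0, 1 :: mpoly:] ^ l) = [:0, 1:] ^ l"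
  unfolding X_power by (rule poly_eqI) (simp add: coeff_map_poly coeff_monom)

text \<open>Divisibility by a power of the variable means that low coefficients vanish, which the
  embedding into fractions does not change. For other divisors, such as the constant 2, this descent
  fails.\<close>

lemma fract_poly_zero_or_X_power_dvd:
  fixes a b :: "mpoly poly"
  assumes "a = 0 \<or> (\<exists>l. a = [:0, 1:] ^ l)" "fract_poly a dvd fract_poly b"
  shows "a dvd b"
proof (cases "a = 0")
  case True
  then have "fract_poly b = 0" using assms(2) by simp
  then have "b = 0" by (simp only: fract_poly_eq_0_iff)
  then show ?thesis by simp
next
  case False
  then obtain l where l: "a = [:0, 1:] ^ l" using assms(1) by blast
  have "\<forall>k<l. Polynomial.coeff (fract_poly b) k = 0"
    using assms(2) unfolding l fract_poly_X_power X_power_dvd_iff .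
  then show ?thesis unfolding l X_power_dvd_iff by (simp add: coeff_map_poly)
qed

lemma zero_or_X_power_cancel:
  fixes a h y :: "mpoly fract poly"
  assumes "a = 0 \<or> (\<exists>l. a = [:0, 1:] ^ l)" "Polynomial.coeff h 0 \<noteq> 0" "a dvd h * y"
  shows "a dvd y"
proof (cases "a = 0")
  case True
  then have "h * y = 0" using assms(3) by simp
  moreover have "h \<noteq> 0" using assms(2) by auto
  ultimately have "y = 0" unfolding mult_eq_0_iff by (elim disjE) (rule notE)
  then show ?thesis by simp
next
  case False
  then obtain l where l: "a = [:0, 1:] ^ l" using assms(1) by blast
  show ?thesis unfolding l by (rule X_power_dvd_mult_cancel[OF assms(2)]) (use assms(3) l in \<open>simp only:\<close>)
qed

lemma zero_or_X_power_prod: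
  fixes a :: "nat \<Rightarrow> 'a::comm_ring_1 poly"
  assumes "\<And>i. i < k \<Longrightarrow> a i = 0 \<or> (\<exists>l. a i = [:0, 1:] ^ l)"
  shows "(\<Prod>i<k. a i) = 0 \<or> (\<exists>l. (\<Prod>i<k. a i) = [:0, 1:] ^ l)"
  using assms
proof (induction k)
  case 0
  show ?case by (rule disjI2, rule exI[of _ 0]) simp
next
  case (Suc k)
  have "(\<Prod>i<k. a i) = 0 \<or> (\<exists>l. (\<Prod>i<k. a i) = [:0, 1:] ^ l)" by (rule Suc.IH) (use Suc.prems in auto)
  moreover have "a k = 0 \<or> (\<exists>l. a k = [:0, 1:] ^ l)" using Suc.prems by simp
  moreover have "(\<Prod>i<Suc k. a i) = (\<Prod>i<k. a i) * a k" by simp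
  ultimately show ?case unfolding power_add[symmetric]
    by (elim disjE exE) (simp_all only: mult_zero_left mult_zero_right simp_thms power_add[symmetric], auto)
qed

lemma map_filter_nonzero_cong:
  fixes a :: "nat \<Rightarrow> int" and b :: "nat \<Rightarrow> 'b::zero"
  assumes "\<And>i. i \<in> set is \<Longrightarrow> a i = (if b i = 0 then 0 else int p ^ r (b i))" "0 < p"
  shows "map nat (filter (\<lambda>d. d \<noteq> 0) (map a is)) = map (\<lambda>l. p ^ l) (map r (filter (\<lambda>d. d \<noteq> 0) (map b is)))"
  using assms by (induction "is") (auto simp: nat_power_eq)

lemma evaluated_smith_entries:
  fixes M :: "mpoly poly mat" and D :: "mpoly fract poly mat"
  assumes p: "prime p"
    and ops: "pseudo_operations m (map_mat fract_poly M) us D" and D: "smith_shape D"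
    and X: "\<And>i. i < min (dim_row D) (dim_col D) \<Longrightarrow> D $$ (i, i) \<noteq> 0 \<Longrightarrow> \<exists>l. D $$ (i, i) = [:0, 1:] ^ l"
    and us: "\<And>u. u \<in> set us \<Longrightarrow> Zp_value m p w x u \<noteq> 0"
    and snf: "int_smith_normal_form (map_mat (value_at p (point w x)) M) D'"
    and pow: "\<And>i. i < min (dim_row D') (dim_col D') \<Longrightarrow> D' $$ (i, i) \<noteq> 0 \<Longrightarrow> \<exists>l. D' $$ (i, i) = int p ^ l"
  shows "map nat (filter (\<lambda>d. d \<noteq> 0) (diagonal_entries D')) =
    map (\<lambda>l. p ^ l) (map p_order (filter (\<lambda>d. d \<noteq> 0) (diagonal_entries D)))"
proof -
  let ?v = "value_at p (point w x)"
  define s where "s = min (dim_row M) (dim_col M)"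
  have dD: "dim_row D = dim_row M" "dim_col D = dim_col M" using pseudo_operations_dims[OF ops] by simp_all
  have dD': "dim_row D' = dim_row M" "dim_col D' = dim_col M"
    using snf unfolding int_smith_normal_form_def by auto
  define a where "a i = (if D $$ (i, i) = 0 then 0 else [:0, 1 :: mpoly:] ^ p_order (D $$ (i, i)))" for i
  have a: "a i = 0 \<or> (\<exists>l. a i = [:0, 1:] ^ l)" for i 
  proof (cases "D $$ (i, i) = 0")
    case False
    then have "a i = [:0, 1:] ^ p_order (D $$ (i, i))" unfolding a_def by (rule if_not_P)
    then show ?thesis by blast
  qed (simp add: a_def)
  have aD: "fract_poly (a i) = D $$ (i, i)" if "i < s" for i
  proof (cases "D $$ (i, i) = 0")
    case False
    have "i < min (dim_row D) (dim_col D)" using that unfolding s_def dD .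
    from X[OF this False] obtain l where l: "D $$ (i, i) = [:0, 1:] ^ l" ..
    have "a i = [:0, 1:] ^ p_order (D $$ (i, i))" unfolding a_def using False by (rule if_not_P)
    then show ?thesis unfolding l p_order_X_power by (simp only: fract_poly_X_power)
  qed (simp add: a_def)
  have va: "?v (a i) = (if D $$ (i, i) = 0 then 0 else int p ^ p_order (D $$ (i, i)))" for i
    unfolding a_def by (simp add: value_hom.hom_power value_at_X value_hom.hom_zero)
  define B where "B = mat (dim_row M) (dim_col M) (\<lambda>(i, j). if i = j then a i else 0)"
  have dB: "dim_row B = dim_row M" "dim_col B = dim_col M" by (simp_all add: B_def)
  have BD: "map_mat fract_poly B = D"
  proof (rule eq_matI)
    fix i j assume ij: "i < dim_row D" "j < dim_col D"
    have "D $$ (i, j) = 0" if "i \<noteq> j" using D ij that unfolding smith_shape_def diagonal_mat_def by simp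
    then show "map_mat fract_poly B $$ (i, j) = D $$ (i, j)"
      using ij dD aD[of i] by (auto simp: B_def s_def)
  qed (simp_all add: dB dD)
  obtain h P Q where h: "\<not> int p dvd ?v h" and P: "P \<in> carrier_mat (dim_row M) (dim_row M)"
    and Q: "Q \<in> carrier_mat (dim_col M) (dim_col M)"
    and e: "fract_poly h \<cdot>\<^sub>m D = map_mat fract_poly P * map_mat fract_poly M * map_mat fract_poly Q"
    using pseudo_operations_specializes[OF p ops us] unfolding specializes_def[OF p] by auto
  have M: "M \<in> carrier_mat (dim_row M) (dim_col M)" by simp
  have "map_mat fract_poly (h \<cdot>\<^sub>m B) = map_mat fract_poly (P * M * Q)"
    unfolding fract_hom.mat_hom_mult[OF mult_carrier_mat[OF P M] Q] fract_hom.mat_hom_mult[OF P M] e[symmetric] BD[symmetric]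
    by (rule eq_matI) (auto simp: fract_hom.hom_mult)
  moreover have inj: "B = C" if "map_mat fract_poly B = map_mat fract_poly C" for B C :: "mpoly poly mat"
  proof (rule eq_matI)
    show d: "dim_row B = dim_row C" "dim_col B = dim_col C"
      using arg_cong[OF that, of dim_row] arg_cong[OF that, of dim_col] by simp_all
    fix i j assume ij: "i < dim_row C" "j < dim_col C"
    have "fract_poly (B $$ (i, j)) = fract_poly (C $$ (i, j))"
      using arg_cong[OF that, of "\<lambda>A. A $$ (i, j)"] ij d by simp
    then show "B $$ (i, j) = C $$ (i, j)" by (simp only: fract_poly_eq_iff)
  qed
  \<comment> \<open>The equation is pulled back along the injective embedding into fractions, since
    evaluation is defined only for polynomials without fractions.\<close>
  ultimately have hB: "h \<cdot>\<^sub>m B = P * M * Q" by blast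
  have "?v h \<cdot>\<^sub>m map_mat ?v B = map_mat ?v (h \<cdot>\<^sub>m B)"
    by (rule eq_matI) (auto simp: value_hom.hom_mult)
  also have "\<dots> = map_mat ?v P * map_mat ?v M * map_mat ?v Q"
    unfolding hB value_hom.mat_hom_mult[OF mult_carrier_mat[OF P M] Q] value_hom.mat_hom_mult[OF P M] ..
  finally have vB: "?v h \<cdot>\<^sub>m map_mat ?v B = map_mat ?v P * map_mat ?v M * map_mat ?v Q" .
  have entry: "map_mat ?v B $$ (i, i) = ?v (a i)" if "i < s" for i
    using that by (simp add: B_def s_def)
  have eq: "D' $$ (i, i) = map_mat ?v B $$ (i, i)" if i: "i < s" for i
  proof (rule smith_entries_determined[OF p snf _ _ _ _ _ _ _ _ _ _ vB])
    show "diagonal_mat (map_mat ?v B)"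
      by (auto simp: diagonal_mat_def B_def value_hom.hom_zero)
    show "dim_row (map_mat ?v B) = dim_row (map_mat ?v M)" "dim_col (map_mat ?v B) = dim_col (map_mat ?v M)"
      using dB by simp_all
    show "map_mat ?v P \<in> carrier_mat (dim_row (map_mat ?v M)) (dim_row (map_mat ?v M))"
      "map_mat ?v Q \<in> carrier_mat (dim_col (map_mat ?v M)) (dim_col (map_mat ?v M))"
      using P Q by simp_all
    show "coprime (?v h) (int p)"
      using prime_imp_coprime[OF _ h] p by (simp add: coprime_commute)
    show "i < min (dim_row (map_mat ?v M)) (dim_col (map_mat ?v M))" using i by (simp add: s_def)
  next
    fix i assume "i < min (dim_row (map_mat ?v M)) (dim_col (map_mat ?v M))"
    then have i: "i < s" by (simp add: s_def)
    show "D' $$ (i, i) \<noteq> 0 \<Longrightarrow> \<exists>l. D' $$ (i, i) = int p ^ l" using pow[of i] i unfolding dD' s_def by blast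
    show "map_mat ?v B $$ (i, i) \<noteq> 0 \<Longrightarrow> \<exists>l. map_mat ?v B $$ (i, i) = int p ^ l"
      unfolding entry[OF i] va by (simp split: if_splits) blast
  next
    fix i assume "Suc i < min (dim_row (map_mat ?v M)) (dim_col (map_mat ?v M))" and z: "map_mat ?v B $$ (i, i) = 0"
    then have i: "Suc i < s" "i < s" by (simp_all add: s_def)
    \<comment> \<open>A power of the prime is never 0, so the evaluated diagonal vanishes exactly
      where the symbolic one does.\<close>
    have "D $$ (i, i) = 0" using z p unfolding entry[OF i(2)] va by (auto split: if_splits)
    moreover have "D $$ (i, i) dvd D $$ (Suc i, Suc i)" using D i(1) unfolding smith_shape_def s_def dD by blast
    ultimately have "D $$ (Suc i, Suc i) = 0" by simp
    then show "map_mat ?v B $$ (Suc i, Suc i) = 0" unfolding entry[OF i(1)] va by simp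
  next
    fix k assume "k \<le> min (dim_row (map_mat ?v M)) (dim_col (map_mat ?v M))"
    then have k: "k \<le> s" by (simp add: s_def)
    define c where "c = (\<Prod>i<k. a i)"
    have c: "c = 0 \<or> (\<exists>l. c = [:0, 1:] ^ l)" unfolding c_def by (rule zero_or_X_power_prod) (rule a)
    have "fract_poly c = (\<Prod>i<k. fract_poly (a i))" unfolding c_def by (rule fract_hom.hom_prod)
    also have "\<dots> = (\<Prod>i<k. D $$ (i, i))" by (rule prod.cong) (use k aD in auto)
    finally have cD: "fract_poly c = (\<Prod>i<k. D $$ (i, i))" .
    have c': "fract_poly c = 0 \<or> (\<exists>l. fract_poly c = [:0, 1:] ^ l)"
      using c by (elim disjE exE) (simp_all add: fract_poly_X_power del: map_poly_pCons, blast)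
    have "minors_dvd (fract_poly c) k D" unfolding cD
      by (rule smith_shape_minors_dvd[OF D]) (use k in \<open>simp add: s_def dD\<close>)
    \<comment> \<open>The bound is carried from \<open>D\<close> to the symbolic matrix while still
      in \<open>Q[p]\<close>; only afterwards does it descend to polynomials without fractions and
      get evaluated.\<close>
    then have min: "minors_dvd (fract_poly c) k (map_mat fract_poly M)"
      by (rule pseudo_operations_minors[OF ops]) (rule zero_or_X_power_cancel[OF c'])
    have vc: "(\<Prod>i<k. map_mat ?v B $$ (i, i)) = ?v c"
      unfolding c_def value_hom.hom_prod by (rule prod.cong) (use k entry in auto)
    show "minors_dvd (\<Prod>i<k. map_mat ?v B $$ (i, i)) k (map_mat ?v M)"
      unfolding vc minors_dvd_def
    proof (intro allI impI)
      fix f g assume "\<forall>i<k. f i < dim_row (map_mat ?v M)" "\<forall>j<k. g j < dim_col (map_mat ?v M)"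
      then have fg: "\<forall>i<k. f i < dim_row M" "\<forall>j<k. g j < dim_col M" by simp_all
      have "fract_poly c dvd minor (map_mat fract_poly M) k f g"
        using min fg unfolding minors_dvd_def by simp
      then have "c dvd minor M k f g"
        unfolding fract_hom.minor_hom[OF fg] by (rule fract_poly_zero_or_X_power_dvd[OF c])
      then show "?v c dvd minor (map_mat ?v M) k f g"
        unfolding value_hom.minor_hom[OF fg] by (rule value_hom.hom_dvd)
    qed
  qed
  have "D' $$ (i, i) = (if D $$ (i, i) = 0 then 0 else int p ^ p_order (D $$ (i, i)))" if "i < s" for i
    using eq[OF that] entry[OF that] va by (simp only:)
  then show ?thesis unfolding diagonal_entries_def dD dD' s_def[symmetric]
    by (intro map_filter_nonzero_cong) (use p prime_gt_0_nat in auto)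
qed

section \<open>The main theorem\<close>

lemma finite_exceptional_sets: "finite (\<Union>u \<in> set us. exceptional_set m p w u)"
proof (rule finite_subset)
  show "(\<Union>u \<in> set us. exceptional_set m p w u) \<subseteq> Zp_tuples p m" by (auto simp: exceptional_set_def)
  show "finite (Zp_tuples p m)" unfolding Zp_tuples_def by (intro finite_PiE) auto
qed

context symbolic_presentation
begin

text \<open>Holds at every admissible point, exceptional or not. It settles the exceptional tuples
  directly and, for the others, supplies the prime powers that the comparison with the symbolic
  divisors needs.\<close>

lemma evaluated_invariants:
  assumes pwx: "p \<in> PS" "w \<in> primitive_roots p" "x \<in> Zp_tuples p m"
    and snf: "int_smith_normal_form (Mat n (int p) (B w x)) D"
  shows "has_abelian_invariants (schur_multiplier (ev_ring p w x))
      (map nat (filter (\<lambda>d. d \<noteq> 0) (diagonal_entries D)))"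
    and "\<And>i. i < min (dim_row D) (dim_col D) \<Longrightarrow> D $$ (i, i) \<noteq> 0 \<Longrightarrow> \<exists>l. D $$ (i, i) = int p ^ l"
proof -
  obtain beta where beta: "lie_model n p (B w x) (ev_ring p w x) beta"
    using lie_model[OF pwx] by (elim exE) (rule that)
  interpret P: smith_model n p "B w x" "ev_ring p w x" beta D
    by (intro smith_model.intro smith_model_axioms.intro beta primes[OF pwx(1)] snf)
  show "has_abelian_invariants (schur_multiplier (ev_ring p w x))
      (map nat (filter (\<lambda>d. d \<noteq> 0) (diagonal_entries D)))"
    using P.schur_multiplier_invariants unfolding P.divisors_def .
  show "\<And>i. i < min (dim_row D) (dim_col D) \<Longrightarrow> D $$ (i, i) \<noteq> 0 \<Longrightarrow> \<exists>l. D $$ (i, i) = int p ^ l"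
    by (rule P.diagonal_prime_power)
qed

lemma symbolic_Mat_Qp_ring:
  assumes "i < dim_row (symbolic_Mat n A)" "j < dim_col (symbolic_Mat n A)"
  shows "symbolic_Mat n A $$ (i, j) \<in> Qp_ring m"
proof -
  have ij: "i < dim_row (polynomial_Mat n A)" "j < dim_col (polynomial_Mat n A)"
    using assms unfolding symbolic_Mat_eq by simp_all
  have "symbolic_Mat n A $$ (i, j) = fract_poly (polynomial_Mat n A $$ (i, j))"
    unfolding symbolic_Mat_eq by (rule index_map_mat(1)[OF ij])
  then show ?thesis using Qp_ring_fract_poly[OF polynomial_Mat_Sp_ring[OF bracket_S power_S ij]] by (simp only:)
qed

lemma computation_correct:
  assumes comp: "pseudo_smith_computation m (symbolic_Mat n A) us ds"
  shows "\<exists>ls :: nat list.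
        filter (\<lambda>d. d \<noteq> 0) ds = map (\<lambda>l. [:0, 1:] ^ l) ls \<and>
        (\<forall>p \<in> PS. \<forall>w \<in> primitive_roots p.
          (\<forall>u \<in> set us. \<forall>x \<in> Zp_tuples p m - exceptional_set m p w u.
             \<exists>r. has_Zp_value m p w x u r \<and> coprime r (int p)) \<and>
          finite (\<Union>u \<in> set us. exceptional_set m p w u) \<and>
          (\<forall>x \<in> Zp_tuples p m - (\<Union>u \<in> set us. exceptional_set m p w u).
             has_abelian_invariants
               (schur_multiplier (presentation_ring n p (evaluated_coefficients w x A)))
               (map (\<lambda>l. p ^ l) ls)) \<and>
          (\<forall>x \<in> (\<Union>u \<in> set us. exceptional_set m p w u).
             (\<exists>D. int_smith_normal_form (Mat n (int p) (evaluated_coefficients w x A)) D) \<and>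
             (\<forall>D. int_smith_normal_form (Mat n (int p) (evaluated_coefficients w x A)) D \<longrightarrow>
                has_abelian_invariants
                  (schur_multiplier (presentation_ring n p (evaluated_coefficients w x A)))
                  (map nat (filter (\<lambda>d. d \<noteq> 0) (diagonal_entries D))))))"
proof -
  obtain D where D: "pseudo_operations m (symbolic_Mat n A) us D" "pseudo_smith_form m D" "ds = diagonal_entries D"
    using comp unfolding pseudo_smith_computation_def by (elim exE conjE) (rule that)
  have shape: "smith_shape D" using D(2) unfolding pseudo_smith_form_def by (rule conjunct1)
  have X: "\<exists>l. D $$ (i, i) = [:0, 1:] ^ l" if "i < min (dim_row D) (dim_col D)" "D $$ (i, i) \<noteq> 0" for i
    by (rule pseudo_smith_form_entries[OF D(2) pseudo_operations_Qp_ring[OF D(1) symbolic_Mat_Qp_ring] that])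
  \<comment> \<open>The exponents are read off the symbolic divisors and so do not depend on the
    prime, the primitive root or the tuple.\<close>
  define ls where "ls = map p_order (filter (\<lambda>d. d \<noteq> 0) ds)"
  have entry: "[:0, 1:] ^ p_order d = d" if d: "d \<in> set (filter (\<lambda>d. d \<noteq> 0) ds)" for d
  proof -
    have "d \<noteq> 0" "d \<in> (\<lambda>i. D $$ (i, i)) ` {0..<min (dim_row D) (dim_col D)}"
      using d unfolding D(3) diagonal_entries_def by simp_all
    then obtain i where i: "d = D $$ (i, i)" "i < min (dim_row D) (dim_col D)" by (elim imageE) simp
    have "D $$ (i, i) \<noteq> 0" using \<open>d \<noteq> 0\<close> unfolding i(1) .
    from X[OF i(2) this] obtain l where l: "D $$ (i, i) = [:0, 1:] ^ l" ..
    show ?thesis unfolding i(1) l p_order_X_power ..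
  qed
  have ls: "filter (\<lambda>d. d \<noteq> 0) ds = map (\<lambda>l. [:0, 1:] ^ l) ls"
    unfolding ls_def map_map comp_def by (rule map_idI[symmetric]) (rule entry)
  show ?thesis
  proof (intro exI[of _ ls] conjI ballI allI impI)
    show "filter (\<lambda>d. d \<noteq> 0) ds = map (\<lambda>l. [:0, 1:] ^ l) ls" by (rule ls)
  next
    fix p w u x
    assume p: "p \<in> PS" and x: "x \<in> Zp_tuples p m - exceptional_set m p w u"
    have "Zp_value m p w x u \<noteq> 0" using x by (simp add: exceptional_set_def)
    from Zp_value_nonzero[OF primes[OF p] this]
    obtain r where r: "has_Zp_value m p w x u r" "r \<noteq> 0" by (elim exE conjE) (rule that)
    show "\<exists>r. has_Zp_value m p w x u r \<and> coprime r (int p)"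
      by (intro exI conjI, rule r(1), rule has_Zp_value_coprime[OF primes[OF p] r])
  next
    fix p w
    show "finite (\<Union>u \<in> set us. exceptional_set m p w u)" by (rule finite_exceptional_sets)
  next
    fix p w x
    assume p: "p \<in> PS" "w \<in> primitive_roots p"
      and x: "x \<in> Zp_tuples p m - (\<Union>u \<in> set us. exceptional_set m p w u)"
    have xt: "x \<in> Zp_tuples p m" using x by (rule DiffD1)
    have us: "Zp_value m p w x u \<noteq> 0" if "u \<in> set us" for u
      using x that by (simp add: exceptional_set_def)
    obtain D' where D': "int_smith_normal_form (Mat n (int p) (B w x)) D'"
      using int_smith_normal_form_exists[of "Mat n (int p) (B w x)"] by (elim exE) (rule that)
    note inv = evaluated_invariants[OF p xt D']
    have "map nat (filter (\<lambda>d. d \<noteq> 0) (diagonal_entries D')) = map (\<lambda>l. p ^ l) ls"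
      unfolding ls_def D(3)
      by (rule evaluated_smith_entries[OF primes[OF p(1)] D(1)[unfolded symbolic_Mat_eq] shape X us
            D'[unfolded evaluated_Mat_eq] inv(2)])
    then show "has_abelian_invariants (schur_multiplier (ev_ring p w x)) (map (\<lambda>l. p ^ l) ls)"
      using inv(1) by (simp only:)
  next
    fix p w x
    show "\<exists>D. int_smith_normal_form (Mat n (int p) (B w x)) D" using int_smith_normal_form_exists .
  next
    fix p w x D'
    assume p: "p \<in> PS" "w \<in> primitive_roots p" and x: "x \<in> (\<Union>u \<in> set us. exceptional_set m p w u)"
      and D': "int_smith_normal_form (Mat n (int p) (B w x)) D'"
    have "x \<in> Zp_tuples p m" using x by (auto simp: exceptional_set_def)
    then show "has_abelian_invariants (schur_multiplier (ev_ring p w x))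
        (map nat (filter (\<lambda>d. d \<noteq> 0) (diagonal_entries D')))"
      by (rule evaluated_invariants(1)[OF p _ D'])
  qed
qed

end

theorem mainTheorem3:
  fixes n m :: nat and PS :: "nat set" and A :: "mpoly coefficients"
  assumes "symbolic_nilpotent_presentation n m PS A"
    and "infinite PS"
  shows "(\<exists>us ds. pseudo_smith_computation m (symbolic_Mat n A) us ds) \<and>
    (\<forall>us ds. pseudo_smith_computation m (symbolic_Mat n A) us ds \<longrightarrow>
      (\<exists>ls :: nat list.
        filter (\<lambda>d. d \<noteq> 0) ds = map (\<lambda>l. [:0, 1:] ^ l) ls \<and>
        (\<forall>p \<in> PS. \<forall>w \<in> primitive_roots p.
          (\<forall>u \<in> set us. \<forall>x \<in> Zp_tuples p m - exceptional_set m p w u.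
             \<exists>r. has_Zp_value m p w x u r \<and> coprime r (int p)) \<and>
          finite (\<Union>u \<in> set us. exceptional_set m p w u) \<and>
          (\<forall>x \<in> Zp_tuples p m - (\<Union>u \<in> set us. exceptional_set m p w u).
             has_abelian_invariants
               (schur_multiplier (presentation_ring n p (evaluated_coefficients w x A)))
               (map (\<lambda>l. p ^ l) ls)) \<and>
          (\<forall>x \<in> (\<Union>u \<in> set us. exceptional_set m p w u).
             (\<exists>D. int_smith_normal_form (Mat n (int p) (evaluated_coefficients w x A)) D) \<and>
             (\<forall>D. int_smith_normal_form (Mat n (int p) (evaluated_coefficients w x A)) D \<longrightarrow>
                has_abelian_invariants
                  (schur_multiplier (presentation_ring n p (evaluated_coefficients w x A)))
                  (map nat (filter (\<lambda>d. d \<noteq> 0) (diagonal_entries D))))))))"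
proof -
  interpret symbolic_presentation n m PS A by (rule symbolic_presentation.intro[OF assms])
  show ?thesis
  proof (intro conjI allI impI)
    show "\<exists>us ds. pseudo_smith_computation m (symbolic_Mat n A) us ds"
      by (rule pseudo_smith_computation_exists) (rule symbolic_Mat_Qp_ring)
  qed (rule computation_correct)
qed

end
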